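(* Let $\mathfrak g$ be a braided Lie algebra associated with a triangular Hopf algebra $(K,\mathsf R)$ and let $\mathsf F$ be a twist for $K$. The braided Hopf algebras $\mathcal U(\mathfrak g)_{\mathsf F}$ and $\mathcal U(\mathfrak g_{\mathsf F})$ associated with the triangular Hopf algebra $(K_{\mathsf F},\mathsf R_{\mathsf F})$ are isomorphic.
   Context: $\Bbbk$ is a field, or the ring of formal power series in a variable over a field; $\otimes$ over $\Bbbk$; sums understood. Triangular Hopf algebra $(K,\mathsf R)$: $\mathsf R=\mathsf R^\alpha\otimes\mathsf R_\alpha\in K\otimes K$ invertible, $\Delta^{cop}(k)=\mathsf R\Delta(k)\mathsf R^{-1}$, $(\Delta\otimes\mathrm{id})\mathsf R=\mathsf R_{13}\mathsf R_{23}$, $(\mathrm{id}\otimes\Delta)\mathsf R=\mathsf R_{13}\mathsf R_{12}$, $\mathsf R^{-1}=\mathsf R_{21}$. A braided Lie algebra associated with $(K,\mathsf R)$ is a $K$-module $\mathfrak g$ with a bilinear bracket such that $k\triangleright[u,v]=[k_{(1)}\triangleright u,k_{(2)}\triangleright v]$, $[u,v]=-[\mathsf R_\alpha\triangleright v,\mathsf R^\alpha\triangleright u]$, $[u,[v,w]]=[[u,v],w]+[\mathsf R_\alpha\triangleright v,[\mathsf R^\alpha\triangleright u,w]]$. Twist: an invertible $\mathsf F=\mathsf F^\alpha\otimes\mathsf F_\alpha\in K\otimes K$, inverse $\bar{\mathsf F}=\bar{\mathsf F}^\alpha\otimes\bar{\mathsf F}_\alpha$, with $(\varepsilon\otimes\mathrm{id})\mathsf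 F=1=(\mathrm{id}\otimes\varepsilon)\mathsf F$ and $(\mathsf F\otimes1)(\Delta\otimes\mathrm{id})\mathsf F=(1\otimes\mathsf F)(\mathrm{id}\otimes\Delta)\mathsf F$. $K_{\mathsf F}$ is the Hopf algebra with the algebra and counit of $K$ and coproduct $\mathsf F\Delta(\cdot)\bar{\mathsf F}$; it is triangular with $\mathsf R_{\mathsf F}=\mathsf F_{21}\mathsf R\bar{\mathsf F}$. $\mathfrak g_{\mathsf F}$ is $\mathfrak g$ with the same action and bracket $[u,v]_{\mathsf F}=[\bar{\mathsf F}^\alpha\triangleright u,\bar{\mathsf F}_\alpha\triangleright v]$, a $(K_{\mathsf F},\mathsf R_{\mathsf F})$-braided Lie algebra. A braided Hopf algebra associated with $(K,\mathsf R)$ is a $K$-module algebra and $K$-module coalgebra $L$ such that $\varepsilon_L$ and $\Delta_L:L\to L\boxtimes L$ are algebra maps, $L\boxtimes L$ being $L\otimes L$ with product $(a\boxtimes c)(a'\boxtimes c')=a(\mathsf R_\alpha\triangleright a')\boxtimes(\mathsf R^\alpha\triangleright c)c'$, with a $K$-equivariant convolution inverse $S_L$ of $\mathrm{id}_L$. Isomorphisms are equivariant linear isomorphisms that are algebra and coalgebra maps. The twist $L_{\mathsf F}$, associated with $(K_{\mathsf F},\mathsf R_{\mathsf F})$, has the same vector space, action, unit, counit, antipode, product $(\bar{\mathsf F}^\alpha\triangleright\xi)(\bar{\mathsf F}_\alpha\triangleright\xi')$ and coproduct $\xi\mapsto(\mathsf F^\alpha\triangleright\xi_{(1)})\otimes(\mathsf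 F_\alpha\triangleright\xi_{(2)})$. $\mathcal U(\mathfrak g)$ is the quotient of the tensor algebra $T(\mathfrak g)$ by the ideal generated by $u\otimes v-\mathsf R_\alpha\triangleright v\otimes\mathsf R^\alpha\triangleright u-[u,v]$, $u,v\in\mathfrak g$; it is a braided Hopf algebra with $\Delta(u)=u\boxtimes1+1\boxtimes u$, $\varepsilon(u)=0$, $S(u)=-u$ for $u\in\mathfrak g$. $\mathcal U(\mathfrak g_{\mathsf F})$ is the same construction for $\mathfrak g_{\mathsf F}$ and $(K_{\mathsf F},\mathsf R_{\mathsf F})$. *)

theory Defs
  imports
    "HOL-Library.Poly_Mapping"
    "HOL-Computational_Algebra.Formal_Power_Series"
    "HOL-Algebra.Algebra"
begin

section \<open>Ground ring\<close>

text \<open>Scalars are the elements of a type \<open>'k\<close>; modules over \<open>'k\<close> are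
  HOL-Algebra records satisfying \<open>module scal\<close>.  The \<open>mult\<close> and \<open>one\<close> fields of a
  record that is only meant as a module carry no information.\<close>

definition scal :: "('k::comm_ring_1, 'k) module" where
  "scal = \<lparr>carrier = UNIV, mult = (*), one = 1, ring.zero = 0, add = (+), smult = (*)\<rparr>"

text \<open>Either a field or a ring of formal power series over a field; the coefficient field \<open>'f\<close>
  plays no role in the first case.\<close>

definition ground_ring :: "'f::field itself \<Rightarrow> 'k::comm_ring_1 itself \<Rightarrow> bool" where
  "ground_ring _ _ \<longleftrightarrow>
     field (scal :: ('k, 'k) module) \<or>
     (\<exists>\<phi> :: 'f fps \<Rightarrow> 'k. \<phi> \<in> ring_iso scal scal)"

definition lin :: "('k::comm_ring_1, 'm, 'x) module_scheme \<Rightarrow> ('k, 'n, 'y) module_scheme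
    \<Rightarrow> ('m \<Rightarrow> 'n) \<Rightarrow> bool" where
  "lin M N f \<longleftrightarrow> f \<in> carrier M \<rightarrow> carrier N \<and>
     (\<forall>x\<in>carrier M. \<forall>y\<in>carrier M. f (x \<oplus>\<^bsub>M\<^esub> y) = f x \<oplus>\<^bsub>N\<^esub> f y) \<and>
     (\<forall>c. \<forall>x\<in>carrier M. f (c \<odot>\<^bsub>M\<^esub> x) = c \<odot>\<^bsub>N\<^esub> f x)"

definition bilin :: "('k::comm_ring_1, 'm, 'x) module_scheme \<Rightarrow> ('k, 'n, 'y) module_scheme
    \<Rightarrow> ('k, 'p, 'z) module_scheme \<Rightarrow> ('m \<Rightarrow> 'n \<Rightarrow> 'p) \<Rightarrow> bool" where
  "bilin M N P b \<longleftrightarrow> (\<forall>x\<in>carrier M. lin N P (b x)) \<and> (\<forall>y\<in>carrier N. lin M P (\<lambda>x. b x y))"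

definition assoc_algebra :: "('k::comm_ring_1, 'm, 'x) module_scheme \<Rightarrow> bool" where
  "assoc_algebra A \<longleftrightarrow> module scal A \<and> ring A \<and> bilin A A A (\<lambda>x y. x \<otimes>\<^bsub>A\<^esub> y)"

definition alg_hom :: "('k::comm_ring_1, 'm, 'x) module_scheme \<Rightarrow> ('k, 'n, 'y) module_scheme
    \<Rightarrow> ('m \<Rightarrow> 'n) \<Rightarrow> bool" where
  "alg_hom A B f \<longleftrightarrow> f \<in> ring_hom A B \<and> lin A B f"

section \<open>Tensor powers and the tensor algebra\<close>

text \<open>\<open>tspace D M\<close> is the direct sum of the tensor powers of \<open>M\<close> of degree \<open>n \<in> D\<close>: the free
  module on the words over \<open>M\<close> whose length is in \<open>D\<close>, modulo multilinearity in the letters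
  (which relates only words of equal length).  Thus \<open>D = {n}\<close> is the \<open>n\<close>-th tensor power and
  \<open>D = UNIV\<close> the tensor algebra.  Elements are cosets; the coset of the word
  \<open>[u\<^sub>1, \<dots>, u\<^sub>n]\<close> is the pure tensor of the letters.\<close>

type_synonym ('k, 'm) tens = "('m list \<Rightarrow>\<^sub>0 'k) set"

definition descend :: "('x \<Rightarrow> 'y) \<Rightarrow> 'x set \<Rightarrow> 'y" where
  \<comment> \<open>the common value of \<open>f\<close> on the representatives of a coset\<close>
  "descend f S = the_elem (f ` S)"

definition words :: "nat set \<Rightarrow> ('k::comm_ring_1, 'm, 'x) module_scheme \<Rightarrow> 'm list set" where
  "words D M = {w. set w \<subseteq> carrier M \<and> length w \<in> D}"

definition pscale :: "'k::comm_ring_1 \<Rightarrow> ('w \<Rightarrow>\<^sub>0 'k) \<Rightarrow> ('w \<Rightarrow>\<^sub>0 'k)" where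
  "pscale c = Poly_Mapping.map ((*) c)"

definition multilin_rels :: "nat set \<Rightarrow> ('k::comm_ring_1, 'm, 'x) module_scheme
    \<Rightarrow> ('m list \<Rightarrow>\<^sub>0 'k) set" where
  "multilin_rels D M =
     {Poly_Mapping.single (xs @ (u \<oplus>\<^bsub>M\<^esub> v) # ys) 1 - Poly_Mapping.single (xs @ u # ys) 1
        - Poly_Mapping.single (xs @ v # ys) 1 | xs u v ys.
        xs @ u # ys \<in> words D M \<and> v \<in> carrier M} \<union>
     {Poly_Mapping.single (xs @ (c \<odot>\<^bsub>M\<^esub> u) # ys) 1 - Poly_Mapping.single (xs @ u # ys) c | xs c u ys.
        xs @ u # ys \<in> words D M}"

definition tclass :: "nat set \<Rightarrow> ('k::comm_ring_1, 'm, 'x) module_scheme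
    \<Rightarrow> ('m list \<Rightarrow>\<^sub>0 'k) \<Rightarrow> ('k, 'm) tens" where
  "tclass D M x = {y. y - x \<in> Modules.module.span pscale (multilin_rels D M)}"

definition tspace :: "nat set \<Rightarrow> ('k::comm_ring_1, 'm, 'x) module_scheme
    \<Rightarrow> ('k, ('k, 'm) tens) module" where
  "tspace D M =
     \<lparr>carrier = {tclass D M x | x. Poly_Mapping.keys x \<subseteq> words D M},
      mult = undefined, one = undefined,
      ring.zero = tclass D M 0,
      add = (\<lambda>S T. descend (\<lambda>x. descend (\<lambda>y. tclass D M (x + y)) T) S),
      smult = (\<lambda>c. descend (\<lambda>x. tclass D M (pscale c x)))\<rparr>"

definition pure :: "nat set \<Rightarrow> ('k::comm_ring_1, 'm, 'x) module_scheme \<Rightarrow> 'm list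
    \<Rightarrow> ('k, 'm) tens" where
  "pure D M w = tclass D M (Poly_Mapping.single w 1)"

text \<open>\<open>tlift P b\<close> is the linear map into \<open>P\<close> which sends the pure tensor of a word \<open>w\<close> to \<open>b w\<close>,
  for \<open>b\<close> multilinear on words of each length.  It renders the sumless notation: a term such
  as \<open>b(S\<^sup>\<alpha>, S\<^sub>\<alpha>)\<close> is \<open>tlift P (\<lambda>x. b (x!0) (x!1)) S\<close>.\<close>

definition tlift :: "('k::comm_ring_1, 'p, 'z) module_scheme \<Rightarrow> ('m list \<Rightarrow> 'p)
    \<Rightarrow> ('k, 'm) tens \<Rightarrow> 'p" where
  "tlift P b = descend (\<lambda>x. \<Oplus>\<^bsub>P\<^esub>w\<in>Poly_Mapping.keys x. Poly_Mapping.lookup x w \<odot>\<^bsub>P\<^esub> b w)"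

definition tpow_alg :: "nat \<Rightarrow> ('k::comm_ring_1, 'm, 'x) module_scheme
    \<Rightarrow> ('k, ('k, 'm) tens) module" where
  "tpow_alg n A = (tspace {n} A)
     \<lparr>mult := \<lambda>S T. tlift (tspace {n} A)
        (\<lambda>x. tlift (tspace {n} A) (\<lambda>y. pure {n} A (map2 (\<lambda>a b. a \<otimes>\<^bsub>A\<^esub> b) x y)) T) S,
      one := pure {n} A (replicate n \<one>\<^bsub>A\<^esub>)\<rparr>"

definition tensor_alg :: "('k::comm_ring_1, 'm, 'x) module_scheme
    \<Rightarrow> ('k, ('k, 'm) tens) module" where
  "tensor_alg M = (tspace UNIV M)
     \<lparr>mult := \<lambda>S T. tlift (tspace UNIV M)
        (\<lambda>x. tlift (tspace UNIV M) (\<lambda>y. pure UNIV M (x @ y)) T) S,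
      one := pure UNIV M []\<rparr>"

section \<open>Triangular Hopf algebras\<close>

record (overloaded) ('k::comm_ring_1, 'a) coalg = "('k, 'a) module" +
  comul :: "'a \<Rightarrow> ('a list \<Rightarrow>\<^sub>0 'k) set"
  counit :: "'a \<Rightarrow> 'k"

definition comul_left :: "('k::comm_ring_1, 'a) coalg \<Rightarrow> ('k, 'a) tens \<Rightarrow> ('k, 'a) tens" where
  \<comment> \<open>\<open>\<Delta> \<otimes> id\<close>\<close>
  "comul_left K = tlift (tspace {3} K)
     (\<lambda>x. tlift (tspace {3} K) (\<lambda>d. pure {3} K [d!0, d!1, x!1]) (comul K (x!0)))"

definition comul_right :: "('k::comm_ring_1, 'a) coalg \<Rightarrow> ('k, 'a) tens \<Rightarrow> ('k, 'a) tens" where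
  \<comment> \<open>\<open>id \<otimes> \<Delta>\<close>\<close>
  "comul_right K = tlift (tspace {3} K)
     (\<lambda>x. tlift (tspace {3} K) (\<lambda>d. pure {3} K [x!0, d!0, d!1]) (comul K (x!1)))"

definition bialgebra :: "('k::comm_ring_1, 'a) coalg \<Rightarrow> bool" where
  "bialgebra K \<longleftrightarrow> assoc_algebra K \<and>
     alg_hom K (tpow_alg 2 K) (comul K) \<and>
     alg_hom K scal (counit K) \<and>
     (\<forall>k\<in>carrier K.
        comul_left K (comul K k) = comul_right K (comul K k) \<and>
        tlift K (\<lambda>d. counit K (d!0) \<odot>\<^bsub>K\<^esub> (d!1)) (comul K k) = k \<and>
        tlift K (\<lambda>d. counit K (d!1) \<odot>\<^bsub>K\<^esub> (d!0)) (comul K k) = k)"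

definition hopf_algebra :: "('k::comm_ring_1, 'a) coalg \<Rightarrow> bool" where
  "hopf_algebra K \<longleftrightarrow> bialgebra K \<and>
     (\<exists>S. lin K K S \<and> (\<forall>k\<in>carrier K.
        tlift K (\<lambda>d. S (d!0) \<otimes>\<^bsub>K\<^esub> (d!1)) (comul K k) = counit K k \<odot>\<^bsub>K\<^esub> \<one>\<^bsub>K\<^esub> \<and>
        tlift K (\<lambda>d. (d!0) \<otimes>\<^bsub>K\<^esub> S (d!1)) (comul K k) = counit K k \<odot>\<^bsub>K\<^esub> \<one>\<^bsub>K\<^esub>))"

definition flip :: "('k::comm_ring_1, 'm, 'x) module_scheme \<Rightarrow> ('k, 'm) tens \<Rightarrow> ('k, 'm) tens" where
  "flip M = tlift (tspace {2} M) (\<lambda>x. pure {2} M [x!1, x!0])"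

definition leg12 :: "('k::comm_ring_1, 'm, 'x) module_scheme \<Rightarrow> ('k, 'm) tens \<Rightarrow> ('k, 'm) tens" where
  "leg12 A = tlift (tspace {3} A) (\<lambda>x. pure {3} A [x!0, x!1, \<one>\<^bsub>A\<^esub>])"

definition leg13 :: "('k::comm_ring_1, 'm, 'x) module_scheme \<Rightarrow> ('k, 'm) tens \<Rightarrow> ('k, 'm) tens" where
  "leg13 A = tlift (tspace {3} A) (\<lambda>x. pure {3} A [x!0, \<one>\<^bsub>A\<^esub>, x!1])"

definition leg23 :: "('k::comm_ring_1, 'm, 'x) module_scheme \<Rightarrow> ('k, 'm) tens \<Rightarrow> ('k, 'm) tens" where
  "leg23 A = tlift (tspace {3} A) (\<lambda>x. pure {3} A [\<one>\<^bsub>A\<^esub>, x!0, x!1])"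

definition triangular_hopf :: "('k::comm_ring_1, 'a) coalg \<Rightarrow> ('k, 'a) tens \<Rightarrow> bool" where
  "triangular_hopf K R \<longleftrightarrow> hopf_algebra K \<and>
     R \<in> Units (tpow_alg 2 K) \<and>
     (\<forall>k\<in>carrier K. flip K (comul K k) =
        R \<otimes>\<^bsub>tpow_alg 2 K\<^esub> comul K k \<otimes>\<^bsub>tpow_alg 2 K\<^esub> inv\<^bsub>tpow_alg 2 K\<^esub> R) \<and>
     comul_left K R = leg13 K R \<otimes>\<^bsub>tpow_alg 3 K\<^esub> leg23 K R \<and>
     comul_right K R = leg13 K R \<otimes>\<^bsub>tpow_alg 3 K\<^esub> leg12 K R \<and>
     inv\<^bsub>tpow_alg 2 K\<^esub> R = flip K R"

definition twist :: "('k::comm_ring_1, 'a) coalg \<Rightarrow> ('k, 'a) tens \<Rightarrow> bool" where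
  "twist K F \<longleftrightarrow> F \<in> Units (tpow_alg 2 K) \<and>
     tlift K (\<lambda>x. counit K (x!0) \<odot>\<^bsub>K\<^esub> (x!1)) F = \<one>\<^bsub>K\<^esub> \<and>
     tlift K (\<lambda>x. counit K (x!1) \<odot>\<^bsub>K\<^esub> (x!0)) F = \<one>\<^bsub>K\<^esub> \<and>
     leg12 K F \<otimes>\<^bsub>tpow_alg 3 K\<^esub> comul_left K F = leg23 K F \<otimes>\<^bsub>tpow_alg 3 K\<^esub> comul_right K F"

definition twist_hopf :: "('k::comm_ring_1, 'a) coalg \<Rightarrow> ('k, 'a) tens \<Rightarrow> ('k, 'a) coalg" where
  "twist_hopf K F = K\<lparr>comul := \<lambda>k.
     F \<otimes>\<^bsub>tpow_alg 2 K\<^esub> comul K k \<otimes>\<^bsub>tpow_alg 2 K\<^esub> inv\<^bsub>tpow_alg 2 K\<^esub> F\<rparr>"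

definition twist_R :: "('k::comm_ring_1, 'a) coalg \<Rightarrow> ('k, 'a) tens \<Rightarrow> ('k, 'a) tens
    \<Rightarrow> ('k, 'a) tens" where
  "twist_R K F R = flip K F \<otimes>\<^bsub>tpow_alg 2 K\<^esub> R \<otimes>\<^bsub>tpow_alg 2 K\<^esub> inv\<^bsub>tpow_alg 2 K\<^esub> F"

section \<open>Braided Lie algebras\<close>

record ('k, 'v, 'a) hmod = "('k, 'v) module" +
  act :: "'a \<Rightarrow> 'v \<Rightarrow> 'v"

definition K_module :: "('k::comm_ring_1, 'a) coalg \<Rightarrow> ('k, 'v, 'a, 'x) hmod_scheme \<Rightarrow> bool" where
  "K_module K V \<longleftrightarrow> module scal V \<and> bilin K V V (act V) \<and>
     (\<forall>v\<in>carrier V. act V \<one>\<^bsub>K\<^esub> v = v) \<and>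
     (\<forall>h\<in>carrier K. \<forall>k\<in>carrier K. \<forall>v\<in>carrier V. act V (h \<otimes>\<^bsub>K\<^esub> k) v = act V h (act V k v))"

record ('k, 'v, 'a) blie = "('k, 'v, 'a) hmod" +
  bracket :: "'v \<Rightarrow> 'v \<Rightarrow> 'v"

definition braided_lie :: "('k::comm_ring_1, 'a) coalg \<Rightarrow> ('k, 'a) tens
    \<Rightarrow> ('k, 'v, 'a) blie \<Rightarrow> bool" where
  "braided_lie K R \<gg> \<longleftrightarrow> K_module K \<gg> \<and> bilin \<gg> \<gg> \<gg> (bracket \<gg>) \<and>
     (\<forall>k\<in>carrier K. \<forall>u\<in>carrier \<gg>. \<forall>v\<in>carrier \<gg>.
        act \<gg> k (bracket \<gg> u v) =
          tlift \<gg> (\<lambda>d. bracket \<gg> (act \<gg> (d!0) u) (act \<gg> (d!1) v)) (comul K k)) \<and>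
     (\<forall>u\<in>carrier \<gg>. \<forall>v\<in>carrier \<gg>.
        bracket \<gg> u v =
          \<ominus>\<^bsub>\<gg>\<^esub> tlift \<gg> (\<lambda>r. bracket \<gg> (act \<gg> (r!1) v) (act \<gg> (r!0) u)) R) \<and>
     (\<forall>u\<in>carrier \<gg>. \<forall>v\<in>carrier \<gg>. \<forall>w\<in>carrier \<gg>.
        bracket \<gg> u (bracket \<gg> v w) = bracket \<gg> (bracket \<gg> u v) w \<oplus>\<^bsub>\<gg>\<^esub>
          tlift \<gg> (\<lambda>r. bracket \<gg> (act \<gg> (r!1) v) (bracket \<gg> (act \<gg> (r!0) u) w)) R)"

definition twist_lie :: "('k::comm_ring_1, 'a) coalg \<Rightarrow> ('k, 'a) tens
    \<Rightarrow> ('k, 'v, 'a) blie \<Rightarrow> ('k, 'v, 'a) blie" where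
  "twist_lie K F \<gg> = \<gg>\<lparr>bracket := \<lambda>u v.
     tlift \<gg> (\<lambda>f. bracket \<gg> (act \<gg> (f!0) u) (act \<gg> (f!1) v)) (inv\<^bsub>tpow_alg 2 K\<^esub> F)\<rparr>"

section \<open>Braided Hopf algebras\<close>

record (overloaded) ('k::comm_ring_1, 'l, 'a) bhopf = "('k, 'l, 'a) hmod" +
  bcomul :: "'l \<Rightarrow> ('l list \<Rightarrow>\<^sub>0 'k) set"
  bcounit :: "'l \<Rightarrow> 'k"
  antipode :: "'l \<Rightarrow> 'l"

definition braided_square :: "('k::comm_ring_1, 'a) tens \<Rightarrow> ('k, 'l, 'a, 'x) hmod_scheme
    \<Rightarrow> ('k, ('k, 'l) tens) module" where
  "braided_square R L = (tspace {2} L)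
     \<lparr>mult := \<lambda>S T. tlift (tspace {2} L) (\<lambda>x. tlift (tspace {2} L) (\<lambda>y. tlift (tspace {2} L)
        (\<lambda>r. pure {2} L [(x!0) \<otimes>\<^bsub>L\<^esub> act L (r!1) (y!0), act L (r!0) (x!1) \<otimes>\<^bsub>L\<^esub> (y!1)]) R) T) S,
      one := pure {2} L [\<one>\<^bsub>L\<^esub>, \<one>\<^bsub>L\<^esub>]\<rparr>"

definition twist_bhopf :: "('k::comm_ring_1, 'a) coalg \<Rightarrow> ('k, 'a) tens
    \<Rightarrow> ('k, 'l, 'a) bhopf \<Rightarrow> ('k, 'l, 'a) bhopf" where
  "twist_bhopf K F L = L
     \<lparr>mult := \<lambda>\<xi> \<xi>'. tlift L (\<lambda>f. act L (f!0) \<xi> \<otimes>\<^bsub>L\<^esub> act L (f!1) \<xi>') (inv\<^bsub>tpow_alg 2 K\<^esub> F),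
      bcomul := \<lambda>\<xi>. tlift (tspace {2} L) (\<lambda>f. tlift (tspace {2} L)
        (\<lambda>d. pure {2} L [act L (f!0) (d!0), act L (f!1) (d!1)]) (bcomul L \<xi>)) F\<rparr>"

definition bhopf_iso :: "('k::comm_ring_1, 'a) coalg \<Rightarrow> ('k, 'l, 'a) bhopf
    \<Rightarrow> ('k, 'm, 'a) bhopf \<Rightarrow> ('l \<Rightarrow> 'm) \<Rightarrow> bool" where
  "bhopf_iso K L M \<phi> \<longleftrightarrow> alg_hom L M \<phi> \<and> bij_betw \<phi> (carrier L) (carrier M) \<and>
     (\<forall>k\<in>carrier K. \<forall>\<xi>\<in>carrier L. \<phi> (act L k \<xi>) = act M k (\<phi> \<xi>)) \<and>
     (\<forall>\<xi>\<in>carrier L. bcounit M (\<phi> \<xi>) = bcounit L \<xi> \<and>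
        bcomul M (\<phi> \<xi>) =
          tlift (tspace {2} M) (\<lambda>d. pure {2} M [\<phi> (d!0), \<phi> (d!1)]) (bcomul L \<xi>))"

definition bhopf_isomorphic :: "('k::comm_ring_1, 'a) coalg \<Rightarrow> ('k, 'l, 'a) bhopf
    \<Rightarrow> ('k, 'm, 'a) bhopf \<Rightarrow> bool" where
  "bhopf_isomorphic K L M \<longleftrightarrow> (\<exists>\<phi>. bhopf_iso K L M \<phi>)"

section \<open>Universal enveloping algebras\<close>

definition env_ideal :: "('k::comm_ring_1, 'a) tens \<Rightarrow> ('k, 'v, 'a) blie \<Rightarrow> ('k, 'v) tens set" where
  "env_ideal R \<gg> = Idl\<^bsub>tensor_alg \<gg>\<^esub>
     {pure UNIV \<gg> [u, v]
        \<ominus>\<^bsub>tensor_alg \<gg>\<^esub> tlift (tensor_alg \<gg>) (\<lambda>r. pure UNIV \<gg> [act \<gg> (r!1) v, act \<gg> (r!0) u]) R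
        \<ominus>\<^bsub>tensor_alg \<gg>\<^esub> pure UNIV \<gg> [bracket \<gg> u v] | u v. u \<in> carrier \<gg> \<and> v \<in> carrier \<gg>}"

abbreviation env_class :: "('k::comm_ring_1, 'a) tens \<Rightarrow> ('k, 'v, 'a) blie
    \<Rightarrow> ('k, 'v) tens \<Rightarrow> ('k, 'v) tens set" where
  "env_class R \<gg> x \<equiv> env_ideal R \<gg> +>\<^bsub>tensor_alg \<gg>\<^esub> x"

text \<open>The action on the tensor algebra which makes it a \<open>K\<close>-module algebra, on words.\<close>

primrec word_act :: "('k::comm_ring_1, 'a) coalg \<Rightarrow> ('k, 'v, 'a) blie \<Rightarrow> 'v list \<Rightarrow> 'a
    \<Rightarrow> ('k, 'v) tens" where
  "word_act K \<gg> [] k = counit K k \<odot>\<^bsub>tensor_alg \<gg>\<^esub> \<one>\<^bsub>tensor_alg \<gg>\<^esub>"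
| "word_act K \<gg> (u # w) k = tlift (tensor_alg \<gg>)
     (\<lambda>d. pure UNIV \<gg> [act \<gg> (d!0) u] \<otimes>\<^bsub>tensor_alg \<gg>\<^esub> word_act K \<gg> w (d!1)) (comul K k)"

definition env_alg :: "('k::comm_ring_1, 'a) coalg \<Rightarrow> ('k, 'a) tens \<Rightarrow> ('k, 'v, 'a) blie
    \<Rightarrow> ('k, ('k, 'v) tens set, 'a) hmod" where
  "env_alg K R \<gg> = (let Q = tensor_alg \<gg> Quot env_ideal R \<gg> in
     \<lparr>carrier = carrier Q, mult = mult Q, one = one Q, ring.zero = ring.zero Q, add = add Q,
      smult = (\<lambda>c. descend (\<lambda>x. env_class R \<gg> (c \<odot>\<^bsub>tensor_alg \<gg>\<^esub> x))),
      act = (\<lambda>k. descend (\<lambda>x. env_class R \<gg>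
        (tlift (tensor_alg \<gg>) (\<lambda>w. word_act K \<gg> w k) x)))\<rparr>)"

definition env_gen :: "('k::comm_ring_1, 'a) tens \<Rightarrow> ('k, 'v, 'a) blie \<Rightarrow> 'v
    \<Rightarrow> ('k, 'v) tens set" where
  "env_gen R \<gg> u = env_class R \<gg> (pure UNIV \<gg> [u])"

text \<open>The coproduct is the algebra map into the braided square with
  \<open>u \<mapsto> u \<boxtimes> 1 + 1 \<boxtimes> u\<close> for \<open>u \<in> \<gg>\<close>, so a word goes to the product of these elements.\<close>

primrec word_comul :: "('k::comm_ring_1, 'a) coalg \<Rightarrow> ('k, 'a) tens \<Rightarrow> ('k, 'v, 'a) blie
    \<Rightarrow> 'v list \<Rightarrow> ('k, ('k, 'v) tens set) tens" where
  "word_comul K R \<gg> [] = \<one>\<^bsub>braided_square R (env_alg K R \<gg>)\<^esub>"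
| "word_comul K R \<gg> (u # w) =
     (let U = env_alg K R \<gg>; B = braided_square R U in
      (pure {2} U [env_gen R \<gg> u, \<one>\<^bsub>U\<^esub>] \<oplus>\<^bsub>B\<^esub> pure {2} U [\<one>\<^bsub>U\<^esub>, env_gen R \<gg> u])
        \<otimes>\<^bsub>B\<^esub> word_comul K R \<gg> w)"

text \<open>The antipode of a braided Hopf algebra is braided antimultiplicative,
  \<open>S(\<xi>\<xi>') = (R\<^sub>\<alpha> \<rhd> S \<xi>') (R\<^sup>\<alpha> \<rhd> S \<xi>)\<close>; with \<open>S u = - u\<close> for \<open>u \<in> \<gg>\<close> this determines it.\<close>

primrec word_antipode :: "('k::comm_ring_1, 'a) coalg \<Rightarrow> ('k, 'a) tens \<Rightarrow> ('k, 'v, 'a) blie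
    \<Rightarrow> 'v list \<Rightarrow> ('k, 'v) tens set" where
  "word_antipode K R \<gg> [] = \<one>\<^bsub>env_alg K R \<gg>\<^esub>"
| "word_antipode K R \<gg> (u # w) =
     (let U = env_alg K R \<gg> in
      tlift U (\<lambda>r. act U (r!1) (word_antipode K R \<gg> w) \<otimes>\<^bsub>U\<^esub> act U (r!0) (\<ominus>\<^bsub>U\<^esub> env_gen R \<gg> u)) R)"

definition enveloping :: "('k::comm_ring_1, 'a) coalg \<Rightarrow> ('k, 'a) tens \<Rightarrow> ('k, 'v, 'a) blie
    \<Rightarrow> ('k, ('k, 'v) tens set, 'a) bhopf" where
  "enveloping K R \<gg> = (let U = env_alg K R \<gg> in
     \<lparr>carrier = carrier U, mult = mult U, one = one U, ring.zero = ring.zero U, add = add U,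
      smult = smult U, act = act U,
      bcomul = descend (tlift (braided_square R U) (word_comul K R \<gg>)),
      bcounit = descend (tlift scal (\<lambda>w. if w = [] then 1 else 0)),
      antipode = descend (tlift U (word_antipode K R \<gg>))\<rparr>)"

end

theory Submission
  imports Defs
begin

text \<open>Both enveloping algebras are quotients of the same module \<open>T(\<gg>)\<close>, and the isomorphism is
  induced by a linear bijection of \<open>T(\<gg>)\<close>. Write \<open>F\<close> for the twist and \<open>G\<close> for its
  inverse, with Sweedler sums understood. The map \<open>\<psi>\<close> is defined on words by \<open>\<psi>(1) = 1\<close>
  and \<open>\<psi>(u t) = (G\<^sup>\<alpha> \<rhd> u) (G\<^sub>\<alpha> \<rhd> \<psi>(t))\<close>; the map \<open>\<chi>\<close> is defined in the same way with \<open>F\<close> and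
  with the action of \<open>K\<^sub>F\<close> on \<open>T(\<gg>)\<close>. Since \<open>G \<Delta>\<^sub>F = \<Delta> G\<close>, the map \<open>\<psi>\<close> carries the action of
  \<open>K\<^sub>F\<close> to the action of \<open>K\<close>, and \<open>\<psi>\<close>, \<open>\<chi>\<close> are inverse to each other because
  \<open>F G = G F = 1\<close>.

  The cocycle identity, in the form \<open>(\<Delta> \<otimes> id)G \<sqdot> G\<^sub>1\<^sub>2 = (id \<otimes> \<Delta>)G \<sqdot> G\<^sub>2\<^sub>3\<close>, says that \<open>\<psi>\<close> is
  multiplicative if its target has the twisted product \<open>(G\<^sup>\<alpha> \<rhd> s) (G\<^sub>\<alpha> \<rhd> t)\<close> (\<open>psi_mul\<close>). On
  words of length two, \<open>R\<^sub>F = F\<^sub>2\<^sub>1 R G\<close> makes the factors \<open>G\<close> and \<open>F\<close> cancel, so that the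
  defining relation of \<open>\<U>(\<gg>\<^sub>F)\<close> for \<open>u, v\<close> goes to the relation of \<open>\<U>(\<gg>)\<close> for
  \<open>G\<^sup>\<alpha> \<rhd> u, G\<^sub>\<alpha> \<rhd> v\<close> (\<open>psi_rel\<close>). The ideals of relations are stable under the actions,
  hence they correspond under \<open>\<psi>\<close> (\<open>Mq_iff\<close>), and \<open>\<chi>\<close> induces an equivariant algebra
  isomorphism \<open>\<Phi> : \<U>(\<gg>)\<^sub>F \<rightarrow> \<U>(\<gg>\<^sub>F)\<close>.

  The counits agree as both vanish on words of positive length. For the coproducts, let
  \<open>\<delta>\<close> be the coproduct of \<open>\<U>(\<gg>)\<close> read on \<open>T(\<gg>)\<close>. It vanishes on the ideal of relations: on
  a relation by \<open>R\<inverse> = R\<^sub>2\<^sub>1\<close> (\<open>delta_rel\<close>), on the ideal as \<open>\<delta>\<close> is multiplicative for the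
  braided square, which rests on the two hexagon identities (\<open>braid_assoc\<close>). The claim
  \<open>\<delta>\<^sub>F = (\<Phi> \<otimes> \<Phi>)(F \<rhd> \<delta>(\<psi>(\<hyphen>)))\<close> is proved by induction on words (\<open>comul_match\<close>). In the
  induction step, multiplication by \<open>u \<boxtimes> 1 + 1 \<boxtimes> u\<close> in the two braided squares has to be
  compared; the summand \<open>u \<boxtimes> 1\<close> is the cocycle identity, and \<open>1 \<boxtimes> u\<close> is the cocycle
  identity together with \<open>R\<^sub>F = F\<^sub>2\<^sub>1 R G\<close> (\<open>braiding_twist\<close>). The formula also shows that
  \<open>\<delta>\<^sub>F\<close> vanishes on its ideal of relations, because \<open>\<delta>\<close> does.\<close>

section \<open>A type that contains all modules\<close>

text \<open>Modules are given by carriers, so every identity between sums would come with membership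
  conditions. To avoid them, all modules whose elements have type \<open>'m\<close> are placed inside
  one type \<open>uvec\<close>, the product of all module structures on subsets of \<open>'m\<close>. It is an
  abelian group with a scalar multiplication in the sense of type classes, and every
  module is a direct summand of it. The key of a module is its factor in the product: the
  record with the fields removed that do not belong to the module structure.\<close>

definition mkey :: "('k::comm_ring_1, 'm, 'x) module_scheme \<Rightarrow> ('k, 'm) module" where
  "mkey M = \<lparr>carrier = carrier M, mult = undefined, one = undefined,
     ring.zero = ring.zero M, add = add M, smult = smult M\<rparr>"

lemma cring_scal: "cring (scal :: ('k::comm_ring_1, 'k) module)"
  by (unfold_locales) (auto simp: scal_def algebra_simps Units_def intro: exI[of _ "- x" for x])

lemma scal_simps [simp]:
  "carrier (scal :: ('k::comm_ring_1, 'k) module) = UNIV"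
  "x \<otimes>\<^bsub>(scal :: ('k, 'k) module)\<^esub> y = x * y" "\<one>\<^bsub>(scal :: ('k, 'k) module)\<^esub> = 1"
  "\<zero>\<^bsub>(scal :: ('k, 'k) module)\<^esub> = 0" "x \<oplus>\<^bsub>(scal :: ('k, 'k) module)\<^esub> y = x + y"
  "x \<odot>\<^bsub>(scal :: ('k, 'k) module)\<^esub> y = x * y"
  by (simp_all add: scal_def)

lemma module_scal_iff:
  fixes M :: "('k::comm_ring_1, 'm, 'x) module_scheme"
  shows "module (scal :: ('k, 'k) module) M \<longleftrightarrow>
    abelian_group M \<and>
    (\<forall>a. \<forall>x\<in>carrier M. a \<odot>\<^bsub>M\<^esub> x \<in> carrier M) \<and>
    (\<forall>a b. \<forall>x\<in>carrier M. (a + b) \<odot>\<^bsub>M\<^esub> x = a \<odot>\<^bsub>M\<^esub> x \<oplus>\<^bsub>M\<^esub> b \<odot>\<^bsub>M\<^esub> x) \<and>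
    (\<forall>a. \<forall>x\<in>carrier M. \<forall>y\<in>carrier M. a \<odot>\<^bsub>M\<^esub> (x \<oplus>\<^bsub>M\<^esub> y) = a \<odot>\<^bsub>M\<^esub> x \<oplus>\<^bsub>M\<^esub> a \<odot>\<^bsub>M\<^esub> y) \<and>
    (\<forall>a b. \<forall>x\<in>carrier M. (a * b) \<odot>\<^bsub>M\<^esub> x = a \<odot>\<^bsub>M\<^esub> (b \<odot>\<^bsub>M\<^esub> x)) \<and>
    (\<forall>x\<in>carrier M. 1 \<odot>\<^bsub>M\<^esub> x = x)"
proof -
  have "module (scal :: ('k, 'k) module) M \<longleftrightarrow> abelian_group M \<and> module_axioms (scal :: ('k, 'k) module) M"
    using cring_scal by (auto simp: module_def)
  then show ?thesis by (simp add: module_axioms_def) blast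
qed

lemma abelian_group_cong:
  fixes M :: "('m, 'x) ring_scheme" and N :: "('m, 'y) ring_scheme"
  assumes "carrier M = carrier N" "add M = add N" "ring.zero M = ring.zero N"
  shows "abelian_group M = abelian_group N"
  using assms by (simp add: abelian_group_def abelian_monoid_def abelian_group_axioms_def comm_group_def
      comm_monoid_def Group.monoid_def comm_monoid_axioms_def group_def group_axioms_def Units_def)

lemma module_mkey:
  fixes M :: "('k::comm_ring_1, 'm, 'x) module_scheme"
  shows "module (scal :: ('k, 'k) module) (mkey M) \<longleftrightarrow> module (scal :: ('k, 'k) module) M"
proof -
  have "abelian_group (mkey M) = abelian_group M"
    by (rule abelian_group_cong) (simp_all add: mkey_def)
  then show ?thesis unfolding module_scal_iff by (simp add: mkey_def)
qed

lemma mkey_simps [simp]: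
  "carrier (mkey M) = carrier M" "ring.zero (mkey M) = ring.zero M" "add (mkey M) = add M"
  "smult (mkey M) = smult M"
  by (simp_all add: mkey_def)

definition valid :: "('k::comm_ring_1, 'm) module \<Rightarrow> bool" where
  "valid N \<longleftrightarrow> module (scal :: ('k, 'k) module) N"

typedef (overloaded) ('k::comm_ring_1, 'm) uvec =
  "{f :: ('k, 'm) module \<Rightarrow> 'm. \<forall>N. if valid N then f N \<in> carrier N else f N = undefined}"
proof -
  have "abelian_group N" if "valid N" for N :: "('k, 'm) module"
    using that by (auto simp: valid_def module_scal_iff)
  then show ?thesis
    by (intro exI[of _ "\<lambda>N. if valid N then \<zero>\<^bsub>N\<^esub> else undefined"])
       (auto intro: abelian_monoid.zero_closed abelian_group.axioms)
qed

definition mkvec :: "(('k::comm_ring_1, 'm) module \<Rightarrow> 'm) \<Rightarrow> ('k, 'm) uvec" where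
  "mkvec f = Abs_uvec (\<lambda>N. if valid N then f N else undefined)"

lemma Rep_mkvec:
  assumes "valid N" "\<And>N. valid N \<Longrightarrow> f N \<in> carrier N"
  shows "Rep_uvec (mkvec f) N = f N"
  using assms by (simp add: mkvec_def Abs_uvec_inverse)

lemma Rep_closed: "valid N \<Longrightarrow> Rep_uvec x N \<in> carrier N"
  using Rep_uvec[of x] by auto

lemma uvec_eqI:
  assumes "\<And>N. valid N \<Longrightarrow> Rep_uvec x N = Rep_uvec y N" shows "x = y"
proof -
  have "Rep_uvec x N = Rep_uvec y N" for N
    using assms[of N] Rep_uvec[of x] Rep_uvec[of y] by (cases "valid N") auto
  then show ?thesis by (simp add: Rep_uvec_inject[symmetric] ext)
qed

lemma validD:
  assumes "valid N"
  shows "module (scal :: ('k::comm_ring_1, 'k) module) (N :: ('k, 'm) module)" "abelian_group N"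
  using assms by (auto simp: valid_def module_scal_iff)

instantiation uvec :: (comm_ring_1, type) ab_group_add
begin

definition zero_uvec :: "('a, 'b) uvec" where "zero_uvec = mkvec (\<lambda>N. \<zero>\<^bsub>N\<^esub>)"
definition plus_uvec :: "('a, 'b) uvec \<Rightarrow> ('a, 'b) uvec \<Rightarrow> ('a, 'b) uvec" where
  "plus_uvec x y = mkvec (\<lambda>N. Rep_uvec x N \<oplus>\<^bsub>N\<^esub> Rep_uvec y N)"
definition uminus_uvec :: "('a, 'b) uvec \<Rightarrow> ('a, 'b) uvec" where
  "uminus_uvec x = mkvec (\<lambda>N. \<ominus>\<^bsub>N\<^esub> Rep_uvec x N)"
definition minus_uvec :: "('a, 'b) uvec \<Rightarrow> ('a, 'b) uvec \<Rightarrow> ('a, 'b) uvec" where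
  "minus_uvec x y = x + (- y)"

lemma Rep_zero: "valid N \<Longrightarrow> Rep_uvec 0 N = \<zero>\<^bsub>N\<^esub>"
  unfolding zero_uvec_def
  by (subst Rep_mkvec) (auto intro: abelian_monoid.zero_closed abelian_group.axioms validD)

lemma Rep_plus: "valid N \<Longrightarrow> Rep_uvec (x + y) N = Rep_uvec x N \<oplus>\<^bsub>N\<^esub> Rep_uvec y N"
  unfolding plus_uvec_def
  by (subst Rep_mkvec) (auto intro: abelian_monoid.a_closed abelian_group.axioms validD Rep_closed)

lemma Rep_uminus: "valid N \<Longrightarrow> Rep_uvec (- x) N = \<ominus>\<^bsub>N\<^esub> Rep_uvec x N"
  unfolding uminus_uvec_def
  by (subst Rep_mkvec) (auto intro: abelian_group.a_inv_closed validD Rep_closed)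

instance
proof
  fix a b c :: "('a, 'b) uvec"
  show "a + b + c = a + (b + c)"
    by (rule uvec_eqI)
       (simp add: Rep_plus Rep_closed abelian_monoid.a_assoc abelian_group.axioms validD)
  show "a + b = b + a"
    by (rule uvec_eqI)
       (simp add: Rep_plus Rep_closed abelian_monoid.a_comm abelian_group.axioms validD)
  show "0 + a = a"
    by (rule uvec_eqI)
       (simp add: Rep_plus Rep_zero Rep_closed abelian_monoid.l_zero abelian_group.axioms validD)
  show "- a + a = 0"
    by (rule uvec_eqI)
       (simp add: Rep_plus Rep_zero Rep_uminus Rep_closed abelian_group.l_neg validD)
  show "a - b = a + - b" by (simp add: minus_uvec_def)
qed

end

definition usc :: "'k::comm_ring_1 \<Rightarrow> ('k, 'm) uvec \<Rightarrow> ('k, 'm) uvec" (infixr \<open>\<bullet>\<close> 75) where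
  "c \<bullet> x = mkvec (\<lambda>N. c \<odot>\<^bsub>N\<^esub> Rep_uvec x N)"

lemma Rep_usc: "valid N \<Longrightarrow> Rep_uvec (c \<bullet> x) N = c \<odot>\<^bsub>N\<^esub> Rep_uvec x N"
  unfolding usc_def
  by (subst Rep_mkvec) (use Rep_closed[of _ x] in \<open>auto simp: valid_def module_scal_iff\<close>)

lemma usc_laws:
  "c \<bullet> (x + y) = c \<bullet> x + c \<bullet> y" "(c + d) \<bullet> x = c \<bullet> x + d \<bullet> x"
  "c \<bullet> d \<bullet> x = (c * d) \<bullet> x" "1 \<bullet> x = x"
  by (rule uvec_eqI; simp add: Rep_plus Rep_usc Rep_closed; simp add: Rep_closed valid_def module_scal_iff)+

interpretation uvec: Modules.module "(\<bullet>) :: 'k::comm_ring_1 \<Rightarrow> ('k, 'm) uvec \<Rightarrow> ('k, 'm) uvec"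
  by unfold_locales (simp_all add: usc_laws)

declare usc_laws(3,4) [simp]
declare uvec.scale_zero_right [simp] uvec.scale_zero_left [simp]

section \<open>Linear maps\<close>

definition linx :: "(('k::comm_ring_1, 'm) uvec \<Rightarrow> ('k, 'n) uvec) \<Rightarrow> bool" where
  "linx f \<longleftrightarrow> (\<forall>x y. f (x + y) = f x + f y) \<and> (\<forall>c x. f (c \<bullet> x) = c \<bullet> f x)"

lemma linxI: "(\<And>x y. f (x + y) = f x + f y) \<Longrightarrow> (\<And>c x. f (c \<bullet> x) = c \<bullet> f x) \<Longrightarrow> linx f"
  by (simp add: linx_def)

lemma linx_add: "linx f \<Longrightarrow> f (x + y) = f x + f y"
  and linx_scale: "linx f \<Longrightarrow> f (c \<bullet> x) = c \<bullet> f x"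
  by (simp_all add: linx_def)

lemma linx_zero: "linx f \<Longrightarrow> f 0 = 0"
  using linx_scale[of f 0 0] by simp

lemma linx_uminus: "linx f \<Longrightarrow> f (- x) = - f x"
  using linx_add[of f x "- x"] linx_zero[of f] by (simp add: eq_neg_iff_add_eq_0 add.commute)

lemma linx_diff: "linx f \<Longrightarrow> f (x - y) = f x - f y"
  using linx_add[of f x "- y"] linx_uminus[of f y] by simp

lemma linx_sum: "linx f \<Longrightarrow> f (sum g A) = (\<Sum>i\<in>A. f (g i))"
  by (induction A rule: infinite_finite_induct) (simp_all add: linx_zero linx_add)

lemmas linx_simps = linx_add linx_scale linx_zero linx_uminus linx_diff linx_sum

definition bilx :: "(('k::comm_ring_1, 'm) uvec \<Rightarrow> ('k, 'n) uvec \<Rightarrow> ('k, 'p) uvec) \<Rightarrow> bool" where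
  "bilx f \<longleftrightarrow> (\<forall>a. linx (f a)) \<and> (\<forall>b. linx (\<lambda>a. f a b))"

definition trilx :: "(('k::comm_ring_1, 'm) uvec \<Rightarrow> ('k, 'n) uvec \<Rightarrow> ('k, 'p) uvec \<Rightarrow> ('k, 'q) uvec) \<Rightarrow> bool" where
  "trilx f \<longleftrightarrow> (\<forall>a b. linx (f a b)) \<and> (\<forall>a c. linx (\<lambda>b. f a b c)) \<and> (\<forall>b c. linx (\<lambda>a. f a b c))"

section \<open>Modules as summands\<close>

text \<open>\<open>emb M\<close> and \<open>prj M\<close> are the inclusion of the summand \<open>M\<close> and the projection to it. The
  idempotent \<open>\<lambda>x. emb M (prj M x)\<close>, written \<open>pp M\<close> below, plays the role of the predicate
  "\<open>x\<close> lies in \<open>M\<close>".\<close>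

definition emb :: "('k::comm_ring_1, 'm, 'x) module_scheme \<Rightarrow> 'm \<Rightarrow> ('k, 'm) uvec" where
  "emb M x = mkvec (\<lambda>N. if N = mkey M \<and> x \<in> carrier M then x else \<zero>\<^bsub>N\<^esub>)"

definition prj :: "('k::comm_ring_1, 'm, 'x) module_scheme \<Rightarrow> ('k, 'm) uvec \<Rightarrow> 'm" where
  "prj M z = Rep_uvec z (mkey M)"

abbreviation kmodule :: "('k::comm_ring_1, 'm, 'x) module_scheme \<Rightarrow> bool" where
  "kmodule M \<equiv> module (scal :: ('k, 'k) module) M"

lemma valid_mkey: "kmodule M \<Longrightarrow> valid (mkey M)"
  by (simp add: valid_def module_mkey)

lemma Rep_emb: "valid N \<Longrightarrow> Rep_uvec (emb M x) N = (if N = mkey M \<and> x \<in> carrier M then x else \<zero>\<^bsub>N\<^esub>)"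
  unfolding emb_def by (subst Rep_mkvec) (auto intro: abelian_monoid.zero_closed abelian_group.axioms validD)

lemma kmodule_abelian: "kmodule M \<Longrightarrow> abelian_group M"
  by (simp add: module_scal_iff)

context
  fixes M :: "('k::comm_ring_1, 'm, 'x) module_scheme"
  assumes M: "kmodule M"
begin

interpretation abelian_group M by (rule kmodule_abelian[OF M])

lemma prj_closed [simp]: "prj M z \<in> carrier M"
  unfolding prj_def using Rep_closed[OF valid_mkey[OF M]] by simp

lemma prj_emb [simp]: "x \<in> carrier M \<Longrightarrow> prj M (emb M x) = x"
  unfolding prj_def by (simp add: Rep_emb valid_mkey M)

lemma prj_add: "prj M (x + y) = prj M x \<oplus>\<^bsub>M\<^esub> prj M y"
  unfolding prj_def by (simp add: Rep_plus valid_mkey M)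
lemma prj_usc: "prj M (c \<bullet> y) = c \<odot>\<^bsub>M\<^esub> prj M y"
  unfolding prj_def by (simp add: Rep_usc valid_mkey M)
lemma prj_zero: "prj M 0 = \<zero>\<^bsub>M\<^esub>"
  unfolding prj_def by (simp add: Rep_zero valid_mkey M)
lemma emb_add: "x \<in> carrier M \<Longrightarrow> y \<in> carrier M \<Longrightarrow> emb M (x \<oplus>\<^bsub>M\<^esub> y) = emb M x + emb M y"
proof (rule uvec_eqI)
  fix N :: "('k, 'm) module" assume xy: "x \<in> carrier M" "y \<in> carrier M" and N: "valid N"
  have "\<zero>\<^bsub>N\<^esub> \<oplus>\<^bsub>N\<^esub> \<zero>\<^bsub>N\<^esub> = \<zero>\<^bsub>N\<^esub>"
    using Rep_plus[OF N, of 0 0] Rep_zero[OF N] by simp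
  then show "Rep_uvec (emb M (x \<oplus>\<^bsub>M\<^esub> y)) N = Rep_uvec (emb M x + emb M y) N"
    using xy N by (auto simp: Rep_emb Rep_plus)
qed
lemma emb_smult: "x \<in> carrier M \<Longrightarrow> emb M (c \<odot>\<^bsub>M\<^esub> x) = c \<bullet> emb M x"
proof (rule uvec_eqI)
  fix N :: "('k, 'm) module" assume x: "x \<in> carrier M" and N: "valid N"
  have "c \<odot>\<^bsub>N\<^esub> \<zero>\<^bsub>N\<^esub> = \<zero>\<^bsub>N\<^esub>"
    using Rep_usc[OF N, of c 0] Rep_zero[OF N] by simp
  then show "Rep_uvec (emb M (c \<odot>\<^bsub>M\<^esub> x)) N = Rep_uvec (c \<bullet> emb M x) N"
    using x N M by (auto simp: Rep_emb Rep_usc module_scal_iff)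
qed
lemma emb_zero: "emb M \<zero>\<^bsub>M\<^esub> = 0"
  by (rule uvec_eqI) (auto simp: Rep_emb Rep_zero)
lemma emb_eq_iff: "x \<in> carrier M \<Longrightarrow> y \<in> carrier M \<Longrightarrow> emb M x = emb M y \<longleftrightarrow> x = y"
  by (metis prj_emb)
lemma emb_uminus: "x \<in> carrier M \<Longrightarrow> emb M (\<ominus>\<^bsub>M\<^esub> x) = - emb M x"
  using emb_add[of "\<ominus>\<^bsub>M\<^esub> x" x] by (simp add: l_neg emb_zero eq_neg_iff_add_eq_0)
lemma emb_diff: "x \<in> carrier M \<Longrightarrow> y \<in> carrier M \<Longrightarrow> emb M (x \<ominus>\<^bsub>M\<^esub> y) = emb M x - emb M y"
  by (simp add: a_minus_def emb_add emb_uminus)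

lemma linx_emb_prj: "linx (\<lambda>z. emb M (prj M z))"
  by (rule linxI) (simp_all add: prj_add prj_usc emb_add emb_smult)

lemma prj_sum: "finite A \<Longrightarrow> prj M (sum g A) = (\<Oplus>\<^bsub>M\<^esub>i\<in>A. prj M (g i))"
  by (induction A rule: finite_induct) (simp_all add: prj_zero prj_add)

end

section \<open>Evaluating multilinear functions on tensors\<close>

lemma lookup_pscale [simp]: "Poly_Mapping.lookup (pscale c x) w = c * Poly_Mapping.lookup x w"
  by (simp add: pscale_def Poly_Mapping.map.rep_eq when_def)

interpretation ps: Modules.module "pscale :: 'k::comm_ring_1 \<Rightarrow> ('w \<Rightarrow>\<^sub>0 'k) \<Rightarrow> _"
  by unfold_locales (auto intro!: poly_mapping_eqI simp: lookup_add algebra_simps)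

lemma keys_pscale: "Poly_Mapping.keys (pscale c x) \<subseteq> Poly_Mapping.keys x"
  by (auto simp: in_keys_iff)

text \<open>The linear extension of a function on words to the free module on words.\<close>

definition ev :: "('w \<Rightarrow>\<^sub>0 'k::comm_ring_1) \<Rightarrow> ('w \<Rightarrow> ('k, 'n) uvec) \<Rightarrow> ('k, 'n) uvec" where
  "ev x f = (\<Sum>w\<in>Poly_Mapping.keys x. Poly_Mapping.lookup x w \<bullet> f w)"

lemma ev_superset:
  "finite A \<Longrightarrow> Poly_Mapping.keys x \<subseteq> A \<Longrightarrow> ev x f = (\<Sum>w\<in>A. Poly_Mapping.lookup x w \<bullet> f w)"
  unfolding ev_def by (rule sum.mono_neutral_left) (auto simp: in_keys_iff)

lemma ev_zero [simp]: "ev 0 f = 0" by (simp add: ev_def)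

lemma ev_add: "ev (x + y) f = ev x f + ev y f"
proof -
  let ?A = "Poly_Mapping.keys x \<union> Poly_Mapping.keys y"
  have "ev z f = (\<Sum>w\<in>?A. Poly_Mapping.lookup z w \<bullet> f w)" if "Poly_Mapping.keys z \<subseteq> ?A" for z
    using that by (intro ev_superset) auto
  then show ?thesis
    using keys_add[of x y] by (simp add: lookup_add usc_laws(2) sum.distrib)
qed

lemma ev_pscale: "ev (pscale c x) f = c \<bullet> ev x f"
  using ev_superset[of "Poly_Mapping.keys x" "pscale c x" f] keys_pscale[of c x]
  by (simp add: ev_def uvec.scale_sum_right)

lemma ev_uminus: "ev (- x) f = - ev x f"
  by (simp add: ev_def sum_negf)

lemma ev_diff: "ev (x - y) f = ev x f - ev y f"
  using ev_add[of x "- y" f] by (simp add: ev_uminus)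

lemma ev_single [simp]: "ev (Poly_Mapping.single w c) f = c \<bullet> f w"
  by (subst ev_superset[of "{w}"]) auto

definition mlin :: "nat set \<Rightarrow> ('k::comm_ring_1, 'm, 'x) module_scheme \<Rightarrow> ('m list \<Rightarrow> ('k, 'n) uvec) \<Rightarrow> bool" where
  "mlin D M f \<longleftrightarrow> (\<forall>xs u ys. xs @ u # ys \<in> words D M \<longrightarrow>
     (\<forall>v\<in>carrier M. f (xs @ (u \<oplus>\<^bsub>M\<^esub> v) # ys) = f (xs @ u # ys) + f (xs @ v # ys)) \<and>
     (\<forall>c. f (xs @ (c \<odot>\<^bsub>M\<^esub> u) # ys) = c \<bullet> f (xs @ u # ys)))"

abbreviation relspan :: "nat set \<Rightarrow> ('k::comm_ring_1, 'm, 'x) module_scheme \<Rightarrow> ('m list \<Rightarrow>\<^sub>0 'k) set" where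
  "relspan D M \<equiv> Modules.module.span pscale (multilin_rels D M)"

text \<open>This is the universal property of the tensor powers: a multilinear function kills the
  relations, hence is defined on their cosets.\<close>

lemma ev_relspan:
  assumes "mlin D M f" "r \<in> relspan D M" shows "ev r f = 0"
proof -
  have "multilin_rels D M \<subseteq> {r. ev r f = 0}"
    using assms(1) by (auto simp: multilin_rels_def mlin_def ev_diff)
  moreover have "ps.subspace {r. ev r f = 0}"
    by (auto simp: ps.subspace_def ev_add ev_pscale)
  ultimately show ?thesis using ps.span_minimal assms(2) by blast
qed

lemma words_insert:
  "xs @ u # ys \<in> words D M \<Longrightarrow> v \<in> carrier M \<Longrightarrow> xs @ v # ys \<in> words D M"
  by (auto simp: words_def)

lemma keys_relspan:
  assumes M: "kmodule M" and r: "r \<in> relspan D M" shows "Poly_Mapping.keys r \<subseteq> words D M"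
proof -
  let ?S = "{r. Poly_Mapping.keys r \<subseteq> words D M}"
  interpret abelian_group M by (rule kmodule_abelian[OF M])
  have sm: "c \<odot>\<^bsub>M\<^esub> u \<in> carrier M" if "u \<in> carrier M" for c u
    using M that by (auto simp: module_scal_iff)
  have car: "u \<in> carrier M" if "xs @ u # ys \<in> words D M" for xs u ys
    using that by (auto simp: words_def)
  have sg: "Poly_Mapping.single w c \<in> ?S" if "w \<in> words D M" for w c
    using that by simp
  have sd: "x - y \<in> ?S" if "x \<in> ?S" "y \<in> ?S" for x y
    using that keys_diff[of x y] by blast
  have "multilin_rels D M \<subseteq> ?S"
  proof
    fix r assume "r \<in> multilin_rels D M"
    then consider
        (1) xs u v ys where "r = Poly_Mapping.single (xs @ (u \<oplus>\<^bsub>M\<^esub> v) # ys) 1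
            - Poly_Mapping.single (xs @ u # ys) 1 - Poly_Mapping.single (xs @ v # ys) 1"
          "xs @ u # ys \<in> words D M" "v \<in> carrier M"
      | (2) xs c u ys where "r = Poly_Mapping.single (xs @ (c \<odot>\<^bsub>M\<^esub> u) # ys) 1 - Poly_Mapping.single (xs @ u # ys) c"
          "xs @ u # ys \<in> words D M"
      unfolding multilin_rels_def by blast
    then show "r \<in> ?S"
    proof cases
      case 1
      show ?thesis unfolding 1(1)
        by (intro sd sg 1(2) words_insert[OF 1(2)] 1(3) a_closed car[OF 1(2)])
    next
      case 2
      show ?thesis unfolding 2(1)
        by (intro sd sg 2(2) words_insert[OF 2(2)] sm car[OF 2(2)])
    qed
  qed
  moreover have "ps.subspace ?S"
  proof (rule ps.subspaceI)
    show "x + y \<in> ?S" if "x \<in> ?S" "y \<in> ?S" for x y using that keys_add[of x y] by blast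
    show "pscale c x \<in> ?S" if "x \<in> ?S" for c x using that keys_pscale[of c x] by blast
  qed simp
  ultimately show ?thesis using ps.span_minimal r by blast
qed

text \<open>\<open>tev S f\<close> is the value on \<open>S\<close> of the linear map induced by the multilinear function \<open>f\<close>.
  It is computed on a chosen representative, so that it is linear in \<open>f\<close> and commutes with
  other such sums whether or not \<open>f\<close> is multilinear; multilinearity enters only where \<open>S\<close>
  varies (\<open>tev_tclass\<close>).\<close>

definition tev :: "('k::comm_ring_1, 'm) tens \<Rightarrow> ('m list \<Rightarrow> ('k, 'n) uvec) \<Rightarrow> ('k, 'n) uvec" where
  "tev S f = ev (SOME x. x \<in> S) f"

lemma tclass_self: "x \<in> tclass D M x"
  by (simp add: tclass_def ps.span_zero)

lemma tclass_eqI: assumes "x - y \<in> relspan D M" shows "tclass D M x = tclass D M y"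
proof -
  have "z - x \<in> relspan D M \<longleftrightarrow> z - y \<in> relspan D M" for z
    using ps.span_add[OF _ assms, of "z - x"] ps.span_diff[OF _ assms, of "z - y"] by auto
  then show ?thesis by (auto simp: tclass_def)
qed

lemma tclass_eqD: "y \<in> tclass D M x \<Longrightarrow> y - x \<in> relspan D M"
  by (simp add: tclass_def)

lemma ev_tclass: "mlin D M f \<Longrightarrow> y \<in> tclass D M x \<Longrightarrow> ev y f = ev x f"
  using ev_relspan[OF _ tclass_eqD] ev_diff[of y x f] by fastforce

lemma tev_tclass: "mlin D M f \<Longrightarrow> tev (tclass D M x) f = ev x f"
  unfolding tev_def by (rule ev_tclass) (auto intro: someI[of _ x] tclass_self)

lemma descend_eq: "x \<in> S \<Longrightarrow> (\<And>y. y \<in> S \<Longrightarrow> f y = c) \<Longrightarrow> descend f S = c"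
proof -
  assume "x \<in> S" "\<And>y. y \<in> S \<Longrightarrow> f y = c"
  then have "f ` S = {c}" by force
  then show ?thesis by (simp add: descend_def)
qed

lemma tspace_add: "tclass D M x \<oplus>\<^bsub>tspace D M\<^esub> tclass D M y = tclass D M (x + y)"
proof -
  have *: "tclass D M (x' + y') = tclass D M (x + y)" if "x' \<in> tclass D M x" "y' \<in> tclass D M y" for x' y'
    using ps.span_add[OF tclass_eqD[OF that(1)] tclass_eqD[OF that(2)]]
    by (intro tclass_eqI) (simp add: algebra_simps)
  have "descend (\<lambda>y. tclass D M (x' + y)) (tclass D M y) = tclass D M (x + y)" if "x' \<in> tclass D M x" for x'
    by (rule descend_eq[OF tclass_self]) (rule *[OF that])
  then show ?thesis
    unfolding tspace_def by (simp, rule descend_eq[OF tclass_self])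
qed

lemma tspace_smult: "c \<odot>\<^bsub>tspace D M\<^esub> tclass D M x = tclass D M (pscale c x)"
proof -
  have "tclass D M (pscale c x') = tclass D M (pscale c x)" if "x' \<in> tclass D M x" for x'
    using ps.span_scale[OF tclass_eqD[OF that], of c]
    by (intro tclass_eqI) (simp add: ps.scale_right_diff_distrib)
  then show ?thesis
    unfolding tspace_def by (simp, intro descend_eq[OF tclass_self])
qed

lemma tspace_zero: "\<zero>\<^bsub>tspace D M\<^esub> = tclass D M 0"
  by (simp add: tspace_def)

lemma tspace_carrier: "carrier (tspace D M) = {tclass D M x | x. Poly_Mapping.keys x \<subseteq> words D M}"
  by (simp add: tspace_def)

lemma tclass_closed: "Poly_Mapping.keys x \<subseteq> words D M \<Longrightarrow> tclass D M x \<in> carrier (tspace D M)"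
  by (auto simp: tspace_carrier)

lemma tspaceE:
  assumes "S \<in> carrier (tspace D M)"
  obtains x where "Poly_Mapping.keys x \<subseteq> words D M" "S = tclass D M x"
  using assms by (auto simp: tspace_carrier)

lemma kmodule_tspace [simp]: "kmodule (tspace D M)"
proof -
  let ?T = "tspace D M"
  have cl: "tclass D M (x + y) \<in> carrier (tspace D M)" "tclass D M (pscale c x) \<in> carrier (tspace D M)"
      "tclass D M (- x) \<in> carrier (tspace D M)"
    if "Poly_Mapping.keys x \<subseteq> words D M" "Poly_Mapping.keys y \<subseteq> words D M" for x y c
    using that keys_add[of x y] keys_pscale[of c x] by (auto intro!: tclass_closed)
  have ag: "abelian_group ?T"
  proof (rule abelian_groupI)
    fix S T U assume S: "S \<in> carrier ?T"
    obtain x where x: "Poly_Mapping.keys x \<subseteq> words D M" "S = tclass D M x" using S by (elim tspaceE)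
    show "\<exists>y\<in>carrier ?T. y \<oplus>\<^bsub>?T\<^esub> S = \<zero>\<^bsub>?T\<^esub>"
      using x cl(3)[OF x(1) x(1)] by (intro bexI[of _ "tclass D M (- x)"]) (simp_all add: tspace_add tspace_zero)
    show "\<zero>\<^bsub>?T\<^esub> \<oplus>\<^bsub>?T\<^esub> S = S" using x by (simp add: tspace_add tspace_zero)
    assume "T \<in> carrier ?T"
    then obtain y where y: "Poly_Mapping.keys y \<subseteq> words D M" "T = tclass D M y" by (elim tspaceE)
    show "S \<oplus>\<^bsub>?T\<^esub> T \<in> carrier ?T" using x y cl(1) by (simp add: tspace_add)
    show "S \<oplus>\<^bsub>?T\<^esub> T = T \<oplus>\<^bsub>?T\<^esub> S" using x y by (simp add: tspace_add add.commute)
    assume "U \<in> carrier ?T"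
    then obtain z where z: "U = tclass D M z" by (elim tspaceE)
    show "S \<oplus>\<^bsub>?T\<^esub> T \<oplus>\<^bsub>?T\<^esub> U = S \<oplus>\<^bsub>?T\<^esub> (T \<oplus>\<^bsub>?T\<^esub> U)" using x y z by (simp add: tspace_add add.assoc)
  next
    show "\<zero>\<^bsub>?T\<^esub> \<in> carrier ?T" unfolding tspace_zero by (rule tclass_closed) simp
  qed
  have 1: "a \<odot>\<^bsub>?T\<^esub> S \<in> carrier ?T \<and> (a + b) \<odot>\<^bsub>?T\<^esub> S = a \<odot>\<^bsub>?T\<^esub> S \<oplus>\<^bsub>?T\<^esub> b \<odot>\<^bsub>?T\<^esub> S
      \<and> (a * b) \<odot>\<^bsub>?T\<^esub> S = a \<odot>\<^bsub>?T\<^esub> (b \<odot>\<^bsub>?T\<^esub> S) \<and> 1 \<odot>\<^bsub>?T\<^esub> S = S" if S: "S \<in> carrier ?T" for a b S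
  proof -
    obtain x where x: "Poly_Mapping.keys x \<subseteq> words D M" "S = tclass D M x" using S by (elim tspaceE)
    show ?thesis using x cl(2)[OF x(1) x(1)] by (simp add: tspace_add tspace_smult ps.scale_left_distrib)
  qed
  have 2: "a \<odot>\<^bsub>?T\<^esub> (S \<oplus>\<^bsub>?T\<^esub> T) = a \<odot>\<^bsub>?T\<^esub> S \<oplus>\<^bsub>?T\<^esub> a \<odot>\<^bsub>?T\<^esub> T" if ST: "S \<in> carrier ?T" "T \<in> carrier ?T" for a S T
  proof -
    obtain x where x: "S = tclass D M x" using ST(1) by (elim tspaceE)
    moreover obtain y where y: "T = tclass D M y" using ST(2) by (elim tspaceE)
    ultimately show ?thesis by (simp add: tspace_add tspace_smult ps.scale_right_distrib)
  qed
  show ?thesis unfolding module_scal_iff by (intro conjI allI ballI ag; simp add: 1 2)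
qed

lemma keys_SOME:
  assumes "kmodule M" "S \<in> carrier (tspace D M)" shows "Poly_Mapping.keys (SOME x. x \<in> S) \<subseteq> words D M"
proof -
  obtain x where x: "S = tclass D M x" "Poly_Mapping.keys x \<subseteq> words D M" using assms by (elim tspaceE)
  have "(SOME x. x \<in> S) \<in> S" unfolding x by (rule someI[of _ x]) (rule tclass_self)
  then have "(SOME x. x \<in> S) - x \<in> relspan D M" unfolding x by (rule tclass_eqD)
  then have k: "Poly_Mapping.keys ((SOME x. x \<in> S) - x) \<subseteq> words D M" by (rule keys_relspan[OF assms(1)])
  have "Poly_Mapping.keys (SOME x. x \<in> S) \<subseteq> Poly_Mapping.keys ((SOME x. x \<in> S) - x) \<union> Poly_Mapping.keys x"
    using keys_add[of "(SOME x. x \<in> S) - x" x] by (simp only: diff_add_cancel)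
  then show ?thesis using k x(2) by blast
qed

lemma tev_cong:
  assumes "kmodule M" "S \<in> carrier (tspace D M)" "\<And>w. w \<in> words D M \<Longrightarrow> f w = g w"
  shows "tev S f = tev S g"
  unfolding tev_def ev_def using keys_SOME[OF assms(1,2)] by (intro sum.cong) (auto simp: assms(3))

lemma tev_plus: "tev S (\<lambda>w. f w + g w) = tev S f + tev S g"
  and tev_usc: "tev S (\<lambda>w. c \<bullet> f w) = c \<bullet> tev S f"
  and tev_0: "tev S (\<lambda>w. 0) = 0"
  and tev_neg: "tev S (\<lambda>w. - f w) = - tev S f"
  by (simp_all add: tev_def ev_def usc_laws(1) sum.distrib uvec.scale_sum_right mult.commute sum_negf)

lemma tev_linx: "linx g \<Longrightarrow> g (tev S f) = tev S (\<lambda>w. g (f w))"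
  by (simp add: tev_def ev_def linx_sum linx_scale)

lemma linx_tev: assumes "\<And>w. linx (\<lambda>z. f z w)" shows "linx (\<lambda>z. tev S (f z))"
proof (rule linxI)
  fix x y c
  have "f (x + y) = (\<lambda>w. f x w + f y w)" "f (c \<bullet> x) = (\<lambda>w. c \<bullet> f x w)"
    using linx_add[OF assms] linx_scale[OF assms] by blast+
  then show "tev S (f (x + y)) = tev S (f x) + tev S (f y)" "tev S (f (c \<bullet> x)) = c \<bullet> tev S (f x)"
    by (simp_all add: tev_plus tev_usc)
qed

lemma tev_swap: "tev S (\<lambda>x. tev T (\<lambda>y. f x y)) = tev T (\<lambda>y. tev S (\<lambda>x. f x y))"
  unfolding tev_def ev_def uvec.scale_sum_right
  by (subst sum.swap) (simp add: mult.commute)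

lemma pure_closed: "w \<in> words D M \<Longrightarrow> pure D M w \<in> carrier (tspace D M)"
  by (auto simp: pure_def intro: tclass_closed)

lemma tev_pure [simp]: "mlin D M f \<Longrightarrow> tev (pure D M w) f = f w"
  by (simp add: pure_def tev_tclass)

lemma tev_add: "mlin D M f \<Longrightarrow> S \<in> carrier (tspace D M) \<Longrightarrow> T \<in> carrier (tspace D M) \<Longrightarrow>
  tev (S \<oplus>\<^bsub>tspace D M\<^esub> T) f = tev S f + tev T f"
  by (elim tspaceE) (simp add: tspace_add tev_tclass ev_add)

lemma tev_smult: "mlin D M f \<Longrightarrow> S \<in> carrier (tspace D M) \<Longrightarrow>
  tev (c \<odot>\<^bsub>tspace D M\<^esub> S) f = c \<bullet> tev S f"
  by (elim tspaceE) (simp add: tspace_smult tev_tclass ev_pscale)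

lemma linx_tev_prj: "mlin D M f \<Longrightarrow> linx (\<lambda>z. tev (prj (tspace D M) z) f)"
  by (rule linxI) (simp_all add: prj_add prj_usc tev_add tev_smult)

lemma mlin_emb_pure:
  assumes M: "kmodule M" shows "mlin D M (\<lambda>w. emb (tspace D M) (pure D M w))"
  unfolding mlin_def
proof (intro allI impI conjI ballI)
  fix xs u ys v c assume w: "xs @ u # ys \<in> words D M"
  then have cl: "pure D M (xs @ u # ys) \<in> carrier (tspace D M)" by (rule pure_closed)
  show "emb (tspace D M) (pure D M (xs @ (c \<odot>\<^bsub>M\<^esub> u) # ys)) = c \<bullet> emb (tspace D M) (pure D M (xs @ u # ys))"
  proof -
    have "pure D M (xs @ (c \<odot>\<^bsub>M\<^esub> u) # ys) = c \<odot>\<^bsub>tspace D M\<^esub> pure D M (xs @ u # ys)"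
      unfolding pure_def tspace_smult
    proof (rule tclass_eqI)
      have e: "pscale c (Poly_Mapping.single (xs @ u # ys) 1) = Poly_Mapping.single (xs @ u # ys) c"
        by (rule poly_mapping_eqI) (simp add: lookup_single when_def)
      show "Poly_Mapping.single (xs @ (c \<odot>\<^bsub>M\<^esub> u) # ys) 1 - pscale c (Poly_Mapping.single (xs @ u # ys) 1) \<in> relspan D M"
        unfolding e by (rule ps.span_base) (use w in \<open>auto simp: multilin_rels_def\<close>)
    qed
    then show ?thesis using cl by (simp add: emb_smult)
  qed
  assume v: "v \<in> carrier M"
  have cl2: "pure D M (xs @ v # ys) \<in> carrier (tspace D M)" by (intro pure_closed words_insert[OF w] v)
  have "pure D M (xs @ (u \<oplus>\<^bsub>M\<^esub> v) # ys) = pure D M (xs @ u # ys) \<oplus>\<^bsub>tspace D M\<^esub> pure D M (xs @ v # ys)"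
    unfolding pure_def tspace_add
    by (rule tclass_eqI, rule ps.span_base)
       (use w v in \<open>auto simp: multilin_rels_def diff_diff_eq intro!: disjI1\<close>)
  then show "emb (tspace D M) (pure D M (xs @ (u \<oplus>\<^bsub>M\<^esub> v) # ys)) =
    emb (tspace D M) (pure D M (xs @ u # ys)) + emb (tspace D M) (pure D M (xs @ v # ys))"
    using cl cl2 by (simp add: emb_add)
qed

lemma pm_expand: "x = (\<Sum>w\<in>Poly_Mapping.keys x. pscale (Poly_Mapping.lookup x w) (Poly_Mapping.single w 1))"
proof (rule poly_mapping_eqI)
  fix v
  have "Poly_Mapping.lookup (\<Sum>w\<in>A. pscale (Poly_Mapping.lookup x w) (Poly_Mapping.single w 1)) v =
      (if v \<in> A then Poly_Mapping.lookup x v else 0)" if "finite A" for A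
    using that by (induction A rule: finite_induct) (auto simp: lookup_add lookup_single when_def)
  then show "Poly_Mapping.lookup x v =
      Poly_Mapping.lookup (\<Sum>w\<in>Poly_Mapping.keys x. pscale (Poly_Mapping.lookup x w) (Poly_Mapping.single w 1)) v"
    by (simp add: in_keys_iff)
qed

lemma emb_tclass:
  assumes x: "Poly_Mapping.keys x \<subseteq> words D M"
  shows "emb (tspace D M) (tclass D M x) = ev x (\<lambda>w. emb (tspace D M) (pure D M w))"
proof -
  let ?t = "\<lambda>A. (\<Sum>w\<in>A. pscale (Poly_Mapping.lookup x w) (Poly_Mapping.single w 1))"
  have "Poly_Mapping.keys (?t A) \<subseteq> words D M \<and>
      emb (tspace D M) (tclass D M (?t A)) = (\<Sum>w\<in>A. Poly_Mapping.lookup x w \<bullet> emb (tspace D M) (pure D M w))"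
    if "finite A" "A \<subseteq> words D M" for A
    using that
  proof (induction A rule: finite_induct)
    case empty
    show ?case by (simp add: emb_zero flip: tspace_zero)
  next
    case (insert w A)
    let ?s = "pscale (Poly_Mapping.lookup x w) (Poly_Mapping.single w 1)"
    have ks: "Poly_Mapping.keys ?s \<subseteq> words D M"
      using keys_pscale[of "Poly_Mapping.lookup x w" "Poly_Mapping.single w 1"] insert.prems by auto
    have IH: "Poly_Mapping.keys (?t A) \<subseteq> words D M"
      "emb (tspace D M) (tclass D M (?t A)) = (\<Sum>w\<in>A. Poly_Mapping.lookup x w \<bullet> emb (tspace D M) (pure D M w))"
      using insert by auto
    have "emb (tspace D M) (tclass D M ?s) = Poly_Mapping.lookup x w \<bullet> emb (tspace D M) (pure D M w)"
      using insert.prems by (simp add: emb_smult pure_closed flip: tspace_smult pure_def)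
    then have "emb (tspace D M) (tclass D M (?s + ?t A)) =
        Poly_Mapping.lookup x w \<bullet> emb (tspace D M) (pure D M w)
        + (\<Sum>w\<in>A. Poly_Mapping.lookup x w \<bullet> emb (tspace D M) (pure D M w))"
      using ks IH by (simp add: emb_add tclass_closed flip: tspace_add)
    then show ?case using insert.hyps ks IH(1) keys_add[of ?s "?t A"] by auto
  qed
  from this[of "Poly_Mapping.keys x"] show ?thesis
    using x pm_expand[of x] by (simp add: ev_def)
qed

lemma tev_emb_pure:
  assumes "kmodule M" "S \<in> carrier (tspace D M)"
  shows "tev S (\<lambda>w. emb (tspace D M) (pure D M w)) = emb (tspace D M) S"
  using assms(2) by (elim tspaceE) (simp add: tev_tclass mlin_emb_pure assms(1) emb_tclass)

text \<open>Multilinear functions separate tensors, because \<open>w \<mapsto> pure w\<close> is itself multilinear.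
  Identities between tensors are proved below by evaluating them on an arbitrary
  multilinear function.\<close>

lemma tens_eqI:
  fixes M :: "('k::comm_ring_1, 'm, 'x) module_scheme"
  assumes "kmodule M" "S \<in> carrier (tspace D M)" "T \<in> carrier (tspace D M)"
    and "\<And>f :: _ \<Rightarrow> ('k, ('k, 'm) tens) uvec. mlin D M f \<Longrightarrow> tev S f = tev T f"
  shows "S = T"
proof -
  have "emb (tspace D M) S = emb (tspace D M) T"
    using assms(4)[OF mlin_emb_pure[OF assms(1)]]
    unfolding tev_emb_pure[OF assms(1,2)] tev_emb_pure[OF assms(1,3)] .
  then show ?thesis by (simp only: emb_eq_iff[OF kmodule_tspace assms(2,3)])
qed

text \<open>The link between \<open>tlift\<close>, which sums in the carrier of \<open>P\<close>, and evaluation in \<open>uvec\<close>.\<close>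

lemma emb_tlift:
  assumes M: "kmodule M" and P: "kmodule P" and S: "S \<in> carrier (tspace D M)"
    and b: "\<And>w. w \<in> words D M \<Longrightarrow> b w \<in> carrier P" and ml: "mlin D M (\<lambda>w. emb P (b w))"
  shows "tlift P b S \<in> carrier P" "emb P (tlift P b S) = tev S (\<lambda>w. emb P (b w))"
proof -
  interpret abelian_group P by (rule kmodule_abelian[OF P])
  obtain x where x: "S = tclass D M x" "Poly_Mapping.keys x \<subseteq> words D M" using S by (elim tspaceE)
  have sm: "c \<odot>\<^bsub>P\<^esub> u \<in> carrier P" if "u \<in> carrier P" for c u
    using P that by (auto simp: module_scal_iff)
  have fs: "(\<Oplus>\<^bsub>P\<^esub>w\<in>Poly_Mapping.keys y. Poly_Mapping.lookup y w \<odot>\<^bsub>P\<^esub> b w) = prj P (ev y (\<lambda>w. emb P (b w)))"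
    if "Poly_Mapping.keys y \<subseteq> words D M" for y
  proof -
    have "prj P (Poly_Mapping.lookup y w \<bullet> emb P (b w)) = Poly_Mapping.lookup y w \<odot>\<^bsub>P\<^esub> b w"
      "Poly_Mapping.lookup y w \<odot>\<^bsub>P\<^esub> b w \<in> carrier P" if "w \<in> Poly_Mapping.keys y" for w
      using b[of w] \<open>Poly_Mapping.keys y \<subseteq> words D M\<close> that by (auto simp: prj_usc[OF P] P sm)
    then show ?thesis
      unfolding ev_def prj_sum[OF P finite_keys] by (intro finsum_cong') auto
  qed
  have "tlift P b S = prj P (ev x (\<lambda>w. emb P (b w)))"
    unfolding tlift_def x
  proof (rule descend_eq[OF tclass_self])
    fix y assume y: "y \<in> tclass D M x"
    have "Poly_Mapping.keys (y - x) \<subseteq> words D M" by (rule keys_relspan[OF M tclass_eqD[OF y]])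
    moreover have "Poly_Mapping.keys y \<subseteq> Poly_Mapping.keys (y - x) \<union> Poly_Mapping.keys x"
      using keys_add[of "y - x" x] by (simp only: diff_add_cancel)
    ultimately have "Poly_Mapping.keys y \<subseteq> words D M" using x(2) by blast
    then show "(\<Oplus>\<^bsub>P\<^esub>w\<in>Poly_Mapping.keys y. Poly_Mapping.lookup y w \<odot>\<^bsub>P\<^esub> b w) = prj P (ev x (\<lambda>w. emb P (b w)))"
      by (simp add: fs ev_tclass[OF ml y])
  qed
  then have e: "tlift P b S = prj P (tev S (\<lambda>w. emb P (b w)))" by (simp add: x(1) tev_tclass[OF ml])
  then show "tlift P b S \<in> carrier P" by (simp add: P)
  show "emb P (tlift P b S) = tev S (\<lambda>w. emb P (b w))"
    unfolding e using tev_linx[OF linx_emb_prj[OF P], of S "\<lambda>w. emb P (b w)"]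
      tev_cong[OF M S, of "\<lambda>w. emb P (prj P (emb P (b w)))" "\<lambda>w. emb P (b w)"] P b by simp
qed

lemma tev_tlift:
  assumes M: "kmodule M" and S: "S \<in> carrier (tspace D M)"
    and b: "\<And>w. w \<in> words D M \<Longrightarrow> b w \<in> carrier (tspace E N)"
    and ml: "mlin D M (\<lambda>w. emb (tspace E N) (b w))" and f: "mlin E N f"
  shows "tev (tlift (tspace E N) b S) f = tev S (\<lambda>w. tev (b w) f)"
proof -
  note e = emb_tlift[OF M kmodule_tspace S b ml]
  have "tlift (tspace E N) b S = prj (tspace E N) (tev S (\<lambda>w. emb (tspace E N) (b w)))"
    using arg_cong[OF e(2), of "prj (tspace E N)"] by (simp only: prj_emb[OF kmodule_tspace e(1)])
  then have "tev (tlift (tspace E N) b S) f = tev S (\<lambda>w. tev (prj (tspace E N) (emb (tspace E N) (b w))) f)"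
    using tev_linx[OF linx_tev_prj[OF f], of S "\<lambda>w. emb (tspace E N) (b w)"] by simp
  also have "\<dots> = tev S (\<lambda>w. tev (b w) f)"
    by (rule tev_cong[OF M S]) (simp add: b)
  finally show ?thesis .
qed

section \<open>Algebras whose product is given on words\<close>

lemma module_simps:
  assumes "kmodule M"
  shows "u \<in> carrier M \<Longrightarrow> v \<in> carrier M \<Longrightarrow> u \<oplus>\<^bsub>M\<^esub> v \<in> carrier M"
    "u \<in> carrier M \<Longrightarrow> c \<odot>\<^bsub>M\<^esub> u \<in> carrier M" "\<zero>\<^bsub>M\<^esub> \<in> carrier M"
proof -
  interpret abelian_group M by (rule kmodule_abelian[OF assms])
  show "u \<in> carrier M \<Longrightarrow> v \<in> carrier M \<Longrightarrow> u \<oplus>\<^bsub>M\<^esub> v \<in> carrier M"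
    "u \<in> carrier M \<Longrightarrow> c \<odot>\<^bsub>M\<^esub> u \<in> carrier M" "\<zero>\<^bsub>M\<^esub> \<in> carrier M"
    using assms by (auto simp: module_scal_iff)
qed

text \<open>An operation on words which, when one letter varies, changes a single letter of the
  result and does so linearly. Such operations preserve multilinear functions under
  composition.\<close>

definition wlin :: "nat set \<Rightarrow> ('k::comm_ring_1, 'm, 'x) module_scheme \<Rightarrow> nat set \<Rightarrow>
    ('k, 'n, 'y) module_scheme \<Rightarrow> ('m list \<Rightarrow> 'n list) \<Rightarrow> bool" where
  "wlin D M E N c \<longleftrightarrow> (\<forall>w\<in>words D M. c w \<in> words E N) \<and>
     (\<forall>xs u ys. xs @ u # ys \<in> words D M \<longrightarrow>
       (\<exists>as bs h. lin M N h \<and> (\<forall>v\<in>carrier M. c (xs @ v # ys) = as @ h v # bs)))"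

lemma mlin_wlin:
  assumes M: "kmodule M" and f: "mlin E N f" and c: "wlin D M E N c"
  shows "mlin D M (\<lambda>w. f (c w))"
  unfolding mlin_def
proof (intro allI impI)
  fix xs u ys assume w: "xs @ u # ys \<in> words D M"
  obtain as bs h where h: "lin M N h" and e': "\<And>v. v \<in> carrier M \<Longrightarrow> c (xs @ v # ys) = as @ h v # bs"
    using c w unfolding wlin_def by meson
  have u: "u \<in> carrier M" using w by (auto simp: words_def)
  have cl: "as @ h u # bs \<in> words E N" using c w e'[OF u] unfolding wlin_def by metis
  show "(\<forall>v\<in>carrier M. f (c (xs @ (u \<oplus>\<^bsub>M\<^esub> v) # ys)) = f (c (xs @ u # ys)) + f (c (xs @ v # ys))) \<and>
      (\<forall>a. f (c (xs @ (a \<odot>\<^bsub>M\<^esub> u) # ys)) = a \<bullet> f (c (xs @ u # ys)))"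
    using f h cl u by (auto simp: e' module_simps[OF M] lin_def mlin_def Pi_iff)
qed

lemma mlin_tev:
  assumes N: "kmodule N" and T: "T \<in> carrier (tspace E N)" and M: "kmodule M"
    and g: "\<And>y. y \<in> words E N \<Longrightarrow> mlin D M (\<lambda>x. g x y)"
  shows "mlin D M (\<lambda>x. tev T (g x))"
  unfolding mlin_def
proof (intro allI impI conjI ballI)
  fix xs u ys c v assume w: "xs @ u # ys \<in> words D M"
  show "tev T (g (xs @ (c \<odot>\<^bsub>M\<^esub> u) # ys)) = c \<bullet> tev T (g (xs @ u # ys))"
    unfolding tev_usc[symmetric]
    by (rule tev_cong[OF N T]) (use g w in \<open>simp add: mlin_def\<close>)
  assume v: "v \<in> carrier M"
  show "tev T (g (xs @ (u \<oplus>\<^bsub>M\<^esub> v) # ys)) = tev T (g (xs @ u # ys)) + tev T (g (xs @ v # ys))"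
    unfolding tev_plus[symmetric]
    by (rule tev_cong[OF N T]) (use g w v in \<open>simp add: mlin_def\<close>)
qed

text \<open>The bilinear extension to tensors of a binary operation on words. Letterwise
  multiplication gives the tensor powers of an algebra, concatenation gives the tensor
  algebra.\<close>

definition mulw :: "nat set \<Rightarrow> ('k::comm_ring_1, 'm, 'x) module_scheme \<Rightarrow> ('m list \<Rightarrow> 'm list \<Rightarrow> 'm list)
    \<Rightarrow> ('k, 'm) tens \<Rightarrow> ('k, 'm) tens \<Rightarrow> ('k, 'm) tens" where
  "mulw D M c S T = tlift (tspace D M) (\<lambda>x. tlift (tspace D M) (\<lambda>y. pure D M (c x y)) T) S"

context
  fixes D and M :: "('k::comm_ring_1, 'm, 'x) module_scheme" and c
  assumes M: "kmodule M"
    and c1: "\<And>x. x \<in> words D M \<Longrightarrow> wlin D M D M (c x)"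
    and c2: "\<And>y. y \<in> words D M \<Longrightarrow> wlin D M D M (\<lambda>x. c x y)"
begin

lemma mulw_words: "x \<in> words D M \<Longrightarrow> y \<in> words D M \<Longrightarrow> c x y \<in> words D M"
  using c1 by (auto simp: wlin_def)

lemma mulw_inner:
  assumes T: "T \<in> carrier (tspace D M)" and x: "x \<in> words D M"
  shows "tlift (tspace D M) (\<lambda>y. pure D M (c x y)) T \<in> carrier (tspace D M)"
    "emb (tspace D M) (tlift (tspace D M) (\<lambda>y. pure D M (c x y)) T) = tev T (\<lambda>y. emb (tspace D M) (pure D M (c x y)))"
    "mlin D M f \<Longrightarrow> tev (tlift (tspace D M) (\<lambda>y. pure D M (c x y)) T) f = tev T (\<lambda>y. f (c x y))"
proof -
  note ml = mlin_wlin[OF M mlin_emb_pure[OF M] c1[OF x]]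
  show "tlift (tspace D M) (\<lambda>y. pure D M (c x y)) T \<in> carrier (tspace D M)"
    "emb (tspace D M) (tlift (tspace D M) (\<lambda>y. pure D M (c x y)) T) = tev T (\<lambda>y. emb (tspace D M) (pure D M (c x y)))"
    by (rule emb_tlift[OF M kmodule_tspace T _ ml]; simp add: pure_closed mulw_words x)+
  assume f: "mlin D M f"
  show "tev (tlift (tspace D M) (\<lambda>y. pure D M (c x y)) T) f = tev T (\<lambda>y. f (c x y))"
    by (subst tev_tlift[OF M T _ ml f]) (simp_all add: pure_closed mulw_words x f)
qed

lemma mulw_mlin:
  assumes S: "S \<in> carrier (tspace D M)" and T: "T \<in> carrier (tspace D M)"
  shows "mlin D M (\<lambda>x. emb (tspace D M) (tlift (tspace D M) (\<lambda>y. pure D M (c x y)) T))"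
proof -
  have "mlin D M (\<lambda>x. tev T (\<lambda>y. emb (tspace D M) (pure D M (c x y))))"
    by (rule mlin_tev[OF M T M], rule mlin_wlin[OF M mlin_emb_pure[OF M] c2])
  moreover have "tev T (\<lambda>y. emb (tspace D M) (pure D M (c x y)))
      = emb (tspace D M) (tlift (tspace D M) (\<lambda>y. pure D M (c x y)) T)" if "x \<in> words D M" for x
    by (simp add: mulw_inner[OF T that])
  ultimately show ?thesis
    unfolding mlin_def by (auto simp: words_insert module_simps[OF M] words_def)
qed

lemma mulw_closed:
  "S \<in> carrier (tspace D M) \<Longrightarrow> T \<in> carrier (tspace D M) \<Longrightarrow> mulw D M c S T \<in> carrier (tspace D M)"
  unfolding mulw_def by (rule emb_tlift(1)[OF M kmodule_tspace]) (auto intro: mulw_inner mulw_mlin)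

lemma tev_mulw:
  assumes S: "S \<in> carrier (tspace D M)" and T: "T \<in> carrier (tspace D M)" and f: "mlin D M f"
  shows "tev (mulw D M c S T) f = tev S (\<lambda>x. tev T (\<lambda>y. f (c x y)))"
  unfolding mulw_def
  by (subst tev_tlift[OF M S _ _ f])
     (auto intro: mulw_inner[OF T] mulw_mlin S T tev_cong[OF M S] simp: mulw_inner(3)[OF T _ f])

text \<open>Evaluated on multilinear functions, the algebra laws become the monoid laws for the
  operation on words.\<close>

lemma mulw_algebra:
  assumes A: "A = (tspace D M)\<lparr>mult := mulw D M c, one := pure D M e\<rparr>"
    and e: "e \<in> words D M" "\<And>x. x \<in> words D M \<Longrightarrow> c e x = x" "\<And>x. x \<in> words D M \<Longrightarrow> c x e = x"
    and as: "\<And>x y z. x \<in> words D M \<Longrightarrow> y \<in> words D M \<Longrightarrow> z \<in> words D M \<Longrightarrow> c (c x y) z = c x (c y z)"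
  shows "assoc_algebra A"
proof -
  let ?T = "tspace D M" and ?m = "mulw D M c"
  have mlin2: "mlin D M (\<lambda>x. tev T (\<lambda>y. f (c x y)))" if "T \<in> carrier ?T" "mlin D M f" for T and f :: "_ \<Rightarrow> ('k, 'z) uvec"
    by (rule mlin_tev[OF M that(1) M], rule mlin_wlin[OF M that(2) c2])
  have mlin1: "mlin D M (\<lambda>y. tev S (\<lambda>x. f (c x y)))" if "S \<in> carrier ?T" "mlin D M f" for S and f :: "_ \<Rightarrow> ('k, 'z) uvec"
    by (rule mlin_tev[OF M that(1) M], rule mlin_wlin[OF M that(2) c1])
  note mt = module_simps[OF kmodule_tspace]
  have assoc: "?m (?m S T) U = ?m S (?m T U)"
    if S: "S \<in> carrier ?T" and T: "T \<in> carrier ?T" and U: "U \<in> carrier ?T" for S T U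
  proof (rule tens_eqI[OF M])
    fix f :: "_ \<Rightarrow> ('k, ('k, 'm) tens) uvec" assume f: "mlin D M f"
    have "tev (?m (?m S T) U) f = tev S (\<lambda>x. tev T (\<lambda>y. tev U (\<lambda>z. f (c (c x y) z))))"
      by (simp add: tev_mulw mulw_closed S T U f mlin2)
    also have "\<dots> = tev S (\<lambda>x. tev T (\<lambda>y. tev U (\<lambda>z. f (c x (c y z)))))"
      by (intro tev_cong[OF M S] tev_cong[OF M T] tev_cong[OF M U]) (simp add: as)
    also have "\<dots> = tev S (\<lambda>x. tev (?m T U) (\<lambda>z. f (c x z)))"
      by (rule tev_cong[OF M S], rule tev_mulw[symmetric, OF T U]) (rule mlin_wlin[OF M f c1])
    finally show "tev (?m (?m S T) U) f = tev (?m S (?m T U)) f"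
      by (simp add: tev_mulw mulw_closed S T U f)
  qed (simp_all add: mulw_closed S T U)
  have one: "?m (pure D M e) S = S" if S: "S \<in> carrier ?T" for S
  proof (rule tens_eqI[OF M])
    fix f :: "_ \<Rightarrow> ('k, ('k, 'm) tens) uvec" assume f: "mlin D M f"
    have "tev (?m (pure D M e) S) f = tev S (\<lambda>y. f (c e y))"
      by (simp add: tev_mulw pure_closed e S f mlin2)
    also have "\<dots> = tev S f" by (rule tev_cong[OF M S]) (simp add: e)
    finally show "tev (?m (pure D M e) S) f = tev S f" .
  qed (simp_all add: mulw_closed pure_closed e S)
  have one': "?m S (pure D M e) = S" if S: "S \<in> carrier ?T" for S
  proof (rule tens_eqI[OF M])
    fix f :: "_ \<Rightarrow> ('k, ('k, 'm) tens) uvec" assume f: "mlin D M f"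
    have "tev (?m S (pure D M e)) f = tev (pure D M e) (\<lambda>y. tev S (\<lambda>x. f (c x y)))"
      by (simp add: tev_mulw pure_closed e S f tev_swap[of S])
    also have "\<dots> = tev S (\<lambda>x. f (c x e))"
      by (simp add: mlin1 S f)
    also have "\<dots> = tev S f" by (rule tev_cong[OF M S]) (simp add: e)
    finally show "tev (?m S (pure D M e)) f = tev S f" .
  qed (simp_all add: mulw_closed pure_closed e S)
  have lin1: "?m (S \<oplus>\<^bsub>?T\<^esub> S') U = ?m S U \<oplus>\<^bsub>?T\<^esub> ?m S' U \<and> ?m (a \<odot>\<^bsub>?T\<^esub> S) U = a \<odot>\<^bsub>?T\<^esub> ?m S U"
    if "S \<in> carrier ?T" "S' \<in> carrier ?T" "U \<in> carrier ?T" for S S' U a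
  proof (intro conjI)
    show "?m (S \<oplus>\<^bsub>?T\<^esub> S') U = ?m S U \<oplus>\<^bsub>?T\<^esub> ?m S' U"
      by (rule tens_eqI[where D = D, OF M]) (simp_all add: that mt mulw_closed tev_mulw tev_add tev_smult mlin2)
    show "?m (a \<odot>\<^bsub>?T\<^esub> S) U = a \<odot>\<^bsub>?T\<^esub> ?m S U"
      by (rule tens_eqI[where D = D, OF M]) (simp_all add: that mt mulw_closed tev_mulw tev_add tev_smult mlin2)
  qed
  have lin2: "?m U (S \<oplus>\<^bsub>?T\<^esub> S') = ?m U S \<oplus>\<^bsub>?T\<^esub> ?m U S' \<and> ?m U (a \<odot>\<^bsub>?T\<^esub> S) = a \<odot>\<^bsub>?T\<^esub> ?m U S"
    if "S \<in> carrier ?T" "S' \<in> carrier ?T" "U \<in> carrier ?T" for S S' U a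
  proof -
    have sw: "tev (?m U V) f = tev V (\<lambda>y. tev U (\<lambda>x. f (c x y)))" if "mlin D M f" "V \<in> carrier ?T"
      for V and f :: "_ \<Rightarrow> ('k, ('k, 'm) tens) uvec"
      unfolding tev_mulw[OF \<open>U \<in> carrier ?T\<close> that(2,1)] by (rule tev_swap)
    show ?thesis
    proof (intro conjI)
      show "?m U (S \<oplus>\<^bsub>?T\<^esub> S') = ?m U S \<oplus>\<^bsub>?T\<^esub> ?m U S'"
        by (rule tens_eqI[where D = D, OF M]) (simp_all add: that mt mulw_closed tev_add tev_smult sw mlin1)
      show "?m U (a \<odot>\<^bsub>?T\<^esub> S) = a \<odot>\<^bsub>?T\<^esub> ?m U S"
        by (rule tens_eqI[where D = D, OF M]) (simp_all add: that mt mulw_closed tev_add tev_smult sw mlin1)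
    qed
  qed
  have mod: "kmodule A"
  proof -
    have "abelian_group A = abelian_group ?T" by (rule abelian_group_cong) (simp_all add: A)
    then show ?thesis using kmodule_tspace[of D M] unfolding module_scal_iff by (simp add: A)
  qed
  have ring: "ring A"
  proof (rule ringI)
    show "abelian_group A" by (rule kmodule_abelian[OF mod])
    show "Group.monoid A"
      by (rule monoidI) (auto simp: A mulw_closed pure_closed e assoc one one')
  qed (simp_all add: A lin1 lin2)
  have "bilin A A A (\<lambda>x y. x \<otimes>\<^bsub>A\<^esub> y)"
    by (auto simp: bilin_def lin_def A mulw_closed lin1 lin2)
  then show ?thesis using mod ring by (simp add: assoc_algebra_def)
qed

end

lemma lin_mult:
  assumes "assoc_algebra A" "a \<in> carrier A"
  shows "lin A A (\<lambda>x. a \<otimes>\<^bsub>A\<^esub> x)" "lin A A (\<lambda>x. x \<otimes>\<^bsub>A\<^esub> a)"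
  using assms by (auto simp: assoc_algebra_def bilin_def)

lemma map2_insert:
  assumes "length x = length (xs @ u # ys)"
  shows "map2 f x (xs @ u # ys) =
    map2 f (take (length xs) x) xs @ f (x ! length xs) u # map2 f (drop (Suc (length xs)) x) ys"
    "map2 f (xs @ u # ys) x =
    map2 f xs (take (length xs) x) @ f u (x ! length xs) # map2 f ys (drop (Suc (length xs)) x)"
  using assms by (subst id_take_nth_drop[of "length xs" x]; simp)+

lemma words_map2:
  assumes A: "assoc_algebra A" and "x \<in> words {n} A" "y \<in> words {n} A"
  shows "map2 (\<lambda>a b. a \<otimes>\<^bsub>A\<^esub> b) x y \<in> words {n} A"
proof -
  interpret ring A using A by (simp add: assoc_algebra_def)
  have "a \<otimes>\<^bsub>A\<^esub> b \<in> carrier A" if "(a, b) \<in> set (zip x y)" for a b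
    using set_zip_leftD[OF that] set_zip_rightD[OF that] assms(2,3) by (auto simp: words_def)
  then show ?thesis using assms(2,3) by (auto simp: words_def)
qed

lemma tpow_alg_eq: "tpow_alg n A =
  (tspace {n} A)\<lparr>mult := mulw {n} A (\<lambda>x y. map2 (\<lambda>a b. a \<otimes>\<^bsub>A\<^esub> b) x y), one := pure {n} A (replicate n \<one>\<^bsub>A\<^esub>)\<rparr>"
  by (simp add: tpow_alg_def mulw_def[abs_def])

lemma wlin_map2:
  assumes A: "assoc_algebra A" and x: "x \<in> words {n} A"
  shows "wlin {n} A {n} A (\<lambda>y. map2 (\<lambda>a b. a \<otimes>\<^bsub>A\<^esub> b) x y)"
    "wlin {n} A {n} A (\<lambda>y. map2 (\<lambda>a b. a \<otimes>\<^bsub>A\<^esub> b) y x)"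
proof -
  have 1: "\<exists>as bs h. lin A A h \<and> (\<forall>v\<in>carrier A. map2 (\<lambda>a b. a \<otimes>\<^bsub>A\<^esub> b) x (xs @ v # ys) = as @ h v # bs)"
    and 2: "\<exists>as bs h. lin A A h \<and> (\<forall>v\<in>carrier A. map2 (\<lambda>a b. a \<otimes>\<^bsub>A\<^esub> b) (xs @ v # ys) x = as @ h v # bs)"
    if w: "xs @ u # ys \<in> words {n} A" for xs u ys
  proof -
    have l: "length x = length (xs @ v # ys)" for v using x w by (simp add: words_def)
    have c: "x ! length xs \<in> carrier A" using x l by (auto simp: words_def)
    show "\<exists>as bs h. lin A A h \<and> (\<forall>v\<in>carrier A. map2 (\<lambda>a b. a \<otimes>\<^bsub>A\<^esub> b) x (xs @ v # ys) = as @ h v # bs)"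
      unfolding map2_insert(1)[OF l] by (intro exI conjI ballI, rule lin_mult(1)[OF A c], rule refl)
    show "\<exists>as bs h. lin A A h \<and> (\<forall>v\<in>carrier A. map2 (\<lambda>a b. a \<otimes>\<^bsub>A\<^esub> b) (xs @ v # ys) x = as @ h v # bs)"
      unfolding map2_insert(2)[OF l] by (intro exI conjI ballI, rule lin_mult(2)[OF A c], rule refl)
  qed
  show "wlin {n} A {n} A (\<lambda>y. map2 (\<lambda>a b. a \<otimes>\<^bsub>A\<^esub> b) x y)"
    unfolding wlin_def by (intro conjI ballI allI impI words_map2[OF A] x; (rule 1)?; assumption)
  show "wlin {n} A {n} A (\<lambda>y. map2 (\<lambda>a b. a \<otimes>\<^bsub>A\<^esub> b) y x)"
    unfolding wlin_def by (intro conjI ballI allI impI words_map2[OF A] x; (rule 2)?; assumption)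
qed

lemma tpow_algebra:
  assumes A: "assoc_algebra A" shows "assoc_algebra (tpow_alg n A)"
proof -
  interpret ring A using A by (simp add: assoc_algebra_def)
  have M: "kmodule A" using A by (simp add: assoc_algebra_def)
  show ?thesis
  proof (rule mulw_algebra[OF M _ _ tpow_alg_eq])
    fix x y z assume w: "x \<in> words {n} A" "y \<in> words {n} A" "z \<in> words {n} A"
    show "map2 (\<lambda>a b. a \<otimes>\<^bsub>A\<^esub> b) (map2 (\<lambda>a b. a \<otimes>\<^bsub>A\<^esub> b) x y) z = map2 (\<lambda>a b. a \<otimes>\<^bsub>A\<^esub> b) x (map2 (\<lambda>a b. a \<otimes>\<^bsub>A\<^esub> b) y z)"
    proof (rule nth_equalityI)
      fix i assume i: "i < length (map2 (\<lambda>a b. a \<otimes>\<^bsub>A\<^esub> b) (map2 (\<lambda>a b. a \<otimes>\<^bsub>A\<^esub> b) x y) z)"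
      then have "x ! i \<in> carrier A" "y ! i \<in> carrier A" "z ! i \<in> carrier A"
        using w nth_mem[of i x] nth_mem[of i y] nth_mem[of i z] by (auto simp: words_def)
      then show "map2 (\<lambda>a b. a \<otimes>\<^bsub>A\<^esub> b) (map2 (\<lambda>a b. a \<otimes>\<^bsub>A\<^esub> b) x y) z ! i =
        map2 (\<lambda>a b. a \<otimes>\<^bsub>A\<^esub> b) x (map2 (\<lambda>a b. a \<otimes>\<^bsub>A\<^esub> b) y z) ! i"
        using i w by (simp add: words_def m_assoc)
    qed (use w in \<open>simp add: words_def\<close>)
    show "map2 (\<lambda>a b. a \<otimes>\<^bsub>A\<^esub> b) (replicate n \<one>\<^bsub>A\<^esub>) x = x" "map2 (\<lambda>a b. a \<otimes>\<^bsub>A\<^esub> b) x (replicate n \<one>\<^bsub>A\<^esub>) = x"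
      using w(1) by (auto intro!: nth_equalityI l_one r_one simp: words_def dest: subsetD[OF _ nth_mem])
  qed (auto intro: wlin_map2[OF A] simp: words_def)
qed

lemma tensor_alg_eq: "tensor_alg M = (tspace UNIV M)\<lparr>mult := mulw UNIV M (@), one := pure UNIV M []\<rparr>"
  by (simp add: tensor_alg_def mulw_def[abs_def])

lemma wlin_append:
  assumes x: "x \<in> words UNIV M"
  shows "wlin UNIV M UNIV M (\<lambda>y. x @ y)" "wlin UNIV M UNIV M (\<lambda>y. y @ x)"
proof -
  have l: "lin M M (\<lambda>u. u)" by (simp add: lin_def)
  have ex: "\<exists>as bs h. lin M M h \<and> (\<forall>u\<in>carrier M. x @ (xs @ u # ys) = as @ h u # bs)"
    "\<exists>as bs h. lin M M h \<and> (\<forall>u\<in>carrier M. (xs @ u # ys) @ x = as @ h u # bs)" for xs ys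
    by (rule exI[of _ "x @ xs"], rule exI[of _ ys], rule exI[of _ "\<lambda>u. u"], simp add: l,
        rule exI[of _ "xs"], rule exI[of _ "ys @ x"], rule exI[of _ "\<lambda>u. u"], simp add: l)
  then show "wlin UNIV M UNIV M (\<lambda>y. x @ y)" "wlin UNIV M UNIV M (\<lambda>y. y @ x)"
    unfolding wlin_def using x ex by (simp_all add: words_def)
qed

lemma tensor_algebra:
  assumes M: "kmodule M" shows "assoc_algebra (tensor_alg M)"
  by (rule mulw_algebra[OF M _ _ tensor_alg_eq]) (simp_all add: wlin_append, simp add: words_def)

section \<open>Bilinear operations made total\<close>

lemma bilxD:
  assumes "bilx f"
  shows "f (x + y) b = f x b + f y b" "f a (z + w) = f a z + f a w"
    "f (c \<bullet> x) b = c \<bullet> f x b" "f a (c \<bullet> z) = c \<bullet> f a z"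
  using assms by (simp_all add: bilx_def linx_def)

lemma trilxD:
  assumes "trilx f"
  shows "f (x + x') b d = f x b d + f x' b d" "f a (y + y') d = f a y d + f a y' d" "f a b (z + z') = f a b z + f a b z'"
    "f (c \<bullet> x) b d = c \<bullet> f x b d" "f a (c \<bullet> y) d = c \<bullet> f a y d" "f a b (c \<bullet> z) = c \<bullet> f a b z"
  using assms by (simp_all add: trilx_def linx_def)

lemma words2: "w \<in> words {2} M \<longleftrightarrow> (\<exists>x\<in>carrier M. \<exists>y\<in>carrier M. w = [x, y])"
  by (auto simp: words_def length_Suc_conv numeral_2_eq_2)

lemma words3: "w \<in> words {3} M \<longleftrightarrow> (\<exists>x\<in>carrier M. \<exists>y\<in>carrier M. \<exists>z\<in>carrier M. w = [x, y, z])"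
  by (auto simp: words_def length_Suc_conv numeral_3_eq_3)

lemma words2I: "x \<in> carrier M \<Longrightarrow> y \<in> carrier M \<Longrightarrow> [x, y] \<in> words {2} M"
  and words3I: "x \<in> carrier M \<Longrightarrow> y \<in> carrier M \<Longrightarrow> z \<in> carrier M \<Longrightarrow> [x, y, z] \<in> words {3} M"
  by (simp_all add: words_def)

text \<open>For \<open>S\<close> in the second or third tensor power, these are the Sweedler sums \<open>f(S\<^sup>\<alpha>, S\<^sub>\<alpha>)\<close> and
  their analogue with three legs, with arguments in \<open>uvec\<close>. The functions \<open>pr2\<close> and \<open>pr3\<close>
  are the universal bilinear and trilinear maps \<open>a \<otimes> b\<close> and \<open>a \<otimes> b \<otimes> c\<close>.\<close>

definition ev2 :: "('k::comm_ring_1, 'm, 'x) module_scheme \<Rightarrow> ('k, 'm) tens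
    \<Rightarrow> (('k, 'm) uvec \<Rightarrow> ('k, 'm) uvec \<Rightarrow> ('k, 'n) uvec) \<Rightarrow> ('k, 'n) uvec" where
  "ev2 M S f = tev S (\<lambda>w. f (emb M (w!0)) (emb M (w!1)))"

definition ev3 :: "('k::comm_ring_1, 'm, 'x) module_scheme \<Rightarrow> ('k, 'm) tens
    \<Rightarrow> (('k, 'm) uvec \<Rightarrow> ('k, 'm) uvec \<Rightarrow> ('k, 'm) uvec \<Rightarrow> ('k, 'n) uvec) \<Rightarrow> ('k, 'n) uvec" where
  "ev3 M S f = tev S (\<lambda>w. f (emb M (w!0)) (emb M (w!1)) (emb M (w!2)))"

definition pr2 :: "('k::comm_ring_1, 'm, 'x) module_scheme \<Rightarrow> ('k, 'm) uvec \<Rightarrow> ('k, 'm) uvec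
    \<Rightarrow> ('k, ('k, 'm) tens) uvec" where
  "pr2 M a b = emb (tspace {2} M) (pure {2} M [prj M a, prj M b])"

definition pr3 :: "('k::comm_ring_1, 'm, 'x) module_scheme \<Rightarrow> ('k, 'm) uvec \<Rightarrow> ('k, 'm) uvec
    \<Rightarrow> ('k, 'm) uvec \<Rightarrow> ('k, ('k, 'm) tens) uvec" where
  "pr3 M a b c = emb (tspace {3} M) (pure {3} M [prj M a, prj M b, prj M c])"

definition mulx :: "('k::comm_ring_1, 'm, 'x) module_scheme \<Rightarrow> ('k, 'm) uvec \<Rightarrow> ('k, 'm) uvec \<Rightarrow> ('k, 'm) uvec" where
  "mulx A x y = emb A (prj A x \<otimes>\<^bsub>A\<^esub> prj A y)"

abbreviation pp :: "('k::comm_ring_1, 'm, 'x) module_scheme \<Rightarrow> ('k, 'm) uvec \<Rightarrow> ('k, 'm) uvec" where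
  "pp M x \<equiv> emb M (prj M x)"

lemma ev2_plus: "ev2 M S (\<lambda>a b. f a b + g a b) = ev2 M S f + ev2 M S g"
  and ev2_usc: "ev2 M S (\<lambda>a b. c \<bullet> f a b) = c \<bullet> ev2 M S f"
  and ev2_neg: "ev2 M S (\<lambda>a b. - f a b) = - ev2 M S f"
  and ev2_0: "ev2 M S (\<lambda>a b. 0) = 0"
  by (simp_all add: ev2_def tev_plus tev_usc tev_0 tev_neg)

lemma ev2_diff: "ev2 M S (\<lambda>a b. f a b - g a b) = ev2 M S f - ev2 M S g"
  using ev2_plus[of M S f "\<lambda>a b. - g a b"] ev2_neg[of M S g] by simp

lemma ev2_linx: "linx g \<Longrightarrow> g (ev2 M S f) = ev2 M S (\<lambda>a b. g (f a b))"
  unfolding ev2_def by (rule tev_linx)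

lemma ev2_swap: "ev2 M S (\<lambda>a b. ev2 N T (\<lambda>c d. f a b c d)) = ev2 N T (\<lambda>c d. ev2 M S (\<lambda>a b. f a b c d))"
  unfolding ev2_def by (rule tev_swap)

context
  fixes M :: "('k::comm_ring_1, 'm, 'x) module_scheme"
  assumes M: "kmodule M"
begin

lemma pp_simps:
  "pp M (x + y) = pp M x + pp M y" "pp M (c \<bullet> x) = c \<bullet> pp M x" "pp M 0 = 0" "pp M (- x) = - pp M x"
  "pp M (x - y) = pp M x - pp M y"
  using linx_emb_prj[OF M] by (simp_all add: linx_simps[of "\<lambda>x. pp M x"])

lemma mlin2: "bilx f \<Longrightarrow> mlin {2} M (\<lambda>w. f (emb M (w!0)) (emb M (w!1)))"
  unfolding mlin_def
  by (auto simp: words2 append_eq_Cons_conv Cons_eq_append_conv emb_add[OF M] emb_smult[OF M] bilxD)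

lemma mlin3: "trilx f \<Longrightarrow> mlin {3} M (\<lambda>w. f (emb M (w!0)) (emb M (w!1)) (emb M (w!2)))"
  unfolding mlin_def
  by (auto simp: words3 append_eq_Cons_conv Cons_eq_append_conv emb_add[OF M] emb_smult[OF M] trilxD)

lemma bilx_pr2: "bilx (pr2 M)"
proof -
  note m = mlin_emb_pure[OF M, of "{2}", unfolded mlin_def, rule_format]
  have c: "prj M a \<in> carrier M" for a by (rule prj_closed[OF M])
  show ?thesis unfolding bilx_def linx_def pr2_def
    using m[of "[]" "prj M a" "[prj M b]" for a b] m[of "[prj M a]" "prj M b" "[]" for a b]
    by (simp add: words2I c prj_add[OF M] prj_usc[OF M])
qed

lemma trilx_pr3: "trilx (pr3 M)"
proof -
  note m = mlin_emb_pure[OF M, of "{3}", unfolded mlin_def, rule_format]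
  have c: "prj M a \<in> carrier M" for a by (rule prj_closed[OF M])
  show ?thesis unfolding trilx_def linx_def pr3_def
    using m[of "[]" "prj M a" "[prj M b, prj M c]" for a b c] m[of "[prj M a]" "prj M b" "[prj M c]" for a b c]
      m[of "[prj M a, prj M b]" "prj M c" "[]" for a b c]
    by (simp add: words3I c prj_add[OF M] prj_usc[OF M])
qed

lemma ev2_cong:
  assumes "S \<in> carrier (tspace {2} M)" "\<And>a b. pp M a = a \<Longrightarrow> pp M b = b \<Longrightarrow> f a b = g a b"
  shows "ev2 M S f = ev2 M S g"
  unfolding ev2_def by (rule tev_cong[OF M assms(1)]) (auto simp: words2 prj_emb[OF M] intro: assms(2))

lemma ev2_pure: "bilx f \<Longrightarrow> ev2 M (pure {2} M [a, b]) f = f (emb M a) (emb M b)"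
  unfolding ev2_def using tev_pure[OF mlin2, of f "[a, b]"] by simp

lemma ev3_pure: "trilx f \<Longrightarrow> ev3 M (pure {3} M [a, b, c]) f = f (emb M a) (emb M b) (emb M c)"
  unfolding ev3_def using tev_pure[OF mlin3, of f "[a, b, c]"] by simp

lemma ev2_pr2: "bilx f \<Longrightarrow> ev2 M (prj (tspace {2} M) (pr2 M a b)) f = f (pp M a) (pp M b)"
  unfolding pr2_def
  by (subst prj_emb) (simp_all add: ev2_pure pure_closed words2I prj_closed[OF M])

lemma linx_ev2_prj: "bilx f \<Longrightarrow> linx (\<lambda>z. ev2 M (prj (tspace {2} M) z) f)"
  unfolding ev2_def by (rule linx_tev_prj) (rule mlin2)

lemma ev2_pr2_id: "S \<in> carrier (tspace {2} M) \<Longrightarrow> ev2 M S (pr2 M) = emb (tspace {2} M) S"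
  unfolding ev2_def pr2_def tev_emb_pure[OF M, symmetric]
  by (rule tev_cong[OF M]) (auto simp: words2 prj_emb[OF M])

text \<open>Turns a \<open>tlift\<close> of the definitions into a Sweedler sum: the function on words of length
  two only has to agree with a bilinear map on the elements of \<open>M\<close>.\<close>

lemma tlift2:
  assumes P: "kmodule P" and S: "S \<in> carrier (tspace {2} M)" and B: "bilx B"
    and b: "\<And>x y. x \<in> carrier M \<Longrightarrow> y \<in> carrier M \<Longrightarrow> b [x, y] \<in> carrier P \<and> emb P (b [x, y]) = B (emb M x) (emb M y)"
  shows "tlift P b S \<in> carrier P" "emb P (tlift P b S) = ev2 M S B"
proof -
  have b1: "b w \<in> carrier P" if "w \<in> words {2} M" for w using that b by (auto simp: words2)
  have b2: "emb P (b w) = B (emb M (w!0)) (emb M (w!1))" if "w \<in> words {2} M" for w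
    using that b by (auto simp: words2)
  have "mlin {2} M (\<lambda>w. B (emb M (w!0)) (emb M (w!1)))" by (rule mlin2[OF B])
  then have ml: "mlin {2} M (\<lambda>w. emb P (b w))"
    unfolding mlin_def by (simp add: b2 words_insert module_simps[OF M] words_def[of "{2}"])
  show "tlift P b S \<in> carrier P" by (rule emb_tlift(1)[OF M P S b1 ml])
  have "emb P (tlift P b S) = tev S (\<lambda>w. emb P (b w))"
    by (rule emb_tlift(2)[OF M P S _ ml]) (rule b1)
  also have "\<dots> = ev2 M S B"
    unfolding ev2_def by (rule tev_cong[OF M S]) (rule b2)
  finally show "emb P (tlift P b S) = ev2 M S B" .
qed

lemma tev_tlift2:
  assumes S: "S \<in> carrier (tspace {2} M)" and B: "bilx B"
    and b: "\<And>x y. x \<in> carrier M \<Longrightarrow> y \<in> carrier M \<Longrightarrow>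
      b [x, y] \<in> carrier (tspace E N) \<and> emb (tspace E N) (b [x, y]) = B (emb M x) (emb M y)"
    and f: "mlin E N f"
  shows "tev (tlift (tspace E N) b S) f = tev S (\<lambda>w. tev (b w) f)"
proof -
  have "tlift (tspace E N) b S = prj (tspace E N) (ev2 M S B)"
    using arg_cong[OF tlift2(2)[OF kmodule_tspace S B b], of "prj (tspace E N)"]
    by (simp only: prj_emb[OF kmodule_tspace tlift2(1)[OF kmodule_tspace S B b]])
  then have "tev (tlift (tspace E N) b S) f = ev2 M S (\<lambda>x y. tev (prj (tspace E N) (B x y)) f)"
    using ev2_linx[OF linx_tev_prj[OF f], of M S B] by simp
  also have "\<dots> = tev S (\<lambda>w. tev (b w) f)"
    unfolding ev2_def
  proof (rule tev_cong[OF M S])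
    fix w assume "w \<in> words {2} M"
    then obtain x y where w: "w = [x, y]" "x \<in> carrier M" "y \<in> carrier M" by (auto simp: words2)
    have "prj (tspace E N) (B (emb M x) (emb M y)) = b [x, y]"
      using b[OF w(2,3)] prj_emb[OF kmodule_tspace] by metis
    then show "tev (prj (tspace E N) (B (emb M (w ! 0)) (emb M (w ! 1)))) f = tev (b w) f" by (simp add: w)
  qed
  finally show ?thesis .
qed

lemma ev2_tlift2:
  assumes S: "S \<in> carrier (tspace {2} M)" and B: "bilx B" and N: "kmodule N"
    and b: "\<And>x y. x \<in> carrier M \<Longrightarrow> y \<in> carrier M \<Longrightarrow>
      b [x, y] \<in> carrier (tspace {2} N) \<and> emb (tspace {2} N) (b [x, y]) = B (emb M x) (emb M y)"
    and f: "mlin {2} N (\<lambda>w. f (emb N (w!0)) (emb N (w!1)))"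
    and bf: "\<And>x y. x \<in> carrier M \<Longrightarrow> y \<in> carrier M \<Longrightarrow> ev2 N (b [x, y]) f = G (emb M x) (emb M y)"
  shows "ev2 N (tlift (tspace {2} N) b S) f = ev2 M S G"
proof -
  have "ev2 N (tlift (tspace {2} N) b S) f = tev S (\<lambda>w. ev2 N (b w) f)"
    unfolding ev2_def[of N] by (rule tev_tlift2[OF S B _ f]) (rule b)
  also have "\<dots> = ev2 M S G"
    unfolding ev2_def[of M] by (rule tev_cong[OF M S]) (auto simp: words2 bf)
  finally show ?thesis .
qed

lemma ev3_tlift2:
  assumes S: "S \<in> carrier (tspace {2} M)" and B: "bilx B" and N: "kmodule N"
    and b: "\<And>x y. x \<in> carrier M \<Longrightarrow> y \<in> carrier M \<Longrightarrow>
      b [x, y] \<in> carrier (tspace {3} N) \<and> emb (tspace {3} N) (b [x, y]) = B (emb M x) (emb M y)"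
    and f: "mlin {3} N (\<lambda>w. f (emb N (w!0)) (emb N (w!1)) (emb N (w!2)))"
    and bf: "\<And>x y. x \<in> carrier M \<Longrightarrow> y \<in> carrier M \<Longrightarrow> ev3 N (b [x, y]) f = G (emb M x) (emb M y)"
  shows "ev3 N (tlift (tspace {3} N) b S) f = ev2 M S G"
proof -
  have "ev3 N (tlift (tspace {3} N) b S) f = tev S (\<lambda>w. ev3 N (b w) f)"
    unfolding ev3_def[of N] by (rule tev_tlift2[OF S B _ f]) (rule b)
  also have "\<dots> = ev2 M S G"
    unfolding ev2_def[of M] by (rule tev_cong[OF M S]) (auto simp: words2 bf)
  finally show ?thesis .
qed

end

context
  fixes A :: "('k::comm_ring_1, 'm, 'x) module_scheme"
  assumes A: "assoc_algebra A"
begin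

interpretation ring A using A by (simp add: assoc_algebra_def)

lemma algebra_module: "kmodule A" using A by (simp add: assoc_algebra_def)

lemma mulx_bil:
  "mulx A (x + y) z = mulx A x z + mulx A y z" "mulx A z (x + y) = mulx A z x + mulx A z y"
  "mulx A (c \<bullet> x) z = c \<bullet> mulx A x z" "mulx A z (c \<bullet> x) = c \<bullet> mulx A z x"
  using lin_mult[OF A, of "prj A z"]
  by (simp_all add: mulx_def prj_add[OF algebra_module] prj_usc[OF algebra_module] lin_def
      prj_closed[OF algebra_module] emb_add[OF algebra_module] emb_smult[OF algebra_module])

lemma mulx_assoc: "mulx A (mulx A x y) z = mulx A x (mulx A y z)"
  by (simp add: mulx_def prj_emb[OF algebra_module] prj_closed[OF algebra_module] m_assoc)

lemma mulx_pp [simp]: "mulx A (pp A x) y = mulx A x y" "mulx A x (pp A y) = mulx A x y" "pp A (mulx A x y) = mulx A x y"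
  by (simp_all add: mulx_def prj_emb[OF algebra_module] prj_closed[OF algebra_module])

lemma mulx_one [simp]: "mulx A (emb A \<one>\<^bsub>A\<^esub>) x = pp A x" "mulx A x (emb A \<one>\<^bsub>A\<^esub>) = pp A x"
  by (simp_all add: mulx_def prj_emb[OF algebra_module] prj_closed[OF algebra_module])

lemma emb_mult: "x \<in> carrier A \<Longrightarrow> y \<in> carrier A \<Longrightarrow> emb A (x \<otimes>\<^bsub>A\<^esub> y) = mulx A (emb A x) (emb A y)"
  by (simp add: mulx_def prj_emb[OF algebra_module])

lemma prj_mulx: "prj A (mulx A x y) = prj A x \<otimes>\<^bsub>A\<^esub> prj A y"
  by (simp add: mulx_def prj_emb[OF algebra_module] prj_closed[OF algebra_module])

text \<open>The product of \<open>A \<otimes> A\<close> in Sweedler notation: \<open>f(S T) = f(S\<^sup>\<alpha> T\<^sup>\<beta>, S\<^sub>\<alpha> T\<^sub>\<beta>)\<close>. With \<open>ev3_mult\<close>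
  it turns every identity in \<open>K \<otimes> K\<close> and \<open>K \<otimes> K \<otimes> K\<close> into a rewrite rule for nested sums.\<close>

lemma ev2_mult:
  assumes S: "S \<in> carrier (tpow_alg 2 A)" and T: "T \<in> carrier (tpow_alg 2 A)" and f: "bilx f"
  shows "ev2 A (S \<otimes>\<^bsub>tpow_alg 2 A\<^esub> T) f = ev2 A S (\<lambda>a b. ev2 A T (\<lambda>c d. f (mulx A a c) (mulx A b d)))"
proof -
  note M = algebra_module
  have ST: "S \<in> carrier (tspace {2} A)" "T \<in> carrier (tspace {2} A)" using S T by (simp_all add: tpow_alg_def)
  have "ev2 A (S \<otimes>\<^bsub>tpow_alg 2 A\<^esub> T) f =
    tev S (\<lambda>x. tev T (\<lambda>y. f (emb A (map2 (\<lambda>a b. a \<otimes>\<^bsub>A\<^esub> b) x y ! 0)) (emb A (map2 (\<lambda>a b. a \<otimes>\<^bsub>A\<^esub> b) x y ! 1))))"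
    unfolding tpow_alg_eq ev2_def
    using tev_mulw[OF M wlin_map2(1)[OF A] wlin_map2(2)[OF A] ST mlin2[OF M f]] by simp
  also have "\<dots> = ev2 A S (\<lambda>a b. ev2 A T (\<lambda>c d. f (mulx A a c) (mulx A b d)))"
    unfolding ev2_def
    by (intro tev_cong[OF M ST(1)] tev_cong[OF M ST(2)]) (auto simp: words2 emb_mult)
  finally show ?thesis .
qed

lemma ev3_mult:
  assumes S: "S \<in> carrier (tpow_alg 3 A)" and T: "T \<in> carrier (tpow_alg 3 A)" and f: "trilx f"
  shows "ev3 A (S \<otimes>\<^bsub>tpow_alg 3 A\<^esub> T) f =
    ev3 A S (\<lambda>a b c. ev3 A T (\<lambda>a' b' c'. f (mulx A a a') (mulx A b b') (mulx A c c')))"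
proof -
  note M = algebra_module
  have ST: "S \<in> carrier (tspace {3} A)" "T \<in> carrier (tspace {3} A)" using S T by (simp_all add: tpow_alg_def)
  have "ev3 A (S \<otimes>\<^bsub>tpow_alg 3 A\<^esub> T) f =
    tev S (\<lambda>x. tev T (\<lambda>y. f (emb A (map2 (\<lambda>a b. a \<otimes>\<^bsub>A\<^esub> b) x y ! 0)) (emb A (map2 (\<lambda>a b. a \<otimes>\<^bsub>A\<^esub> b) x y ! 1))
       (emb A (map2 (\<lambda>a b. a \<otimes>\<^bsub>A\<^esub> b) x y ! 2))))"
    unfolding tpow_alg_eq ev3_def
    using tev_mulw[OF M wlin_map2(1)[OF A] wlin_map2(2)[OF A] ST mlin3[OF M f]] by simp
  also have "\<dots> = ev3 A S (\<lambda>a b c. ev3 A T (\<lambda>a' b' c'. f (mulx A a a') (mulx A b b') (mulx A c c')))"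
    unfolding ev3_def
    by (intro tev_cong[OF M ST(1)] tev_cong[OF M ST(2)]) (auto simp: words3 emb_mult)
  finally show ?thesis .
qed

lemma ev2_one: "bilx f \<Longrightarrow> ev2 A \<one>\<^bsub>tpow_alg 2 A\<^esub> f = f (emb A \<one>\<^bsub>A\<^esub>) (emb A \<one>\<^bsub>A\<^esub>)"
  by (simp add: tpow_alg_def numeral_2_eq_2 ev2_pure[OF algebra_module, unfolded numeral_2_eq_2])

end

lemma emb_cong:
  assumes "carrier M = carrier N" "add M = add N" "ring.zero M = ring.zero N" "smult M = smult N"
  shows "emb M = emb N" "prj M = prj N"
  using assms by (simp_all add: emb_def[abs_def] prj_def[abs_def] mkey_def)

section \<open>Coproducts as operations on bilinear functions\<close>

lemma trilx_part: "trilx f \<Longrightarrow> bilx (\<lambda>a b. f a b z)" "trilx f \<Longrightarrow> bilx (\<lambda>a b. f a y b)" "trilx f \<Longrightarrow> bilx (f x)"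
  by (simp_all add: trilx_def bilx_def)

lemma ev2_add:
  "kmodule M \<Longrightarrow> bilx f \<Longrightarrow> S \<in> carrier (tspace {2} M) \<Longrightarrow> T \<in> carrier (tspace {2} M) \<Longrightarrow>
    ev2 M (S \<oplus>\<^bsub>tspace {2} M\<^esub> T) f = ev2 M S f + ev2 M T f"
  and ev2_smult: "kmodule M \<Longrightarrow> bilx f \<Longrightarrow> S \<in> carrier (tspace {2} M) \<Longrightarrow>
    ev2 M (c \<odot>\<^bsub>tspace {2} M\<^esub> S) f = c \<bullet> ev2 M S f"
  unfolding ev2_def by (rule tev_add tev_smult; simp only: mlin2)+

text \<open>The part of the bialgebra structure that is needed to speak of Sweedler sums. It is
  passed from \<open>K\<close> to \<open>K\<^sub>F\<close> by linearity alone, so that the constructions based on it apply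
  to both.\<close>

locale prebialg =
  fixes K :: "('k::comm_ring_1, 'a) coalg"
  assumes alg: "assoc_algebra K"
    and com: "lin K (tspace {2} K) (comul K)"
    and cou: "lin K scal (counit K)"
begin

abbreviation mul (infixl \<open>\<star>\<close> 70) where "x \<star> y \<equiv> mulx K x y"
abbreviation one (\<open>\<^bold>1\<close>) where "\<^bold>1 \<equiv> emb K \<one>\<^bsub>K\<^esub>"

text \<open>\<open>cop h f\<close> is \<open>f(h\<^sub>1, h\<^sub>2)\<close> for the coproduct \<open>h\<^sub>1 \<otimes> h\<^sub>2\<close> of \<open>h\<close>.\<close>

definition cop :: "('k, 'a) uvec \<Rightarrow> (('k, 'a) uvec \<Rightarrow> ('k, 'a) uvec \<Rightarrow> ('k, 'n) uvec) \<Rightarrow> ('k, 'n) uvec" where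
  "cop h f = ev2 K (comul K (prj K h)) f"

definition eps :: "('k, 'a) uvec \<Rightarrow> 'k" where
  "eps h = counit K (prj K h)"

lemma kmod: "kmodule K" by (rule algebra_module[OF alg])

lemma one_closed: "\<one>\<^bsub>K\<^esub> \<in> carrier K"
proof -
  interpret ring K using alg by (simp add: assoc_algebra_def)
  show ?thesis by simp
qed

lemma pp_one [simp]: "pp K \<^bold>1 = \<^bold>1" by (simp add: prj_emb[OF kmod] one_closed)

lemma com_closed: "comul K (prj K h) \<in> carrier (tspace {2} K)"
  using com prj_closed[OF kmod, of h] by (auto simp: lin_def)

lemma com_closed': "x \<in> carrier K \<Longrightarrow> comul K x \<in> carrier (tspace {2} K)"
  using com by (auto simp: lin_def)

lemma cop_emb: "x \<in> carrier K \<Longrightarrow> ev2 K (comul K x) f = cop (emb K x) f"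
  by (simp add: cop_def prj_emb[OF kmod])

lemma cop_lin:
  "bilx f \<Longrightarrow> cop (x + y) f = cop x f + cop y f" "bilx f \<Longrightarrow> cop (c \<bullet> x) f = c \<bullet> cop x f"
  using com prj_closed[OF kmod, of x] prj_closed[OF kmod, of y]
  by (simp_all add: cop_def prj_add[OF kmod] prj_usc[OF kmod] lin_def ev2_add[OF kmod]
      ev2_smult[OF kmod] com_closed)

lemma cop_fun:
  "cop h (\<lambda>a b. f a b + g a b) = cop h f + cop h g" "cop h (\<lambda>a b. c \<bullet> f a b) = c \<bullet> cop h f"
  by (simp_all add: cop_def ev2_plus ev2_usc)

lemma cop_pp [simp]: "cop (pp K h) f = cop h f"
  by (simp add: cop_def prj_emb[OF kmod] prj_closed[OF kmod])

lemma ev2_scale: "ev2 M S (\<lambda>a b. (c * f a b) \<bullet> g a b) = c \<bullet> ev2 M S (\<lambda>a b. f a b \<bullet> g a b)"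
  using ev2_usc[of M S c "\<lambda>a b. f a b \<bullet> g a b"] by simp

lemma cop_scale: "cop h (\<lambda>a b. (c * f a b) \<bullet> g a b) = c \<bullet> cop h (\<lambda>a b. f a b \<bullet> g a b)"
  unfolding cop_def by (rule ev2_scale)

lemma eps_lin: "eps (x + y) = eps x + eps y" "eps (c \<bullet> x) = c * eps x"
  using cou by (simp_all add: eps_def lin_def prj_add[OF kmod] prj_usc[OF kmod] prj_closed[OF kmod])

lemma eps_pp [simp]: "eps (pp K h) = eps h"
  by (simp add: eps_def prj_emb[OF kmod] prj_closed[OF kmod])

lemma eps_emb: "x \<in> carrier K \<Longrightarrow> counit K x = eps (emb K x)"
  by (simp add: eps_def prj_emb[OF kmod])

lemmas Kbil = mulx_bil[OF alg] cop_fun cop_lin ev2_plus ev2_usc ev2_scale cop_scale eps_lin usc_laws(1,2) mult_ac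

lemma bilx_cop1: assumes f: "trilx f" shows "bilx (\<lambda>x y. cop x (\<lambda>a b. f a b y))"
proof -
  note l = trilx_part(1)[OF f]
  show ?thesis unfolding bilx_def linx_def
    by (simp add: cop_lin[OF l] trilxD[OF f] cop_fun)
qed

lemma bilx_cop2: assumes f: "trilx f" shows "bilx (\<lambda>x y. cop y (\<lambda>a b. f x a b))"
proof -
  note l = trilx_part(3)[OF f]
  have "f (x + y) = (\<lambda>a b. f x a b + f y a b)" "f (c \<bullet> x) = (\<lambda>a b. c \<bullet> f x a b)" for x y c
    by (simp_all add: trilxD[OF f] fun_eq_iff)
  then show ?thesis unfolding bilx_def linx_def
    by (simp add: cop_lin[OF l] cop_fun)
qed

lemma tens3_eqI:
  assumes "S \<in> carrier (tspace {3} K)" "T \<in> carrier (tspace {3} K)" "ev3 K S (pr3 K) = ev3 K T (pr3 K)"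
  shows "S = T"
proof -
  have "ev3 K S (pr3 K) = emb (tspace {3} K) S" if "S \<in> carrier (tspace {3} K)" for S
    unfolding ev3_def pr3_def tev_emb_pure[OF kmod that, symmetric]
    by (rule tev_cong[OF kmod that]) (auto simp: words3 prj_emb[OF kmod])
  then show ?thesis using assms by (simp add: emb_eq_iff)
qed

lemma pr3_emb: "x \<in> carrier K \<Longrightarrow> y \<in> carrier K \<Longrightarrow> z \<in> carrier K \<Longrightarrow>
  pure {3} K [x, y, z] \<in> carrier (tspace {3} K) \<and> emb (tspace {3} K) (pure {3} K [x, y, z]) = pr3 K (emb K x) (emb K y) (emb K z)"
  by (simp add: pr3_def prj_emb[OF kmod] pure_closed words3I)

lemma pr2_emb: "x \<in> carrier K \<Longrightarrow> y \<in> carrier K \<Longrightarrow>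
  pure {2} K [x, y] \<in> carrier (tspace {2} K) \<and> emb (tspace {2} K) (pure {2} K [x, y]) = pr2 K (emb K x) (emb K y)"
  by (simp add: pr2_def prj_emb[OF kmod] pure_closed words2I)

lemma ev3_pure': "trilx f \<Longrightarrow> ev3 K (pure {3} K [a, b, c]) f = f (emb K a) (emb K b) (emb K c)"
  by (rule ev3_pure[OF kmod])

context
  fixes S assumes S: "S \<in> carrier (tspace {2} K)"
begin

lemma tlift_left:
  assumes y: "y \<in> carrier K"
  shows "tlift (tspace {3} K) (\<lambda>d. pure {3} K [d!0, d!1, y]) S \<in> carrier (tspace {3} K)"
    "emb (tspace {3} K) (tlift (tspace {3} K) (\<lambda>d. pure {3} K [d!0, d!1, y]) S) = ev2 K S (\<lambda>a b. pr3 K a b (emb K y))"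
    "trilx f \<Longrightarrow> ev3 K (tlift (tspace {3} K) (\<lambda>d. pure {3} K [d!0, d!1, y]) S) f = ev2 K S (\<lambda>a b. f a b (emb K y))"
proof -
  have B: "bilx (\<lambda>a b. pr3 K a b (emb K y))" by (rule trilx_part(1)[OF trilx_pr3[OF kmod]])
  show "tlift (tspace {3} K) (\<lambda>d. pure {3} K [d!0, d!1, y]) S \<in> carrier (tspace {3} K)"
    "emb (tspace {3} K) (tlift (tspace {3} K) (\<lambda>d. pure {3} K [d!0, d!1, y]) S) = ev2 K S (\<lambda>a b. pr3 K a b (emb K y))"
    by (rule tlift2[OF kmod kmodule_tspace S B]; simp add: pr3_emb y)+
  show "trilx f \<Longrightarrow> ev3 K (tlift (tspace {3} K) (\<lambda>d. pure {3} K [d!0, d!1, y]) S) f = ev2 K S (\<lambda>a b. f a b (emb K y))"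
    by (rule ev3_tlift2[OF kmod S B kmod _ mlin3[OF kmod]]) (simp_all add: pr3_emb y ev3_pure')
qed

lemma tlift_right:
  assumes y: "y \<in> carrier K"
  shows "tlift (tspace {3} K) (\<lambda>d. pure {3} K [y, d!0, d!1]) S \<in> carrier (tspace {3} K)"
    "emb (tspace {3} K) (tlift (tspace {3} K) (\<lambda>d. pure {3} K [y, d!0, d!1]) S) = ev2 K S (\<lambda>a b. pr3 K (emb K y) a b)"
    "trilx f \<Longrightarrow> ev3 K (tlift (tspace {3} K) (\<lambda>d. pure {3} K [y, d!0, d!1]) S) f = ev2 K S (\<lambda>a b. f (emb K y) a b)"
proof -
  have B: "bilx (\<lambda>a b. pr3 K (emb K y) a b)" by (rule trilx_part(3)[OF trilx_pr3[OF kmod]])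
  show "tlift (tspace {3} K) (\<lambda>d. pure {3} K [y, d!0, d!1]) S \<in> carrier (tspace {3} K)"
    "emb (tspace {3} K) (tlift (tspace {3} K) (\<lambda>d. pure {3} K [y, d!0, d!1]) S) = ev2 K S (\<lambda>a b. pr3 K (emb K y) a b)"
    by (rule tlift2[OF kmod kmodule_tspace S B]; simp add: pr3_emb y)+
  show "trilx f \<Longrightarrow> ev3 K (tlift (tspace {3} K) (\<lambda>d. pure {3} K [y, d!0, d!1]) S) f = ev2 K S (\<lambda>a b. f (emb K y) a b)"
    by (rule ev3_tlift2[OF kmod S B kmod _ mlin3[OF kmod]]) (simp_all add: pr3_emb y ev3_pure')
qed

end

context
  fixes S assumes S: "S \<in> carrier (tspace {2} K)"
begin

lemma comul_left_closed: "comul_left K S \<in> carrier (tspace {3} K)"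
  and ev3_comul_left: "trilx f \<Longrightarrow> ev3 K (comul_left K S) f = ev2 K S (\<lambda>x y. cop x (\<lambda>a b. f a b y))"
proof -
  have B: "bilx (\<lambda>x y. cop x (\<lambda>a b. pr3 K a b y))" by (rule bilx_cop1[OF trilx_pr3[OF kmod]])
  note t = tlift_left[OF com_closed']
  show "comul_left K S \<in> carrier (tspace {3} K)"
    unfolding comul_left_def by (rule tlift2(1)[OF kmod kmodule_tspace S B]) (use t(1,2) in \<open>simp add: cop_emb\<close>)
  show "trilx f \<Longrightarrow> ev3 K (comul_left K S) f = ev2 K S (\<lambda>x y. cop x (\<lambda>a b. f a b y))"
    unfolding comul_left_def
    by (rule ev3_tlift2[OF kmod S B kmod _ mlin3[OF kmod]]) (use t in \<open>simp_all add: cop_emb\<close>)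
qed

lemma comul_right_closed: "comul_right K S \<in> carrier (tspace {3} K)"
  and ev3_comul_right: "trilx f \<Longrightarrow> ev3 K (comul_right K S) f = ev2 K S (\<lambda>x y. cop y (\<lambda>a b. f x a b))"
proof -
  have B: "bilx (\<lambda>x y. cop y (\<lambda>a b. pr3 K x a b))" by (rule bilx_cop2[OF trilx_pr3[OF kmod]])
  note t = tlift_right[OF com_closed']
  show "comul_right K S \<in> carrier (tspace {3} K)"
    unfolding comul_right_def by (rule tlift2(1)[OF kmod kmodule_tspace S B]) (use t(1,2) in \<open>simp add: cop_emb\<close>)
  show "trilx f \<Longrightarrow> ev3 K (comul_right K S) f = ev2 K S (\<lambda>x y. cop y (\<lambda>a b. f x a b))"
    unfolding comul_right_def
    by (rule ev3_tlift2[OF kmod S B kmod _ mlin3[OF kmod]]) (use t in \<open>simp_all add: cop_emb\<close>)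
qed

lemma leg12_closed: "leg12 K S \<in> carrier (tspace {3} K)"
  and ev3_leg12: "trilx f \<Longrightarrow> ev3 K (leg12 K S) f = ev2 K S (\<lambda>x y. f x y \<^bold>1)"
  unfolding leg12_def using trilx_part(1)[OF trilx_pr3[OF kmod]]
  by (auto intro!: tlift2(1)[OF kmod kmodule_tspace S] ev3_tlift2[OF kmod S _ kmod _ mlin3[OF kmod]]
      simp: pr3_emb one_closed ev3_pure')

lemma leg13_closed: "leg13 K S \<in> carrier (tspace {3} K)"
  and ev3_leg13: "trilx f \<Longrightarrow> ev3 K (leg13 K S) f = ev2 K S (\<lambda>x y. f x \<^bold>1 y)"
  unfolding leg13_def using trilx_part(2)[OF trilx_pr3[OF kmod]]
  by (auto intro!: tlift2(1)[OF kmod kmodule_tspace S] ev3_tlift2[OF kmod S _ kmod _ mlin3[OF kmod]]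
      simp: pr3_emb one_closed ev3_pure')

lemma leg23_closed: "leg23 K S \<in> carrier (tspace {3} K)"
  and ev3_leg23: "trilx f \<Longrightarrow> ev3 K (leg23 K S) f = ev2 K S (\<lambda>x y. f \<^bold>1 x y)"
  unfolding leg23_def using trilx_part(3)[OF trilx_pr3[OF kmod]]
  by (auto intro!: tlift2(1)[OF kmod kmodule_tspace S] ev3_tlift2[OF kmod S _ kmod _ mlin3[OF kmod]]
      simp: pr3_emb one_closed ev3_pure')

lemma flip_closed: "flip K S \<in> carrier (tspace {2} K)"
  and ev2_flip: "bilx f \<Longrightarrow> ev2 K (flip K S) f = ev2 K S (\<lambda>x y. f y x)"
proof -
  have B: "bilx (\<lambda>x y. pr2 K y x)" using bilx_pr2[OF kmod] by (simp add: bilx_def)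
  show "flip K S \<in> carrier (tspace {2} K)"
    unfolding flip_def by (rule tlift2(1)[OF kmod kmodule_tspace S B]) (simp add: pr2_emb)
  show "bilx f \<Longrightarrow> ev2 K (flip K S) f = ev2 K S (\<lambda>x y. f y x)"
    unfolding flip_def by (rule ev2_tlift2[OF kmod S B kmod _ mlin2[OF kmod]]) (simp_all add: pr2_emb ev2_pure[OF kmod])
qed

end

lemma carrier_tpow [simp]: "carrier (tpow_alg n K) = carrier (tspace {n} K)"
  by (simp add: tpow_alg_def)

lemma ring_tpow: "ring (tpow_alg n K)"
  using tpow_algebra[OF alg] by (simp add: assoc_algebra_def)

lemma tpow_mult_closed:
  "S \<in> carrier (tspace {n} K) \<Longrightarrow> T \<in> carrier (tspace {n} K) \<Longrightarrow> S \<otimes>\<^bsub>tpow_alg n K\<^esub> T \<in> carrier (tspace {n} K)"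
proof -
  interpret ring "tpow_alg n K" by (rule ring_tpow)
  show "S \<in> carrier (tspace {n} K) \<Longrightarrow> T \<in> carrier (tspace {n} K) \<Longrightarrow> S \<otimes>\<^bsub>tpow_alg n K\<^esub> T \<in> carrier (tspace {n} K)"
    using m_closed by simp
qed

lemma ev2_mul: "S \<in> carrier (tspace {2} K) \<Longrightarrow> T \<in> carrier (tspace {2} K) \<Longrightarrow> bilx f \<Longrightarrow>
  ev2 K (S \<otimes>\<^bsub>tpow_alg 2 K\<^esub> T) f = ev2 K S (\<lambda>a b. ev2 K T (\<lambda>c d. f (a \<star> c) (b \<star> d)))"
  using ev2_mult[OF alg] by simp

lemma ev3_mul: "S \<in> carrier (tspace {3} K) \<Longrightarrow> T \<in> carrier (tspace {3} K) \<Longrightarrow> trilx f \<Longrightarrow>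
  ev3 K (S \<otimes>\<^bsub>tpow_alg 3 K\<^esub> T) f = ev3 K S (\<lambda>a b c. ev3 K T (\<lambda>x y z. f (a \<star> x) (b \<star> y) (c \<star> z)))"
  using ev3_mult[OF alg] by simp

lemma trilx_mul: "trilx f \<Longrightarrow> trilx (\<lambda>x y z. f (a \<star> x) (b \<star> y) (c \<star> z))"
  by (simp add: trilx_def linx_def mulx_bil[OF alg])

lemma trilx_ev3: assumes "\<And>x y z. trilx (\<lambda>a b c. f a b c x y z)"
  shows "trilx (\<lambda>a b c. ev3 K T (f a b c))"
  using assms unfolding trilx_def ev3_def by (auto intro!: linx_tev)

lemma bilx_mul: "bilx f \<Longrightarrow> bilx (\<lambda>x y. f (a \<star> x) (b \<star> y))"
  by (simp add: bilx_def linx_def mulx_bil[OF alg])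

lemma trilx_mul': "trilx f \<Longrightarrow> trilx (\<lambda>x y z. f (x \<star> a) (y \<star> b) (z \<star> c))"
  by (simp add: trilx_def linx_def mulx_bil[OF alg])

end

section \<open>Bialgebras, R-matrices and twists in terms of multilinear functions\<close>

locale bialg =
  fixes K :: "('k::comm_ring_1, 'a) coalg"
  assumes bi: "bialgebra K"

sublocale bialg \<subseteq> prebialg
  using bi by unfold_locales (auto simp: bialgebra_def alg_hom_def lin_def tpow_alg_def)

context prebialg
begin

lemma cop_swap: "cop h (\<lambda>a b. ev2 M S (\<lambda>c d. f a b c d)) = ev2 M S (\<lambda>c d. cop h (\<lambda>a b. f a b c d))"
  unfolding cop_def by (rule ev2_swap)

lemma cop_cop_swap: "cop h (\<lambda>a b. cop k (\<lambda>c d. f a b c d)) = cop k (\<lambda>c d. cop h (\<lambda>a b. f a b c d))"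
  unfolding cop_def by (rule ev2_swap)

lemma cop_linx: "linx g \<Longrightarrow> g (cop h f) = cop h (\<lambda>a b. g (f a b))"
  unfolding cop_def by (rule ev2_linx)

lemma ev3_one: "trilx f \<Longrightarrow> ev3 K \<one>\<^bsub>tpow_alg 3 K\<^esub> f = f \<^bold>1 \<^bold>1 \<^bold>1"
  by (simp add: tpow_alg_def numeral_3_eq_3 ev3_pure'[unfolded numeral_3_eq_3])

lemma ev2_1: "bilx f \<Longrightarrow> ev2 K \<one>\<^bsub>tpow_alg 2 K\<^esub> f = f \<^bold>1 \<^bold>1"
  by (rule ev2_one[OF alg])

lemma tpow_one_closed: "\<one>\<^bsub>tpow_alg n K\<^esub> \<in> carrier (tspace {n} K)"
proof -
  interpret ring "tpow_alg n K" by (rule ring_tpow)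
  show ?thesis using one_closed by simp
qed

end

context bialg
begin

lemma cop_mult:
  assumes f: "bilx f" shows "cop (h \<star> k) f = cop h (\<lambda>a b. cop k (\<lambda>c d. f (a \<star> c) (b \<star> d)))"
proof -
  have "comul K (prj K (h \<star> k)) = comul K (prj K h) \<otimes>\<^bsub>tpow_alg 2 K\<^esub> comul K (prj K k)"
    using bi prj_closed[OF kmod] by (simp add: prj_mulx[OF alg] bialgebra_def alg_hom_def ring_hom_mult)
  then show ?thesis by (simp add: cop_def ev2_mul com_closed f)
qed

lemma cop_one: "bilx f \<Longrightarrow> cop \<^bold>1 f = f \<^bold>1 \<^bold>1"
proof -
  have "comul K \<one>\<^bsub>K\<^esub> = \<one>\<^bsub>tpow_alg 2 K\<^esub>"
    using bi by (simp add: bialgebra_def alg_hom_def ring_hom_one)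
  then show "bilx f \<Longrightarrow> cop \<^bold>1 f = f \<^bold>1 \<^bold>1"
    by (simp add: cop_def prj_emb[OF kmod] one_closed ev2_1)
qed

lemma eps_mult: "eps (h \<star> k) = eps h * eps k"
  using bi prj_closed[OF kmod, of h] prj_closed[OF kmod, of k]
  by (simp add: eps_def prj_mulx[OF alg] bialgebra_def alg_hom_def ring_hom_def)

lemma eps_one: "eps \<^bold>1 = 1"
  using bi by (simp add: eps_def prj_emb[OF kmod] one_closed bialgebra_def alg_hom_def ring_hom_def)

lemma coassoc:
  assumes f: "trilx f"
  shows "cop h (\<lambda>x y. cop x (\<lambda>a b. f a b y)) = cop h (\<lambda>x y. cop y (\<lambda>a b. f x a b))"
proof -
  have "comul_left K (comul K (prj K h)) = comul_right K (comul K (prj K h))"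
    using bi prj_closed[OF kmod, of h] by (simp add: bialgebra_def)
  then show ?thesis
    using ev3_comul_left[OF com_closed f, of h] ev3_comul_right[OF com_closed f, of h] by (simp add: cop_def)
qed

lemma counit_cop: "linx f \<Longrightarrow> cop h (\<lambda>a b. eps a \<bullet> f b) = f (pp K h)"
  "linx f \<Longrightarrow> cop h (\<lambda>a b. eps b \<bullet> f a) = f (pp K h)"
proof -
  have B: "bilx (\<lambda>a b. eps a \<bullet> b)" "bilx (\<lambda>a b. eps b \<bullet> a)" by (simp_all add: bilx_def linx_def Kbil)
  have "emb K (tlift K (\<lambda>d. counit K (d!0) \<odot>\<^bsub>K\<^esub> (d!1)) (comul K (prj K h))) = cop h (\<lambda>a b. eps a \<bullet> b)"
    unfolding cop_def
    by (rule tlift2(2)[OF kmod kmod com_closed B(1)]) (simp add: module_simps[OF kmod] emb_smult[OF kmod] eps_emb)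
  then have 1: "cop h (\<lambda>a b. eps a \<bullet> b) = pp K h"
    using bi prj_closed[OF kmod, of h] by (simp add: bialgebra_def)
  show "linx f \<Longrightarrow> cop h (\<lambda>a b. eps a \<bullet> f b) = f (pp K h)"
    unfolding 1[symmetric] by (simp add: cop_linx linx_scale)
  have "emb K (tlift K (\<lambda>d. counit K (d!1) \<odot>\<^bsub>K\<^esub> (d!0)) (comul K (prj K h))) = cop h (\<lambda>a b. eps b \<bullet> a)"
    unfolding cop_def
    by (rule tlift2(2)[OF kmod kmod com_closed B(2)]) (simp add: module_simps[OF kmod] emb_smult[OF kmod] eps_emb)
  then have 2: "cop h (\<lambda>a b. eps b \<bullet> a) = pp K h"
    using bi prj_closed[OF kmod, of h] by (simp add: bialgebra_def)
  show "linx f \<Longrightarrow> cop h (\<lambda>a b. eps b \<bullet> f a) = f (pp K h)"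
    unfolding 2[symmetric] by (simp add: cop_linx linx_scale)
qed

end

locale tri = bialg K for K :: "('k::comm_ring_1, 'a) coalg" +
  fixes R :: "('k, 'a) tens"
  assumes tri: "triangular_hopf K R"
begin

abbreviation SR :: "(('k, 'a) uvec \<Rightarrow> ('k, 'a) uvec \<Rightarrow> ('k, 'n) uvec) \<Rightarrow> ('k, 'n) uvec" where
  "SR \<equiv> ev2 K R"

lemma R_closed: "R \<in> carrier (tspace {2} K)"
  using tri by (auto simp: triangular_hopf_def Units_def)

lemma R_flip: "R \<otimes>\<^bsub>tpow_alg 2 K\<^esub> flip K R = \<one>\<^bsub>tpow_alg 2 K\<^esub>" "flip K R \<otimes>\<^bsub>tpow_alg 2 K\<^esub> R = \<one>\<^bsub>tpow_alg 2 K\<^esub>"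
proof -
  interpret ring "tpow_alg 2 K" by (rule ring_tpow)
  have "R \<in> Units (tpow_alg 2 K)" "flip K R = inv\<^bsub>tpow_alg 2 K\<^esub> R" using tri by (auto simp: triangular_hopf_def)
  then show "R \<otimes>\<^bsub>tpow_alg 2 K\<^esub> flip K R = \<one>\<^bsub>tpow_alg 2 K\<^esub>" "flip K R \<otimes>\<^bsub>tpow_alg 2 K\<^esub> R = \<one>\<^bsub>tpow_alg 2 K\<^esub>"
    by (simp_all add: Units_r_inv Units_l_inv)
qed

lemma bilx_ev2_mul: "bilx f \<Longrightarrow> bilx (\<lambda>a b. f (x \<star> a) (y \<star> b))" "bilx f \<Longrightarrow> bilx (\<lambda>a b. f (a \<star> x) (b \<star> y))"
  "bilx f \<Longrightarrow> bilx (\<lambda>a b. f b a)"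
  by (simp_all add: bilx_def linx_def mulx_bil[OF alg])

text \<open>The condition \<open>R\<inverse> = R\<^sub>2\<^sub>1\<close>.\<close>

lemma R_inv:
  assumes f: "bilx f"
  shows "SR (\<lambda>a b. SR (\<lambda>c d. f (a \<star> d) (b \<star> c))) = f \<^bold>1 \<^bold>1"
    "SR (\<lambda>a b. SR (\<lambda>c d. f (b \<star> c) (a \<star> d))) = f \<^bold>1 \<^bold>1"
proof -
  have "ev2 K (R \<otimes>\<^bsub>tpow_alg 2 K\<^esub> flip K R) f = SR (\<lambda>a b. SR (\<lambda>c d. f (a \<star> d) (b \<star> c)))"
    by (simp add: ev2_mul R_closed flip_closed f ev2_flip bilx_ev2_mul)
  then show "SR (\<lambda>a b. SR (\<lambda>c d. f (a \<star> d) (b \<star> c))) = f \<^bold>1 \<^bold>1"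
    by (simp add: R_flip ev2_1 f)
  have B: "bilx (\<lambda>a b. SR (\<lambda>c d. f (a \<star> c) (b \<star> d)))"
    unfolding bilx_def linx_def by (simp add: Kbil bilxD[OF f])
  have "ev2 K (flip K R \<otimes>\<^bsub>tpow_alg 2 K\<^esub> R) f = SR (\<lambda>a b. SR (\<lambda>c d. f (b \<star> c) (a \<star> d)))"
    by (simp add: ev2_mul R_closed flip_closed f ev2_flip[OF R_closed B])
  then show "SR (\<lambda>a b. SR (\<lambda>c d. f (b \<star> c) (a \<star> d))) = f \<^bold>1 \<^bold>1"
    by (simp add: R_flip ev2_1 f)
qed

text \<open>The condition \<open>\<Delta>\<^sup>c\<^sup>o\<^sup>p(h) R = R \<Delta>(h)\<close>. The next two lemmas are the hexagon identities.\<close>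

lemma quasi_cocomm:
  assumes f: "bilx f"
  shows "cop h (\<lambda>c d. SR (\<lambda>a b. f (d \<star> a) (c \<star> b))) = SR (\<lambda>a b. cop h (\<lambda>c d. f (a \<star> c) (b \<star> d)))"
proof -
  interpret T: ring "tpow_alg 2 K" by (rule ring_tpow)
  let ?D = "comul K (prj K h)"
  have B: "bilx (\<lambda>a b. SR (\<lambda>c d. f (a \<star> c) (b \<star> d)))"
    unfolding bilx_def linx_def by (simp add: Kbil bilxD[OF f])
  have RU: "R \<in> Units (tpow_alg 2 K)" using tri by (auto simp: triangular_hopf_def)
  have fl: "flip K ?D = R \<otimes>\<^bsub>tpow_alg 2 K\<^esub> ?D \<otimes>\<^bsub>tpow_alg 2 K\<^esub> inv\<^bsub>tpow_alg 2 K\<^esub> R"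
    using tri prj_closed[OF kmod, of h] by (auto simp: triangular_hopf_def)
  have "flip K ?D \<otimes>\<^bsub>tpow_alg 2 K\<^esub> R = R \<otimes>\<^bsub>tpow_alg 2 K\<^esub> ?D"
    unfolding fl by (simp only: T.m_assoc T.m_closed T.Units_inv_closed T.Units_closed T.Units_l_inv T.r_one
        carrier_tpow[symmetric] com_closed[unfolded carrier_tpow[symmetric]] RU)
  then have "ev2 K (flip K ?D \<otimes>\<^bsub>tpow_alg 2 K\<^esub> R) f = ev2 K (R \<otimes>\<^bsub>tpow_alg 2 K\<^esub> ?D) f" by simp
  then show ?thesis
    by (simp add: ev2_mul R_closed com_closed flip_closed f ev2_flip[OF com_closed B] cop_def)
qed

lemma hex1:
  assumes f: "trilx f"
  shows "SR (\<lambda>a c. cop a (\<lambda>x y. f x y c)) = SR (\<lambda>a c. SR (\<lambda>b d. f a b (c \<star> d)))"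
proof -
  have B: "trilx (\<lambda>a b c. ev3 K (leg23 K R) (\<lambda>x y z. f (a \<star> x) (b \<star> y) (c \<star> z)))"
    by (rule trilx_ev3) (rule trilx_mul'[OF f])
  have "comul_left K R = leg13 K R \<otimes>\<^bsub>tpow_alg 3 K\<^esub> leg23 K R" using tri by (simp add: triangular_hopf_def)
  then have "SR (\<lambda>a c. cop a (\<lambda>x y. f x y c)) = ev3 K (leg13 K R \<otimes>\<^bsub>tpow_alg 3 K\<^esub> leg23 K R) f"
    by (simp add: ev3_comul_left R_closed f flip: \<open>comul_left K R = _\<close>)
  also have "\<dots> = SR (\<lambda>a c. SR (\<lambda>b d. f (a \<star> \<^bold>1) (\<^bold>1 \<star> b) (c \<star> d)))"
    by (simp only: ev3_mul[OF leg13_closed leg23_closed f] R_closed, simp only: ev3_leg13[OF R_closed B],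
      simp only: ev3_leg23[OF R_closed trilx_mul[OF f]])
  also have "\<dots> = SR (\<lambda>a c. SR (\<lambda>b d. f a b (c \<star> d)))"
    by (intro ev2_cong[OF kmod R_closed]) (simp add: mulx_one[OF alg])
  finally show ?thesis .
qed

lemma hex2:
  assumes f: "trilx f"
  shows "SR (\<lambda>a c. cop c (\<lambda>x y. f a x y)) = SR (\<lambda>a c. SR (\<lambda>b d. f (a \<star> b) d c))"
proof -
  have B: "trilx (\<lambda>a b c. ev3 K (leg12 K R) (\<lambda>x y z. f (a \<star> x) (b \<star> y) (c \<star> z)))"
    by (rule trilx_ev3) (rule trilx_mul'[OF f])
  have "comul_right K R = leg13 K R \<otimes>\<^bsub>tpow_alg 3 K\<^esub> leg12 K R" using tri by (simp add: triangular_hopf_def)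
  then have "SR (\<lambda>a c. cop c (\<lambda>x y. f a x y)) = ev3 K (leg13 K R \<otimes>\<^bsub>tpow_alg 3 K\<^esub> leg12 K R) f"
    by (simp add: ev3_comul_right R_closed f flip: \<open>comul_right K R = _\<close>)
  also have "\<dots> = SR (\<lambda>a c. SR (\<lambda>b d. f (a \<star> b) (\<^bold>1 \<star> d) (c \<star> \<^bold>1)))"
    by (simp only: ev3_mul[OF leg13_closed leg12_closed f] R_closed, simp only: ev3_leg13[OF R_closed B],
      simp only: ev3_leg12[OF R_closed trilx_mul[OF f]])
  also have "\<dots> = SR (\<lambda>a c. SR (\<lambda>b d. f (a \<star> b) d c))"
    by (intro ev2_cong[OF kmod R_closed]) (simp add: mulx_one[OF alg])
  finally show ?thesis .
qed

text \<open>Applying \<open>\<epsilon>\<close> to the first leg of \<open>(\<Delta> \<otimes> id)R = R\<^sub>1\<^sub>3 R\<^sub>2\<^sub>3\<close> gives \<open>R = (1 \<otimes> r) R\<close> with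
  \<open>r = \<epsilon>(R\<^sup>\<alpha>) R\<^sub>\<alpha>\<close>, and \<open>R\<close> is invertible, so \<open>r = 1\<close>. The other identity follows in the
  same way from the other hexagon.\<close>

lemma R_eps:
  assumes g: "linx g"
  shows "SR (\<lambda>a b. eps a \<bullet> g b) = g \<^bold>1" "SR (\<lambda>a b. eps b \<bullet> g a) = g \<^bold>1"
proof -
  have 1: "SR f = SR (\<lambda>a b. SR (\<lambda>c d. eps a \<bullet> f c (b \<star> d)))" if f: "bilx f" for f :: "_ \<Rightarrow> _ \<Rightarrow> ('k, 'z) uvec"
  proof -
    have "trilx (\<lambda>a b c. eps a \<bullet> f b c)" by (simp add: trilx_def linx_def Kbil bilxD[OF f])
    from hex1[OF this] have "SR (\<lambda>a c. cop a (\<lambda>x y. eps x \<bullet> f y c)) = SR (\<lambda>a b. SR (\<lambda>c d. eps a \<bullet> f c (b \<star> d)))" .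
    moreover have "SR (\<lambda>a c. cop a (\<lambda>x y. eps x \<bullet> f y c)) = SR f"
      by (intro ev2_cong[OF kmod R_closed]) (use f in \<open>simp add: counit_cop bilx_def\<close>)
    ultimately show ?thesis by simp
  qed
  have 2: "SR f = SR (\<lambda>a b. SR (\<lambda>c d. eps b \<bullet> f (a \<star> c) d))" if f: "bilx f" for f :: "_ \<Rightarrow> _ \<Rightarrow> ('k, 'z) uvec"
  proof -
    have "trilx (\<lambda>a b c. eps c \<bullet> f a b)" by (simp add: trilx_def linx_def Kbil bilxD[OF f])
    from hex2[OF this] have "SR (\<lambda>a c. cop c (\<lambda>x y. eps y \<bullet> f a x)) = SR (\<lambda>a b. SR (\<lambda>c d. eps b \<bullet> f (a \<star> c) d))" .
    moreover have "SR (\<lambda>a c. cop c (\<lambda>x y. eps y \<bullet> f a x)) = SR f"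
      by (intro ev2_cong[OF kmod R_closed]) (use f in \<open>simp add: counit_cop bilx_def\<close>)
    ultimately show ?thesis by simp
  qed
  have f: "bilx (\<lambda>a b. eps a \<bullet> g b)" "bilx (\<lambda>a b. eps b \<bullet> g a)"
    by (simp_all add: bilx_def linx_def Kbil linx_simps[OF g])
  have B: "bilx (\<lambda>x y. SR (\<lambda>p q. eps (x \<star> q) \<bullet> g (y \<star> p)))" "bilx (\<lambda>x y. SR (\<lambda>p q. eps (y \<star> p) \<bullet> g (x \<star> q)))"
    unfolding bilx_def linx_def by (simp_all add: Kbil linx_simps[OF g])
  have C: "bilx (\<lambda>x y. eps x \<bullet> g (z \<star> y))" "bilx (\<lambda>x y. eps y \<bullet> g (z \<star> x))" for z
    unfolding bilx_def linx_def by (simp_all add: Kbil linx_simps[OF g])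
  \<comment> \<open>Insert \<open>R R\<^sub>2\<^sub>1 = 1\<close>, replace \<open>R\<close> by \<open>(1 \<otimes> r) R\<close>, and cancel \<open>R R\<^sub>2\<^sub>1\<close> again.\<close>
  have "g \<^bold>1 = SR (\<lambda>a b. SR (\<lambda>p q. eps (a \<star> q) \<bullet> g (b \<star> p)))"
    using R_inv(1)[OF f(1)] by (simp add: eps_one)
  also have "\<dots> = SR (\<lambda>a b. SR (\<lambda>c d. eps a \<bullet> SR (\<lambda>p q. eps (c \<star> q) \<bullet> g ((b \<star> d) \<star> p))))"
    by (rule 1[OF B(1)])
  also have "\<dots> = SR (\<lambda>a b. eps a \<bullet> SR (\<lambda>c d. SR (\<lambda>p q. eps (c \<star> q) \<bullet> g (b \<star> (d \<star> p)))))"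
    by (simp add: ev2_usc mulx_assoc[OF alg])
  also have "\<dots> = SR (\<lambda>a b. eps a \<bullet> g b)"
    by (intro ev2_cong[OF kmod R_closed]) (simp add: R_inv(1)[OF C(1)] eps_one mulx_one[OF alg])
  finally show "SR (\<lambda>a b. eps a \<bullet> g b) = g \<^bold>1" by simp
  have "g \<^bold>1 = SR (\<lambda>a b. SR (\<lambda>p q. eps (b \<star> p) \<bullet> g (a \<star> q)))"
    using R_inv(1)[OF f(2)] by (simp add: eps_one)
  also have "\<dots> = SR (\<lambda>a b. SR (\<lambda>c d. eps b \<bullet> SR (\<lambda>p q. eps (d \<star> p) \<bullet> g ((a \<star> c) \<star> q))))"
    by (rule 2[OF B(2)])
  also have "\<dots> = SR (\<lambda>a b. eps b \<bullet> SR (\<lambda>c d. SR (\<lambda>p q. eps (d \<star> p) \<bullet> g (a \<star> (c \<star> q)))))"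
    by (simp add: ev2_usc mulx_assoc[OF alg])
  also have "\<dots> = SR (\<lambda>a b. eps b \<bullet> g a)"
    by (intro ev2_cong[OF kmod R_closed]) (simp add: R_inv(1)[OF C(2)] eps_one mulx_one[OF alg])
  finally show "SR (\<lambda>a b. eps b \<bullet> g a) = g \<^bold>1" by simp
qed

end

locale tw = bialg K for K :: "('k::comm_ring_1, 'a) coalg" +
  fixes F :: "('k, 'a) tens"
  assumes tw: "twist K F"
begin

abbreviation G where "G \<equiv> inv\<^bsub>tpow_alg 2 K\<^esub> F"
abbreviation SF :: "(('k, 'a) uvec \<Rightarrow> ('k, 'a) uvec \<Rightarrow> ('k, 'n) uvec) \<Rightarrow> ('k, 'n) uvec" where
  "SF \<equiv> ev2 K F"
abbreviation SG :: "(('k, 'a) uvec \<Rightarrow> ('k, 'a) uvec \<Rightarrow> ('k, 'n) uvec) \<Rightarrow> ('k, 'n) uvec" where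
  "SG \<equiv> ev2 K G"

lemma F_closed: "F \<in> carrier (tspace {2} K)"
  using tw by (auto simp: twist_def Units_def)

lemma G_closed: "G \<in> carrier (tspace {2} K)"
  and FG: "F \<otimes>\<^bsub>tpow_alg 2 K\<^esub> G = \<one>\<^bsub>tpow_alg 2 K\<^esub>" and GF: "G \<otimes>\<^bsub>tpow_alg 2 K\<^esub> F = \<one>\<^bsub>tpow_alg 2 K\<^esub>"
proof -
  interpret ring "tpow_alg 2 K" by (rule ring_tpow)
  have "F \<in> Units (tpow_alg 2 K)" using tw by (auto simp: twist_def)
  then show "G \<in> carrier (tspace {2} K)" "F \<otimes>\<^bsub>tpow_alg 2 K\<^esub> G = \<one>\<^bsub>tpow_alg 2 K\<^esub>" "G \<otimes>\<^bsub>tpow_alg 2 K\<^esub> F = \<one>\<^bsub>tpow_alg 2 K\<^esub>"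
    using Units_inv_closed by (simp_all add: Units_r_inv Units_l_inv)
qed

lemma SF_SG: "bilx f \<Longrightarrow> SF (\<lambda>a b. SG (\<lambda>c d. f (a \<star> c) (b \<star> d))) = f \<^bold>1 \<^bold>1"
  and SG_SF: "bilx f \<Longrightarrow> SG (\<lambda>a b. SF (\<lambda>c d. f (a \<star> c) (b \<star> d))) = f \<^bold>1 \<^bold>1"
  by (simp_all flip: ev2_mul[OF F_closed G_closed] ev2_mul[OF G_closed F_closed] add: FG GF ev2_1)

lemma F_eps:
  assumes g: "linx g"
  shows "SF (\<lambda>a b. eps a \<bullet> g b) = g \<^bold>1" "SF (\<lambda>a b. eps b \<bullet> g a) = g \<^bold>1"
proof -
  have B: "bilx (\<lambda>a b. eps a \<bullet> b)" "bilx (\<lambda>a b. eps b \<bullet> a)" by (simp_all add: bilx_def linx_def Kbil)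
  have "emb K (tlift K (\<lambda>d. counit K (d!0) \<odot>\<^bsub>K\<^esub> (d!1)) F) = SF (\<lambda>a b. eps a \<bullet> b)"
    by (rule tlift2(2)[OF kmod kmod F_closed B(1)]) (simp add: module_simps[OF kmod] emb_smult[OF kmod] eps_emb)
  then have 1: "\<^bold>1 = SF (\<lambda>a b. eps a \<bullet> b)" using tw by (simp add: twist_def)
  have "emb K (tlift K (\<lambda>d. counit K (d!1) \<odot>\<^bsub>K\<^esub> (d!0)) F) = SF (\<lambda>a b. eps b \<bullet> a)"
    by (rule tlift2(2)[OF kmod kmod F_closed B(2)]) (simp add: module_simps[OF kmod] emb_smult[OF kmod] eps_emb)
  then have 2: "\<^bold>1 = SF (\<lambda>a b. eps b \<bullet> a)" using tw by (simp add: twist_def)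
  show "SF (\<lambda>a b. eps a \<bullet> g b) = g \<^bold>1" unfolding 1 by (simp add: ev2_linx[OF g] linx_scale[OF g])
  show "SF (\<lambda>a b. eps b \<bullet> g a) = g \<^bold>1" unfolding 2 by (simp add: ev2_linx[OF g] linx_scale[OF g])
qed

lemma G_eps:
  assumes g: "linx g"
  shows "SG (\<lambda>a b. eps a \<bullet> g b) = g \<^bold>1" "SG (\<lambda>a b. eps b \<bullet> g a) = g \<^bold>1"
proof -
  have B: "bilx (\<lambda>a b. eps a \<bullet> g b)" "bilx (\<lambda>a b. eps b \<bullet> g a)"
    by (simp_all add: bilx_def linx_def Kbil linx_simps[OF g])
  have L: "linx (\<lambda>b. g (c \<star> b))" for c by (simp add: linx_def Kbil linx_simps[OF g])
  have "g \<^bold>1 = SG (\<lambda>a b. eps a \<bullet> SF (\<lambda>c d. eps c \<bullet> g (b \<star> d)))"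
    using SG_SF[OF B(1)] by (simp add: eps_one eps_mult flip: ev2_usc)
  also have "\<dots> = SG (\<lambda>a b. eps a \<bullet> g b)"
    by (intro ev2_cong[OF kmod G_closed]) (simp add: F_eps[OF L] mulx_one[OF alg])
  finally show "SG (\<lambda>a b. eps a \<bullet> g b) = g \<^bold>1" by simp
  have "g \<^bold>1 = SG (\<lambda>a b. eps b \<bullet> SF (\<lambda>c d. eps d \<bullet> g (a \<star> c)))"
    using SG_SF[OF B(2)] by (simp add: eps_one eps_mult flip: ev2_usc)
  also have "\<dots> = SG (\<lambda>a b. eps b \<bullet> g a)"
    by (intro ev2_cong[OF kmod G_closed]) (simp add: F_eps[OF L] mulx_one[OF alg])
  finally show "SG (\<lambda>a b. eps b \<bullet> g a) = g \<^bold>1" by simp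
qed

lemma tens3_mult_eqI:
  assumes cl: "S \<in> carrier (tspace {3} K)" "T \<in> carrier (tspace {3} K)" "U \<in> carrier (tspace {3} K)"
    and e: "ev3 K U (pr3 K) = ev3 K S (\<lambda>a b c. ev3 K T (\<lambda>x y z. pr3 K (a \<star> x) (b \<star> y) (c \<star> z)))"
  shows "U = S \<otimes>\<^bsub>tpow_alg 3 K\<^esub> T"
  by (rule tens3_eqI) (simp_all add: cl tpow_mult_closed ev3_mul trilx_pr3[OF kmod] e)

text \<open>The four maps \<open>K \<otimes> K \<rightarrow> K \<otimes> K \<otimes> K\<close> in the cocycle identity are algebra maps, hence send
  the inverse of \<open>F\<close> to the inverses of their values at \<open>F\<close>.\<close>

lemma leg_mult:
  assumes S: "S \<in> carrier (tspace {2} K)" and T: "T \<in> carrier (tspace {2} K)"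
  shows "leg12 K (S \<otimes>\<^bsub>tpow_alg 2 K\<^esub> T) = leg12 K S \<otimes>\<^bsub>tpow_alg 3 K\<^esub> leg12 K T"
    "leg23 K (S \<otimes>\<^bsub>tpow_alg 2 K\<^esub> T) = leg23 K S \<otimes>\<^bsub>tpow_alg 3 K\<^esub> leg23 K T"
    "comul_left K (S \<otimes>\<^bsub>tpow_alg 2 K\<^esub> T) = comul_left K S \<otimes>\<^bsub>tpow_alg 3 K\<^esub> comul_left K T"
    "comul_right K (S \<otimes>\<^bsub>tpow_alg 2 K\<^esub> T) = comul_right K S \<otimes>\<^bsub>tpow_alg 3 K\<^esub> comul_right K T"
proof -
  note ST = tpow_mult_closed[OF S T]
  note t = trilx_pr3[OF kmod] and t' = trilx_mul[OF trilx_pr3[OF kmod]]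
  have t2: "trilx (\<lambda>a b c. ev3 K U (\<lambda>x y z. pr3 K (a \<star> x) (b \<star> y) (c \<star> z)))" for U
    by (rule trilx_ev3) (rule trilx_mul'[OF t])
  note cls = leg12_closed leg23_closed comul_left_closed comul_right_closed
  note evs = ev3_leg12[OF ST t] ev3_leg23[OF ST t] ev3_comul_left[OF ST t] ev3_comul_right[OF ST t]
    ev3_leg12[OF S t2] ev3_leg23[OF S t2] ev3_comul_left[OF S t2] ev3_comul_right[OF S t2]
  note evT = ev3_leg12[OF T t'] ev3_leg23[OF T t'] ev3_comul_left[OF T t'] ev3_comul_right[OF T t']
  have one: "\<^bold>1 \<star> \<^bold>1 = \<^bold>1" by (simp add: mulx_one[OF alg])
  show "leg12 K (S \<otimes>\<^bsub>tpow_alg 2 K\<^esub> T) = leg12 K S \<otimes>\<^bsub>tpow_alg 3 K\<^esub> leg12 K T"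
    by (rule tens3_mult_eqI; (simp only: cls S T ST; fail)?)
       (simp only: evs, simp only: evT one ev2_mul[OF S T trilx_part(1)[OF t]])
  show "leg23 K (S \<otimes>\<^bsub>tpow_alg 2 K\<^esub> T) = leg23 K S \<otimes>\<^bsub>tpow_alg 3 K\<^esub> leg23 K T"
    by (rule tens3_mult_eqI; (simp only: cls S T ST; fail)?)
       (simp only: evs, simp only: evT one ev2_mul[OF S T trilx_part(3)[OF t]])
  show "comul_left K (S \<otimes>\<^bsub>tpow_alg 2 K\<^esub> T) = comul_left K S \<otimes>\<^bsub>tpow_alg 3 K\<^esub> comul_left K T"
    by (rule tens3_mult_eqI; (simp only: cls S T ST; fail)?)
       (simp only: evs, simp only: evT ev2_mul[OF S T bilx_cop1[OF t]] cop_mult[OF trilx_part(1)[OF t]] cop_swap)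
  show "comul_right K (S \<otimes>\<^bsub>tpow_alg 2 K\<^esub> T) = comul_right K S \<otimes>\<^bsub>tpow_alg 3 K\<^esub> comul_right K T"
    by (rule tens3_mult_eqI; (simp only: cls S T ST; fail)?)
       (simp only: evs, simp only: evT ev2_mul[OF S T bilx_cop2[OF t]] cop_mult[OF trilx_part(3)[OF t]] cop_swap)
qed

lemma leg_one:
  "leg12 K \<one>\<^bsub>tpow_alg 2 K\<^esub> = \<one>\<^bsub>tpow_alg 3 K\<^esub>" "leg23 K \<one>\<^bsub>tpow_alg 2 K\<^esub> = \<one>\<^bsub>tpow_alg 3 K\<^esub>"
  "comul_left K \<one>\<^bsub>tpow_alg 2 K\<^esub> = \<one>\<^bsub>tpow_alg 3 K\<^esub>" "comul_right K \<one>\<^bsub>tpow_alg 2 K\<^esub> = \<one>\<^bsub>tpow_alg 3 K\<^esub>"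
proof -
  note t = trilx_pr3[OF kmod] and o = tpow_one_closed
  note s = leg12_closed leg23_closed comul_left_closed comul_right_closed o ev3_one[OF t]
    ev3_leg12[OF o t] ev3_leg23[OF o t] ev3_comul_left[OF o t] ev3_comul_right[OF o t]
    ev2_1[OF trilx_part(1)[OF t]] ev2_1[OF trilx_part(3)[OF t]] ev2_1[OF bilx_cop1[OF t]] ev2_1[OF bilx_cop2[OF t]]
    cop_one[OF trilx_part(1)[OF t]] cop_one[OF trilx_part(3)[OF t]]
  show "leg12 K \<one>\<^bsub>tpow_alg 2 K\<^esub> = \<one>\<^bsub>tpow_alg 3 K\<^esub>" "leg23 K \<one>\<^bsub>tpow_alg 2 K\<^esub> = \<one>\<^bsub>tpow_alg 3 K\<^esub>"
  "comul_left K \<one>\<^bsub>tpow_alg 2 K\<^esub> = \<one>\<^bsub>tpow_alg 3 K\<^esub>" "comul_right K \<one>\<^bsub>tpow_alg 2 K\<^esub> = \<one>\<^bsub>tpow_alg 3 K\<^esub>"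
    by (rule tens3_eqI; simp only: s)+
qed

text \<open>Two rearrangements of the cocycle identity \<open>F\<^sub>1\<^sub>2 (\<Delta> \<otimes> id)F = F\<^sub>2\<^sub>3 (id \<otimes> \<Delta>)F\<close>, in which all
  four factors are invertible: \<open>(\<Delta> \<otimes> id)F \<sqdot> (id \<otimes> \<Delta>)G = G\<^sub>1\<^sub>2 F\<^sub>2\<^sub>3\<close> and the identity of the
  inverses. The two lemmas after it are their Sweedler forms.\<close>

lemma cocycle_inverses:
  "comul_left K F \<otimes>\<^bsub>tpow_alg 3 K\<^esub> comul_right K G = leg12 K G \<otimes>\<^bsub>tpow_alg 3 K\<^esub> leg23 K F"
  "comul_left K G \<otimes>\<^bsub>tpow_alg 3 K\<^esub> leg12 K G = comul_right K G \<otimes>\<^bsub>tpow_alg 3 K\<^esub> leg23 K G"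
proof -
  interpret T: ring "tpow_alg 3 K" by (rule ring_tpow)
  let ?a = "leg12 K F" and ?b = "comul_left K F" and ?c = "leg23 K F" and ?d = "comul_right K F"
  let ?a' = "leg12 K G" and ?b' = "comul_left K G" and ?c' = "leg23 K G" and ?d' = "comul_right K G"
  have cl: "?a \<in> carrier (tpow_alg 3 K)" "?b \<in> carrier (tpow_alg 3 K)" "?c \<in> carrier (tpow_alg 3 K)" "?d \<in> carrier (tpow_alg 3 K)"
     "?a' \<in> carrier (tpow_alg 3 K)" "?b' \<in> carrier (tpow_alg 3 K)" "?c' \<in> carrier (tpow_alg 3 K)" "?d' \<in> carrier (tpow_alg 3 K)"
    using leg12_closed[OF F_closed] leg12_closed[OF G_closed] leg23_closed[OF F_closed] leg23_closed[OF G_closed]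
      comul_left_closed[OF F_closed] comul_left_closed[OF G_closed] comul_right_closed[OF F_closed] comul_right_closed[OF G_closed]
    by simp_all
  have i: "?a' \<otimes>\<^bsub>tpow_alg 3 K\<^esub> ?a = \<one>\<^bsub>tpow_alg 3 K\<^esub>" "?b' \<otimes>\<^bsub>tpow_alg 3 K\<^esub> ?b = \<one>\<^bsub>tpow_alg 3 K\<^esub>"
    "?c \<otimes>\<^bsub>tpow_alg 3 K\<^esub> ?c' = \<one>\<^bsub>tpow_alg 3 K\<^esub>" "?d \<otimes>\<^bsub>tpow_alg 3 K\<^esub> ?d' = \<one>\<^bsub>tpow_alg 3 K\<^esub>"
    by (simp_all flip: leg_mult[OF F_closed G_closed] leg_mult[OF G_closed F_closed] add: FG GF leg_one)
  have co: "?a \<otimes>\<^bsub>tpow_alg 3 K\<^esub> ?b = ?c \<otimes>\<^bsub>tpow_alg 3 K\<^esub> ?d" using tw by (simp add: twist_def)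
  have "?b \<otimes>\<^bsub>tpow_alg 3 K\<^esub> ?d' = ?a' \<otimes>\<^bsub>tpow_alg 3 K\<^esub> ?a \<otimes>\<^bsub>tpow_alg 3 K\<^esub> ?b \<otimes>\<^bsub>tpow_alg 3 K\<^esub> ?d'" using i cl by simp
  also have "\<dots> = ?a' \<otimes>\<^bsub>tpow_alg 3 K\<^esub> (?a \<otimes>\<^bsub>tpow_alg 3 K\<^esub> ?b) \<otimes>\<^bsub>tpow_alg 3 K\<^esub> ?d'" by (simp only: T.m_assoc cl T.m_closed)
  also have "\<dots> = ?a' \<otimes>\<^bsub>tpow_alg 3 K\<^esub> ?c \<otimes>\<^bsub>tpow_alg 3 K\<^esub> (?d \<otimes>\<^bsub>tpow_alg 3 K\<^esub> ?d')" unfolding co by (simp only: T.m_assoc cl T.m_closed)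
  also have "\<dots> = ?a' \<otimes>\<^bsub>tpow_alg 3 K\<^esub> ?c" unfolding i by (simp only: T.r_one cl T.m_closed)
  finally show e: "?b \<otimes>\<^bsub>tpow_alg 3 K\<^esub> ?d' = ?a' \<otimes>\<^bsub>tpow_alg 3 K\<^esub> ?c" .
  have "?b' \<otimes>\<^bsub>tpow_alg 3 K\<^esub> ?a' = ?b' \<otimes>\<^bsub>tpow_alg 3 K\<^esub> (?a' \<otimes>\<^bsub>tpow_alg 3 K\<^esub> (?c \<otimes>\<^bsub>tpow_alg 3 K\<^esub> ?c'))" unfolding i by (simp only: T.r_one cl)
  also have "\<dots> = ?b' \<otimes>\<^bsub>tpow_alg 3 K\<^esub> ((?a' \<otimes>\<^bsub>tpow_alg 3 K\<^esub> ?c) \<otimes>\<^bsub>tpow_alg 3 K\<^esub> ?c')" by (simp only: T.m_assoc cl T.m_closed)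
  also have "\<dots> = (?b' \<otimes>\<^bsub>tpow_alg 3 K\<^esub> ?b) \<otimes>\<^bsub>tpow_alg 3 K\<^esub> (?d' \<otimes>\<^bsub>tpow_alg 3 K\<^esub> ?c')" unfolding e[symmetric] by (simp only: T.m_assoc cl T.m_closed)
  also have "\<dots> = ?d' \<otimes>\<^bsub>tpow_alg 3 K\<^esub> ?c'" unfolding i by (simp only: T.l_one cl T.m_closed)
  finally show "?b' \<otimes>\<^bsub>tpow_alg 3 K\<^esub> ?a' = ?d' \<otimes>\<^bsub>tpow_alg 3 K\<^esub> ?c'" .
qed

lemma cocycle_mixed:
  assumes f: "trilx f"
  shows "SF (\<lambda>a b. cop a (\<lambda>a1 a2. SG (\<lambda>c d. cop d (\<lambda>d1 d2. f (a1 \<star> c) (a2 \<star> d1) (b \<star> d2)))))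
    = SG (\<lambda>a b. SF (\<lambda>c d. f a (b \<star> c) d))"
proof -
  note t = trilx_mul[OF f]
  have t2: "trilx (\<lambda>a b c. ev3 K U (\<lambda>x y z. f (a \<star> x) (b \<star> y) (c \<star> z)))" for U
    by (rule trilx_ev3) (rule trilx_mul'[OF f])
  have "SF (\<lambda>a b. cop a (\<lambda>a1 a2. SG (\<lambda>c d. cop d (\<lambda>d1 d2. f (a1 \<star> c) (a2 \<star> d1) (b \<star> d2)))))
     = ev3 K (comul_left K F \<otimes>\<^bsub>tpow_alg 3 K\<^esub> comul_right K G) f"
    by (simp only: ev3_mul[OF comul_left_closed[OF F_closed] comul_right_closed[OF G_closed] f],
        simp only: ev3_comul_left[OF F_closed t2], simp only: ev3_comul_right[OF G_closed t])
  also have "\<dots> = SG (\<lambda>a b. SF (\<lambda>c d. f (a \<star> \<^bold>1) (b \<star> c) (\<^bold>1 \<star> d)))"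
    by (simp only: cocycle_inverses ev3_mul[OF leg12_closed[OF G_closed] leg23_closed[OF F_closed] f],
        simp only: ev3_leg12[OF G_closed t2], simp only: ev3_leg23[OF F_closed t])
  also have "\<dots> = SG (\<lambda>a b. SF (\<lambda>c d. f a (b \<star> c) d))"
    by (intro ev2_cong[OF kmod G_closed] ev2_cong[OF kmod F_closed]) (simp add: mulx_one[OF alg])
  finally show ?thesis .
qed

lemma cocycle_inv:
  assumes f: "trilx f"
  shows "SG (\<lambda>a b. cop a (\<lambda>a1 a2. SG (\<lambda>c d. f (a1 \<star> c) (a2 \<star> d) b)))
    = SG (\<lambda>a b. cop b (\<lambda>b1 b2. SG (\<lambda>c d. f a (b1 \<star> c) (b2 \<star> d))))"
proof -
  note t = trilx_mul[OF f]
  have t2: "trilx (\<lambda>a b c. ev3 K U (\<lambda>x y z. f (a \<star> x) (b \<star> y) (c \<star> z)))" for U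
    by (rule trilx_ev3) (rule trilx_mul'[OF f])
  have "SG (\<lambda>a b. cop a (\<lambda>a1 a2. SG (\<lambda>c d. f (a1 \<star> c) (a2 \<star> d) (b \<star> \<^bold>1))))
     = ev3 K (comul_left K G \<otimes>\<^bsub>tpow_alg 3 K\<^esub> leg12 K G) f"
    by (simp only: ev3_mul[OF comul_left_closed[OF G_closed] leg12_closed[OF G_closed] f],
        simp only: ev3_comul_left[OF G_closed t2], simp only: ev3_leg12[OF G_closed t])
  also have "\<dots> = SG (\<lambda>a b. cop b (\<lambda>b1 b2. SG (\<lambda>c d. f (a \<star> \<^bold>1) (b1 \<star> c) (b2 \<star> d))))"
    by (simp only: cocycle_inverses ev3_mul[OF comul_right_closed[OF G_closed] leg23_closed[OF G_closed] f],
        simp only: ev3_comul_right[OF G_closed t2], simp only: ev3_leg23[OF G_closed t])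
  finally have e: "SG (\<lambda>a b. cop a (\<lambda>a1 a2. SG (\<lambda>c d. f (a1 \<star> c) (a2 \<star> d) (b \<star> \<^bold>1))))
     = SG (\<lambda>a b. cop b (\<lambda>b1 b2. SG (\<lambda>c d. f (a \<star> \<^bold>1) (b1 \<star> c) (b2 \<star> d))))" .
  have "SG (\<lambda>a b. cop a (\<lambda>a1 a2. SG (\<lambda>c d. f (a1 \<star> c) (a2 \<star> d) b)))
     = SG (\<lambda>a b. cop a (\<lambda>a1 a2. SG (\<lambda>c d. f (a1 \<star> c) (a2 \<star> d) (b \<star> \<^bold>1))))"
    by (intro ev2_cong[OF kmod G_closed]) (simp add: mulx_one[OF alg])
  also note e
  also have "SG (\<lambda>a b. cop b (\<lambda>b1 b2. SG (\<lambda>c d. f (a \<star> \<^bold>1) (b1 \<star> c) (b2 \<star> d))))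
     = SG (\<lambda>a b. cop b (\<lambda>b1 b2. SG (\<lambda>c d. f a (b1 \<star> c) (b2 \<star> d))))"
    by (intro ev2_cong[OF kmod G_closed]) (simp add: mulx_one[OF alg])
  finally show ?thesis .
qed

end

section \<open>The tensor algebra of a module\<close>

definition actx :: "('k::comm_ring_1, 'a, 'x) module_scheme \<Rightarrow> ('k, 'v, 'a, 'y) hmod_scheme
    \<Rightarrow> ('k, 'a) uvec \<Rightarrow> ('k, 'v) uvec \<Rightarrow> ('k, 'v) uvec" where
  "actx K V h v = emb V (act V (prj K h) (prj V v))"

lemma bilin_total:
  assumes M: "kmodule M" and N: "kmodule N" and P: "kmodule P" and b: "bilin M N P b"
  shows "bilx (\<lambda>x y. emb P (b (prj M x) (prj N y)))"
    and "x \<in> carrier M \<Longrightarrow> y \<in> carrier N \<Longrightarrow> b x y \<in> carrier P"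
proof -
  have cl: "x \<in> carrier M \<Longrightarrow> y \<in> carrier N \<Longrightarrow> b x y \<in> carrier P" for x y
    using b unfolding bilin_def lin_def by blast
  then show "x \<in> carrier M \<Longrightarrow> y \<in> carrier N \<Longrightarrow> b x y \<in> carrier P" .
  have l: "lin N P (b (prj M x))" "lin M P (\<lambda>x. b x (prj N y))" for x y
    using b prj_closed[OF M, of x] prj_closed[OF N, of y] unfolding bilin_def by blast+
  note c = cl[OF prj_closed[OF M] prj_closed[OF N]]
  have "linx (\<lambda>y. emb P (b (prj M x) (prj N y)))" for x
    using l(1)[of x] unfolding lin_def
    by (intro linxI) (simp_all add: prj_add[OF N] prj_usc[OF N] prj_closed[OF N] emb_add[OF P] emb_smult[OF P] c)
  moreover have "linx (\<lambda>x. emb P (b (prj M x) (prj N y)))" for y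
    using l(2)[of y] unfolding lin_def
    by (intro linxI) (simp_all add: prj_add[OF M] prj_usc[OF M] prj_closed[OF M] emb_add[OF P] emb_smult[OF P] c)
  ultimately show "bilx (\<lambda>x y. emb P (b (prj M x) (prj N y)))" unfolding bilx_def by blast
qed

text \<open>A module with an action and a bilinear bracket. The hypotheses hold for \<open>\<gg>\<close> over \<open>K\<close> and
  for \<open>\<gg>\<^sub>F\<close> over \<open>K\<^sub>F\<close>, so the tensor algebra with its action, and later its quotient, are
  constructed once for both. \<open>gen\<close> is the inclusion of \<open>\<gg>\<close> as the words of length one.\<close>

locale gmod = prebialg K for K :: "('k::comm_ring_1, 'a) coalg" +
  fixes g :: "('k, 'v, 'a) blie"
  assumes Kg: "K_module K g" and brg: "bilin g g g (bracket g)"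
begin

lemma gmod: "kmodule g" using Kg by (simp add: K_module_def)

abbreviation actg (infixr \<open>\<rhd>\<close> 76) where "h \<rhd> v \<equiv> actx K g h v"
definition br where "br u v = emb g (bracket g (prj g u) (prj g v))"
abbreviation T where "T \<equiv> tensor_alg g"
abbreviation mulT (infixl \<open>\<otimes>\<otimes>\<close> 70) where "x \<otimes>\<otimes> y \<equiv> mulx T x y"
abbreviation oneT where "oneT \<equiv> emb T \<one>\<^bsub>T\<^esub>"
definition gen where "gen v = emb T (pure UNIV g [prj g v])"

lemma act_bil:
  "(h + h') \<rhd> v = h \<rhd> v + h' \<rhd> v" "h \<rhd> (v + v') = h \<rhd> v + h \<rhd> v'" "(c \<bullet> h) \<rhd> v = c \<bullet> h \<rhd> v" "h \<rhd> (c \<bullet> v) = c \<bullet> h \<rhd> v"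
proof -
  have "bilin K g g (act g)" using Kg by (simp add: K_module_def)
  then have "bilx (actx K g)" unfolding actx_def[abs_def] by (rule bilin_total(1)[OF kmod gmod gmod])
  note b = bilxD[OF this]
  show "(h + h') \<rhd> v = h \<rhd> v + h' \<rhd> v" "h \<rhd> (v + v') = h \<rhd> v + h \<rhd> v'"
    "(c \<bullet> h) \<rhd> v = c \<bullet> h \<rhd> v" "h \<rhd> (c \<bullet> v) = c \<bullet> h \<rhd> v"
    by (rule b)+
qed

lemma act_closed: "h \<in> carrier K \<Longrightarrow> v \<in> carrier g \<Longrightarrow> act g h v \<in> carrier g"
proof -
  have "bilin K g g (act g)" using Kg by (simp add: K_module_def)
  from bilin_total(2)[OF kmod gmod gmod this]
  show "h \<in> carrier K \<Longrightarrow> v \<in> carrier g \<Longrightarrow> act g h v \<in> carrier g" .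
qed

lemma act_pp [simp]: "pp K h \<rhd> v = h \<rhd> v" "h \<rhd> pp g v = h \<rhd> v" "pp g (h \<rhd> v) = h \<rhd> v"
  by (simp_all add: actx_def prj_emb[OF kmod] prj_emb[OF gmod] prj_closed[OF kmod] prj_closed[OF gmod] act_closed)

lemma act_mul: "(h \<star> k) \<rhd> v = h \<rhd> k \<rhd> v"
  using Kg by (simp add: actx_def prj_mulx[OF alg] prj_closed kmod gmod act_closed K_module_def prj_emb)

lemma act_one: "\<^bold>1 \<rhd> v = pp g v"
  using Kg by (simp add: actx_def prj_emb one_closed prj_closed kmod gmod K_module_def)

lemma act_emb: "h \<in> carrier K \<Longrightarrow> v \<in> carrier g \<Longrightarrow> emb g (act g h v) = emb K h \<rhd> emb g v"
  by (simp add: actx_def prj_emb kmod gmod)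

lemma br_bil: "br (u + u') v = br u v + br u' v" "br u (v + v') = br u v + br u v'"
  "br (c \<bullet> u) v = c \<bullet> br u v" "br u (c \<bullet> v) = c \<bullet> br u v"
proof -
  have "bilx br" unfolding br_def[abs_def] by (rule bilin_total(1)[OF gmod gmod gmod brg])
  note b = bilxD[OF this]
  show "br (u + u') v = br u v + br u' v" "br u (v + v') = br u v + br u v'"
    "br (c \<bullet> u) v = c \<bullet> br u v" "br u (c \<bullet> v) = c \<bullet> br u v"
    by (rule b)+
qed

lemma br_closed: "u \<in> carrier g \<Longrightarrow> v \<in> carrier g \<Longrightarrow> bracket g u v \<in> carrier g"
  by (rule bilin_total(2)[OF gmod gmod gmod brg])

lemma br_pp [simp]: "br (pp g u) v = br u v" "br u (pp g v) = br u v" "pp g (br u v) = br u v"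
  by (simp_all add: br_def prj_emb prj_closed gmod br_closed)

lemma br_emb: "u \<in> carrier g \<Longrightarrow> v \<in> carrier g \<Longrightarrow> emb g (bracket g u v) = br (emb g u) (emb g v)"
  by (simp add: br_def prj_emb gmod)

lemma Talg: "assoc_algebra T" by (rule tensor_algebra[OF gmod])
lemma Tmod: "kmodule T" by (rule algebra_module[OF Talg])

lemma carrier_T [simp]: "carrier T = carrier (tspace UNIV g)" by (simp add: tensor_alg_def)

lemma emb_T: "emb (tspace UNIV g) = emb T" "prj (tspace UNIV g) = prj T"
  by (intro ext emb_cong[THEN fun_cong]; simp add: tensor_alg_def)+

lemma oneT_closed: "\<one>\<^bsub>T\<^esub> \<in> carrier T"
proof -
  interpret ring T using Talg by (simp add: assoc_algebra_def)
  show ?thesis by (rule one_closed)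
qed

lemma pp_oneT [simp]: "pp T oneT = oneT"
  using oneT_closed by (simp add: prj_emb[OF Tmod] del: carrier_T)

lemma pure_closed_T: "set w \<subseteq> carrier g \<Longrightarrow> pure UNIV g w \<in> carrier (tspace UNIV g)"
  by (rule pure_closed) (simp add: words_def)

lemma pp_gen [simp]: "pp T (gen v) = gen v" "gen (pp g v) = gen v"
  by (simp_all add: gen_def prj_emb Tmod gmod pure_closed_T prj_closed)

lemma linx_gen: "linx gen"
proof -
  note m = mlin_emb_pure[OF gmod, of UNIV, unfolded mlin_def emb_T, rule_format, of "[]" _ "[]", simplified]
  show ?thesis unfolding linx_def gen_def
    by (simp add: prj_add[OF gmod] prj_usc[OF gmod] m words_def prj_closed[OF gmod])
qed

lemma gen_lin: "gen (u + v) = gen u + gen v" "gen (c \<bullet> v) = c \<bullet> gen v"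
  using linx_gen by (simp_all add: linx_def)

lemma gen_emb: "v \<in> carrier g \<Longrightarrow> gen (emb g v) = emb T (pure UNIV g [v])"
  by (simp add: gen_def prj_emb gmod)

lemma mult_T: "S \<otimes>\<^bsub>T\<^esub> U = mulw UNIV g (@) S U"
  by (simp add: tensor_alg_eq)

lemma tev_mulT:
  assumes "S \<in> carrier (tspace UNIV g)" "U \<in> carrier (tspace UNIV g)" "mlin UNIV g f"
  shows "tev (S \<otimes>\<^bsub>T\<^esub> U) f = tev S (\<lambda>x. tev U (\<lambda>y. f (x @ y)))"
  unfolding mult_T by (rule tev_mulw[OF gmod wlin_append assms])

lemma mlin_append: "set x \<subseteq> carrier g \<Longrightarrow> mlin UNIV g f \<Longrightarrow> mlin UNIV g (\<lambda>y. f (x @ y))"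
  and mlin_append': "set x \<subseteq> carrier g \<Longrightarrow> mlin UNIV g f \<Longrightarrow> mlin UNIV g (\<lambda>y. f (y @ x))"
  using mlin_wlin[OF gmod _ wlin_append(1)] mlin_wlin[OF gmod _ wlin_append(2)] by (simp_all add: words_def)

lemma tev_gen_mul:
  assumes f: "mlin UNIV g f"
  shows "tev (prj T (gen v \<otimes>\<otimes> t)) f = tev (prj T t) (\<lambda>y. f (prj g v # y))"
proof -
  have c: "prj T t \<in> carrier (tspace UNIV g)" using prj_closed[OF Tmod] by simp
  have m: "mlin UNIV g (\<lambda>x. tev (prj T t) (\<lambda>y. f (x @ y)))"
    by (rule mlin_tev[OF gmod c gmod]) (rule mlin_append'[OF _ f], simp add: words_def)
  have "prj T (gen v) = pure UNIV g [prj g v]"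
    by (simp add: gen_def prj_emb Tmod pure_closed_T prj_closed gmod)
  then show ?thesis
    by (simp add: prj_mulx[OF Talg] tev_mulT pure_closed_T prj_closed gmod c f tev_pure[OF m])
qed

lemma tev_oneT: "mlin UNIV g f \<Longrightarrow> tev (prj T oneT) f = f []"
proof -
  have "prj T oneT = pure UNIV g []"
    unfolding prj_emb[OF Tmod oneT_closed] by (simp add: tensor_alg_def)
  then show "mlin UNIV g f \<Longrightarrow> tev (prj T oneT) f = f []" by simp
qed

lemma linx_tevT: "mlin UNIV g f \<Longrightarrow> linx (\<lambda>z. tev (prj T z) f)"
  using linx_tev_prj[of UNIV g f] by (simp add: emb_T)

lemma tev_T_pure: "tev (prj T x) (\<lambda>w. emb T (pure UNIV g w)) = pp T x"
  using tev_emb_pure[OF gmod, of "prj T x" UNIV] prj_closed[OF Tmod] by (simp add: emb_T)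

lemma pure_Cons: "u \<in> carrier g \<Longrightarrow> set w \<subseteq> carrier g \<Longrightarrow>
  emb T (pure UNIV g (u # w)) = gen (emb g u) \<otimes>\<otimes> emb T (pure UNIV g w)"
proof -
  assume u: "u \<in> carrier g" and w: "set w \<subseteq> carrier g"
  note m = mlin_emb_pure[OF gmod, of UNIV, unfolded emb_T]
  have "gen (emb g u) \<otimes>\<otimes> emb T (pure UNIV g w) = tev (prj T (gen (emb g u) \<otimes>\<otimes> emb T (pure UNIV g w))) (\<lambda>w. emb T (pure UNIV g w))"
    by (simp add: tev_T_pure mulx_pp[OF Talg])
  also have "\<dots> = tev (pure UNIV g w) (\<lambda>y. emb T (pure UNIV g (u # y)))"
    by (simp add: tev_gen_mul[OF m] prj_emb gmod Tmod u w pure_closed_T)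
  also have "\<dots> = emb T (pure UNIV g (u # w))"
    by (rule tev_pure) (use mlin_append[of "[u]", OF _ m] u in simp)
  finally show ?thesis ..
qed

text \<open>Words are obtained from the empty word by multiplying with letters from the left.\<close>

lemma T_induct [consumes 0, case_names add scale one gen]:
  assumes "\<And>x y. P x \<Longrightarrow> P y \<Longrightarrow> P (x + y)" "\<And>c x. P x \<Longrightarrow> P (c \<bullet> x)" "P oneT"
    "\<And>v t. P t \<Longrightarrow> pp T t = t \<Longrightarrow> P (gen v \<otimes>\<otimes> t)"
  shows "P (pp T x)"
proof -
  have w: "P (emb T (pure UNIV g w)) \<and> pure UNIV g w \<in> carrier T" if "set w \<subseteq> carrier g" for w
    using that
  proof (induction w)
    case Nil
    then show ?case using assms(3) pure_closed_T[of "[]"] by (simp add: tensor_alg_def)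
  next
    case (Cons u w)
    then show ?case using pure_closed_T[of "u # w"]
      by (simp add: pure_Cons) (intro assms(4), auto simp: prj_emb[OF Tmod])
  qed
  have z: "P 0" using assms(2)[OF assms(3), of 0] by simp
  let ?r = "SOME y. y \<in> prj T x"
  have k: "Poly_Mapping.keys ?r \<subseteq> words UNIV g"
    by (rule keys_SOME[OF gmod]) (use prj_closed[OF Tmod] in simp)
  have "P (\<Sum>w\<in>A. Poly_Mapping.lookup ?r w \<bullet> emb T (pure UNIV g w))" if "finite A" "A \<subseteq> words UNIV g" for A
    using that by (induction A rule: finite_induct) (auto simp: z words_def intro!: assms(1,2) w[THEN conjunct1])
  from this[OF _ k] show ?thesis
    unfolding tev_T_pure[symmetric] by (simp add: tev_def ev_def)
qed

lemma T_linear_eq: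
  assumes f: "linx f" and h: "linx h" and "f oneT = h oneT"
    and "\<And>v t. f t = h t \<Longrightarrow> pp T t = t \<Longrightarrow> f (gen v \<otimes>\<otimes> t) = h (gen v \<otimes>\<otimes> t)"
  shows "f (pp T x) = h (pp T x)"
  by (rule T_induct) (simp_all add: assms linx_simps[OF f] linx_simps[OF h])

text \<open>Linear maps out of the tensor algebra are defined by recursion on words: \<open>recT f z\<close>
  sends \<open>1\<close> to \<open>z\<close> and \<open>v t\<close> to \<open>f v\<close> applied to the value at \<open>t\<close>. Since \<open>f\<close> is bilinear,
  the function on words is multilinear, and no compatibility has to be checked.\<close>

definition foldw :: "(('k, 'v) uvec \<Rightarrow> ('k, 'n) uvec \<Rightarrow> ('k, 'n) uvec) \<Rightarrow> ('k, 'n) uvec \<Rightarrow> 'v list \<Rightarrow> ('k, 'n) uvec" where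
  "foldw f z w = foldr (\<lambda>u y. f (emb g u) y) w z"

lemma mlin_foldw:
  assumes f: "bilx f" shows "mlin UNIV g (foldw f z)"
proof -
  have "foldw f z (xs @ (u \<oplus>\<^bsub>g\<^esub> v) # ys) = foldw f z (xs @ u # ys) + foldw f z (xs @ v # ys)"
    if "u \<in> carrier g" "v \<in> carrier g" for xs ys u v
    using that by (induction xs) (simp_all add: foldw_def emb_add[OF gmod] bilxD[OF f])
  moreover have "foldw f z (xs @ (c \<odot>\<^bsub>g\<^esub> u) # ys) = c \<bullet> foldw f z (xs @ u # ys)"
    if "u \<in> carrier g" for xs ys u c
    using that by (induction xs) (simp_all add: foldw_def emb_smult[OF gmod] bilxD[OF f])
  ultimately show ?thesis by (simp add: mlin_def words_def)
qed

definition recT :: "(('k, 'v) uvec \<Rightarrow> ('k, 'n) uvec \<Rightarrow> ('k, 'n) uvec) \<Rightarrow> ('k, 'n) uvec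
    \<Rightarrow> ('k, ('k, 'v) tens) uvec \<Rightarrow> ('k, 'n) uvec" where
  "recT f z x = tev (prj T x) (foldw f z)"

lemma recT:
  assumes f: "bilx f"
  shows "linx (recT f z)" "recT f z oneT = z" "recT f z (gen v \<otimes>\<otimes> t) = f (pp g v) (recT f z t)" "recT f z (pp T x) = recT f z x"
proof -
  note m = mlin_foldw[OF f]
  have fv: "linx (f (pp g v))" using f by (simp add: bilx_def)
  show "linx (recT f z)" unfolding recT_def by (rule linx_tevT[OF m])
  show "recT f z oneT = z" unfolding recT_def tev_oneT[OF m] by (simp add: foldw_def)
  show "recT f z (gen v \<otimes>\<otimes> t) = f (pp g v) (recT f z t)"
    unfolding recT_def tev_gen_mul[OF m] tev_linx[OF fv] by (simp add: foldw_def)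
  show "recT f z (pp T x) = recT f z x" by (simp add: recT_def prj_emb[OF Tmod] prj_closed[OF Tmod] del: carrier_T)
qed

definition wact :: "'v list \<Rightarrow> ('k, 'a) uvec \<Rightarrow> ('k, ('k, 'v) tens) uvec" where
  "wact w h = emb T (word_act K g w (prj K h))"

text \<open>\<open>word_act\<close> sums over the coproduct of its argument, which makes sense only once the
  action of the tail is known to be linear in that argument; hence closedness, linearity
  and the recursion equation are proved by one induction.\<close>

lemma word_act:
  assumes "set w \<subseteq> carrier g"
  shows "(\<forall>k\<in>carrier K. word_act K g w k \<in> carrier T) \<and> linx (wact w)"
    "u \<in> carrier g \<Longrightarrow> wact (u # w) h = cop h (\<lambda>a b. gen (a \<rhd> emb g u) \<otimes>\<otimes> wact w b)"
proof -
  have step: "(\<forall>k\<in>carrier K. word_act K g (u # w) k \<in> carrier T) \<and>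
     (\<forall>h. wact (u # w) h = cop h (\<lambda>a b. gen (a \<rhd> emb g u) \<otimes>\<otimes> wact w b)) \<and>
     linx (wact (u # w))"
    if u: "u \<in> carrier g" and cl: "\<forall>k\<in>carrier K. word_act K g w k \<in> carrier T" and l: "linx (wact w)" for u w
  proof -
    have B: "bilx (\<lambda>a b. gen (a \<rhd> emb g u) \<otimes>\<otimes> wact w b)"
      by (simp add: bilx_def linx_def act_bil gen_lin mulx_bil[OF Talg] linx_simps[OF l])
    have e: "emb T (word_act K g w y) = wact w (emb K y)" if "y \<in> carrier K" for y
      by (simp add: wact_def prj_emb[OF kmod that])
    interpret r: ring T using Talg by (simp add: assoc_algebra_def)
    have b: "pure UNIV g [act g x u] \<otimes>\<^bsub>T\<^esub> word_act K g w y \<in> carrier T \<and>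
        emb T (pure UNIV g [act g x u] \<otimes>\<^bsub>T\<^esub> word_act K g w y) = gen (emb K x \<rhd> emb g u) \<otimes>\<otimes> wact w (emb K y)"
      if x: "x \<in> carrier K" and y: "y \<in> carrier K" for x y
    proof
      have c: "pure UNIV g [act g x u] \<in> carrier T" using pure_closed_T[of "[act g x u]"] act_closed[OF x u] by simp
      have c': "word_act K g w y \<in> carrier T" using cl y by blast
      show "pure UNIV g [act g x u] \<otimes>\<^bsub>T\<^esub> word_act K g w y \<in> carrier T" by (rule r.m_closed[OF c c'])
      show "emb T (pure UNIV g [act g x u] \<otimes>\<^bsub>T\<^esub> word_act K g w y) = gen (emb K x \<rhd> emb g u) \<otimes>\<otimes> wact w (emb K y)"
        unfolding emb_mult[OF Talg c c'] e[OF y] act_emb[OF x u, symmetric] gen_emb[OF act_closed[OF x u]] ..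
    qed
    have c: "word_act K g (u # w) k \<in> carrier T" if k: "k \<in> carrier K" for k
      unfolding word_act.simps by (rule tlift2(1)[OF kmod Tmod com_closed'[OF k] B]) (use b in \<open>simp only: nth_Cons_0 nth_Cons_Suc One_nat_def\<close>)
    have w: "wact (u # w) h = cop h (\<lambda>a b. gen (a \<rhd> emb g u) \<otimes>\<otimes> wact w b)" for h
      unfolding wact_def[of "u # w"] word_act.simps cop_def
      by (rule tlift2(2)[OF kmod Tmod com_closed B]) (use b in \<open>simp only: nth_Cons_0 nth_Cons_Suc One_nat_def\<close>)
    have "linx (wact (u # w))"
    proof (rule linxI)
      show "wact (u # w) (x + y) = wact (u # w) x + wact (u # w) y" for x y
        unfolding w by (rule cop_lin(1)[OF B])
      show "wact (u # w) (c \<bullet> x) = c \<bullet> wact (u # w) x" for c x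
        unfolding w by (rule cop_lin(2)[OF B])
    qed
    then show ?thesis by (intro conjI ballI allI c w)
  qed
  have nil: "(\<forall>k\<in>carrier K. word_act K g [] k \<in> carrier T) \<and> linx (wact [])"
  proof -
    have "wact [] h = eps h \<bullet> oneT" for h
      using emb_smult[OF Tmod oneT_closed] by (simp add: wact_def eps_def)
    then show ?thesis using module_simps(2)[OF Tmod oneT_closed] by (simp add: linx_def Kbil del: carrier_T)
  qed
  show 1: "(\<forall>k\<in>carrier K. word_act K g w k \<in> carrier T) \<and> linx (wact w)"
    using assms
  proof (induction w)
    case Nil show ?case by (rule nil)
  next
    case (Cons u w)
    then have "u \<in> carrier g" and w: "(\<forall>k\<in>carrier K. word_act K g w k \<in> carrier T) \<and> linx (wact w)" by simp_all
    note s = step[OF this(1) w[THEN conjunct1] w[THEN conjunct2]]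
    show ?case by (rule conjI[OF s[THEN conjunct1] s[THEN conjunct2, THEN conjunct2]])
  qed
  show "u \<in> carrier g \<Longrightarrow> wact (u # w) h = cop h (\<lambda>a b. gen (a \<rhd> emb g u) \<otimes>\<otimes> wact w b)"
    by (rule step[OF _ 1[THEN conjunct1] 1[THEN conjunct2], THEN conjunct2, THEN conjunct1, rule_format])
qed

lemma wact_Nil: "wact [] h = eps h \<bullet> oneT"
  using emb_smult[OF Tmod oneT_closed] by (simp add: wact_def eps_def)

lemma mlin_wact: "mlin UNIV g (\<lambda>w. wact w h)"
proof -
  have "wact (xs @ (u \<oplus>\<^bsub>g\<^esub> v) # ys) h = wact (xs @ u # ys) h + wact (xs @ v # ys) h \<and>
    wact (xs @ (c \<odot>\<^bsub>g\<^esub> u) # ys) h = c \<bullet> wact (xs @ u # ys) h"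
    if "u \<in> carrier g" "v \<in> carrier g" "set xs \<subseteq> carrier g" "set ys \<subseteq> carrier g" for xs ys u v c
    using that(3)
  proof (induction xs arbitrary: h)
    case Nil
    then show ?case using that
      by (simp add: word_act(2) module_simps[OF gmod] emb_add[OF gmod] emb_smult[OF gmod] act_bil gen_lin
          mulx_bil[OF Talg] cop_fun)
  next
    case (Cons x xs)
    then show ?case using that
      by (simp add: word_act(2) module_simps[OF gmod] mulx_bil[OF Talg] cop_fun)
  qed
  note * = this
  show ?thesis unfolding mlin_def
  proof (intro allI impI conjI ballI)
    fix xs u ys v c assume "xs @ u # ys \<in> words UNIV g"
    then have w: "u \<in> carrier g" "set xs \<subseteq> carrier g" "set ys \<subseteq> carrier g" by (simp_all add: words_def)
    show "wact (xs @ (c \<odot>\<^bsub>g\<^esub> u) # ys) h = c \<bullet> wact (xs @ u # ys) h"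
      using *[OF w(1,1,2,3)] by blast
    show "wact (xs @ (u \<oplus>\<^bsub>g\<^esub> v) # ys) h = wact (xs @ u # ys) h + wact (xs @ v # ys) h" if "v \<in> carrier g"
      using *[OF w(1) that w(2,3)] by blast
  qed
qed

definition actT :: "('k, 'a) uvec \<Rightarrow> ('k, ('k, 'v) tens) uvec \<Rightarrow> ('k, ('k, 'v) tens) uvec" where
  "actT h x = tev (prj T x) (\<lambda>w. wact w h)"

lemma actT_eq:
  assumes "x \<in> carrier T" "k \<in> carrier K"
  shows "tlift T (\<lambda>w. word_act K g w k) x \<in> carrier T"
    "emb T (tlift T (\<lambda>w. word_act K g w k) x) = actT (emb K k) (emb T x)"
proof -
  have c: "word_act K g w k \<in> carrier T" if "w \<in> words UNIV g" for w
    using word_act(1)[of w] that assms(2) by (simp add: words_def)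
  have x: "x \<in> carrier (tspace UNIV g)" using assms by simp
  have e: "emb T (word_act K g w k) = wact w (emb K k)" for w
    by (simp add: wact_def prj_emb[OF kmod assms(2)])
  note m = mlin_wact[of "emb K k", folded e]
  show "tlift T (\<lambda>w. word_act K g w k) x \<in> carrier T" by (rule emb_tlift(1)[OF gmod Tmod x c m])
  show "emb T (tlift T (\<lambda>w. word_act K g w k) x) = actT (emb K k) (emb T x)"
    unfolding actT_def prj_emb[OF Tmod assms(1)] e[symmetric] by (rule emb_tlift(2)[OF gmod Tmod x c m])
qed

lemma actT_bil: "actT (h + h') x = actT h x + actT h' x" "actT h (x + x') = actT h x + actT h x'"
  "actT (c \<bullet> h) x = c \<bullet> actT h x" "actT h (c \<bullet> x) = c \<bullet> actT h x"
proof -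
  have c: "prj T x \<in> carrier (tspace UNIV g)" using prj_closed[OF Tmod] by simp
  show "actT h (x + x') = actT h x + actT h x'" "actT h (c \<bullet> x) = c \<bullet> actT h x"
    using linx_tevT[OF mlin_wact, of h] by (simp_all add: actT_def linx_def)
  have l: "linx (wact w)" if "w \<in> words UNIV g" for w using word_act(1)[of w] that by (simp add: words_def)
  show "actT (h + h') x = actT h x + actT h' x" unfolding actT_def tev_plus[symmetric]
    by (rule tev_cong[OF gmod c]) (simp add: linx_add l)
  show "actT (c \<bullet> h) x = c \<bullet> actT h x" unfolding actT_def tev_usc[symmetric]
    by (rule tev_cong[OF gmod c]) (simp add: linx_scale l)
qed

lemma actT_one: "actT h oneT = eps h \<bullet> oneT"
  by (simp add: actT_def tev_oneT[OF mlin_wact] wact_Nil)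

lemma actT_gen: "actT h (gen v \<otimes>\<otimes> t) = cop h (\<lambda>a b. gen (a \<rhd> v) \<otimes>\<otimes> actT b t)"
proof -
  have c: "prj T t \<in> carrier (tspace UNIV g)" using prj_closed[OF Tmod] by simp
  have l: "linx (\<lambda>y. gen (a \<rhd> v) \<otimes>\<otimes> y)" for a by (simp add: linx_def mulx_bil[OF Talg])
  have "actT h (gen v \<otimes>\<otimes> t) = tev (prj T t) (\<lambda>y. cop h (\<lambda>a b. gen (a \<rhd> v) \<otimes>\<otimes> wact y b))"
    unfolding actT_def tev_gen_mul[OF mlin_wact]
    by (rule tev_cong[OF gmod c]) (simp add: word_act(2) prj_closed gmod words_def)
  also have "\<dots> = cop h (\<lambda>a b. tev (prj T t) (\<lambda>y. gen (a \<rhd> v) \<otimes>\<otimes> wact y b))"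
    unfolding cop_def ev2_def by (rule tev_swap)
  also have "\<dots> = cop h (\<lambda>a b. gen (a \<rhd> v) \<otimes>\<otimes> actT b t)"
    unfolding actT_def tev_linx[OF l] ..
  finally show ?thesis .
qed

lemma actT_pp [simp]: "actT (pp K h) x = actT h x" "actT h (pp T x) = actT h x" "pp T (actT h x) = actT h x"
proof -
  show "actT (pp K h) x = actT h x" by (simp add: actT_def wact_def prj_emb[OF kmod] prj_closed[OF kmod])
  show 1: "actT h (pp T x) = actT h x" by (simp add: actT_def prj_emb[OF Tmod] prj_closed[OF Tmod] del: carrier_T)
  have "pp T (actT h x) = tev (prj T x) (\<lambda>w. pp T (wact w h))"
    unfolding actT_def by (rule tev_linx[OF linx_emb_prj[OF Tmod]])
  also have "\<dots> = actT h x"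
    unfolding actT_def
  proof (rule tev_cong[OF gmod])
    show "prj T x \<in> carrier (tspace UNIV g)" using prj_closed[OF Tmod] by simp
    fix w assume "w \<in> words UNIV g"
    then have "word_act K g w (prj K h) \<in> carrier T"
      using word_act(1)[of w] prj_closed[OF kmod, of h] by (simp add: words_def)
    from prj_emb[OF Tmod this] show "pp T (wact w h) = wact w h" unfolding wact_def by (rule arg_cong)
  qed
  finally show "pp T (actT h x) = actT h x" .
qed

lemmas Tbil = Kbil act_bil br_bil gen_lin mulx_bil[OF Talg] actT_bil

end

section \<open>The tensor algebra as a module algebra\<close>

lemma ring_cong:
  fixes M :: "('m, 'x) ring_scheme" and N :: "('m, 'y) ring_scheme"
  assumes "carrier M = carrier N" "add M = add N" "ring.zero M = ring.zero N" "mult M = mult N" "one M = one N"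
  shows "ring M = ring N"
  unfolding ring_def ring_axioms_def Group.monoid_def assms abelian_group_cong[OF assms(1-3)] ..

context gmod
begin

lemma pullT:
  "x \<otimes>\<otimes> cop h f = cop h (\<lambda>a b. x \<otimes>\<otimes> f a b)" "cop h f \<otimes>\<otimes> x = cop h (\<lambda>a b. f a b \<otimes>\<otimes> x)"
  "actT k (cop h f) = cop h (\<lambda>a b. actT k (f a b))"
  "x \<otimes>\<otimes> ev2 M S f' = ev2 M S (\<lambda>a b. x \<otimes>\<otimes> f' a b)" "ev2 M S f' \<otimes>\<otimes> x = ev2 M S (\<lambda>a b. f' a b \<otimes>\<otimes> x)"
  "actT k (ev2 M S f') = ev2 M S (\<lambda>a b. actT k (f' a b))"
proof -
  have l: "linx (\<lambda>y. x \<otimes>\<otimes> y)" "linx (\<lambda>y. y \<otimes>\<otimes> x)" "linx (actT k)" for x k by (simp_all add: linx_def Tbil)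
  show "x \<otimes>\<otimes> cop h f = cop h (\<lambda>a b. x \<otimes>\<otimes> f a b)" by (rule cop_linx[OF l(1)])
  show "cop h f \<otimes>\<otimes> x = cop h (\<lambda>a b. f a b \<otimes>\<otimes> x)" by (rule cop_linx[OF l(2)])
  show "actT k (cop h f) = cop h (\<lambda>a b. actT k (f a b))" by (rule cop_linx[OF l(3)])
  show "x \<otimes>\<otimes> ev2 M S f' = ev2 M S (\<lambda>a b. x \<otimes>\<otimes> f' a b)" by (rule ev2_linx[OF l(1)])
  show "ev2 M S f' \<otimes>\<otimes> x = ev2 M S (\<lambda>a b. f' a b \<otimes>\<otimes> x)" by (rule ev2_linx[OF l(2)])
  show "actT k (ev2 M S f') = ev2 M S (\<lambda>a b. actT k (f' a b))" by (rule ev2_linx[OF l(3)])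
qed

lemma mulT_simps [simp]: "pp T x \<otimes>\<otimes> y = x \<otimes>\<otimes> y" "x \<otimes>\<otimes> pp T y = x \<otimes>\<otimes> y" "pp T (x \<otimes>\<otimes> y) = x \<otimes>\<otimes> y"
  "oneT \<otimes>\<otimes> x = pp T x" "x \<otimes>\<otimes> oneT = pp T x"
  by (simp_all add: mulx_pp[OF Talg] mulx_one[OF Talg])

lemma mulT_assoc: "(x \<otimes>\<otimes> y) \<otimes>\<otimes> z = x \<otimes>\<otimes> (y \<otimes>\<otimes> z)"
  by (rule mulx_assoc[OF Talg])

lemma pp_T: "pp T (x + y) = pp T x + pp T y" "pp T (c \<bullet> x) = c \<bullet> pp T x" "pp T (pp T x) = pp T x"
  by (simp_all add: pp_simps[OF Tmod] prj_emb[OF Tmod prj_closed[OF Tmod]])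

text \<open>Compatibility of the action with the product of the Hopf algebra uses only that the
  coproduct and the counit are multiplicative. They appear as hypotheses so that the lemma
  applies to \<open>K\<^sub>F\<close>, for which both are verified directly.\<close>

lemma actT_mul_if:
  assumes cop_mult: "\<And>h k. \<And>f :: _ \<Rightarrow> _ \<Rightarrow> ('k, ('k, 'v) tens) uvec. bilx f \<Longrightarrow>
      cop (h \<star> k) f = cop h (\<lambda>a b. cop k (\<lambda>c d. f (a \<star> c) (b \<star> d)))"
    and eps_mult: "\<And>h k. eps (h \<star> k) = eps h * eps k"
  shows "actT (h \<star> k) t = actT h (actT k t)"
proof -
  let ?P = "\<lambda>t. \<forall>h k. actT (h \<star> k) t = actT h (actT k t)"
  have "?P (pp T t)"
  proof (rule T_induct)
    show "?P (x + y)" if "?P x" "?P y" for x y using that by (simp add: Tbil)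
    show "?P (c \<bullet> x)" if "?P x" for c x using that by (simp add: Tbil)
    show "?P oneT" by (simp add: actT_one eps_mult Tbil)
    fix v s assume IH: "?P s"
    show "?P (gen v \<otimes>\<otimes> s)"
    proof (intro allI)
      fix h k
      have B: "bilx (\<lambda>a b. gen (a \<rhd> v) \<otimes>\<otimes> actT b s)" by (simp add: bilx_def linx_def Tbil)
      have "actT (h \<star> k) (gen v \<otimes>\<otimes> s) = cop h (\<lambda>a b. cop k (\<lambda>c d. gen (a \<rhd> c \<rhd> v) \<otimes>\<otimes> actT b (actT d s)))"
        by (simp add: actT_gen cop_mult[OF B] act_mul IH)
      also have "\<dots> = cop k (\<lambda>c d. cop h (\<lambda>a b. gen (a \<rhd> c \<rhd> v) \<otimes>\<otimes> actT b (actT d s)))"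
        by (rule cop_cop_swap)
      also have "\<dots> = actT h (actT k (gen v \<otimes>\<otimes> s))"
        by (simp add: actT_gen pullT)
      finally show "actT (h \<star> k) (gen v \<otimes>\<otimes> s) = actT h (actT k (gen v \<otimes>\<otimes> s))" .
    qed
  qed
  then show ?thesis by simp
qed

end

locale bgmod = bialg K + gmod K g for K :: "('k::comm_ring_1, 'a) coalg" and g :: "('k, 'v, 'a) blie"
begin

text \<open>Coassociativity makes the tensor algebra a module algebra: the recursion peels letters
  from the left, so \<open>\<Delta>\<close> has to be moved from the second factor to the first.\<close>

lemma actT_mulT: "actT h (s \<otimes>\<otimes> t) = cop h (\<lambda>a b. actT a s \<otimes>\<otimes> actT b t)"
proof -
  let ?P = "\<lambda>s. \<forall>h. actT h (s \<otimes>\<otimes> t) = cop h (\<lambda>a b. actT a s \<otimes>\<otimes> actT b t)"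
  have "?P (pp T s)"
  proof (rule T_induct)
    show "?P (x + y)" if "?P x" "?P y" for x y using that by (simp add: Tbil)
    show "?P (c \<bullet> x)" if "?P x" for c x using that by (simp add: Tbil)
    have l: "linx (\<lambda>b. actT b t)" by (simp add: linx_def Tbil)
    show "?P oneT"
      using counit_cop(1)[OF l] by (simp add: actT_one mulx_bil[OF Talg])
    fix v s assume IH: "?P s"
    show "?P (gen v \<otimes>\<otimes> s)"
    proof
      fix h
      have t: "trilx (\<lambda>a c d. gen (a \<rhd> v) \<otimes>\<otimes> (actT c s \<otimes>\<otimes> actT d t))" by (simp add: trilx_def linx_def Tbil)
      have "actT h (gen v \<otimes>\<otimes> s \<otimes>\<otimes> t) = cop h (\<lambda>a b. cop b (\<lambda>c d. gen (a \<rhd> v) \<otimes>\<otimes> (actT c s \<otimes>\<otimes> actT d t)))"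
        by (simp add: mulT_assoc actT_gen IH pullT)
      also have "\<dots> = cop h (\<lambda>x y. cop x (\<lambda>a b. gen (a \<rhd> v) \<otimes>\<otimes> (actT b s \<otimes>\<otimes> actT y t)))"
        by (rule coassoc[OF t, symmetric])
      also have "\<dots> = cop h (\<lambda>x y. actT x (gen v \<otimes>\<otimes> s) \<otimes>\<otimes> actT y t)"
        by (simp add: mulT_assoc actT_gen pullT)
      finally show "actT h (gen v \<otimes>\<otimes> s \<otimes>\<otimes> t) = cop h (\<lambda>x y. actT x (gen v \<otimes>\<otimes> s) \<otimes>\<otimes> actT y t)" .
    qed
  qed
  then show ?thesis by simp
qed

lemma actT_mul: "actT (h \<star> k) t = actT h (actT k t)"
  by (rule actT_mul_if[OF cop_mult eps_mult])

lemma actT_1: "actT \<^bold>1 t = pp T t"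
proof -
  have "actT \<^bold>1 (pp T t) = pp T (pp T t)"
  proof (rule T_linear_eq[where f = "actT \<^bold>1" and h = "\<lambda>x. pp T x"])
    show "linx (actT \<^bold>1)" by (simp add: linx_def Tbil)
    show "linx (\<lambda>x. pp T x)" by (rule linx_emb_prj[OF Tmod])
    show "actT \<^bold>1 oneT = pp T oneT" by (simp add: actT_one eps_one)
    fix v t assume IH: "actT \<^bold>1 t = pp T t"
    have B: "bilx (\<lambda>a b. gen (a \<rhd> v) \<otimes>\<otimes> actT b t)" by (simp add: bilx_def linx_def Tbil)
    show "actT \<^bold>1 (gen v \<otimes>\<otimes> t) = pp T (gen v \<otimes>\<otimes> t)"
      by (simp add: actT_gen cop_one[OF B] act_one IH)
  qed
  then show ?thesis by (simp add: pp_T)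
qed

end

section \<open>The enveloping algebra as a quotient\<close>

text \<open>The quotient of the tensor algebra by the relations, as an algebra. Like \<open>gmod\<close>, this
  locale is interpreted for both sets of data.\<close>

locale lied = gmod K g for K :: "('k::comm_ring_1, 'a) coalg" and g :: "('k, 'v, 'a) blie" +
  fixes R :: "('k, 'a) tens"
  assumes Rc: "R \<in> carrier (tspace {2} K)"
begin

text \<open>The defining relations, first as elements of \<open>uvec\<close>, then in the form of the definition
  of \<open>env_ideal\<close>. Lemma \<open>relc\<close> identifies them.\<close>

definition rel where
  "rel u v = gen u \<otimes>\<otimes> gen v - ev2 K R (\<lambda>a b. gen (b \<rhd> v) \<otimes>\<otimes> gen (a \<rhd> u)) - gen (br u v)"

definition relc where
  "relc u v = pure UNIV g [u, v]
        \<ominus>\<^bsub>T\<^esub> tlift T (\<lambda>r. pure UNIV g [act g (r!1) v, act g (r!0) u]) R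
        \<ominus>\<^bsub>T\<^esub> pure UNIV g [bracket g u v]"

abbreviation I where "I \<equiv> env_ideal R g"
abbreviation U where "U \<equiv> env_alg K R g"
abbreviation cls where "cls x \<equiv> env_class R g x"

lemma ringT: "ring T" using Talg by (simp add: assoc_algebra_def)

lemma relc:
  assumes u: "u \<in> carrier g" and v: "v \<in> carrier g"
  shows "relc u v \<in> carrier T" "emb T (relc u v) = rel (emb g u) (emb g v)"
proof -
  interpret ring T by (rule ringT)
  have p2: "emb T (pure UNIV g [x, y]) = gen (emb g x) \<otimes>\<otimes> gen (emb g y)" if "x \<in> carrier g" "y \<in> carrier g" for x y
    using that pure_Cons[of x "[y]"] by (simp add: gen_emb)
  have B: "bilx (\<lambda>a b. gen (b \<rhd> emb g v) \<otimes>\<otimes> gen (a \<rhd> emb g u))"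
    by (simp add: bilx_def linx_def Tbil)
  have b: "pure UNIV g [act g ([x, y]!1) v, act g ([x, y]!0) u] \<in> carrier T \<and>
     emb T (pure UNIV g [act g ([x, y]!1) v, act g ([x, y]!0) u]) = gen (emb K y \<rhd> emb g v) \<otimes>\<otimes> gen (emb K x \<rhd> emb g u)"
    if "x \<in> carrier K" "y \<in> carrier K" for x y
    using that u v by (simp add: p2 act_closed act_emb pure_closed_T)
  let ?t = "tlift T (\<lambda>r. pure UNIV g [act g (r!1) v, act g (r!0) u]) R"
  have t: "?t \<in> carrier T" "emb T ?t = ev2 K R (\<lambda>a b. gen (b \<rhd> emb g v) \<otimes>\<otimes> gen (a \<rhd> emb g u))"
    by (rule tlift2[OF kmod Tmod Rc B]; rule b; assumption)+
  have c: "pure UNIV g [u, v] \<in> carrier T" "pure UNIV g [bracket g u v] \<in> carrier T"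
    using u v pure_closed_T by (simp_all add: br_closed)
  show "relc u v \<in> carrier T" unfolding relc_def by (intro minus_closed c t(1))
  have "emb T (relc u v) = emb T (pure UNIV g [u, v])
      - emb T (tlift T (\<lambda>r. pure UNIV g [act g (r!1) v, act g (r!0) u]) R) - emb T (pure UNIV g [bracket g u v])"
    unfolding relc_def emb_diff[OF Tmod minus_closed[OF c(1) t(1)] c(2)] emb_diff[OF Tmod c(1) t(1)] ..
  then show "emb T (relc u v) = rel (emb g u) (emb g v)"
    unfolding t(2) rel_def p2[OF u v] br_emb[OF u v, symmetric] gen_emb[OF br_closed[OF u v]] .
qed

lemma I_def: "I = Idl\<^bsub>T\<^esub> {relc u v | u v. u \<in> carrier g \<and> v \<in> carrier g}"
  unfolding env_ideal_def relc_def ..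

lemma I_ideal: "ideal I T"
  unfolding I_def by (rule ring.genideal_ideal[OF ringT]) (auto intro: relc(1) simp del: carrier_T)

lemma relc_in_I: "u \<in> carrier g \<Longrightarrow> v \<in> carrier g \<Longrightarrow> relc u v \<in> I"
  unfolding I_def
  by (rule subsetD[OF ring.genideal_self[OF ringT]]) (auto intro: relc(1) simp del: carrier_T)

lemma I_smult: assumes i: "i \<in> I" shows "c \<odot>\<^bsub>T\<^esub> i \<in> I"
proof -
  interpret ideal I T by (rule I_ideal)
  have ic: "i \<in> carrier T" using i a_subset by blast
  have l: "lin T T (\<lambda>x. x \<otimes>\<^bsub>T\<^esub> i)" by (rule lin_mult(2)[OF Talg ic])
  have "c \<odot>\<^bsub>T\<^esub> i = (c \<odot>\<^bsub>T\<^esub> \<one>\<^bsub>T\<^esub>) \<otimes>\<^bsub>T\<^esub> i"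
    using l[unfolded lin_def, THEN conjunct2, THEN conjunct2, rule_format, OF oneT_closed, of c]
    unfolding l_one[OF ic] by (rule sym)
  moreover have "c \<odot>\<^bsub>T\<^esub> \<one>\<^bsub>T\<^esub> \<in> carrier T" by (rule module_simps(2)[OF Tmod oneT_closed])
  ultimately show ?thesis using I_l_closed[OF i, of "c \<odot>\<^bsub>T\<^esub> \<one>\<^bsub>T\<^esub>"] by (simp only:)
qed

lemma cls_eq: "x \<in> carrier T \<Longrightarrow> y \<in> carrier T \<Longrightarrow> cls x = cls y \<longleftrightarrow> x \<ominus>\<^bsub>T\<^esub> y \<in> I"
  using ring.quotient_eq_iff_same_a_r_cos[OF ringT I_ideal] by blast

lemma cls_mem: assumes x: "x \<in> carrier T" and y: "y \<in> cls x" shows "y \<in> carrier T" "cls y = cls x"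
proof -
  interpret ideal I T by (rule I_ideal)
  show "y \<in> carrier T" using y x a_r_coset_subset_G[OF a_subset x] by blast
  show "cls y = cls x" using a_repr_independence'[OF y x] by (rule sym)
qed

lemma cls_self: "x \<in> carrier T \<Longrightarrow> x \<in> cls x"
proof -
  interpret ideal I T by (rule I_ideal)
  show "x \<in> carrier T \<Longrightarrow> x \<in> cls x" by (rule a_rcos_self)
qed

lemma U_simps:
  "carrier U = {cls x | x. x \<in> carrier T}"
  "\<zero>\<^bsub>U\<^esub> = I" "\<one>\<^bsub>U\<^esub> = cls \<one>\<^bsub>T\<^esub>" "add U = add (T Quot I)" "mult U = mult (T Quot I)"
proof -
  show "carrier U = {cls x | x. x \<in> carrier T}"
    unfolding env_alg_def Let_def FactRing_def A_RCOSETS_def' by (simp del: carrier_T) blast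
qed (simp_all add: env_alg_def Let_def FactRing_def del: carrier_T)

lemma U_add: "x \<in> carrier T \<Longrightarrow> y \<in> carrier T \<Longrightarrow> cls x \<oplus>\<^bsub>U\<^esub> cls y = cls (x \<oplus>\<^bsub>T\<^esub> y)"
proof -
  interpret ideal I T by (rule I_ideal)
  show "x \<in> carrier T \<Longrightarrow> y \<in> carrier T \<Longrightarrow> cls x \<oplus>\<^bsub>U\<^esub> cls y = cls (x \<oplus>\<^bsub>T\<^esub> y)"
    unfolding U_simps FactRing_def by (simp add: a_rcos_sum del: carrier_T)
qed

lemma U_mult: "x \<in> carrier T \<Longrightarrow> y \<in> carrier T \<Longrightarrow> cls x \<otimes>\<^bsub>U\<^esub> cls y = cls (x \<otimes>\<^bsub>T\<^esub> y)"
proof -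
  interpret ideal I T by (rule I_ideal)
  show "x \<in> carrier T \<Longrightarrow> y \<in> carrier T \<Longrightarrow> cls x \<otimes>\<^bsub>U\<^esub> cls y = cls (x \<otimes>\<^bsub>T\<^esub> y)"
    unfolding U_simps FactRing_def by (simp add: rcoset_mult_add del: carrier_T)
qed

lemma T_diff_smult: "x \<in> carrier T \<Longrightarrow> y \<in> carrier T \<Longrightarrow> (c \<odot>\<^bsub>T\<^esub> x) \<ominus>\<^bsub>T\<^esub> (c \<odot>\<^bsub>T\<^esub> y) = c \<odot>\<^bsub>T\<^esub> (x \<ominus>\<^bsub>T\<^esub> y)"
proof -
  assume x: "x \<in> carrier T" and y: "y \<in> carrier T"
  interpret ring T by (rule ringT)
  note cl = minus_closed[OF x y] module_simps(2)[OF Tmod x, of c] module_simps(2)[OF Tmod y, of c]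
  have "emb T ((c \<odot>\<^bsub>T\<^esub> x) \<ominus>\<^bsub>T\<^esub> (c \<odot>\<^bsub>T\<^esub> y)) = emb T (c \<odot>\<^bsub>T\<^esub> (x \<ominus>\<^bsub>T\<^esub> y))"
    unfolding emb_diff[OF Tmod cl(2,3)] emb_smult[OF Tmod x] emb_smult[OF Tmod y] emb_smult[OF Tmod cl(1)]
      emb_diff[OF Tmod x y] by (simp add: uvec.scale_right_diff_distrib)
  then show ?thesis
    unfolding emb_eq_iff[OF Tmod minus_closed[OF cl(2,3)] module_simps(2)[OF Tmod cl(1), of c]] .
qed

lemma U_smult: assumes x: "x \<in> carrier T" shows "c \<odot>\<^bsub>U\<^esub> cls x = cls (c \<odot>\<^bsub>T\<^esub> x)"
proof -
  have "descend (\<lambda>x. cls (c \<odot>\<^bsub>T\<^esub> x)) (cls x) = cls (c \<odot>\<^bsub>T\<^esub> x)"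
  proof (rule descend_eq[OF cls_self[OF x]])
    fix y assume y: "y \<in> cls x"
    note m = cls_mem[OF x y]
    have "y \<ominus>\<^bsub>T\<^esub> x \<in> I" using cls_eq[OF m(1) x] m(2) by blast
    then have "(c \<odot>\<^bsub>T\<^esub> y) \<ominus>\<^bsub>T\<^esub> (c \<odot>\<^bsub>T\<^esub> x) \<in> I" unfolding T_diff_smult[OF m(1) x] by (rule I_smult)
    then show "cls (c \<odot>\<^bsub>T\<^esub> y) = cls (c \<odot>\<^bsub>T\<^esub> x)"
      using cls_eq[OF module_simps(2)[OF Tmod m(1)] module_simps(2)[OF Tmod x]] by blast
  qed
  then show ?thesis by (simp add: env_alg_def Let_def)
qed

lemma cls_closed: "x \<in> carrier T \<Longrightarrow> cls x \<in> carrier U"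
  unfolding U_simps by blast

lemma U_E: assumes "z \<in> carrier U" obtains x where "x \<in> carrier T" "z = cls x"
  using assms unfolding U_simps by blast

lemma ringU: "ring U"
proof -
  interpret ideal I T by (rule I_ideal)
  have "ring U = ring (T Quot I)"
    by (rule ring_cong) (simp_all add: env_alg_def Let_def)
  then show ?thesis using quotient_is_ring by simp
qed

lemma Umod: "kmodule U"
proof -
  note t = module_simps[OF Tmod]
  have 1: "a \<odot>\<^bsub>U\<^esub> z \<in> carrier U \<and> (a + b) \<odot>\<^bsub>U\<^esub> z = a \<odot>\<^bsub>U\<^esub> z \<oplus>\<^bsub>U\<^esub> b \<odot>\<^bsub>U\<^esub> z
      \<and> (a * b) \<odot>\<^bsub>U\<^esub> z = a \<odot>\<^bsub>U\<^esub> (b \<odot>\<^bsub>U\<^esub> z) \<and> 1 \<odot>\<^bsub>U\<^esub> z = z" if z: "z \<in> carrier U" for a b z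
  proof -
    obtain x where x: "x \<in> carrier T" "z = cls x" using z by (rule U_E)
    have m: "(a + b) \<odot>\<^bsub>T\<^esub> x = a \<odot>\<^bsub>T\<^esub> x \<oplus>\<^bsub>T\<^esub> b \<odot>\<^bsub>T\<^esub> x" "(a * b) \<odot>\<^bsub>T\<^esub> x = a \<odot>\<^bsub>T\<^esub> (b \<odot>\<^bsub>T\<^esub> x)" "1 \<odot>\<^bsub>T\<^esub> x = x"
      using Module.module.smult_l_distr[OF Tmod, of a b x] Module.module.smult_assoc1[OF Tmod, of a b x]
        Module.module.smult_one[OF Tmod, of x] x(1) by (simp_all del: carrier_T)
    show ?thesis unfolding x(2) U_smult[OF x(1)] U_smult[OF t(2)[OF x(1)]] U_add[OF t(2)[OF x(1)] t(2)[OF x(1)]] m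
      by (intro conjI refl cls_closed t(2) x(1))
  qed
  have 2: "a \<odot>\<^bsub>U\<^esub> (z \<oplus>\<^bsub>U\<^esub> w) = a \<odot>\<^bsub>U\<^esub> z \<oplus>\<^bsub>U\<^esub> a \<odot>\<^bsub>U\<^esub> w" if z: "z \<in> carrier U" and w: "w \<in> carrier U" for a z w
  proof -
    obtain x where x: "x \<in> carrier T" "z = cls x" using z by (rule U_E)
    obtain y where y: "y \<in> carrier T" "w = cls y" using w by (rule U_E)
    have m: "a \<odot>\<^bsub>T\<^esub> (x \<oplus>\<^bsub>T\<^esub> y) = a \<odot>\<^bsub>T\<^esub> x \<oplus>\<^bsub>T\<^esub> a \<odot>\<^bsub>T\<^esub> y" 
      using Module.module.smult_r_distr[OF Tmod, of a x y] x(1) y(1) by (simp del: carrier_T)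
    show ?thesis unfolding x(2) y(2) U_add[OF x(1) y(1)] U_smult[OF x(1)] U_smult[OF y(1)] U_smult[OF t(1)[OF x(1) y(1)]]
        U_add[OF t(2)[OF x(1)] t(2)[OF y(1)]] m ..
  qed
  have "abelian_group U" using ringU by (rule ring.axioms)
  moreover note 1[THEN conjunct1] 1[THEN conjunct2, THEN conjunct1]
    1[THEN conjunct2, THEN conjunct2, THEN conjunct1] 1[THEN conjunct2, THEN conjunct2, THEN conjunct2] 2
  ultimately show ?thesis unfolding module_scal_iff by (intro conjI allI ballI)
qed

lemma Ualg: "assoc_algebra U"
proof -
  interpret ring U by (rule ringU)
  interpret Tr: ring T by (rule ringT)
  have "(c \<odot>\<^bsub>U\<^esub> z) \<otimes>\<^bsub>U\<^esub> w = c \<odot>\<^bsub>U\<^esub> (z \<otimes>\<^bsub>U\<^esub> w) \<and> z \<otimes>\<^bsub>U\<^esub> (c \<odot>\<^bsub>U\<^esub> w) = c \<odot>\<^bsub>U\<^esub> (z \<otimes>\<^bsub>U\<^esub> w)"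
    if z: "z \<in> carrier U" and w: "w \<in> carrier U" for c z w
  proof -
    obtain x where x: "x \<in> carrier T" "z = cls x" using z by (rule U_E)
    obtain y where y: "y \<in> carrier T" "w = cls y" using w by (rule U_E)
    have m: "(c \<odot>\<^bsub>T\<^esub> x) \<otimes>\<^bsub>T\<^esub> y = c \<odot>\<^bsub>T\<^esub> (x \<otimes>\<^bsub>T\<^esub> y)" "x \<otimes>\<^bsub>T\<^esub> (c \<odot>\<^bsub>T\<^esub> y) = c \<odot>\<^bsub>T\<^esub> (x \<otimes>\<^bsub>T\<^esub> y)"
      using lin_mult(2)[OF Talg y(1)] lin_mult(1)[OF Talg x(1)] x(1) y(1) unfolding lin_def by simp_all
    note t = module_simps(2)[OF Tmod]
    show ?thesis unfolding x(2) y(2) U_mult[OF x(1) y(1)] U_smult[OF x(1)] U_smult[OF y(1)]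
        U_smult[OF Tr.m_closed[OF x(1) y(1)]] U_mult[OF t[OF x(1)] y(1)] U_mult[OF x(1) t[OF y(1)]] m by blast
  qed
  then have "bilin U U U (\<lambda>x y. x \<otimes>\<^bsub>U\<^esub> y)" unfolding bilin_def lin_def by (simp add: l_distr r_distr)
  then show ?thesis using Umod ringU by (simp add: assoc_algebra_def)
qed

abbreviation mulU (infixl \<open>\<odot>\<odot>\<close> 70) where "x \<odot>\<odot> y \<equiv> mulx U x y"
abbreviation oneU where "oneU \<equiv> emb U \<one>\<^bsub>U\<^esub>"

text \<open>The quotient map \<open>T(\<gg>) \<rightarrow> \<U>(\<gg>)\<close> on \<open>uvec\<close>. Statements about the ideal of relations are
  phrased below as \<open>q x = 0\<close>.\<close>

definition q where "q x = emb U (cls (prj T x))"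

lemma q_emb: "x \<in> carrier T \<Longrightarrow> q (emb T x) = emb U (cls x)"
  unfolding q_def by (simp only: prj_emb[OF Tmod])

lemma q_lin: "q (x + y) = q x + q y" "q (c \<bullet> x) = c \<bullet> q x"
  unfolding q_def prj_add[OF Tmod] prj_usc[OF Tmod] U_add[OF prj_closed[OF Tmod] prj_closed[OF Tmod], symmetric]
    U_smult[OF prj_closed[OF Tmod], symmetric]
  by (rule emb_add[OF Umod] emb_smult[OF Umod]; rule cls_closed[OF prj_closed[OF Tmod]])+

lemma linx_q: "linx q" by (simp add: linx_def q_lin)

lemma q_mul: "q (x \<otimes>\<otimes> y) = q x \<odot>\<odot> q y"
  unfolding q_def prj_mulx[OF Talg] U_mult[OF prj_closed[OF Tmod] prj_closed[OF Tmod], symmetric]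
  by (rule emb_mult[OF Ualg]; rule cls_closed[OF prj_closed[OF Tmod]])

lemma q_one: "q oneT = oneU"
  unfolding q_emb[OF oneT_closed] U_simps(3) ..

lemma q_pp [simp]: "q (pp T x) = q x" "pp U (q x) = q x"
  unfolding q_def by (simp_all only: prj_emb[OF Tmod prj_closed[OF Tmod]] prj_emb[OF Umod cls_closed[OF prj_closed[OF Tmod]]])

lemma q_surj: obtains x where "pp T x = x" "pp U z = q x"
proof -
  obtain t where t: "t \<in> carrier T" "prj U z = cls t" using prj_closed[OF Umod, of z] by (rule U_E)
  show thesis
    by (rule that[of "emb T t"]) (simp_all only: prj_emb[OF Tmod t(1)] q_emb[OF t(1)] t(2))
qed

lemma q_zero_iff: "q x = 0 \<longleftrightarrow> prj T x \<in> I"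
proof -
  interpret ideal I T by (rule I_ideal)
  note c = prj_closed[OF Tmod, of x]
  have zero: "0 = emb U I" using emb_zero[OF Umod] unfolding U_simps(2) by (rule sym)
  have Ic: "I \<in> carrier U" using module_simps(3)[OF Umod] unfolding U_simps(2) .
  have "q x = 0 \<longleftrightarrow> cls (prj T x) = I"
    unfolding q_def zero by (rule emb_eq_iff[OF Umod cls_closed[OF c] Ic])
  moreover have "prj T x \<in> I" if "cls (prj T x) = I" using cls_self[OF c] unfolding that .
  moreover have "cls (prj T x) = I" if "prj T x \<in> I" by (rule a_rcos_const[OF that])
  ultimately show ?thesis by blast
qed

lemma q_rel: "q (rel u v) = 0"
proof -
  have "rel (pp g u) (pp g v) = rel u v" by (simp add: rel_def)
  then have "rel u v = emb T (relc (prj g u) (prj g v))"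
    using relc(2)[OF prj_closed[OF gmod] prj_closed[OF gmod], of u v] by simp
  then have "prj T (rel u v) = relc (prj g u) (prj g v)"
    using prj_emb[OF Tmod relc(1)[OF prj_closed[OF gmod] prj_closed[OF gmod]], of u v] by simp
  then show ?thesis unfolding q_zero_iff
    using relc_in_I[OF prj_closed[OF gmod] prj_closed[OF gmod], of u v] by simp
qed

text \<open>The elements with a property closed under these operations form an ideal, which contains
  the ideal generated by the relations.\<close>

lemma q_zero_induct:
  assumes add: "\<And>x y. P x \<Longrightarrow> P y \<Longrightarrow> P (x + y)" and sc: "\<And>c x. P x \<Longrightarrow> P (c \<bullet> x)"
    and rel: "\<And>u v. P (rel u v)"
    and l: "\<And>x y. P x \<Longrightarrow> P (y \<otimes>\<otimes> x)" and r: "\<And>x y. P x \<Longrightarrow> P (x \<otimes>\<otimes> y)"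
    and q: "q x = 0"
  shows "P (pp T x)"
proof -
  interpret Tr: ring T by (rule ringT)
  have z: "P 0" using sc[OF rel, of 0] by simp
  have um: "P x \<Longrightarrow> P (- x)" for x using sc[of x "-1"] by simp
  let ?J = "{t \<in> carrier T. P (emb T t)}"
  have "subgroup ?J (add_monoid T)"
  proof (rule Tr.add.subgroupI)
    show "?J \<subseteq> carrier T" by blast
    show "?J \<noteq> {}" using Tr.zero_closed z emb_zero[OF Tmod] by (auto simp del: carrier_T)
    fix a b assume a: "a \<in> ?J"
    then have ac: "a \<in> carrier T" by blast
    show "\<ominus>\<^bsub>T\<^esub> a \<in> ?J" using a Tr.a_inv_closed[OF ac] um emb_uminus[OF Tmod ac] by (simp del: carrier_T)
    assume b: "b \<in> ?J"
    then have bc: "b \<in> carrier T" by blast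
    show "a \<oplus>\<^bsub>T\<^esub> b \<in> ?J" using a b Tr.a_closed[OF ac bc] add emb_add[OF Tmod ac bc] by (simp del: carrier_T)
  qed
  then have "ideal ?J T"
  proof (rule idealI[OF ringT])
    fix a x assume a: "a \<in> ?J" and x: "x \<in> carrier T"
    then have ac: "a \<in> carrier T" by blast
    show "x \<otimes>\<^bsub>T\<^esub> a \<in> ?J" using a l Tr.m_closed[OF x ac] emb_mult[OF Talg x ac] by (simp del: carrier_T)
    show "a \<otimes>\<^bsub>T\<^esub> x \<in> ?J" using a r Tr.m_closed[OF ac x] emb_mult[OF Talg ac x] by (simp del: carrier_T)
  qed
  moreover have "{relc u v | u v. u \<in> carrier g \<and> v \<in> carrier g} \<subseteq> ?J"
    using relc rel by (auto simp del: carrier_T)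
  ultimately have "I \<subseteq> ?J" unfolding I_def by (rule Tr.genideal_minimal)
  then have "prj T x \<in> ?J" using q unfolding q_zero_iff by (rule subsetD)
  then show ?thesis by simp
qed

end

section \<open>Twisting\<close>

lemma tspace_cong:
  assumes "carrier M = carrier N" "add M = add N" "smult M = smult N"
  shows "tspace D M = tspace D N" "pure D M = pure D N"
proof -
  have w: "words D M = words D N" unfolding words_def assms ..
  have r: "multilin_rels D M = multilin_rels D N" unfolding multilin_rels_def w assms ..
  have t: "tclass D M x = tclass D N x" for x unfolding tclass_def r ..
  show "tspace D M = tspace D N" unfolding tspace_def w t ..
  show "pure D M = pure D N" unfolding pure_def t ..
qed

lemma tspace_twist_hopf: "tspace D (twist_hopf K F) = tspace D K" "pure D (twist_hopf K F) = pure D K"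
  by (rule tspace_cong; simp add: twist_hopf_def)+

lemma tspace_twist_lie: "tspace D (twist_lie K F g) = tspace D g" "pure D (twist_lie K F g) = pure D g"
  by (rule tspace_cong; simp add: twist_lie_def)+

lemma emb_twist_hopf: "emb (twist_hopf K F) = emb K" "prj (twist_hopf K F) = prj K"
  by (rule emb_cong; simp add: twist_hopf_def)+

lemma emb_twist_lie: "emb (twist_lie K F g) = emb g" "prj (twist_lie K F g) = prj g"
  by (rule emb_cong; simp add: twist_lie_def)+

lemma tensor_alg_twist: "tensor_alg (twist_lie K F g) = tensor_alg g"
  unfolding tensor_alg_def tspace_twist_lie ..

lemma kmodule_cong:
  assumes "carrier M = carrier N" "add M = add N" "smult M = smult N" "ring.zero M = ring.zero N"
  shows "kmodule M = kmodule N"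
  unfolding module_scal_iff assms abelian_group_cong[OF assms(1,2,4)] ..

lemma lin_comp: "lin M N f \<Longrightarrow> lin N P h \<Longrightarrow> lin M P (\<lambda>x. h (f x))"
  unfolding lin_def by (simp add: Pi_iff)

lemma bilin_of_total:
  assumes M: "kmodule M" and N: "kmodule N" and P: "kmodule P" and B: "bilx B"
    and cl: "\<And>x y. x \<in> carrier M \<Longrightarrow> y \<in> carrier N \<Longrightarrow> b x y \<in> carrier P"
    and e: "\<And>x y. x \<in> carrier M \<Longrightarrow> y \<in> carrier N \<Longrightarrow> emb P (b x y) = B (emb M x) (emb N y)"
  shows "bilin M N P b"
proof -
  note m = module_simps[OF M] and n = module_simps[OF N] and p = module_simps[OF P]
  have eq: "u = v" if "u \<in> carrier P" "v \<in> carrier P" "emb P u = emb P v" for u v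
    using that emb_eq_iff[OF P that(1,2)] by simp
  have "lin N P (b x)" if x: "x \<in> carrier M" for x
    unfolding lin_def using x
    by (intro conjI funcsetI ballI allI eq)
       (simp_all add: cl n p e emb_add[OF N] emb_add[OF P] emb_smult[OF N] emb_smult[OF P] bilxD[OF B])
  moreover have "lin M P (\<lambda>x. b x y)" if y: "y \<in> carrier N" for y
    unfolding lin_def using y
    by (intro conjI funcsetI ballI allI eq)
       (simp_all add: cl m p e emb_add[OF M] emb_add[OF P] emb_smult[OF M] emb_smult[OF P] bilxD[OF B])
  ultimately show ?thesis unfolding bilin_def by simp
qed

text \<open>All data of the theorem. Inside this locale, the prefix \<open>M\<close> refers to the constructions
  for the twisted data \<open>K\<^sub>F\<close>, \<open>\<gg>\<^sub>F\<close>, \<open>R\<^sub>F\<close>.\<close>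

locale full = tri K R + tw K F + gmod K g
  for K :: "('k::comm_ring_1, 'a) coalg" and R :: "('k, 'a) tens" and F :: "('k, 'a) tens"
    and g :: "('k, 'v, 'a) blie" +
  assumes lie: "braided_lie K R g"

sublocale full \<subseteq> bgmod K g by unfold_locales
sublocale full \<subseteq> lied K g R by unfold_locales (rule R_closed)

context full
begin

abbreviation KF where "KF \<equiv> twist_hopf K F"
abbreviation gF where "gF \<equiv> twist_lie K F g"
abbreviation RF where "RF \<equiv> twist_R K F R"

lemma comul_KF: "comul KF k = F \<otimes>\<^bsub>tpow_alg 2 K\<^esub> comul K k \<otimes>\<^bsub>tpow_alg 2 K\<^esub> G"
  by (simp add: twist_hopf_def)

lemma bracket_gF:
  assumes "u \<in> carrier g" "v \<in> carrier g"
  shows "bracket gF u v \<in> carrier g" "emb g (bracket gF u v) = SG (\<lambda>a b. br (a \<rhd> emb g u) (b \<rhd> emb g v))"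
proof -
  have B: "bilx (\<lambda>a b. br (a \<rhd> emb g u) (b \<rhd> emb g v))" by (simp add: bilx_def linx_def Tbil)
  have e: "bracket gF u v = tlift g (\<lambda>f. bracket g (act g (f!0) u) (act g (f!1) v)) G"
    by (simp add: twist_lie_def)
  show "bracket gF u v \<in> carrier g" "emb g (bracket gF u v) = SG (\<lambda>a b. br (a \<rhd> emb g u) (b \<rhd> emb g v))"
    unfolding e by (rule tlift2[OF kmod gmod G_closed B]; simp add: br_closed act_closed br_emb act_emb assms)+
qed

lemma M_lied: "lied KF gF RF"
proof -
  interpret T2: ring "tpow_alg 2 K" by (rule ring_tpow)
  have kK: "kmodule KF = kmodule K" by (rule kmodule_cong) (simp_all add: twist_hopf_def)
  have rK: "ring KF = ring K" by (rule ring_cong) (simp_all add: twist_hopf_def)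
  have bl: "bilin KF KF KF (\<lambda>x y. x \<otimes>\<^bsub>KF\<^esub> y) = bilin K K K (\<lambda>x y. x \<otimes>\<^bsub>K\<^esub> y)"
    by (simp add: bilin_def lin_def twist_hopf_def)
  have A: "assoc_algebra KF" using alg unfolding assoc_algebra_def kK rK bl .
  have t: "assoc_algebra (tpow_alg 2 K)" by (rule tpow_algebra[OF alg])
  have c0: "lin K (tpow_alg 2 K) (comul K)" using com by (simp add: lin_def tpow_alg_def)
  have "lin K (tpow_alg 2 K) (\<lambda>k. F \<otimes>\<^bsub>tpow_alg 2 K\<^esub> comul K k \<otimes>\<^bsub>tpow_alg 2 K\<^esub> G)"
    using lin_comp[OF lin_comp[OF c0 lin_mult(1)[OF t, of F]] lin_mult(2)[OF t, of G]] F_closed G_closed by simp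
  then have C: "lin KF (tspace {2} KF) (comul KF)"
    unfolding comul_KF[abs_def] tspace_twist_hopf by (simp add: lin_def tpow_alg_def twist_hopf_def)
  have E: "lin KF scal (counit KF)" using cou by (simp add: lin_def twist_hopf_def)
  have kg: "kmodule gF = kmodule g" by (rule kmodule_cong) (simp_all add: twist_lie_def)
  have "bilin KF gF gF (act gF) = bilin K g g (act g)"
    by (simp add: bilin_def lin_def twist_hopf_def twist_lie_def)
  then have Kg': "K_module KF gF" using Kg unfolding K_module_def kg by (simp add: twist_hopf_def twist_lie_def)
  have B: "bilx (\<lambda>u v. SG (\<lambda>a b. br (a \<rhd> u) (b \<rhd> v)))" by (simp add: bilx_def linx_def Tbil)
  have "bilin g g g (bracket gF)"
    by (rule bilin_of_total[OF gmod gmod gmod B]; rule bracket_gF; assumption)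
  then have Br: "bilin gF gF gF (bracket gF)" by (simp add: bilin_def lin_def twist_lie_def)
  have "RF \<in> carrier (tspace {2} KF)"
    unfolding tspace_twist_hopf twist_R_def by (intro tpow_mult_closed flip_closed F_closed G_closed R_closed)
  then show ?thesis using A C E Kg' Br by unfold_locales
qed

end

sublocale full \<subseteq> M: lied "twist_hopf K F" "twist_lie K F g" "twist_R K F R"
  by (rule M_lied)

context full
begin

lemma mulx_KF: "mulx KF = mulx K"
  by (intro ext) (simp add: mulx_def emb_twist_hopf, simp add: twist_hopf_def)

lemma ev2_KF: "ev2 KF S f = ev2 K S f"
  by (simp add: ev2_def emb_twist_hopf)

lemma actx_KF: "actx KF gF = actx K g"
  by (intro ext) (simp add: actx_def emb_twist_hopf emb_twist_lie, simp add: twist_lie_def)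

lemma gen_KF: "M.gen v = gen v"
  by (simp add: M.gen_def gen_def tensor_alg_twist tspace_twist_lie emb_twist_lie)

lemma eps_KF: "M.eps h = eps h"
  by (simp add: M.eps_def eps_def emb_twist_hopf, simp add: twist_hopf_def)

lemma br_KF: "M.br u v = SG (\<lambda>a b. br (a \<rhd> u) (b \<rhd> v))"
  unfolding M.br_def emb_twist_lie
  using bracket_gF(2)[OF prj_closed[OF gmod] prj_closed[OF gmod], of u v] by simp

lemmas KF_simps = mulx_KF ev2_KF actx_KF gen_KF eps_KF br_KF tensor_alg_twist emb_twist_hopf emb_twist_lie

abbreviation copF where "copF \<equiv> M.cop"
abbreviation actF where "actF \<equiv> M.actT"

lemma copF_def: "copF h f = ev2 K (F \<otimes>\<^bsub>tpow_alg 2 K\<^esub> comul K (prj K h) \<otimes>\<^bsub>tpow_alg 2 K\<^esub> G) f"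
  by (simp add: M.cop_def KF_simps comul_KF)

lemma copF_bil:
  "bilx f \<Longrightarrow> copF (x + y) f = copF x f + copF y f" "bilx f \<Longrightarrow> copF (c \<bullet> x) f = c \<bullet> copF x f"
  "copF h (\<lambda>a b. f1 a b + f2 a b) = copF h f1 + copF h f2" "copF h (\<lambda>a b. c \<bullet> f1 a b) = c \<bullet> copF h f1"
  by (simp_all add: M.cop_lin M.cop_fun)

lemma copF:
  assumes f: "bilx f"
  shows "copF h f = SF (\<lambda>a b. cop h (\<lambda>c d. SG (\<lambda>e k. f (a \<star> c \<star> e) (b \<star> d \<star> k))))"
proof -
  have B: "bilx (\<lambda>x y. SG (\<lambda>e k. f (x \<star> e) (y \<star> k)))" by (simp add: bilx_def linx_def Kbil bilxD[OF f])
  show ?thesis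
    unfolding copF_def
    by (simp add: ev2_mul[OF tpow_mult_closed[OF F_closed com_closed] G_closed f] ev2_mul[OF F_closed com_closed B] cop_def)
qed

text \<open>The coproduct of \<open>K\<^sub>F\<close> is \<open>F \<Delta>(\<hyphen>) G\<close>; one cancellation gives \<open>\<Delta>\<^sub>F F = F \<Delta>\<close> here and
  \<open>G \<Delta>\<^sub>F = \<Delta> G\<close> in the next lemma.\<close>

lemma copF_F:
  assumes f: "bilx f"
  shows "copF h (\<lambda>a b. SF (\<lambda>c d. f (a \<star> c) (b \<star> d))) = SF (\<lambda>a b. cop h (\<lambda>c d. f (a \<star> c) (b \<star> d)))"
proof -
  interpret T2: ring "tpow_alg 2 K" by (rule ring_tpow)
  let ?D = "comul K (prj K h)"
  have c: "F \<in> carrier (tpow_alg 2 K)" "G \<in> carrier (tpow_alg 2 K)" "?D \<in> carrier (tpow_alg 2 K)"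
    by (simp_all add: F_closed G_closed com_closed)
  have "(F \<otimes>\<^bsub>tpow_alg 2 K\<^esub> ?D \<otimes>\<^bsub>tpow_alg 2 K\<^esub> G) \<otimes>\<^bsub>tpow_alg 2 K\<^esub> F = F \<otimes>\<^bsub>tpow_alg 2 K\<^esub> ?D"
    by (simp only: T2.m_assoc c T2.m_closed GF T2.r_one)
  then have "ev2 K ((F \<otimes>\<^bsub>tpow_alg 2 K\<^esub> ?D \<otimes>\<^bsub>tpow_alg 2 K\<^esub> G) \<otimes>\<^bsub>tpow_alg 2 K\<^esub> F) f = ev2 K (F \<otimes>\<^bsub>tpow_alg 2 K\<^esub> ?D) f"
    by simp
  then show ?thesis
    unfolding ev2_mul[OF F_closed com_closed f]
      ev2_mul[OF tpow_mult_closed[OF tpow_mult_closed[OF F_closed com_closed] G_closed] F_closed f]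
    by (simp add: copF_def cop_def)
qed

lemma G_copF:
  assumes f: "bilx f"
  shows "SG (\<lambda>a b. copF h (\<lambda>c d. f (a \<star> c) (b \<star> d))) = cop h (\<lambda>a b. SG (\<lambda>c d. f (a \<star> c) (b \<star> d)))"
proof -
  interpret T2: ring "tpow_alg 2 K" by (rule ring_tpow)
  let ?D = "comul K (prj K h)"
  have c: "F \<in> carrier (tpow_alg 2 K)" "G \<in> carrier (tpow_alg 2 K)" "?D \<in> carrier (tpow_alg 2 K)"
    by (simp_all add: F_closed G_closed com_closed)
  have "G \<otimes>\<^bsub>tpow_alg 2 K\<^esub> (F \<otimes>\<^bsub>tpow_alg 2 K\<^esub> ?D \<otimes>\<^bsub>tpow_alg 2 K\<^esub> G) = (G \<otimes>\<^bsub>tpow_alg 2 K\<^esub> F) \<otimes>\<^bsub>tpow_alg 2 K\<^esub> (?D \<otimes>\<^bsub>tpow_alg 2 K\<^esub> G)"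
    by (simp only: T2.m_assoc c T2.m_closed)
  also have "\<dots> = ?D \<otimes>\<^bsub>tpow_alg 2 K\<^esub> G" by (simp only: c T2.m_closed GF T2.l_one)
  finally have "ev2 K (G \<otimes>\<^bsub>tpow_alg 2 K\<^esub> (F \<otimes>\<^bsub>tpow_alg 2 K\<^esub> ?D \<otimes>\<^bsub>tpow_alg 2 K\<^esub> G)) f = ev2 K (?D \<otimes>\<^bsub>tpow_alg 2 K\<^esub> G) f"
    by simp
  then show ?thesis
    unfolding ev2_mul[OF com_closed G_closed f]
      ev2_mul[OF G_closed tpow_mult_closed[OF tpow_mult_closed[OF F_closed com_closed] G_closed] f]
    by (simp add: copF_def cop_def)
qed

lemma copF_mult:
  assumes f: "bilx f"
  shows "copF (h \<star> k) f = copF h (\<lambda>a b. copF k (\<lambda>c d. f (a \<star> c) (b \<star> d)))"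
proof -
  interpret T2: ring "tpow_alg 2 K" by (rule ring_tpow)
  let ?D = "comul K (prj K h)" and ?E = "comul K (prj K k)"
  have c: "F \<in> carrier (tpow_alg 2 K)" "G \<in> carrier (tpow_alg 2 K)" "?D \<in> carrier (tpow_alg 2 K)" "?E \<in> carrier (tpow_alg 2 K)"
    by (simp_all add: F_closed G_closed com_closed)
  have "comul K (prj K (h \<star> k)) = ?D \<otimes>\<^bsub>tpow_alg 2 K\<^esub> ?E"
    using bi prj_closed[OF kmod] by (simp add: prj_mulx[OF alg] bialgebra_def alg_hom_def ring_hom_mult)
  moreover have "F \<otimes>\<^bsub>tpow_alg 2 K\<^esub> (?D \<otimes>\<^bsub>tpow_alg 2 K\<^esub> ?E) \<otimes>\<^bsub>tpow_alg 2 K\<^esub> G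
    = F \<otimes>\<^bsub>tpow_alg 2 K\<^esub> ?D \<otimes>\<^bsub>tpow_alg 2 K\<^esub> (G \<otimes>\<^bsub>tpow_alg 2 K\<^esub> F) \<otimes>\<^bsub>tpow_alg 2 K\<^esub> ?E \<otimes>\<^bsub>tpow_alg 2 K\<^esub> G"
    unfolding GF by (simp only: T2.m_assoc c T2.m_closed T2.r_one)
  moreover have "\<dots> = (F \<otimes>\<^bsub>tpow_alg 2 K\<^esub> ?D \<otimes>\<^bsub>tpow_alg 2 K\<^esub> G) \<otimes>\<^bsub>tpow_alg 2 K\<^esub> (F \<otimes>\<^bsub>tpow_alg 2 K\<^esub> ?E \<otimes>\<^bsub>tpow_alg 2 K\<^esub> G)"
    by (simp only: T2.m_assoc c T2.m_closed)
  ultimately show ?thesis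
    unfolding copF_def
    by (simp add: ev2_mul[OF tpow_mult_closed[OF tpow_mult_closed[OF F_closed com_closed] G_closed]
          tpow_mult_closed[OF tpow_mult_closed[OF F_closed com_closed] G_closed] f])
qed

lemma RF_ev:
  assumes f: "bilx f"
  shows "ev2 K RF f = SF (\<lambda>a b. SR (\<lambda>c d. SG (\<lambda>e k. f (b \<star> c \<star> e) (a \<star> d \<star> k))))"
proof -
  have B: "bilx (\<lambda>x y. SG (\<lambda>e k. f (x \<star> e) (y \<star> k)))" by (simp add: bilx_def linx_def Kbil bilxD[OF f])
  have B2: "bilx (\<lambda>a b. SR (\<lambda>c d. SG (\<lambda>e k. f (a \<star> c \<star> e) (b \<star> d \<star> k))))"
    by (simp add: bilx_def linx_def Kbil bilxD[OF f])
  show ?thesis unfolding twist_R_def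
    by (simp add: ev2_mul[OF tpow_mult_closed[OF flip_closed[OF F_closed] R_closed] G_closed f]
       ev2_mul[OF flip_closed[OF F_closed] R_closed B] ev2_flip[OF F_closed B2])
qed

section \<open>The comparison map on tensor algebras\<close>

lemma actF_bil: "actF (h + h') x = actF h x + actF h' x" "actF h (x + x') = actF h x + actF h x'"
  "actF (c \<bullet> h) x = c \<bullet> actF h x" "actF h (c \<bullet> x) = c \<bullet> actF h x"
  by (rule M.actT_bil)+

lemma actF_one: "actF h oneT = eps h \<bullet> oneT"
  using M.actT_one[of h] by (simp only: KF_simps)

lemma actF_gen: "actF h (gen v \<otimes>\<otimes> t) = copF h (\<lambda>a b. gen (a \<rhd> v) \<otimes>\<otimes> actF b t)"
  using M.actT_gen[of h v t] by (simp only: KF_simps)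

lemma actF_pp [simp]: "actF (pp K h) x = actF h x" "actF h (pp T x) = actF h x" "pp T (actF h x) = actF h x"
  using M.actT_pp[of h x] by (simp_all only: KF_simps)

lemma actF_mul: "actF (h \<star> k) t = actF h (actF k t)"
proof -
  have "actF (mulx KF h k) t = actF h (actF k t)"
    by (rule M.actT_mul_if) (simp_all only: KF_simps copF_mult eps_mult)
  then show ?thesis by (simp only: KF_simps)
qed

lemma pull_copF: "linx f \<Longrightarrow> f (copF h k) = copF h (\<lambda>a b. f (k a b))"
  by (rule M.cop_linx)

lemma copF_swap: "copF h (\<lambda>a b. ev2 N S (\<lambda>c d. f a b c d)) = ev2 N S (\<lambda>c d. copF h (\<lambda>a b. f a b c d))"
  by (rule M.cop_swap)

text \<open>The recursion for \<open>chi\<close> uses the action of \<open>K\<^sub>F\<close>, not of \<open>K\<close>: by \<open>psi_actF\<close> below this is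
  the action which \<open>psi\<close> carries to that of \<open>K\<close>, and so \<open>F\<close> meets \<open>G\<close> without a coproduct
  between them.\<close>

definition psi :: "('k, ('k, 'v) tens) uvec \<Rightarrow> ('k, ('k, 'v) tens) uvec" where
  "psi = recT (\<lambda>v z. SG (\<lambda>a b. gen (a \<rhd> v) \<otimes>\<otimes> actT b z)) oneT"

definition chi :: "('k, ('k, 'v) tens) uvec \<Rightarrow> ('k, ('k, 'v) tens) uvec" where
  "chi = recT (\<lambda>v z. SF (\<lambda>a b. gen (a \<rhd> v) \<otimes>\<otimes> actF b z)) oneT"

lemmas Fbil = Tbil actF_bil copF_bil

lemma psi_bil: "bilx (\<lambda>v z. SG (\<lambda>a b. gen (a \<rhd> v) \<otimes>\<otimes> actT b z))"
  and chi_bil: "bilx (\<lambda>v z. SF (\<lambda>a b. gen (a \<rhd> v) \<otimes>\<otimes> actF b z))"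
  by (simp_all add: bilx_def linx_def Fbil)

lemma linx_psi: "linx psi" and psi_one: "psi oneT = oneT"
  and psi_gen: "psi (gen v \<otimes>\<otimes> t) = SG (\<lambda>a b. gen (a \<rhd> v) \<otimes>\<otimes> actT b (psi t))"
  and psi_pp: "psi (pp T t) = psi t"
  using recT[OF psi_bil, of oneT] by (simp_all add: psi_def)

lemma linx_chi: "linx chi" and chi_one: "chi oneT = oneT"
  and chi_gen: "chi (gen v \<otimes>\<otimes> t) = SF (\<lambda>a b. gen (a \<rhd> v) \<otimes>\<otimes> actF b (chi t))"
  and chi_pp: "chi (pp T t) = chi t"
  using recT[OF chi_bil, of oneT] by (simp_all add: chi_def)

lemma psi_lin: "psi (x + y) = psi x + psi y" "psi (c \<bullet> x) = c \<bullet> psi x"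
  "psi (ev2 N S f) = ev2 N S (\<lambda>a b. psi (f a b))" "psi (copF h f') = copF h (\<lambda>a b. psi (f' a b))"
  using linx_psi by (simp_all add: linx_def ev2_linx[OF linx_psi] pull_copF[OF linx_psi])

lemma chi_lin: "chi (x + y) = chi x + chi y" "chi (c \<bullet> x) = c \<bullet> chi x"
  "chi (ev2 N S f) = ev2 N S (\<lambda>a b. chi (f a b))" "chi (cop h f') = cop h (\<lambda>a b. chi (f' a b))"
  using linx_chi by (simp_all add: linx_def ev2_linx[OF linx_chi] cop_linx[OF linx_chi])

lemma pp_psi [simp]: "pp T (psi t) = psi t"
proof -
  have "pp T (psi (pp T t)) = psi (pp T t)"
    by (rule T_induct[where P = "\<lambda>x. pp T (psi x) = psi x"])
       (simp_all add: psi_lin pp_T psi_one psi_gen ev2_linx[OF linx_emb_prj[OF Tmod]])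
  then show ?thesis by (simp add: psi_pp)
qed

lemma pp_chi [simp]: "pp T (chi t) = chi t"
proof -
  have "pp T (chi (pp T t)) = chi (pp T t)"
    by (rule T_induct[where P = "\<lambda>x. pp T (chi x) = chi x"])
       (simp_all add: chi_lin pp_T chi_one chi_gen ev2_linx[OF linx_emb_prj[OF Tmod]])
  then show ?thesis by (simp add: chi_pp)
qed

text \<open>In the induction step \<open>G\<close> from the definition of \<open>psi\<close> stands to the left of \<open>\<Delta>\<^sub>F(h)\<close>,
  and \<open>G \<Delta>\<^sub>F(h) = \<Delta>(h) G\<close>.\<close>

lemma psi_actF: "psi (actF h t) = actT h (psi t)"
proof -
  let ?P = "\<lambda>t. \<forall>h. psi (actF h t) = actT h (psi t)"
  have "?P (pp T t)"
  proof (rule T_induct)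
    show "?P (x + y)" if "?P x" "?P y" for x y using that by (simp add: Fbil psi_lin)
    show "?P (c \<bullet> x)" if "?P x" for c x using that by (simp add: Fbil psi_lin)
    show "?P oneT" by (simp add: actF_one actT_one psi_one psi_lin)
    fix v t assume IH: "?P t"
    show "?P (gen v \<otimes>\<otimes> t)"
    proof
      fix h
      have B: "bilx (\<lambda>a b. gen (a \<rhd> v) \<otimes>\<otimes> actT b (psi t))" by (simp add: bilx_def linx_def Fbil)
      have "psi (actF h (gen v \<otimes>\<otimes> t)) = copF h (\<lambda>a b. SG (\<lambda>c d. gen ((c \<star> a) \<rhd> v) \<otimes>\<otimes> actT (d \<star> b) (psi t)))"
        by (simp add: actF_gen psi_lin psi_gen IH act_mul actT_mul)
      also have "\<dots> = cop h (\<lambda>a b. SG (\<lambda>c d. gen ((a \<star> c) \<rhd> v) \<otimes>\<otimes> actT (b \<star> d) (psi t)))"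
        unfolding copF_swap by (rule G_copF[OF B])
      also have "\<dots> = actT h (psi (gen v \<otimes>\<otimes> t))"
        by (simp add: psi_gen pullT actT_gen cop_swap act_mul actT_mul)
      finally show "psi (actF h (gen v \<otimes>\<otimes> t)) = actT h (psi (gen v \<otimes>\<otimes> t))" .
    qed
  qed
  then show ?thesis by (simp add: psi_pp)
qed

lemma chi_actT: "chi (actT h t) = actF h (chi t)"
proof -
  let ?P = "\<lambda>t. \<forall>h. chi (actT h t) = actF h (chi t)"
  have l: "linx (actF h)" for h by (simp add: linx_def Fbil)
  have "?P (pp T t)"
  proof (rule T_induct)
    show "?P (x + y)" if "?P x" "?P y" for x y using that by (simp add: Fbil chi_lin)
    show "?P (c \<bullet> x)" if "?P x" for c x using that by (simp add: Fbil chi_lin)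
    show "?P oneT" by (simp add: actF_one actT_one chi_one chi_lin)
    fix v t assume IH: "?P t"
    show "?P (gen v \<otimes>\<otimes> t)"
    proof
      fix h
      have B: "bilx (\<lambda>a b. gen (a \<rhd> v) \<otimes>\<otimes> actF b (chi t))" by (simp add: bilx_def linx_def Fbil)
      have "chi (actT h (gen v \<otimes>\<otimes> t)) = SF (\<lambda>c d. cop h (\<lambda>a b. gen ((c \<star> a) \<rhd> v) \<otimes>\<otimes> actF (d \<star> b) (chi t)))"
        by (simp add: actT_gen chi_lin chi_gen IH act_mul actF_mul cop_swap)
      also have "\<dots> = copF h (\<lambda>a b. SF (\<lambda>c d. gen ((a \<star> c) \<rhd> v) \<otimes>\<otimes> actF (b \<star> d) (chi t)))"
        by (rule copF_F[OF B, symmetric])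
      also have "\<dots> = actF h (chi (gen v \<otimes>\<otimes> t))"
        by (simp add: chi_gen ev2_linx[OF l] actF_gen copF_swap act_mul actF_mul)
      finally show "chi (actT h (gen v \<otimes>\<otimes> t)) = actF h (chi (gen v \<otimes>\<otimes> t))" .
    qed
  qed
  then show ?thesis by (simp add: chi_pp)
qed

lemma actF_1: "actF \<^bold>1 t = pp T t"
proof -
  have "actF \<^bold>1 (pp T t) = pp T (pp T t)"
  proof (rule T_linear_eq[where f = "actF \<^bold>1" and h = "\<lambda>x. pp T x"])
    show "linx (actF \<^bold>1)" by (simp add: linx_def Fbil)
    show "linx (\<lambda>x. pp T x)" by (rule linx_emb_prj[OF Tmod])
    show "actF \<^bold>1 oneT = pp T oneT" by (simp add: actF_one eps_one)
    fix v t assume IH: "actF \<^bold>1 t = pp T t"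
    have B: "bilx (\<lambda>a b. gen (a \<rhd> v) \<otimes>\<otimes> actF b t)" by (simp add: bilx_def linx_def Fbil)
    have B': "bilx (\<lambda>x y. SG (\<lambda>e k. gen ((x \<star> e) \<rhd> v) \<otimes>\<otimes> actF (y \<star> k) t))" by (simp add: bilx_def linx_def Fbil)
    have "copF \<^bold>1 (\<lambda>a b. gen (a \<rhd> v) \<otimes>\<otimes> actF b t) = SF (\<lambda>a b. cop \<^bold>1 (\<lambda>c d. SG (\<lambda>e k. gen ((a \<star> c \<star> e) \<rhd> v) \<otimes>\<otimes> actF (b \<star> d \<star> k) t)))"
      by (rule copF[OF B])
    also have "\<dots> = SF (\<lambda>a b. SG (\<lambda>e k. gen ((a \<star> \<^bold>1 \<star> e) \<rhd> v) \<otimes>\<otimes> actF (b \<star> \<^bold>1 \<star> k) t))"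
      by (simp only: cop_one[OF bilx_mul[OF B']])
    also have "\<dots> = gen (\<^bold>1 \<rhd> v) \<otimes>\<otimes> actF \<^bold>1 t"
      using SF_SG[OF B] by (simp add: mulx_one[OF alg] mulx_pp[OF alg])
    finally show "actF \<^bold>1 (gen v \<otimes>\<otimes> t) = pp T (gen v \<otimes>\<otimes> t)"
      by (simp add: actF_gen act_one IH)
  qed
  then show ?thesis by (simp add: pp_T)
qed

lemma psi_chi: "psi (chi t) = pp T t"
proof -
  have "psi (chi (pp T t)) = pp T (pp T t)"
  proof (rule T_linear_eq[where f = "\<lambda>t. psi (chi t)" and h = "\<lambda>x. pp T x"])
    show "linx (\<lambda>t. psi (chi t))" by (simp add: linx_def psi_lin chi_lin)
    show "linx (\<lambda>x. pp T x)" by (rule linx_emb_prj[OF Tmod])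
    show "psi (chi oneT) = pp T oneT" by (simp add: chi_one psi_one)
    fix v t assume IH: "psi (chi t) = pp T t"
    have B: "bilx (\<lambda>a b. gen (a \<rhd> v) \<otimes>\<otimes> actT b t)" by (simp add: bilx_def linx_def Fbil)
    have "psi (chi (gen v \<otimes>\<otimes> t)) = SG (\<lambda>c d. SF (\<lambda>a b. gen ((c \<star> a) \<rhd> v) \<otimes>\<otimes> actT (d \<star> b) t))"
      by (simp add: chi_gen psi_lin psi_gen psi_actF IH act_mul actT_mul ev2_swap[of K F])
    also have "\<dots> = gen (\<^bold>1 \<rhd> v) \<otimes>\<otimes> actT \<^bold>1 t" by (rule SG_SF[OF B])
    finally show "psi (chi (gen v \<otimes>\<otimes> t)) = pp T (gen v \<otimes>\<otimes> t)" by (simp add: act_one actT_1)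
  qed
  then show ?thesis by (simp add: pp_T chi_pp)
qed

lemma chi_psi: "chi (psi t) = pp T t"
proof -
  have "chi (psi (pp T t)) = pp T (pp T t)"
  proof (rule T_linear_eq[where f = "\<lambda>t. chi (psi t)" and h = "\<lambda>x. pp T x"])
    show "linx (\<lambda>t. chi (psi t))" by (simp add: linx_def psi_lin chi_lin)
    show "linx (\<lambda>x. pp T x)" by (rule linx_emb_prj[OF Tmod])
    show "chi (psi oneT) = pp T oneT" by (simp add: chi_one psi_one)
    fix v t assume IH: "chi (psi t) = pp T t"
    have B: "bilx (\<lambda>a b. gen (a \<rhd> v) \<otimes>\<otimes> actF b t)" by (simp add: bilx_def linx_def Fbil)
    have "chi (psi (gen v \<otimes>\<otimes> t)) = SF (\<lambda>c d. SG (\<lambda>a b. gen ((c \<star> a) \<rhd> v) \<otimes>\<otimes> actF (d \<star> b) t))"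
      by (simp add: psi_gen chi_lin chi_gen chi_actT IH act_mul actF_mul ev2_swap[of K G])
    also have "\<dots> = gen (\<^bold>1 \<rhd> v) \<otimes>\<otimes> actF \<^bold>1 t" by (rule SF_SG[OF B])
    finally show "chi (psi (gen v \<otimes>\<otimes> t)) = pp T (gen v \<otimes>\<otimes> t)" by (simp add: act_one actF_1)
  qed
  then show ?thesis by (simp add: pp_T psi_pp)
qed

text \<open>The 2-cocycle identity for \<open>G\<close> is exactly the induction step.\<close>

lemma psi_mul: "psi (s \<otimes>\<otimes> t) = SG (\<lambda>a b. actT a (psi s) \<otimes>\<otimes> actT b (psi t))"
proof -
  have "psi (pp T s \<otimes>\<otimes> t) = SG (\<lambda>a b. actT a (psi (pp T s)) \<otimes>\<otimes> actT b (psi t))"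
  proof (rule T_linear_eq[where f = "\<lambda>s. psi (s \<otimes>\<otimes> t)" and h = "\<lambda>s. SG (\<lambda>a b. actT a (psi s) \<otimes>\<otimes> actT b (psi t))"])
    show "linx (\<lambda>s. psi (s \<otimes>\<otimes> t))" "linx (\<lambda>s. SG (\<lambda>a b. actT a (psi s) \<otimes>\<otimes> actT b (psi t)))"
      by (simp_all add: linx_def psi_lin Fbil)
    have l: "linx (\<lambda>b. actT b (psi t))" by (simp add: linx_def Fbil)
    show "psi (oneT \<otimes>\<otimes> t) = SG (\<lambda>a b. actT a (psi oneT) \<otimes>\<otimes> actT b (psi t))"
      using G_eps(1)[OF l] by (simp add: psi_one actT_one mulx_bil[OF Talg] psi_pp actT_1)
    fix v s assume IH: "psi (s \<otimes>\<otimes> t) = SG (\<lambda>a b. actT a (psi s) \<otimes>\<otimes> actT b (psi t))"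
    have t: "trilx (\<lambda>x y z. gen (x \<rhd> v) \<otimes>\<otimes> (actT y (psi s) \<otimes>\<otimes> actT z (psi t)))"
      by (simp add: trilx_def linx_def Fbil)
    have "psi (gen v \<otimes>\<otimes> s \<otimes>\<otimes> t) =
      SG (\<lambda>a b. cop b (\<lambda>b1 b2. SG (\<lambda>c d. gen (a \<rhd> v) \<otimes>\<otimes> (actT (b1 \<star> c) (psi s) \<otimes>\<otimes> actT (b2 \<star> d) (psi t)))))"
      by (simp add: mulT_assoc psi_gen IH pullT actT_mulT actT_mul cop_swap)
    also have "\<dots> = SG (\<lambda>a b. cop a (\<lambda>a1 a2. SG (\<lambda>c d. gen ((a1 \<star> c) \<rhd> v) \<otimes>\<otimes> (actT (a2 \<star> d) (psi s) \<otimes>\<otimes> actT b (psi t)))))"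
      by (rule cocycle_inv[OF t, symmetric])
    also have "\<dots> = SG (\<lambda>a b. actT a (psi (gen v \<otimes>\<otimes> s)) \<otimes>\<otimes> actT b (psi t))"
      by (simp add: mulT_assoc psi_gen pullT actT_gen actT_mul act_mul cop_swap)
    finally show "psi (gen v \<otimes>\<otimes> s \<otimes>\<otimes> t) = SG (\<lambda>a b. actT a (psi (gen v \<otimes>\<otimes> s)) \<otimes>\<otimes> actT b (psi t))" .
  qed
  then show ?thesis by (simp add: psi_pp)
qed

section \<open>The comparison map on relations and ideals\<close>

text \<open>Equivariance of the bracket is the axiom of braided Lie algebras used for the relations;
  with quasi-cocommutativity it shows in \<open>act_rel\<close> that their span is stable under the
  action.\<close>

lemma br_equiv: "h \<rhd> br u v = cop h (\<lambda>a b. br (a \<rhd> u) (b \<rhd> v))"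
proof -
  let ?h = "prj K h" and ?u = "prj g u" and ?v = "prj g v"
  note c = prj_closed[OF kmod, of h] prj_closed[OF gmod, of u] prj_closed[OF gmod, of v]
  have B: "bilx (\<lambda>a b. br (a \<rhd> u) (b \<rhd> v))" by (simp add: bilx_def linx_def Tbil)
  have "act g ?h (bracket g ?u ?v) = tlift g (\<lambda>d. bracket g (act g (d!0) ?u) (act g (d!1) ?v)) (comul K ?h)"
    by (rule lie[unfolded braided_lie_def, THEN conjunct2, THEN conjunct2, THEN conjunct1, rule_format, OF c])
  moreover have "emb g (tlift g (\<lambda>d. bracket g (act g (d!0) ?u) (act g (d!1) ?v)) (comul K ?h))
      = cop h (\<lambda>a b. br (a \<rhd> u) (b \<rhd> v))"
    unfolding cop_def
    by (rule tlift2(2)[OF kmod gmod com_closed B]) (simp add: br_closed act_closed br_emb act_emb c)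
  moreover have "emb g (act g ?h (bracket g ?u ?v)) = h \<rhd> br u v"
    by (simp add: act_emb br_emb br_closed c)
  ultimately show ?thesis by simp
qed

lemma cop_diff: "cop h (\<lambda>a b. f a b - k a b) = cop h f - cop h k"
  unfolding cop_def by (rule ev2_diff)

lemma act_diff: "actT h (x - y) = actT h x - actT h y"
  by (rule linx_diff) (simp add: linx_def Tbil)

lemma actT_gen1: "actT h (gen v) = gen (h \<rhd> v)"
proof -
  have l: "linx (\<lambda>a. gen (a \<rhd> v))" by (simp add: linx_def Tbil)
  have "actT h (gen v \<otimes>\<otimes> oneT) = cop h (\<lambda>a b. eps b \<bullet> gen (a \<rhd> v))"
    unfolding actT_gen by (simp add: actT_one mulx_bil[OF Talg])
  also have "\<dots> = gen (h \<rhd> v)" using counit_cop(2)[OF l] by simp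
  finally show ?thesis by simp
qed

lemma act_rel: "actT h (rel u v) = cop h (\<lambda>a b. rel (a \<rhd> u) (b \<rhd> v))"
proof -
  have B: "bilx (\<lambda>x y. gen (y \<rhd> v) \<otimes>\<otimes> gen (x \<rhd> u))" by (simp add: bilx_def linx_def Tbil)
  have "actT h (SR (\<lambda>a b. gen (b \<rhd> v) \<otimes>\<otimes> gen (a \<rhd> u)))
      = SR (\<lambda>a b. cop h (\<lambda>c d. gen ((c \<star> b) \<rhd> v) \<otimes>\<otimes> gen ((d \<star> a) \<rhd> u)))"
    by (simp add: pullT actT_mulT actT_gen1 act_mul)
  also have "\<dots> = cop h (\<lambda>c d. SR (\<lambda>a b. gen ((c \<star> b) \<rhd> v) \<otimes>\<otimes> gen ((d \<star> a) \<rhd> u)))"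
    by (rule cop_swap[symmetric])
  also have "\<dots> = SR (\<lambda>a b. cop h (\<lambda>c d. gen ((b \<star> d) \<rhd> v) \<otimes>\<otimes> gen ((a \<star> c) \<rhd> u)))"
    by (rule quasi_cocomm[OF B])
  also have "\<dots> = cop h (\<lambda>c d. SR (\<lambda>a b. gen (b \<rhd> d \<rhd> v) \<otimes>\<otimes> gen (a \<rhd> c \<rhd> u)))"
    unfolding act_mul by (rule cop_swap[symmetric])
  finally have 1: "actT h (SR (\<lambda>a b. gen (b \<rhd> v) \<otimes>\<otimes> gen (a \<rhd> u)))
      = cop h (\<lambda>c d. SR (\<lambda>a b. gen (b \<rhd> d \<rhd> v) \<otimes>\<otimes> gen (a \<rhd> c \<rhd> u)))" .
  have 2: "actT h (gen (br u v)) = cop h (\<lambda>a b. gen (br (a \<rhd> u) (b \<rhd> v)))"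
    unfolding actT_gen1 br_equiv by (rule cop_linx[OF linx_gen])
  have 3: "actT h (gen u \<otimes>\<otimes> gen v) = cop h (\<lambda>a b. gen (a \<rhd> u) \<otimes>\<otimes> gen (b \<rhd> v))"
    by (simp add: actT_mulT actT_gen1)
  show ?thesis unfolding rel_def cop_diff act_diff 1 2 3 ..
qed

lemma cop_0: "cop h (\<lambda>a b. 0) = 0"
  by (simp add: cop_def ev2_0)

lemma q_pull: "q (cop h f) = cop h (\<lambda>a b. q (f a b))" "q (ev2 N S f') = ev2 N S (\<lambda>a b. q (f' a b))"
  by (rule cop_linx[OF linx_q] ev2_linx[OF linx_q])+

lemma mulU_zero: "x \<odot>\<odot> 0 = 0" "0 \<odot>\<odot> x = 0"
  using mulx_bil(3,4)[OF Ualg, of 0 0 x] mulx_bil(4)[OF Ualg, of x 0 0] by simp_all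

lemma MmulU_zero: "mulx M.U x 0 = 0" "mulx M.U 0 x = 0"
  using mulx_bil(3)[OF M.Ualg, of 0 0 x] mulx_bil(4)[OF M.Ualg, of x 0 0] by simp_all

lemma q_act: assumes "q x = 0" shows "q (actT h x) = 0"
proof -
  have "\<forall>h. q (actT h (pp T x)) = 0"
  proof (rule q_zero_induct[where P = "\<lambda>x. \<forall>h. q (actT h x) = 0"])
    show "\<forall>h. q (actT h (rel u v)) = 0" for u v
      by (simp only: act_rel q_pull q_rel cop_0 simp_thms)
  qed (simp_all add: Tbil q_lin actT_mulT q_pull q_mul mulU_zero cop_0 assms)
  then show ?thesis by simp
qed

lemma psi_gen1: "psi (gen v) = gen v"
proof -
  have l: "linx (\<lambda>a. gen (a \<rhd> v))" by (simp add: linx_def Tbil)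
  have "psi (gen v \<otimes>\<otimes> oneT) = SG (\<lambda>a b. eps b \<bullet> gen (a \<rhd> v))"
    unfolding psi_gen by (simp add: psi_one actT_one mulx_bil[OF Talg])
  also have "\<dots> = gen v" using G_eps(2)[OF l] by (simp add: act_one)
  finally show ?thesis by simp
qed

lemma psi_gen2: "psi (gen u \<otimes>\<otimes> gen v) = SG (\<lambda>a b. gen (a \<rhd> u) \<otimes>\<otimes> gen (b \<rhd> v))"
  by (simp add: psi_gen psi_gen1 actT_gen1)

lemma ev2_swap3: "ev2 N S (\<lambda>r s. ev2 P V (\<lambda>e k. ev2 Q W (\<lambda>c d. f r s e k c d)))
   = ev2 Q W (\<lambda>c d. ev2 N S (\<lambda>r s. ev2 P V (\<lambda>e k. f r s e k c d)))"
proof -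
  have "ev2 P V (\<lambda>e k. ev2 Q W (\<lambda>c d. f r s e k c d)) = ev2 Q W (\<lambda>c d. ev2 P V (\<lambda>e k. f r s e k c d))" for r s
    by (rule ev2_swap)
  then show ?thesis by (simp only:) (rule ev2_swap)
qed

text \<open>The summand with \<open>R\<^sub>F\<close> carries the factor \<open>F\<^sub>2\<^sub>1 R G\<close>, and \<open>psi\<close> contributes \<open>G\<^sub>2\<^sub>1\<close> on its
  left. What remains is \<open>R G\<close>, the braiding applied after \<open>G\<close>.\<close>

lemma psi_rel: "psi (M.rel u v) = SG (\<lambda>a b. rel (a \<rhd> u) (b \<rhd> v))"
proof -
  let ?X = "\<lambda>x y. SR (\<lambda>r s. SG (\<lambda>e k. gen ((x \<star> s \<star> k) \<rhd> v) \<otimes>\<otimes> gen ((y \<star> r \<star> e) \<rhd> u)))"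
  have f: "bilx (\<lambda>x y. SG (\<lambda>c d. gen ((c \<star> y) \<rhd> v) \<otimes>\<otimes> gen ((d \<star> x) \<rhd> u)))" "bilx ?X"
    by (simp_all add: bilx_def linx_def Tbil)
  have "psi (ev2 K RF (\<lambda>a b. gen (b \<rhd> v) \<otimes>\<otimes> gen (a \<rhd> u)))
      = ev2 K RF (\<lambda>a b. SG (\<lambda>c d. gen ((c \<star> b) \<rhd> v) \<otimes>\<otimes> gen ((d \<star> a) \<rhd> u)))"
    by (simp add: psi_lin psi_gen2 act_mul)
  also have "\<dots> = SF (\<lambda>a b. SR (\<lambda>r s. SG (\<lambda>e k. SG (\<lambda>c d.
        gen ((c \<star> (a \<star> s \<star> k)) \<rhd> v) \<otimes>\<otimes> gen ((d \<star> (b \<star> r \<star> e)) \<rhd> u)))))"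
    by (rule RF_ev[OF f(1)])
  also have "\<dots> = SF (\<lambda>a b. SG (\<lambda>c d. ?X (c \<star> a) (d \<star> b)))"
    unfolding ev2_swap3[of K R K G K G] mulx_assoc[OF alg] ..
  also have "\<dots> = SG (\<lambda>c d. SF (\<lambda>a b. ?X (c \<star> a) (d \<star> b)))" by (rule ev2_swap)
  also have "\<dots> = ?X \<^bold>1 \<^bold>1" by (rule SG_SF[OF f(2)])
  also have "\<dots> = SR (\<lambda>r s. SG (\<lambda>e k. gen (s \<rhd> k \<rhd> v) \<otimes>\<otimes> gen (r \<rhd> e \<rhd> u)))"
    by (simp add: mulx_one[OF alg] mulx_pp[OF alg] act_mul)
  also have "\<dots> = SG (\<lambda>e k. SR (\<lambda>r s. gen (s \<rhd> k \<rhd> v) \<otimes>\<otimes> gen (r \<rhd> e \<rhd> u)))" by (rule ev2_swap)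
  finally have 1: "psi (ev2 K RF (\<lambda>a b. gen (b \<rhd> v) \<otimes>\<otimes> gen (a \<rhd> u))) = \<dots>" .
  have 2: "psi (gen (SG (\<lambda>a b. br (a \<rhd> u) (b \<rhd> v)))) = SG (\<lambda>a b. gen (br (a \<rhd> u) (b \<rhd> v)))"
    unfolding psi_gen1 by (rule ev2_linx[OF linx_gen])
  show ?thesis
    unfolding M.rel_def KF_simps linx_diff[OF linx_psi] 1 2 psi_gen2 rel_def ev2_diff ..
qed

lemma q_psi: assumes "M.q x = 0" shows "q (psi x) = 0"
proof -
  have "q (psi (pp T x)) = 0"
    by (rule M.q_zero_induct[where P = "\<lambda>x. q (psi x) = 0", unfolded KF_simps])
       (simp_all add: psi_lin q_lin psi_rel psi_mul q_pull q_rel q_mul q_act mulU_zero ev2_0 assms)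
  then show ?thesis by (simp add: psi_pp)
qed

lemma chi_mul: "chi (y \<otimes>\<otimes> x) = SF (\<lambda>a b. actF a (chi y) \<otimes>\<otimes> actF b (chi x))"
proof -
  let ?r = "SF (\<lambda>a b. actF a (chi y) \<otimes>\<otimes> actF b (chi x))"
  have B: "bilx (\<lambda>a b. actT a y \<otimes>\<otimes> actT b x)" by (simp add: bilx_def linx_def Tbil)
  have "psi ?r = SF (\<lambda>c d. SG (\<lambda>a b. actT (a \<star> c) y \<otimes>\<otimes> actT (b \<star> d) x))"
    by (simp add: psi_lin psi_mul psi_actF psi_chi actT_mul)
  also have "\<dots> = SG (\<lambda>a b. SF (\<lambda>c d. actT (a \<star> c) y \<otimes>\<otimes> actT (b \<star> d) x))" by (rule ev2_swap)
  also have "\<dots> = y \<otimes>\<otimes> x" using SG_SF[OF B] by (simp add: actT_1)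
  finally have "psi ?r = y \<otimes>\<otimes> x" .
  then have "chi (y \<otimes>\<otimes> x) = pp T ?r" using chi_psi[of ?r] by simp
  also have "\<dots> = ?r" by (simp add: ev2_linx[OF linx_emb_prj[OF Tmod]])
  finally show ?thesis .
qed

lemma rel_lin: "rel (u + u') v = rel u v + rel u' v" "rel u (v + v') = rel u v + rel u v'"
  "rel (c \<bullet> u) v = c \<bullet> rel u v" "rel u (c \<bullet> v) = c \<bullet> rel u v"
  by (simp_all add: rel_def Tbil uvec.scale_right_diff_distrib)

lemma rel_pp: "rel (pp g u) (pp g v) = rel u v"
  by (simp add: rel_def)

lemma chi_rel: "chi (rel u v) = SF (\<lambda>a b. M.rel (a \<rhd> u) (b \<rhd> v))"
proof -
  let ?r = "SF (\<lambda>a b. M.rel (a \<rhd> u) (b \<rhd> v))"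
  have B: "bilx (\<lambda>a b. rel (a \<rhd> u) (b \<rhd> v))" by (simp add: bilx_def linx_def Tbil rel_lin)
  have "psi ?r = SF (\<lambda>c d. SG (\<lambda>a b. rel ((a \<star> c) \<rhd> u) ((b \<star> d) \<rhd> v)))"
    by (simp add: psi_lin psi_rel act_mul)
  also have "\<dots> = SG (\<lambda>a b. SF (\<lambda>c d. rel ((a \<star> c) \<rhd> u) ((b \<star> d) \<rhd> v)))" by (rule ev2_swap)
  also have "\<dots> = rel u v" using SG_SF[OF B] by (simp add: act_one rel_pp)
  finally have "psi ?r = rel u v" .
  then have "chi (rel u v) = pp T ?r" using chi_psi[of ?r] by simp
  also have "\<dots> = ?r"
    by (simp add: ev2_linx[OF linx_emb_prj[OF Tmod]] M.rel_def KF_simps pp_simps[OF Tmod])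
  finally show ?thesis .
qed

lemma Mq_pull: "M.q (cop h f) = cop h (\<lambda>a b. M.q (f a b))" "M.q (ev2 N S f') = ev2 N S (\<lambda>a b. M.q (f' a b))"
  by (rule cop_linx[OF M.linx_q] ev2_linx[OF M.linx_q])+

lemma Mq_mul: "M.q (x \<otimes>\<otimes> y) = mulx M.U (M.q x) (M.q y)"
  using M.q_mul[of x y] by (simp only: KF_simps)

lemma Mq_pp: "M.q (pp T x) = M.q x" "pp M.U (M.q x) = M.q x"
  using M.q_pp[of x] by (simp_all only: KF_simps)

text \<open>\<open>chi\<close> turns a product into the twisted product \<open>chi_mul\<close>, whose factors are acted upon.
  Hence the induction over the ideal is run for all translates \<open>actT h x\<close> at once.\<close>

lemma Mq_chi: assumes "q x = 0" shows "M.q (chi x) = 0"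
proof -
  have "\<forall>h. M.q (chi (actT h (pp T x))) = 0"
  proof (rule q_zero_induct[where P = "\<lambda>x. \<forall>h. M.q (chi (actT h x)) = 0"])
    show "\<forall>h. M.q (chi (actT h (rel u v))) = 0" for u v
      by (simp only: act_rel chi_lin chi_rel Mq_pull M.q_rel ev2_0 cop_0 simp_thms)
    \<comment> \<open>Absorbs the action produced by \<open>chi_mul\<close> into the translate of the induction hypothesis.\<close>
    have 1: "actF c (chi (actT a z)) = chi (actT (c \<star> a) z)" for c a z by (simp add: chi_actT actT_mul)
    show "\<forall>h. M.q (chi (actT h (y \<otimes>\<otimes> x))) = 0" "\<forall>h. M.q (chi (actT h (x \<otimes>\<otimes> y))) = 0"
      if "\<forall>h. M.q (chi (actT h x)) = 0" for x y
      using that by (simp_all only: actT_mulT chi_lin chi_mul 1 Mq_pull Mq_mul MmulU_zero ev2_0 cop_0 simp_thms)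
  qed (simp_all add: Tbil M.q_lin chi_lin assms)
  from this[rule_format, of "\<^bold>1"] show ?thesis by (simp add: actT_1 chi_pp)
qed

lemma Mq_iff: "M.q x = 0 \<longleftrightarrow> q (psi x) = 0"
proof
  assume "q (psi x) = 0"
  then have "M.q (chi (psi x)) = 0" by (rule Mq_chi)
  then show "M.q x = 0" by (simp add: chi_psi Mq_pp)
qed (rule q_psi)

lemma Mq_act: assumes "M.q x = 0" shows "M.q (actF h x) = 0"
  unfolding Mq_iff psi_actF by (rule q_act) (rule q_psi[OF assms])

text \<open>\<open>(\<epsilon> \<otimes> id)R\<^sub>F = 1\<close>, as \<open>\<epsilon>\<close> is multiplicative and removes the three factors of \<open>F\<^sub>2\<^sub>1 R G\<close> in
  turn.\<close>

lemma RF_eps: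
  assumes l: "linx f" shows "ev2 K RF (\<lambda>a b. eps a \<bullet> f b) = f \<^bold>1"
proof -
  have B: "bilx (\<lambda>a b. eps a \<bullet> f b)" by (simp add: bilx_def linx_def Kbil linx_simps[OF l])
  have lm: "linx (\<lambda>x. f (x \<star> y))" "linx (\<lambda>x. f (y \<star> x))" for y by (simp_all add: linx_def Kbil linx_simps[OF l])
  have "ev2 K RF (\<lambda>a b. eps a \<bullet> f b) = SF (\<lambda>a b. SR (\<lambda>c d. SG (\<lambda>e k. (eps b * eps c * eps e) \<bullet> f (a \<star> d \<star> k))))"
    by (simp add: RF_ev[OF B] eps_mult)
  also have "\<dots> = SF (\<lambda>a b. SR (\<lambda>c d. (eps b * eps c) \<bullet> SG (\<lambda>e k. eps e \<bullet> f (a \<star> d \<star> k))))"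
    by (simp add: ev2_usc[symmetric])
  also have "\<dots> = SF (\<lambda>a b. eps b \<bullet> SR (\<lambda>c d. eps c \<bullet> f (a \<star> d)))"
    by (simp add: G_eps(1)[OF lm(2)] mulx_one[OF alg] mulx_pp[OF alg] ev2_usc[symmetric])
  also have "\<dots> = SF (\<lambda>a b. eps b \<bullet> f (a \<star> \<^bold>1))" by (simp only: R_eps(1)[OF lm(2)])
  also have "\<dots> = f (\<^bold>1 \<star> \<^bold>1)" by (rule F_eps(2)[OF lm(1)])
  also have "\<dots> = f \<^bold>1" by (simp add: mulx_one[OF alg])
  finally show ?thesis .
qed

end

section \<open>The action and the coproduct on the enveloping algebra\<close>

text \<open>The properties by which the action and the coproduct are computed on the quotient: the
  ideal is stable, the action is unital, and \<open>(\<epsilon> \<otimes> id)R = 1\<close>. For the twisted data these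
  are \<open>Mq_act\<close>, \<open>actF_1\<close> and \<open>RF_eps\<close>.\<close>

locale ulied = lied K g R for K :: "('k::comm_ring_1, 'a) coalg" and g :: "('k, 'v, 'a) blie" and R :: "('k, 'a) tens" +
  assumes stable: "\<And>h x. q x = 0 \<Longrightarrow> q (actT h x) = 0"
    and act1: "\<And>t. actT \<^bold>1 t = pp T t"
    and Reps: "\<And>f :: _ \<Rightarrow> ('k, ('k, ('k, 'v) tens set) tens) uvec. linx f \<Longrightarrow> ev2 K R (\<lambda>a b. eps a \<bullet> f b) = f \<^bold>1"
begin

abbreviation lft where "lft k x \<equiv> tlift T (\<lambda>w. word_act K g w k) x"

lemma q_act_eq: assumes "q x = q y" shows "q (actT h x) = q (actT h y)"
proof -
  have "q (x - y) = 0" using assms by (simp add: linx_diff[OF linx_q])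
  then have "q (actT h (x - y)) = 0" by (rule stable)
  moreover have "linx (\<lambda>x. q (actT h x))" by (simp add: linx_def Tbil q_lin)
  ultimately show ?thesis using linx_diff[of "\<lambda>x. q (actT h x)" x y] by simp
qed

lemma act_U:
  assumes x: "x \<in> carrier T" and k: "k \<in> carrier K"
  shows "act U k (cls x) = cls (lft k x)" "cls (lft k x) \<in> carrier U"
    "emb U (cls (lft k x)) = q (actT (emb K k) (emb T x))"
proof -
  have 1: "cls (lft k y) \<in> carrier U" "emb U (cls (lft k y)) = q (actT (emb K k) (emb T y))" if y: "y \<in> carrier T" for y
    using cls_closed[OF actT_eq(1)[OF y k]] q_emb[OF actT_eq(1)[OF y k]] actT_eq(2)[OF y k] by simp_all
  have "descend (\<lambda>x. cls (lft k x)) (cls x) = cls (lft k x)"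
  proof (rule descend_eq[OF cls_self[OF x]])
    fix y assume y: "y \<in> cls x"
    note m = cls_mem[OF x y]
    have "q (emb T y) = q (emb T x)" using m by (simp only: q_emb x)
    then have "q (actT (emb K k) (emb T y)) = q (actT (emb K k) (emb T x))" by (rule q_act_eq)
    then have "emb U (cls (lft k y)) = emb U (cls (lft k x))" by (simp only: 1 m x)
    then show "cls (lft k y) = cls (lft k x)" by (simp only: emb_eq_iff[OF Umod 1(1)[OF m(1)] 1(1)[OF x]])
  qed
  then show "act U k (cls x) = cls (lft k x)" by (simp add: env_alg_def Let_def)
qed (rule cls_closed[OF actT_eq(1)[OF x k]], use q_emb[OF actT_eq(1)[OF x k]] actT_eq(2)[OF x k] in simp)

abbreviation actU (infixr \<open>\<rhd>\<rhd>\<close> 76) where "h \<rhd>\<rhd> z \<equiv> actx K U h z"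

lemma act_U_closed: "k \<in> carrier K \<Longrightarrow> z \<in> carrier U \<Longrightarrow> act U k z \<in> carrier U"
  by (elim U_E) (simp only: act_U)

lemma actU_q: "h \<rhd>\<rhd> q x = q (actT h x)"
proof -
  note c = prj_closed[OF Tmod, of x] and k = prj_closed[OF kmod, of h]
  have "prj U (q x) = cls (prj T x)" unfolding q_def by (rule prj_emb[OF Umod cls_closed[OF c]])
  then have "h \<rhd>\<rhd> q x = q (actT (pp K h) (pp T x))"
    unfolding actx_def by (simp only: act_U[OF c k])
  then show ?thesis by simp
qed

lemma actU_emb: "k \<in> carrier K \<Longrightarrow> z \<in> carrier U \<Longrightarrow> emb U (act U k z) = emb K k \<rhd>\<rhd> emb U z"
  by (simp add: actx_def prj_emb[OF kmod] prj_emb[OF Umod])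

lemma actU_pp [simp]: "pp K h \<rhd>\<rhd> z = h \<rhd>\<rhd> z" "h \<rhd>\<rhd> pp U z = h \<rhd>\<rhd> z" "pp U (h \<rhd>\<rhd> z) = h \<rhd>\<rhd> z"
  by (simp_all add: actx_def prj_emb[OF kmod prj_closed[OF kmod]] prj_emb[OF Umod prj_closed[OF Umod]]
      prj_emb[OF Umod act_U_closed[OF prj_closed[OF kmod] prj_closed[OF Umod]]])

lemma q_rep: "\<exists>x. (\<forall>h. h \<rhd>\<rhd> z = h \<rhd>\<rhd> q x) \<and> pp U z = q x"
proof -
  obtain x where x: "pp U z = q x" by (rule q_surj)
  have "h \<rhd>\<rhd> z = h \<rhd>\<rhd> q x" for h unfolding x[symmetric] by simp
  then show ?thesis using x by blast
qed

lemma actU_bil: "(h + h') \<rhd>\<rhd> z = h \<rhd>\<rhd> z + h' \<rhd>\<rhd> z" "h \<rhd>\<rhd> (z + z') = h \<rhd>\<rhd> z + h \<rhd>\<rhd> z'"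
  "(c \<bullet> h) \<rhd>\<rhd> z = c \<bullet> h \<rhd>\<rhd> z" "h \<rhd>\<rhd> (c \<bullet> z) = c \<bullet> h \<rhd>\<rhd> z"
proof -
  obtain x where x0: "\<forall>h. h \<rhd>\<rhd> z = h \<rhd>\<rhd> q x" "pp U z = q x" using q_rep[of z] by blast
  note x = x0(1)[rule_format] x0(2)
  obtain y where y0: "\<forall>h. h \<rhd>\<rhd> z' = h \<rhd>\<rhd> q y" "pp U z' = q y" using q_rep[of z'] by blast
  note y = y0(1)[rule_format] y0(2)
  show "(h + h') \<rhd>\<rhd> z = h \<rhd>\<rhd> z + h' \<rhd>\<rhd> z" "(c \<bullet> h) \<rhd>\<rhd> z = c \<bullet> h \<rhd>\<rhd> z"
    unfolding x(1) actU_q by (simp_all add: actT_bil q_lin)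
  have e: "pp U (z + z') = q (x + y)" "pp U (c \<bullet> z) = q (c \<bullet> x)"
    by (simp_all only: pp_simps[OF Umod] x(2) y(2) q_lin)
  have "h \<rhd>\<rhd> (z + z') = q (actT h (x + y))" "h \<rhd>\<rhd> (c \<bullet> z) = q (actT h (c \<bullet> x))"
    unfolding actU_q[symmetric] e[symmetric] actU_pp by (rule refl)+
  then show "h \<rhd>\<rhd> (z + z') = h \<rhd>\<rhd> z + h \<rhd>\<rhd> z'" "h \<rhd>\<rhd> (c \<bullet> z) = c \<bullet> h \<rhd>\<rhd> z"
    unfolding x(1) y(1) actU_q by (simp_all only: actT_bil q_lin)
qed

lemma actU_oneU: "h \<rhd>\<rhd> oneU = eps h \<bullet> oneU"
  unfolding q_one[symmetric] actU_q actT_one q_lin ..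

lemma actU_1: "\<^bold>1 \<rhd>\<rhd> z = pp U z"
proof -
  obtain x where x0: "\<forall>h. h \<rhd>\<rhd> z = h \<rhd>\<rhd> q x" "pp U z = q x" using q_rep[of z] by blast
  note x = x0(1)[rule_format] x0(2)
  show ?thesis unfolding x actU_q act1 by simp
qed

lemma one_closed_U: "\<one>\<^bsub>U\<^esub> \<in> carrier U"
  unfolding U_simps(3) by (rule cls_closed[OF oneT_closed])

lemma pp_oneU [simp]: "pp U oneU = oneU"
  by (simp only: prj_emb[OF Umod one_closed_U])

abbreviation pur where "pur \<equiv> pr2 U"

lemma pur_pp [simp]: "pur (pp U a) c = pur a c" "pur a (pp U c) = pur a c" "pp (tspace {2} U) (pur a c) = pur a c"
  unfolding pr2_def by (simp_all only: prj_emb[OF Umod prj_closed[OF Umod]]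
    prj_emb[OF kmodule_tspace pure_closed[OF words2I[OF prj_closed[OF Umod] prj_closed[OF Umod]]]])

lemma pur_emb: "x \<in> carrier U \<Longrightarrow> y \<in> carrier U \<Longrightarrow>
  pure {2} U [x, y] \<in> carrier (tspace {2} U) \<and> emb (tspace {2} U) (pure {2} U [x, y]) = pur (emb U x) (emb U y)"
  by (simp add: pr2_def prj_emb[OF Umod] pure_closed words2I)

lemmas pur_bil = bilxD[OF bilx_pr2[OF Umod]]
lemmas Ubil = Tbil mulx_bil[OF Ualg] actU_bil pur_bil q_lin

text \<open>Evaluation of a bilinear function on a tensor \<open>z\<close> over \<open>\<U>(\<gg>)\<close> given as an element of
  \<open>uvec\<close>, so that it is linear in \<open>z\<close>.\<close>

definition lf :: "(('k, ('k, 'v) tens set) uvec \<Rightarrow> ('k, ('k, 'v) tens set) uvec \<Rightarrow> ('k, 'n) uvec)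
    \<Rightarrow> ('k, ('k, ('k, 'v) tens set) tens) uvec \<Rightarrow> ('k, 'n) uvec" where
  "lf f z = ev2 U (prj (tspace {2} U) z) f"

lemma linx_lf: "bilx f \<Longrightarrow> linx (lf f)"
  unfolding lf_def[abs_def] by (rule linx_ev2_prj[OF Umod])

lemma lf_lin: "bilx f \<Longrightarrow> lf f (x + y) = lf f x + lf f y" "bilx f \<Longrightarrow> lf f (c \<bullet> x) = c \<bullet> lf f x"
  using linx_lf[of f] by (simp_all add: linx_def)

lemma lf_fun: "lf (\<lambda>a b. f a b + k a b) z = lf f z + lf k z" "lf (\<lambda>a b. c \<bullet> f a b) z = c \<bullet> lf f z"
  by (simp_all add: lf_def ev2_plus ev2_usc)

lemma lf_pur: "bilx f \<Longrightarrow> lf f (pur a c) = f (pp U a) (pp U c)"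
  unfolding lf_def by (rule ev2_pr2[OF Umod])

lemma lf_ext: "linx f \<Longrightarrow> f (pp (tspace {2} U) z) = lf (\<lambda>a c. f (pur a c)) z"
  unfolding lf_def ev2_pr2_id[OF Umod prj_closed[OF kmodule_tspace], symmetric] by (rule ev2_linx)

lemma lf_linx: "linx k \<Longrightarrow> k (lf f z) = lf (\<lambda>a c. k (f a c)) z"
  unfolding lf_def by (rule ev2_linx)

lemma lf_swap: "lf (\<lambda>a c. ev2 N S (\<lambda>x y. f a c x y)) z = ev2 N S (\<lambda>x y. lf (\<lambda>a c. f a c x y) z)"
  unfolding lf_def by (rule ev2_swap)

lemma lf_swap_cop: "lf (\<lambda>a c. cop h (\<lambda>x y. f a c x y)) z = cop h (\<lambda>x y. lf (\<lambda>a c. f a c x y) z)"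
  unfolding lf_def cop_def by (rule ev2_swap)

lemma lf_cong: "(\<And>a c. pp U a = a \<Longrightarrow> pp U c = c \<Longrightarrow> f a c = k a c) \<Longrightarrow> lf f z = lf k z"
  unfolding lf_def by (rule ev2_cong[OF Umod prj_closed[OF kmodule_tspace]])

lemma lf_pp [simp]: "lf f (pp (tspace {2} U) z) = lf f z"
  unfolding lf_def prj_emb[OF kmodule_tspace prj_closed[OF kmodule_tspace]] ..

abbreviation Bs where "Bs \<equiv> braided_square R U"

lemma Bs_simps: "carrier Bs = carrier (tspace {2} U)" "add Bs = add (tspace {2} U)" "ring.zero Bs = ring.zero (tspace {2} U)"
  "smult Bs = smult (tspace {2} U)" "\<one>\<^bsub>Bs\<^esub> = pure {2} U [\<one>\<^bsub>U\<^esub>, \<one>\<^bsub>U\<^esub>]"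
  by (simp_all add: braided_square_def)

lemma emb_Bs: "emb Bs = emb (tspace {2} U)" "prj Bs = prj (tspace {2} U)"
  by (rule emb_cong; simp only: Bs_simps)+

lemma kmodule_Bs: "kmodule Bs"
  using kmodule_cong[of Bs "tspace {2} U", OF Bs_simps(1,2,4,3)] by simp

text \<open>The product \<open>(a \<boxtimes> c)(a' \<boxtimes> c')\<close> of the braided square.\<close>

abbreviation braid where
  "braid a c a' c' \<equiv> ev2 K R (\<lambda>r s. pur (a \<odot>\<odot> s \<rhd>\<rhd> a') ((r \<rhd>\<rhd> c) \<odot>\<odot> c'))"

lemma Bs_mult:
  assumes S: "S \<in> carrier (tspace {2} U)" and V: "V \<in> carrier (tspace {2} U)"
  shows "S \<otimes>\<^bsub>Bs\<^esub> V \<in> carrier (tspace {2} U)"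
    "emb (tspace {2} U) (S \<otimes>\<^bsub>Bs\<^esub> V) = ev2 U S (\<lambda>a c. ev2 U V (\<lambda>a' c'. braid a c a' c'))"
proof -
  interpret ring U by (rule ringU)
  let ?i = "\<lambda>x y. tlift (tspace {2} U) (\<lambda>r. pure {2} U [(x!0) \<otimes>\<^bsub>U\<^esub> act U (r!1) (y!0), act U (r!0) (x!1) \<otimes>\<^bsub>U\<^esub> (y!1)]) R"
  have b: "bilx (\<lambda>r s. pur (a \<odot>\<odot> s \<rhd>\<rhd> a') ((r \<rhd>\<rhd> c) \<odot>\<odot> c'))" for a c a' c'
    by (simp add: bilx_def linx_def Ubil)
  have b2: "bilx (\<lambda>a' c'. braid a c a' c')" for a c by (simp add: bilx_def linx_def Ubil)
  have b3: "bilx (\<lambda>a c. ev2 U V (\<lambda>a' c'. braid a c a' c'))" by (simp add: bilx_def linx_def Ubil)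
  have i: "?i [a, c] [a', c'] \<in> carrier (tspace {2} U) \<and>
     emb (tspace {2} U) (?i [a, c] [a', c']) = braid (emb U a) (emb U c) (emb U a') (emb U c')"
    if "a \<in> carrier U" "c \<in> carrier U" "a' \<in> carrier U" "c' \<in> carrier U" for a c a' c'
  proof -
    have p: "pure {2} U [a \<otimes>\<^bsub>U\<^esub> act U y a', act U x c \<otimes>\<^bsub>U\<^esub> c'] \<in> carrier (tspace {2} U) \<and>
      emb (tspace {2} U) (pure {2} U [a \<otimes>\<^bsub>U\<^esub> act U y a', act U x c \<otimes>\<^bsub>U\<^esub> c'])
       = pur (emb U a \<odot>\<odot> emb K y \<rhd>\<rhd> emb U a') ((emb K x \<rhd>\<rhd> emb U c) \<odot>\<odot> emb U c')"
      if "x \<in> carrier K" "y \<in> carrier K" for x y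
      using that \<open>a \<in> carrier U\<close> \<open>c \<in> carrier U\<close> \<open>a' \<in> carrier U\<close> \<open>c' \<in> carrier U\<close>
      by (simp only: pur_emb act_U_closed m_closed emb_mult[OF Ualg] actU_emb simp_thms)
    show ?thesis
      by (intro conjI; rule tlift2[OF kmod kmodule_tspace Rc b]; use p in \<open>simp only: nth_Cons_0 nth_Cons_Suc One_nat_def simp_thms\<close>)
  qed
  let ?j = "\<lambda>x. tlift (tspace {2} U) (\<lambda>y. ?i x y) V"
  have j: "?j [a, c] \<in> carrier (tspace {2} U) \<and>
     emb (tspace {2} U) (?j [a, c]) = ev2 U V (\<lambda>a' c'. braid (emb U a) (emb U c) a' c')"
    if "a \<in> carrier U" "c \<in> carrier U" for a c
    by (intro conjI; rule tlift2[OF Umod kmodule_tspace V b2]; rule i[OF that]; assumption)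
  have e: "S \<otimes>\<^bsub>Bs\<^esub> V = tlift (tspace {2} U) ?j S" by (simp add: braided_square_def)
  show "S \<otimes>\<^bsub>Bs\<^esub> V \<in> carrier (tspace {2} U)"
    "emb (tspace {2} U) (S \<otimes>\<^bsub>Bs\<^esub> V) = ev2 U S (\<lambda>a c. ev2 U V (\<lambda>a' c'. braid a c a' c'))"
    unfolding e by (rule tlift2[OF Umod kmodule_tspace S b3]; rule j; assumption)+
qed

text \<open>Left multiplication by \<open>v \<boxtimes> 1 + 1 \<boxtimes> v\<close> in the braided square. Words act by composites of
  these operators, so the coproduct of a word is defined and computed without
  associativity of the braided square.\<close>

definition opD where
  "opD v z = lf (\<lambda>a c. pur (q (gen v) \<odot>\<odot> a) c + ev2 K R (\<lambda>r s. pur (s \<rhd>\<rhd> a) ((r \<rhd>\<rhd> q (gen v)) \<odot>\<odot> c))) z"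

lemma opD_fun: "bilx (\<lambda>a c. pur (q (gen v) \<odot>\<odot> a) c + ev2 K R (\<lambda>r s. pur (s \<rhd>\<rhd> a) ((r \<rhd>\<rhd> q (gen v)) \<odot>\<odot> c)))"
  by (simp add: bilx_def linx_def Ubil)

lemma bilx_opD: "bilx opD"
  unfolding bilx_def linx_def opD_def
proof (intro conjI allI)
  show "lf (\<lambda>a c. pur (q (gen v) \<odot>\<odot> a) c + ev2 K R (\<lambda>r s. pur (s \<rhd>\<rhd> a) ((r \<rhd>\<rhd> q (gen v)) \<odot>\<odot> c))) (x + y)
     = lf (\<lambda>a c. pur (q (gen v) \<odot>\<odot> a) c + ev2 K R (\<lambda>r s. pur (s \<rhd>\<rhd> a) ((r \<rhd>\<rhd> q (gen v)) \<odot>\<odot> c))) x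
     + lf (\<lambda>a c. pur (q (gen v) \<odot>\<odot> a) c + ev2 K R (\<lambda>r s. pur (s \<rhd>\<rhd> a) ((r \<rhd>\<rhd> q (gen v)) \<odot>\<odot> c))) y" for v x y
    by (rule lf_lin(1)[OF opD_fun])
  show "lf (\<lambda>a c. pur (q (gen v) \<odot>\<odot> a) c + ev2 K R (\<lambda>r s. pur (s \<rhd>\<rhd> a) ((r \<rhd>\<rhd> q (gen v)) \<odot>\<odot> c))) (k \<bullet> x)
     = k \<bullet> lf (\<lambda>a c. pur (q (gen v) \<odot>\<odot> a) c + ev2 K R (\<lambda>r s. pur (s \<rhd>\<rhd> a) ((r \<rhd>\<rhd> q (gen v)) \<odot>\<odot> c))) x" for v x k
    by (rule lf_lin(2)[OF opD_fun])
qed (simp_all add: Ubil lf_fun)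

lemma opD_pur: "opD v (pur a c) = pur (q (gen v) \<odot>\<odot> a) c + ev2 K R (\<lambda>r s. pur (s \<rhd>\<rhd> a) ((r \<rhd>\<rhd> q (gen v)) \<odot>\<odot> c))"
  unfolding opD_def lf_pur[OF opD_fun] by (simp add: mulx_pp[OF Ualg])

lemma env_gen_emb: "u \<in> carrier g \<Longrightarrow> env_gen R g u \<in> carrier U \<and> emb U (env_gen R g u) = q (gen (emb g u))"
  using pure_closed_T[of "[u]"] by (simp add: env_gen_def cls_closed gen_emb q_emb)

lemma word_comul:
  assumes "set w \<subseteq> carrier g"
  shows "word_comul K R g w \<in> carrier (tspace {2} U) \<and> emb (tspace {2} U) (word_comul K R g w) = foldw opD (pur oneU oneU) w"
  using assms
proof (induction w)
  case Nil
  show ?case using pur_emb[OF one_closed_U one_closed_U] by (simp add: Bs_simps foldw_def)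
next
  case (Cons u w)
  let ?W = "word_comul K R g w" and ?u = "env_gen R g u" and ?q = "q (gen (emb g u))"
  have u: "?u \<in> carrier U" "emb U ?u = ?q" using env_gen_emb[of u] Cons.prems by simp_all
  have W: "?W \<in> carrier (tspace {2} U)" "emb (tspace {2} U) ?W = foldw opD (pur oneU oneU) w"
    using Cons by simp_all
  let ?S = "pure {2} U [?u, \<one>\<^bsub>U\<^esub>]" and ?V = "pure {2} U [\<one>\<^bsub>U\<^esub>, ?u]"
  have SV: "?S \<in> carrier (tspace {2} U)" "?V \<in> carrier (tspace {2} U)"
    using pur_emb[OF u(1) one_closed_U] pur_emb[OF one_closed_U u(1)] by blast+
  have B: "bilx (\<lambda>a c. ev2 U ?W (\<lambda>a' c'. braid a c a' c'))" by (simp add: bilx_def linx_def Ubil)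
  have e: "word_comul K R g (u # w) = (?S \<oplus>\<^bsub>tspace {2} U\<^esub> ?V) \<otimes>\<^bsub>Bs\<^esub> ?W"
    by (simp add: Let_def Bs_simps)
  have c: "?S \<oplus>\<^bsub>tspace {2} U\<^esub> ?V \<in> carrier (tspace {2} U)" by (rule module_simps(1)[OF kmodule_tspace SV])
  have 1: "braid ?q oneU a' c' = pur (?q \<odot>\<odot> a') c'" for a' c'
  proof -
    have l: "linx (\<lambda>s. pur (?q \<odot>\<odot> s \<rhd>\<rhd> a') c')" by (simp add: linx_def Ubil)
    have "braid ?q oneU a' c' = ev2 K R (\<lambda>r s. eps r \<bullet> pur (?q \<odot>\<odot> s \<rhd>\<rhd> a') c')"
      by (simp add: actU_oneU mulx_bil[OF Ualg] mulx_one[OF Ualg] pur_bil)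
    also have "\<dots> = pur (?q \<odot>\<odot> \<^bold>1 \<rhd>\<rhd> a') c'" by (rule Reps[OF l])
    finally show ?thesis by (simp add: actU_1 mulx_pp[OF Ualg])
  qed
  have 2: "braid oneU ?q a' c' = ev2 K R (\<lambda>r s. pur (s \<rhd>\<rhd> a') ((r \<rhd>\<rhd> ?q) \<odot>\<odot> c'))" for a' c'
    by (simp add: mulx_one[OF Ualg])
  have "emb (tspace {2} U) (word_comul K R g (u # w)) = ev2 U ?W (\<lambda>a' c'. braid ?q oneU a' c') + ev2 U ?W (\<lambda>a' c'. braid oneU ?q a' c')"
    unfolding e Bs_mult(2)[OF c W(1)] ev2_add[OF Umod B SV] ev2_pure[OF Umod B] u(2) ..
  also have "\<dots> = opD (emb g u) (emb (tspace {2} U) ?W)"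
    unfolding opD_def lf_def prj_emb[OF kmodule_tspace W(1)] 1 2 ev2_plus ..
  finally show ?case using Bs_mult(1)[OF c W(1)] unfolding W(2) e by (simp add: foldw_def)
qed

text \<open>The coproduct on \<open>T(\<gg>)\<close> with values in \<open>\<U>(\<gg>) \<boxtimes> \<U>(\<gg>)\<close>. Whether it vanishes on the ideal
  of relations is a hypothesis of \<open>comul_E\<close>, since this is shown by different arguments
  for \<open>\<gg>\<close> and for \<open>\<gg>\<^sub>F\<close>.\<close>

definition delta where "delta = recT opD (pur oneU oneU)"

lemma linx_delta: "linx delta" and delta_one: "delta oneT = pur oneU oneU"
  and delta_gen: "delta (gen v \<otimes>\<otimes> t) = opD v (delta t)" and delta_pp [simp]: "delta (pp T x) = delta x"
  using recT[OF bilx_opD, of "pur oneU oneU"] by (simp_all add: delta_def opD_def)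

lemma pp_delta [simp]: "pp (tspace {2} U) (delta t) = delta t"
proof -
  have "pp (tspace {2} U) (delta (pp T t)) = delta (pp T t)"
  proof (rule T_induct[where P = "\<lambda>x. pp (tspace {2} U) (delta x) = delta x"])
    fix v t
    show "pp (tspace {2} U) (delta (gen v \<otimes>\<otimes> t)) = delta (gen v \<otimes>\<otimes> t)"
      unfolding delta_gen opD_def
      by (simp add: lf_linx[OF linx_emb_prj[OF kmodule_tspace]] pp_simps[OF kmodule_tspace]
          ev2_linx[OF linx_emb_prj[OF kmodule_tspace]])
  qed (simp_all add: pp_simps[OF kmodule_tspace] linx_simps[OF linx_delta] delta_one)
  then show ?thesis by simp
qed

definition cou where "cou = recT (\<lambda>v z. 0) (emb scal 1)"

lemma kmodule_scal: "kmodule scal"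
proof -
  have "abelian_group scal" by (rule ring.axioms(1)[OF cring.axioms(1)[OF cring_scal]])
  then show ?thesis by (simp add: module_scal_iff algebra_simps)
qed

lemma bilx_0: "bilx (\<lambda>v z. 0)" by (simp add: bilx_def linx_def)

lemma linx_cou: "linx cou" and cou_one: "cou oneT = emb scal 1"
  and cou_gen: "cou (gen v \<otimes>\<otimes> t) = 0" and cou_pp [simp]: "cou (pp T x) = cou x"
  using recT[OF bilx_0, of "emb scal 1"] by (simp_all add: cou_def)

lemma cou_mul: "cou (x \<otimes>\<otimes> y) = prj scal (cou x) \<bullet> cou y"
proof -
  have "cou (pp T x \<otimes>\<otimes> y) = prj scal (cou (pp T x)) \<bullet> cou y"
    by (rule T_linear_eq[where f = "\<lambda>x. cou (x \<otimes>\<otimes> y)" and h = "\<lambda>x. prj scal (cou x) \<bullet> cou y"])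
       (simp_all add: linx_def Tbil linx_simps[OF linx_cou] prj_add[OF kmodule_scal] prj_usc[OF kmodule_scal]
          prj_zero[OF kmodule_scal] prj_emb[OF kmodule_scal] cou_one cou_gen mulT_assoc)
  then show ?thesis by simp
qed

lemma cou_gen1: "cou (gen v) = 0"
  using cou_gen[of v oneT] by simp

lemma cou_ideal: assumes "q x = 0" shows "cou x = 0"
proof -
  have "cou (pp T x) = 0"
    by (rule q_zero_induct[where P = "\<lambda>x. cou x = 0"])
       (simp_all add: linx_simps[OF linx_cou] cou_mul prj_zero[OF kmodule_scal] rel_def cou_gen cou_gen1
         ev2_linx[OF linx_cou] ev2_0 assms)
  then show ?thesis by simp
qed

abbreviation E where "E \<equiv> enveloping K R g"

lemma E_simps: "carrier E = carrier U" "mult E = mult U" "\<one>\<^bsub>E\<^esub> = \<one>\<^bsub>U\<^esub>" "ring.zero E = ring.zero U" "add E = add U"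
  "smult E = smult U" "act E = act U"
  by (simp_all add: enveloping_def Let_def)

lemma emb_E: "emb E = emb U" "prj E = prj U"
  by (rule emb_cong; simp only: E_simps)+

lemma tspace_E: "tspace D E = tspace D U" "pure D E = pure D U"
  by (rule tspace_cong; simp only: E_simps)+

lemma counit_E: assumes x: "x \<in> carrier T" shows "bcounit E (cls x) = prj scal (cou (emb T x))"
proof -
  let ?b = "\<lambda>w. if w = [] then 1 else 0 :: 'k"
  have f: "foldw (\<lambda>v z. 0) (emb scal 1) = (\<lambda>w. emb scal (?b w))"
    using emb_zero[OF kmodule_scal] by (auto simp: foldw_def fun_eq_iff neq_Nil_conv)
  have t: "tlift scal ?b y = prj scal (cou (emb T y))" if y: "y \<in> carrier T" for y
  proof -
    have y': "y \<in> carrier (tspace UNIV g)" using y by simp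
    have "emb scal (tlift scal ?b y) = tev y (\<lambda>w. emb scal (?b w))"
      by (rule emb_tlift(2)[OF gmod kmodule_scal y' _ mlin_foldw[OF bilx_0, of "emb scal 1", unfolded f]]) simp
    also have "\<dots> = cou (emb T y)" unfolding cou_def recT_def f prj_emb[OF Tmod y] ..
    finally have "prj scal (emb scal (tlift scal ?b y)) = prj scal (cou (emb T y))" by simp
    then show ?thesis by (simp add: prj_emb[OF kmodule_scal])
  qed
  have "descend (tlift scal ?b) (cls x) = prj scal (cou (emb T x))"
  proof (rule descend_eq[OF cls_self[OF x]])
    fix y assume y: "y \<in> cls x"
    note m = cls_mem[OF x y]
    have "q (emb T y - emb T x) = 0" using m by (simp only: linx_diff[OF linx_q] q_emb x) simp
    then have "cou (emb T y) = cou (emb T x)" using cou_ideal[of "emb T y - emb T x"] by (simp add: linx_diff[OF linx_cou])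
    then show "tlift scal ?b y = prj scal (cou (emb T x))" by (simp only: t m)
  qed
  then show ?thesis by (simp add: enveloping_def Let_def)
qed

lemma comul_E:
  assumes d: "\<And>x. q x = 0 \<Longrightarrow> delta x = 0" and x: "x \<in> carrier T"
  shows "bcomul E (cls x) \<in> carrier (tspace {2} U)" "emb (tspace {2} U) (bcomul E (cls x)) = delta (emb T x)"
proof -
  note ml = mlin_foldw[OF bilx_opD, of "pur oneU oneU"]
  have t: "tlift Bs (word_comul K R g) y \<in> carrier (tspace {2} U)"
     "emb (tspace {2} U) (tlift Bs (word_comul K R g) y) = delta (emb T y)" if y: "y \<in> carrier T" for y
  proof -
    have y': "y \<in> carrier (tspace UNIV g)" using y by simp
    have wc: "word_comul K R g w \<in> carrier Bs" "emb Bs (word_comul K R g w) = foldw opD (pur oneU oneU) w"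
      if "w \<in> words UNIV g" for w
      using word_comul[of w] that by (simp_all add: words_def Bs_simps emb_Bs)
    have ml': "mlin UNIV g (\<lambda>w. emb Bs (word_comul K R g w))"
      using ml unfolding mlin_def
      by (simp add: wc words_insert module_simps[OF gmod] words_def[of UNIV g])
    show "tlift Bs (word_comul K R g) y \<in> carrier (tspace {2} U)"
      using emb_tlift(1)[OF gmod kmodule_Bs y' wc(1) ml'] by (simp add: Bs_simps)
    have "emb Bs (tlift Bs (word_comul K R g) y) = tev y (\<lambda>w. emb Bs (word_comul K R g w))"
      by (rule emb_tlift(2)[OF gmod kmodule_Bs y' _ ml']) (rule wc(1))
    also have "\<dots> = tev y (foldw opD (pur oneU oneU))"
      by (rule tev_cong[OF gmod y']) (rule wc(2))
    also have "\<dots> = delta (emb T y)" unfolding delta_def recT_def prj_emb[OF Tmod y] ..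
    finally show "emb (tspace {2} U) (tlift Bs (word_comul K R g) y) = delta (emb T y)" unfolding emb_Bs .
  qed
  have "descend (tlift Bs (word_comul K R g)) (cls x) = tlift Bs (word_comul K R g) x"
  proof (rule descend_eq[OF cls_self[OF x]])
    fix y assume y: "y \<in> cls x"
    note m = cls_mem[OF x y]
    have "q (emb T y - emb T x) = 0" using m by (simp only: linx_diff[OF linx_q] q_emb x) simp
    then have "delta (emb T y) = delta (emb T x)" using d[of "emb T y - emb T x"] by (simp add: linx_diff[OF linx_delta])
    then have "emb (tspace {2} U) (tlift Bs (word_comul K R g) y) = emb (tspace {2} U) (tlift Bs (word_comul K R g) x)"
      by (simp only: t m x)
    then show "tlift Bs (word_comul K R g) y = tlift Bs (word_comul K R g) x"
      by (simp only: emb_eq_iff[OF kmodule_tspace t(1)[OF m(1)] t(1)[OF x]])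
  qed
  then have e: "bcomul E (cls x) = tlift Bs (word_comul K R g) x" by (simp add: enveloping_def Let_def)
  show "bcomul E (cls x) \<in> carrier (tspace {2} U)" "emb (tspace {2} U) (bcomul E (cls x)) = delta (emb T x)"
    unfolding e by (rule t[OF x])+
qed

end

section \<open>The coproduct of the enveloping algebra is well defined and equivariant\<close>

sublocale full \<subseteq> ulied K g R
  by unfold_locales (rule q_act, assumption, rule actT_1, rule R_eps(1), assumption)

context full
begin

lemma one_KF: "\<one>\<^bsub>KF\<^esub> = \<one>\<^bsub>K\<^esub>"
  by (simp add: twist_hopf_def)

lemma M_ulied: "ulied KF gF RF"
proof unfold_locales
  show "M.q x = 0 \<Longrightarrow> M.q (M.actT h x) = 0" for h x by (rule Mq_act)
  show "M.actT (emb KF \<one>\<^bsub>KF\<^esub>) t = pp M.T t" for t by (simp only: KF_simps one_KF actF_1)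
  show "ev2 KF RF (\<lambda>a b. M.eps a \<bullet> f b) = f (emb KF \<one>\<^bsub>KF\<^esub>)" if "linx f"
    for f :: "_ \<Rightarrow> ('k, ('k, ('k, 'v) tens set) tens) uvec"
    using RF_eps[OF that] by (simp only: KF_simps one_KF)
qed

end

sublocale full \<subseteq> M: ulied "twist_hopf K F" "twist_lie K F g" "twist_R K F R"
  by (rule M_ulied)

context full
begin

lemma pullU:
  "x \<odot>\<odot> cop h f = cop h (\<lambda>a b. x \<odot>\<odot> f a b)" "cop h f \<odot>\<odot> x = cop h (\<lambda>a b. f a b \<odot>\<odot> x)"
  "k \<rhd>\<rhd> cop h f = cop h (\<lambda>a b. k \<rhd>\<rhd> f a b)"
  "pur (cop h f) x = cop h (\<lambda>a b. pur (f a b) x)" "pur x (cop h f) = cop h (\<lambda>a b. pur x (f a b))"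
  "opD v (cop h f') = cop h (\<lambda>a b. opD v (f' a b))" "opD v (ev2 N S f'') = ev2 N S (\<lambda>a b. opD v (f'' a b))"
proof -
  have l: "linx (\<lambda>y. x \<odot>\<odot> y)" "linx (\<lambda>y. y \<odot>\<odot> x)" "linx (\<lambda>y. k \<rhd>\<rhd> y)" "linx (\<lambda>y. pur y x)" "linx (\<lambda>y. pur x y)"
    "linx (opD v)" for x k v
    using bilx_opD by (simp_all add: linx_def Ubil bilx_def)
  show "x \<odot>\<odot> cop h f = cop h (\<lambda>a b. x \<odot>\<odot> f a b)" by (rule cop_linx[OF l(1)])
  show "cop h f \<odot>\<odot> x = cop h (\<lambda>a b. f a b \<odot>\<odot> x)" by (rule cop_linx[OF l(2)])
  show "k \<rhd>\<rhd> cop h f = cop h (\<lambda>a b. k \<rhd>\<rhd> f a b)" by (rule cop_linx[OF l(3)])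
  show "pur (cop h f) x = cop h (\<lambda>a b. pur (f a b) x)" by (rule cop_linx[OF l(4)])
  show "pur x (cop h f) = cop h (\<lambda>a b. pur x (f a b))" by (rule cop_linx[OF l(5)])
  show "opD v (cop h f') = cop h (\<lambda>a b. opD v (f' a b))" by (rule cop_linx[OF l(6)])
  show "opD v (ev2 N S f'') = ev2 N S (\<lambda>a b. opD v (f'' a b))" by (rule ev2_linx[OF l(6)])
qed

lemma actU_mulU: "h \<rhd>\<rhd> (x \<odot>\<odot> y) = cop h (\<lambda>a b. (a \<rhd>\<rhd> x) \<odot>\<odot> (b \<rhd>\<rhd> y))"
proof -
  obtain s where s: "\<forall>h. h \<rhd>\<rhd> x = h \<rhd>\<rhd> q s" "pp U x = q s" using q_rep[of x] by blast
  obtain t where t: "\<forall>h. h \<rhd>\<rhd> y = h \<rhd>\<rhd> q t" "pp U y = q t" using q_rep[of y] by blast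
  have "x \<odot>\<odot> y = q (s \<otimes>\<otimes> t)" unfolding q_mul s(2)[symmetric] t(2)[symmetric] by (simp add: mulx_pp[OF Ualg])
  then have "h \<rhd>\<rhd> (x \<odot>\<odot> y) = q (actT h (s \<otimes>\<otimes> t))" by (simp only:) (rule actU_q)
  also have "\<dots> = cop h (\<lambda>a b. q (actT a s) \<odot>\<odot> q (actT b t))"
    by (simp only: actT_mulT q_pull q_mul)
  finally show ?thesis by (simp only: s(1)[rule_format] t(1)[rule_format] actU_q)
qed

lemma actU_mul: "(h \<star> k) \<rhd>\<rhd> z = h \<rhd>\<rhd> k \<rhd>\<rhd> z"
proof -
  obtain s where s: "\<forall>h. h \<rhd>\<rhd> z = h \<rhd>\<rhd> q s" "pp U z = q s" using q_rep[of z] by blast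
  show ?thesis unfolding s(1)[rule_format] actU_q actT_mul ..
qed

abbreviation qg where "qg v \<equiv> q (gen v)"

lemma qg_act: "qg (h \<rhd> v) = h \<rhd>\<rhd> qg v"
  by (simp only: actU_q actT_gen1)

lemma mulU_simps [simp]: "pp U x \<odot>\<odot> y = x \<odot>\<odot> y" "x \<odot>\<odot> pp U y = x \<odot>\<odot> y" "pp U (x \<odot>\<odot> y) = x \<odot>\<odot> y"
  "oneU \<odot>\<odot> x = pp U x" "x \<odot>\<odot> oneU = pp U x"
  by (simp_all add: mulx_pp[OF Ualg] mulx_one[OF Ualg])

lemma ev2_rev3: "ev2 N S (\<lambda>r s. ev2 P V (\<lambda>e k. ev2 Q W (\<lambda>c d. f r s e k c d)))
   = ev2 Q W (\<lambda>c d. ev2 P V (\<lambda>e k. ev2 N S (\<lambda>r s. f r s e k c d)))"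
proof -
  have "ev2 N S (\<lambda>r s. ev2 P V (\<lambda>e k. f r s e k c d)) = ev2 P V (\<lambda>e k. ev2 N S (\<lambda>r s. f r s e k c d))" for c d
    by (rule ev2_swap)
  then have "ev2 Q W (\<lambda>c d. ev2 N S (\<lambda>r s. ev2 P V (\<lambda>e k. f r s e k c d)))
    = ev2 Q W (\<lambda>c d. ev2 P V (\<lambda>e k. ev2 N S (\<lambda>r s. f r s e k c d)))"
    by (intro arg_cong[where f = "ev2 Q W"] ext)
  with ev2_swap3 show ?thesis by (rule trans)
qed

text \<open>Associativity of the braided square when the leftmost factor is \<open>v \<boxtimes> 1 + 1 \<boxtimes> v\<close>. The
  summand \<open>v \<boxtimes> 1\<close> is immediate; for \<open>1 \<boxtimes> v\<close> one hexagon splits the action on a product in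
  the first leg, the other reassembles the action on a product in the second leg.\<close>

lemma braid_assoc:
  "SR (\<lambda>r s. opD v (pur (a \<odot>\<odot> s \<rhd>\<rhd> a') ((r \<rhd>\<rhd> c) \<odot>\<odot> c'))) =
    braid (qg v \<odot>\<odot> a) c a' c' + SR (\<lambda>r s. braid (s \<rhd>\<rhd> a) ((r \<rhd>\<rhd> qg v) \<odot>\<odot> c) a' c')"
proof -
  let ?v = "qg v"
  have t1: "trilx (\<lambda>p x y. pur ((x \<rhd>\<rhd> a) \<odot>\<odot> ((y \<star> s) \<rhd>\<rhd> a')) ((p \<rhd>\<rhd> ?v) \<odot>\<odot> ((r \<rhd>\<rhd> c) \<odot>\<odot> c')))" for r s
    by (simp add: trilx_def linx_def Ubil)
  have t2: "trilx (\<lambda>x y s. pur ((s' \<rhd>\<rhd> a) \<odot>\<odot> (s \<rhd>\<rhd> a')) (((x \<star> r') \<rhd>\<rhd> ?v) \<odot>\<odot> ((y \<rhd>\<rhd> c) \<odot>\<odot> c')))" for r' s'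
    by (simp add: trilx_def linx_def Ubil)
  have "SR (\<lambda>r s. SR (\<lambda>r' s'. pur (s' \<rhd>\<rhd> (a \<odot>\<odot> s \<rhd>\<rhd> a')) ((r' \<rhd>\<rhd> ?v) \<odot>\<odot> ((r \<rhd>\<rhd> c) \<odot>\<odot> c'))))
    = SR (\<lambda>r s. SR (\<lambda>r' s'. cop s' (\<lambda>x y. pur ((x \<rhd>\<rhd> a) \<odot>\<odot> ((y \<star> s) \<rhd>\<rhd> a')) ((r' \<rhd>\<rhd> ?v) \<odot>\<odot> ((r \<rhd>\<rhd> c) \<odot>\<odot> c')))))"
    by (simp add: actU_mulU pullU actU_mul)
  also have "\<dots> = SR (\<lambda>r s. SR (\<lambda>e k. SR (\<lambda>b d. pur ((d \<rhd>\<rhd> a) \<odot>\<odot> ((k \<star> s) \<rhd>\<rhd> a')) (((e \<star> b) \<rhd>\<rhd> ?v) \<odot>\<odot> ((r \<rhd>\<rhd> c) \<odot>\<odot> c')))))"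
    by (simp only: hex2[OF t1])
  also have "\<dots> = SR (\<lambda>b d. SR (\<lambda>e k. SR (\<lambda>r s. pur ((d \<rhd>\<rhd> a) \<odot>\<odot> ((k \<star> s) \<rhd>\<rhd> a')) (((e \<star> b) \<rhd>\<rhd> ?v) \<odot>\<odot> ((r \<rhd>\<rhd> c) \<odot>\<odot> c')))))"
    by (rule ev2_rev3)
  also have "\<dots> = SR (\<lambda>r' s'. SR (\<lambda>r s. cop r (\<lambda>x y. pur ((s' \<rhd>\<rhd> a) \<odot>\<odot> (s \<rhd>\<rhd> a')) (((x \<star> r') \<rhd>\<rhd> ?v) \<odot>\<odot> ((y \<rhd>\<rhd> c) \<odot>\<odot> c')))))"
    by (simp only: hex1[OF t2])
  also have "\<dots> = SR (\<lambda>r s. braid (s \<rhd>\<rhd> a) ((r \<rhd>\<rhd> ?v) \<odot>\<odot> c) a' c')"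
    by (simp add: actU_mulU pullU actU_mul mulx_assoc[OF Ualg])
  finally show ?thesis by (simp add: opD_pur ev2_plus mulx_assoc[OF Ualg])
qed

text \<open>The product of the braided square, as a bilinear operation on \<open>uvec\<close>.\<close>

definition bm where "bm z w = lf (\<lambda>a c. lf (\<lambda>a' c'. braid a c a' c') w) z"

lemma braid_bil: "bilx (\<lambda>a' c'. braid a c a' c')" "bilx (\<lambda>a c. lf (\<lambda>a' c'. braid a c a' c') w)"
  by (simp_all add: bilx_def linx_def Ubil lf_fun)

lemma bm_linx: "linx (\<lambda>z. bm z w)" "linx (bm z)"
  unfolding bm_def[abs_def]
  using linx_lf[OF braid_bil(2)] by (simp_all add: linx_def lf_lin[OF braid_bil(1)] lf_fun)

lemma opD_bm: "opD v (bm z w) = bm (opD v z) w"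
proof -
  have lv: "linx (opD v)" using bilx_opD by (simp add: bilx_def)
  let ?H = "\<lambda>a c. lf (\<lambda>a' c'. braid a c a' c') w"
  have lH: "linx (lf ?H)" by (rule linx_lf[OF braid_bil(2)])
  have "opD v (bm z w) = lf (\<lambda>a c. lf (\<lambda>a' c'. SR (\<lambda>r s. opD v (pur (a \<odot>\<odot> s \<rhd>\<rhd> a') ((r \<rhd>\<rhd> c) \<odot>\<odot> c')))) w) z"
    unfolding bm_def by (simp only: lf_linx[OF lv] pullU)
  also have "\<dots> = lf (\<lambda>a c. ?H (qg v \<odot>\<odot> a) c + SR (\<lambda>r s. ?H (s \<rhd>\<rhd> a) ((r \<rhd>\<rhd> qg v) \<odot>\<odot> c))) z"
    unfolding braid_assoc by (simp only: lf_fun lf_swap)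
  also have "\<dots> = lf (\<lambda>a c. lf ?H (pur (qg v \<odot>\<odot> a) c + SR (\<lambda>r s. pur (s \<rhd>\<rhd> a) ((r \<rhd>\<rhd> qg v) \<odot>\<odot> c)))) z"
    by (rule lf_cong) (simp add: linx_add[OF lH] ev2_linx[OF lH] lf_pur[OF braid_bil(2)])
  also have "\<dots> = bm (opD v z) w"
    unfolding bm_def opD_def[of v z] lf_linx[OF lH] ..
  finally show ?thesis .
qed

lemma bm_one: "bm (pur oneU oneU) w = pp (tspace {2} U) w"
proof -
  have 1: "braid oneU oneU a' c' = pur a' c'" for a' c'
  proof -
    have l: "linx (\<lambda>s. pur (s \<rhd>\<rhd> a') c')" by (simp add: linx_def Ubil)
    have "braid oneU oneU a' c' = SR (\<lambda>r s. eps r \<bullet> pur (s \<rhd>\<rhd> a') c')"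
      by (simp add: actU_oneU mulx_bil[OF Ualg] pur_bil)
    also have "\<dots> = pur a' c'" unfolding R_eps(1)[OF l] by (simp add: actU_1)
    finally show ?thesis .
  qed
  have "linx (\<lambda>z. z)" by (simp add: linx_def)
  from lf_ext[OF this, of w] have "lf (\<lambda>a' c'. braid oneU oneU a' c') w = pp (tspace {2} U) w"
    unfolding 1 by simp
  then show ?thesis unfolding bm_def lf_pur[OF braid_bil(2)] pp_oneU .
qed

lemma delta_mul: "delta (s \<otimes>\<otimes> t) = bm (delta s) (delta t)"
proof -
  have "delta (pp T s \<otimes>\<otimes> t) = bm (delta (pp T s)) (delta t)"
  proof (rule T_linear_eq[where f = "\<lambda>s. delta (s \<otimes>\<otimes> t)" and h = "\<lambda>s. bm (delta s) (delta t)"])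
    show "linx (\<lambda>s. delta (s \<otimes>\<otimes> t))" by (simp add: linx_def Tbil linx_simps[OF linx_delta])
    show "linx (\<lambda>s. bm (delta s) (delta t))"
      by (simp add: linx_def linx_simps[OF linx_delta] linx_simps[OF bm_linx(1)])
    show "delta (oneT \<otimes>\<otimes> t) = bm (delta oneT) (delta t)" by (simp add: delta_one bm_one)
  qed (simp add: mulT_assoc delta_gen opD_bm)
  then show ?thesis by simp
qed

lemma delta_gen1: "delta (gen v) = pur (qg v) oneU + pur oneU (qg v)"
proof -
  have l: "linx (\<lambda>r. pur oneU (r \<rhd>\<rhd> qg v))" by (simp add: linx_def Ubil)
  have "delta (gen v \<otimes>\<otimes> oneT) = pur (qg v) oneU + SR (\<lambda>r s. eps s \<bullet> pur oneU (r \<rhd>\<rhd> qg v))"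
    unfolding delta_gen delta_one opD_pur by (simp add: actU_oneU pur_bil)
  also have "\<dots> = pur (qg v) oneU + pur oneU (qg v)" unfolding R_eps(2)[OF l] by (simp add: actU_1)
  finally show ?thesis by simp
qed

lemma delta_gen2: "delta (gen u \<otimes>\<otimes> gen v) = pur (qg u \<odot>\<odot> qg v) oneU + SR (\<lambda>r s. pur (s \<rhd>\<rhd> qg v) (r \<rhd>\<rhd> qg u))
   + (pur (qg u) (qg v) + pur oneU (qg u \<odot>\<odot> qg v))"
proof -
  have l: "linx (\<lambda>r. pur oneU ((r \<rhd>\<rhd> qg u) \<odot>\<odot> qg v))" by (simp add: linx_def Ubil)
  have "linx (opD u)" using bilx_opD by (simp add: bilx_def)
  from linx_add[OF this] have "delta (gen u \<otimes>\<otimes> gen v) = pur (qg u \<odot>\<odot> qg v) oneU + SR (\<lambda>r s. pur (s \<rhd>\<rhd> qg v) (r \<rhd>\<rhd> qg u))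
   + (pur (qg u) (qg v) + SR (\<lambda>r s. eps s \<bullet> pur oneU ((r \<rhd>\<rhd> qg u) \<odot>\<odot> qg v)))"
    unfolding delta_gen delta_gen1 by (simp add: opD_pur actU_oneU pur_bil)
  also have "SR (\<lambda>r s. eps s \<bullet> pur oneU ((r \<rhd>\<rhd> qg u) \<odot>\<odot> qg v)) = pur oneU (qg u \<odot>\<odot> qg v)"
    unfolding R_eps(2)[OF l] by (simp add: actU_1)
  finally show ?thesis .
qed

text \<open>The mixed terms of \<open>\<delta>(u v)\<close> are \<open>u \<boxtimes> v + (R\<^sub>\<alpha> \<rhd> v) \<boxtimes> (R\<^sup>\<alpha> \<rhd> u)\<close>. Replacing \<open>u v\<close> by its
  braided flip exchanges the two, because \<open>R\<inverse> = R\<^sub>2\<^sub>1\<close>, so they cancel in a relation. The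
  other terms are the relation itself in one leg and \<open>1\<close> in the other.\<close>

lemma delta_rel: "delta (rel u v) = 0"
proof -
  let ?u = "qg u" and ?v = "qg v"
  have B: "bilx (\<lambda>x y. pur (x \<rhd>\<rhd> ?u) (y \<rhd>\<rhd> ?v))" by (simp add: bilx_def linx_def Ubil)
  have l: "linx (\<lambda>x. pur (q x) oneU)" "linx (\<lambda>x. pur oneU (q x))" by (simp_all add: linx_def Ubil)
  have i: "SR (\<lambda>a b. SR (\<lambda>r s. pur (s \<rhd>\<rhd> a \<rhd>\<rhd> ?u) (r \<rhd>\<rhd> b \<rhd>\<rhd> ?v))) = pur ?u ?v"
  proof -
    have "SR (\<lambda>a b. SR (\<lambda>r s. pur (s \<rhd>\<rhd> a \<rhd>\<rhd> ?u) (r \<rhd>\<rhd> b \<rhd>\<rhd> ?v))) =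
      SR (\<lambda>r s. SR (\<lambda>a b. pur ((s \<star> a) \<rhd>\<rhd> ?u) ((r \<star> b) \<rhd>\<rhd> ?v)))"
      unfolding actU_mul by (rule ev2_swap)
    also have "\<dots> = pur ?u ?v" unfolding R_inv(2)[OF B] by (simp add: actU_1)
    finally show ?thesis .
  qed
  let ?Y = "\<lambda>a b. (b \<rhd>\<rhd> ?v) \<odot>\<odot> (a \<rhd>\<rhd> ?u)"
  have z: "pur (q (rel u v)) oneU = 0" "pur oneU (q (rel u v)) = 0"
    using linx_zero[OF l(1)] linx_zero[OF l(2)] unfolding q_rel linx_zero[OF linx_q] .
  have z1: "0 = pur (?u \<odot>\<odot> ?v) oneU - SR (\<lambda>a b. pur (?Y a b) oneU) - pur (qg (br u v)) oneU"
    using z(1) unfolding rel_def linx_diff[OF l(1)] ev2_linx[OF l(1)] q_mul qg_act by (rule sym)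
  have z2: "0 = pur oneU (?u \<odot>\<odot> ?v) - SR (\<lambda>a b. pur oneU (?Y a b)) - pur oneU (qg (br u v))"
    using z(2) unfolding rel_def linx_diff[OF l(2)] ev2_linx[OF l(2)] q_mul qg_act by (rule sym)
  have "delta (rel u v) = delta (gen u \<otimes>\<otimes> gen v) - SR (\<lambda>a b. delta (gen (b \<rhd> v) \<otimes>\<otimes> gen (a \<rhd> u))) - delta (gen (br u v))"
    unfolding rel_def by (simp only: linx_diff[OF linx_delta] ev2_linx[OF linx_delta])
  also have "\<dots> = (pur (?u \<odot>\<odot> ?v) oneU - SR (\<lambda>a b. pur (?Y a b) oneU) - pur (qg (br u v)) oneU)
     + (pur oneU (?u \<odot>\<odot> ?v) - SR (\<lambda>a b. pur oneU (?Y a b)) - pur oneU (qg (br u v)))"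
    unfolding delta_gen2 delta_gen1 qg_act ev2_plus i by simp
  also have "\<dots> = 0" unfolding z1[symmetric] z2[symmetric] by simp
  finally show ?thesis .
qed

lemma delta_ideal: assumes "q x = 0" shows "delta x = 0"
proof -
  have "delta (pp T x) = 0"
    by (rule q_zero_induct[where P = "\<lambda>x. delta x = 0"])
       (simp_all add: linx_simps[OF linx_delta] delta_rel delta_mul linx_zero[OF bm_linx(1)] linx_zero[OF bm_linx(2)] assms)
  then show ?thesis by simp
qed

text \<open>The diagonal action on \<open>\<U>(\<gg>) \<boxtimes> \<U>(\<gg>)\<close>.\<close>

definition actD where "actD h z = lf (\<lambda>a c. cop h (\<lambda>x y. pur (x \<rhd>\<rhd> a) (y \<rhd>\<rhd> c))) z"

lemma actD_fun: "bilx (\<lambda>a c. cop h (\<lambda>x y. pur (x \<rhd>\<rhd> a) (y \<rhd>\<rhd> c)))"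
  by (simp add: bilx_def linx_def Ubil)

lemma linx_actD: "linx (actD h)"
  unfolding actD_def[abs_def] by (rule linx_lf[OF actD_fun])

lemma actD_pur: "actD h (pur a c) = cop h (\<lambda>x y. pur (x \<rhd>\<rhd> a) (y \<rhd>\<rhd> c))"
  unfolding actD_def lf_pur[OF actD_fun] by simp

text \<open>The summand \<open>v \<boxtimes> 1\<close> is coassociativity. For \<open>1 \<boxtimes> v\<close> the braiding has to be moved past
  the action, which is quasi-cocommutativity, used between two applications of
  coassociativity.\<close>

lemma opD_equiv:
  "cop h (\<lambda>a b. cop b (\<lambda>x y. opD (a \<rhd> v) (pur (x \<rhd>\<rhd> p) (y \<rhd>\<rhd> c)))) = actD h (opD v (pur p c))"
proof -
  let ?v = "qg v"
  have t1: "trilx (\<lambda>a x y. pur ((a \<rhd>\<rhd> ?v) \<odot>\<odot> (x \<rhd>\<rhd> p)) (y \<rhd>\<rhd> c))"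
    by (simp add: trilx_def linx_def Ubil)
  have t2: "trilx (\<lambda>a x y. SR (\<lambda>r s. pur ((s \<star> x) \<rhd>\<rhd> p) (((r \<star> a) \<rhd>\<rhd> ?v) \<odot>\<odot> (y \<rhd>\<rhd> c))))"
    "trilx (\<lambda>x d y. SR (\<lambda>r s. pur ((x \<star> s) \<rhd>\<rhd> p) (((d \<star> r) \<rhd>\<rhd> ?v) \<odot>\<odot> (y \<rhd>\<rhd> c))))"
    by (simp_all add: trilx_def linx_def Ubil)
  have b: "bilx (\<lambda>x z. pur (z \<rhd>\<rhd> p) ((x \<rhd>\<rhd> ?v) \<odot>\<odot> (y \<rhd>\<rhd> c)))" for y
    by (simp add: bilx_def linx_def Ubil)
  have 1: "cop h (\<lambda>a b. cop b (\<lambda>x y. pur ((a \<rhd>\<rhd> ?v) \<odot>\<odot> (x \<rhd>\<rhd> p)) (y \<rhd>\<rhd> c))) = cop h (\<lambda>x y. pur (x \<rhd>\<rhd> (?v \<odot>\<odot> p)) (y \<rhd>\<rhd> c))"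
    unfolding coassoc[OF t1, symmetric] by (simp add: actU_mulU pullU)
  have "cop h (\<lambda>a b. cop b (\<lambda>x y. SR (\<lambda>r s. pur ((s \<star> x) \<rhd>\<rhd> p) (((r \<star> a) \<rhd>\<rhd> ?v) \<odot>\<odot> (y \<rhd>\<rhd> c)))))
     = cop h (\<lambda>x y. cop x (\<lambda>a b. SR (\<lambda>r s. pur ((s \<star> b) \<rhd>\<rhd> p) (((r \<star> a) \<rhd>\<rhd> ?v) \<odot>\<odot> (y \<rhd>\<rhd> c)))))"
    by (rule coassoc[OF t2(1), symmetric])
  also have "\<dots> = cop h (\<lambda>x y. cop x (\<lambda>k d. SR (\<lambda>r s. pur ((k \<star> s) \<rhd>\<rhd> p) (((d \<star> r) \<rhd>\<rhd> ?v) \<odot>\<odot> (y \<rhd>\<rhd> c)))))"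
    unfolding quasi_cocomm[OF b] cop_swap ..
  also have "\<dots> = cop h (\<lambda>x y. cop y (\<lambda>d y. SR (\<lambda>r s. pur ((x \<star> s) \<rhd>\<rhd> p) (((d \<star> r) \<rhd>\<rhd> ?v) \<odot>\<odot> (y \<rhd>\<rhd> c)))))"
    by (rule coassoc[OF t2(2)])
  also have "\<dots> = SR (\<lambda>r s. cop h (\<lambda>x y. pur (x \<rhd>\<rhd> s \<rhd>\<rhd> p) (y \<rhd>\<rhd> ((r \<rhd>\<rhd> ?v) \<odot>\<odot> c))))"
    by (simp add: actU_mulU pullU actU_mul cop_swap)
  finally have 2: "cop h (\<lambda>a b. cop b (\<lambda>x y. SR (\<lambda>r s. pur ((s \<star> x) \<rhd>\<rhd> p) (((r \<star> a) \<rhd>\<rhd> ?v) \<odot>\<odot> (y \<rhd>\<rhd> c)))))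
     = SR (\<lambda>r s. cop h (\<lambda>x y. pur (x \<rhd>\<rhd> s \<rhd>\<rhd> p) (y \<rhd>\<rhd> ((r \<rhd>\<rhd> ?v) \<odot>\<odot> c))))" .
  have "cop h (\<lambda>a b. cop b (\<lambda>x y. opD (a \<rhd> v) (pur (x \<rhd>\<rhd> p) (y \<rhd>\<rhd> c)))) =
     cop h (\<lambda>a b. cop b (\<lambda>x y. pur ((a \<rhd>\<rhd> ?v) \<odot>\<odot> (x \<rhd>\<rhd> p)) (y \<rhd>\<rhd> c)))
     + cop h (\<lambda>a b. cop b (\<lambda>x y. SR (\<lambda>r s. pur ((s \<star> x) \<rhd>\<rhd> p) (((r \<star> a) \<rhd>\<rhd> ?v) \<odot>\<odot> (y \<rhd>\<rhd> c)))))"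
    by (simp add: opD_pur qg_act cop_fun actU_mul)
  then show ?thesis unfolding 1 2 by (simp add: opD_pur linx_add[OF linx_actD] ev2_linx[OF linx_actD] actD_pur)
qed

lemma delta_act: "delta (actT h t) = actD h (delta t)"
proof -
  let ?P = "\<lambda>t. \<forall>h. delta (actT h t) = actD h (delta t)"
  have "?P (pp T t)"
  proof (rule T_induct)
    show "?P (x + y)" if "?P x" "?P y" for x y using that by (simp add: Tbil linx_simps[OF linx_delta] linx_simps[OF linx_actD])
    show "?P (c \<bullet> x)" if "?P x" for c x using that by (simp add: Tbil linx_simps[OF linx_delta] linx_simps[OF linx_actD])
    have l: "linx (\<lambda>b. eps b \<bullet> pur oneU oneU)" by (simp add: linx_def Ubil)
    show "?P oneT"
      using counit_cop(1)[OF l] by (simp add: actT_one delta_one linx_simps[OF linx_delta] actD_pur actU_oneU pur_bil mult.commute)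
    fix v t assume IH: "?P t"
    show "?P (gen v \<otimes>\<otimes> t)"
    proof
      fix h
      have lv: "linx (opD v)" for v using bilx_opD by (simp add: bilx_def)
      have "delta (actT h (gen v \<otimes>\<otimes> t)) = cop h (\<lambda>a b. opD (a \<rhd> v) (actD b (delta t)))"
        by (simp add: actT_gen cop_linx[OF linx_delta] delta_gen IH)
      also have "\<dots> = lf (\<lambda>p c. cop h (\<lambda>a b. cop b (\<lambda>x y. opD (a \<rhd> v) (pur (x \<rhd>\<rhd> p) (y \<rhd>\<rhd> c))))) (delta t)"
        by (simp only: actD_def lf_linx[OF lv] pullU lf_swap_cop)
      also have "\<dots> = lf (\<lambda>p c. actD h (opD v (pur p c))) (delta t)" unfolding opD_equiv ..
      also have "\<dots> = actD h (opD v (delta t))"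
      proof -
        have "linx (\<lambda>z. actD h (opD v z))" by (simp add: linx_def linx_simps[OF linx_actD] linx_simps[OF lv])
        from lf_ext[OF this, of "delta t"] show ?thesis by simp
      qed
      finally show "delta (actT h (gen v \<otimes>\<otimes> t)) = actD h (delta (gen v \<otimes>\<otimes> t))" unfolding delta_gen .
    qed
  qed
  then show ?thesis by simp
qed

section \<open>The comparison map on enveloping algebras\<close>

text \<open>The map induced by \<open>chi\<close> on the quotients; \<open>Mq_chi\<close> makes it independent of the chosen
  representative.\<close>

definition Phi :: "('k, ('k, 'v) tens set) uvec \<Rightarrow> ('k, ('k, 'v) tens set) uvec" where
  "Phi z = M.q (chi (SOME x. q x = pp U z))"

lemma Phi_q: "Phi (q x) = M.q (chi x)"
proof -
  let ?y = "SOME y. q y = pp U (q x)"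
  have "q ?y = pp U (q x)" by (rule someI[of _ x]) simp
  then have "q (?y - x) = 0" by (simp add: linx_diff[OF linx_q])
  then have "M.q (chi (?y - x)) = 0" by (rule Mq_chi)
  then show ?thesis by (simp add: Phi_def linx_diff[OF linx_chi] linx_diff[OF M.linx_q])
qed

lemma Phi_pp: "Phi (pp U z) = Phi z"
  by (simp add: Phi_def prj_emb[OF Umod prj_closed[OF Umod]])

lemma linx_Phi: "linx Phi"
proof (rule linxI)
  fix z w c
  obtain x where x: "pp U z = q x" by (rule q_surj)
  obtain y where y: "pp U w = q y" by (rule q_surj)
  have "Phi (z + w) = Phi (q (x + y))" "Phi (c \<bullet> z) = Phi (q (c \<bullet> x))" "Phi z = Phi (q x)" "Phi w = Phi (q y)"
    unfolding q_lin x[symmetric] y[symmetric] pp_simps[OF Umod, symmetric] Phi_pp by (rule refl)+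
  then show "Phi (z + w) = Phi z + Phi w" "Phi (c \<bullet> z) = c \<bullet> Phi z"
    by (simp_all only: Phi_q chi_lin M.q_lin)
qed

lemma Phi_pp2 [simp]: "pp M.U (Phi z) = Phi z"
  unfolding Phi_def by (rule Mq_pp)

abbreviation actM (infixr \<open>\<rhd>\<^sub>M\<close> 76) where "h \<rhd>\<^sub>M z \<equiv> actx KF M.U h z"
abbreviation mulM (infixl \<open>\<odot>\<^sub>M\<close> 70) where "x \<odot>\<^sub>M y \<equiv> mulx M.U x y"

lemma Phi_act: "h \<rhd>\<^sub>M Phi z = Phi (h \<rhd>\<rhd> z)"
proof -
  obtain x where x: "\<forall>h. h \<rhd>\<rhd> z = h \<rhd>\<rhd> q x" "pp U z = q x" using q_rep[of z] by blast
  have P: "Phi z = M.q (chi x)" using Phi_pp[of z] unfolding x(2) Phi_q by simp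
  show ?thesis unfolding P x(1)[rule_format] M.actU_q actU_q Phi_q chi_actT ..
qed

text \<open>The right-hand side is the product of \<open>\<U>(\<gg>)\<^sub>F\<close>, so this is \<open>psi_mul\<close> read through the
  inverse \<open>chi\<close>.\<close>

lemma Phi_mul: "Phi z \<odot>\<^sub>M Phi w = Phi (SG (\<lambda>a b. (a \<rhd>\<rhd> z) \<odot>\<odot> (b \<rhd>\<rhd> w)))"
proof -
  obtain x where x: "\<forall>h. h \<rhd>\<rhd> z = h \<rhd>\<rhd> q x" "pp U z = q x" using q_rep[of z] by blast
  obtain y where y: "\<forall>h. h \<rhd>\<rhd> w = h \<rhd>\<rhd> q y" "pp U w = q y" using q_rep[of w] by blast
  have P: "Phi z = M.q (chi x)" "Phi w = M.q (chi y)"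
    using Phi_pp[of z] Phi_pp[of w] unfolding x(2) y(2) Phi_q by simp_all
  have "chi (SG (\<lambda>a b. actT a x \<otimes>\<otimes> actT b y)) = chi (psi (chi x \<otimes>\<otimes> chi y))"
    by (simp add: psi_mul psi_chi)
  then have c: "chi (SG (\<lambda>a b. actT a x \<otimes>\<otimes> actT b y)) = chi x \<otimes>\<otimes> chi y" by (simp add: chi_psi)
  have "SG (\<lambda>a b. (a \<rhd>\<rhd> z) \<odot>\<odot> (b \<rhd>\<rhd> w)) = q (SG (\<lambda>a b. actT a x \<otimes>\<otimes> actT b y))"
    by (simp only: x(1)[rule_format] y(1)[rule_format] actU_q q_pull q_mul)
  then show ?thesis unfolding P by (simp only: Phi_q c Mq_mul)
qed

lemma chi_gen1: "chi (gen v) = gen v"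
  using chi_psi[of "gen v"] by (simp add: psi_gen1)

lemma Phi_gen: "Phi (qg v) = M.q (M.gen v)"
  by (simp only: Phi_q chi_gen1 gen_KF)

lemma oneUM: "emb M.U \<one>\<^bsub>M.U\<^esub> = Phi oneU"
  unfolding q_one[symmetric] Phi_q chi_one using M.q_one by (simp only: KF_simps)

lemma Phi_ker: "Phi z = 0 \<Longrightarrow> pp U z = 0"
proof -
  assume z: "Phi z = 0"
  obtain x where x: "pp U z = q x" by (rule q_surj)
  have "M.q (chi x) = 0" using z Phi_pp[of z] unfolding x Phi_q by simp
  then have "q (psi (chi x)) = 0" by (simp only: Mq_iff)
  then show ?thesis unfolding x psi_chi by simp
qed

abbreviation Mpur where "Mpur \<equiv> pr2 M.U"

text \<open>\<open>(\<Phi> \<otimes> \<Phi>)(F \<rhd> z)\<close>: the coproduct of the twist \<open>\<U>(\<gg>)\<^sub>F\<close> is \<open>F \<rhd> \<Delta>(\<hyphen>)\<close>, carried over to the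
  other side by \<open>\<Phi> \<otimes> \<Phi>\<close>.\<close>

definition Th where "Th z = lf (\<lambda>x y. SF (\<lambda>a b. Mpur (Phi (a \<rhd>\<rhd> x)) (Phi (b \<rhd>\<rhd> y)))) z"

lemmas Mpur_bil = bilxD[OF bilx_pr2[OF M.Umod]]
lemmas Vbil = Ubil Mpur_bil linx_add[OF linx_Phi] linx_scale[OF linx_Phi]

lemma Th_fun: "bilx (\<lambda>x y. SF (\<lambda>a b. Mpur (Phi (a \<rhd>\<rhd> x)) (Phi (b \<rhd>\<rhd> y))))"
  by (simp add: bilx_def linx_def Vbil)

lemma linx_Th: "linx Th"
  unfolding Th_def[abs_def] by (rule linx_lf[OF Th_fun])

lemma Th_pur: "Th (pur x y) = SF (\<lambda>a b. Mpur (Phi (a \<rhd>\<rhd> x)) (Phi (b \<rhd>\<rhd> y)))"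
  unfolding Th_def lf_pur[OF Th_fun] by simp

text \<open>The cocycle identity solved for \<open>(id \<otimes> \<Delta>)F = G\<^sub>2\<^sub>3 F\<^sub>1\<^sub>2 (\<Delta> \<otimes> id)F\<close>.\<close>

lemma cocycle_right:
  assumes f: "trilx f"
  shows "SF (\<lambda>c d. cop d (\<lambda>x y. f c x y)) =
    SG (\<lambda>p p'. SF (\<lambda>m m'. SF (\<lambda>a b. cop a (\<lambda>x y. f (m \<star> x) (p \<star> m' \<star> y) (p' \<star> b)))))"
proof -
  interpret T3: ring "tpow_alg 3 K" by (rule ring_tpow)
  note cl = leg12_closed[OF F_closed] leg23_closed[OF F_closed] leg23_closed[OF G_closed] comul_left_closed[OF F_closed] comul_right_closed[OF F_closed]
  note cl' = cl[folded carrier_tpow]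
  have co: "leg12 K F \<otimes>\<^bsub>tpow_alg 3 K\<^esub> comul_left K F = leg23 K F \<otimes>\<^bsub>tpow_alg 3 K\<^esub> comul_right K F"
    using tw by (simp add: twist_def)
  have i: "leg23 K G \<otimes>\<^bsub>tpow_alg 3 K\<^esub> leg23 K F = \<one>\<^bsub>tpow_alg 3 K\<^esub>"
    by (simp flip: leg_mult[OF G_closed F_closed] add: GF leg_one)
  have "comul_right K F = (leg23 K G \<otimes>\<^bsub>tpow_alg 3 K\<^esub> leg23 K F) \<otimes>\<^bsub>tpow_alg 3 K\<^esub> comul_right K F"
    unfolding i by (simp only: T3.l_one cl')
  also have "\<dots> = leg23 K G \<otimes>\<^bsub>tpow_alg 3 K\<^esub> (leg12 K F \<otimes>\<^bsub>tpow_alg 3 K\<^esub> comul_left K F)"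
    unfolding co by (simp only: T3.m_assoc cl')
  finally have e: "comul_right K F = leg23 K G \<otimes>\<^bsub>tpow_alg 3 K\<^esub> (leg12 K F \<otimes>\<^bsub>tpow_alg 3 K\<^esub> comul_left K F)" .
  have t1: "trilx (\<lambda>a b c. ev3 K V (\<lambda>x y z. h (a \<star> x) (b \<star> y) (c \<star> z)))" if "trilx h" for V and h :: "_ \<Rightarrow> _ \<Rightarrow> _ \<Rightarrow> ('k, 'z) uvec"
    by (rule trilx_ev3) (rule trilx_mul'[OF that])
  note s1 = ev3_mul[OF cl(3) tpow_mult_closed[OF cl(1,4)] f]
  note s2 = ev3_leg23[OF G_closed t1[OF f]]
  note s3 = ev3_mul[OF cl(1,4) trilx_mul[OF f]]
  note s4 = ev3_leg12[OF F_closed t1[OF trilx_mul[OF f]]]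
  note s5 = ev3_comul_left[OF F_closed trilx_mul[OF trilx_mul[OF f]]]
  have "SF (\<lambda>c d. cop d (\<lambda>x y. f c x y)) = ev3 K (comul_right K F) f"
    by (rule ev3_comul_right[OF F_closed f, symmetric])
  also have "\<dots> = SG (\<lambda>p p'. SF (\<lambda>m m'. SF (\<lambda>a b. cop a (\<lambda>x y. f (\<^bold>1 \<star> (m \<star> x)) (p \<star> (m' \<star> y)) (p' \<star> (\<^bold>1 \<star> b))))))"
    unfolding e by (simp only: s1, simp only: s2, simp only: s3, simp only: s4, simp only: s5)
  also have "\<dots> = SG (\<lambda>p p'. SF (\<lambda>m m'. SF (\<lambda>a b. cop a (\<lambda>x y. f (m \<star> x) (p \<star> m' \<star> y) (p' \<star> b)))))"
    by (simp add: mulx_one[OF alg] mulx_pp[OF alg] mulx_assoc[OF alg])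
  finally show ?thesis .
qed

lemma ev2_rev5: "ev2 A1 S1 (\<lambda>a b. ev2 A2 S2 (\<lambda>c d. ev2 A3 S3 (\<lambda>e k. ev2 A4 S4 (\<lambda>m n. ev2 A5 S5 (\<lambda>x y. f a b c d e k m n x y)))))
   = ev2 A5 S5 (\<lambda>x y. ev2 A2 S2 (\<lambda>c d. ev2 A3 S3 (\<lambda>e k. ev2 A4 S4 (\<lambda>m n. ev2 A1 S1 (\<lambda>a b. f a b c d e k m n x y)))))"
proof -
  have in3: "ev2 A2 S2 (\<lambda>c d. ev2 A3 S3 (\<lambda>e k. ev2 A4 S4 (\<lambda>m n. ev2 N S (\<lambda>x y. h c d e k m n x y))))
     = ev2 N S (\<lambda>x y. ev2 A2 S2 (\<lambda>c d. ev2 A3 S3 (\<lambda>e k. ev2 A4 S4 (\<lambda>m n. h c d e k m n x y))))" for N S h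
  proof -
    have 1: "ev2 A4 S4 (\<lambda>m n. ev2 N S (\<lambda>x y. h c d e k m n x y)) = ev2 N S (\<lambda>x y. ev2 A4 S4 (\<lambda>m n. h c d e k m n x y))" for c d e k
      by (rule ev2_swap)
    have 2: "ev2 A3 S3 (\<lambda>e k. ev2 N S (\<lambda>x y. ev2 A4 S4 (\<lambda>m n. h c d e k m n x y))) = ev2 N S (\<lambda>x y. ev2 A3 S3 (\<lambda>e k. ev2 A4 S4 (\<lambda>m n. h c d e k m n x y)))" for c d
      by (rule ev2_swap)
    show ?thesis unfolding 1 2 by (rule ev2_swap)
  qed
  have s: "ev2 A1 S1 (\<lambda>a b. ev2 A5 S5 (\<lambda>x y. ev2 A2 S2 (\<lambda>c d. ev2 A3 S3 (\<lambda>e k. ev2 A4 S4 (\<lambda>m n. f a b c d e k m n x y)))))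
     = ev2 A5 S5 (\<lambda>x y. ev2 A1 S1 (\<lambda>a b. ev2 A2 S2 (\<lambda>c d. ev2 A3 S3 (\<lambda>e k. ev2 A4 S4 (\<lambda>m n. f a b c d e k m n x y)))))"
    by (rule ev2_swap)
  have "ev2 A1 S1 (\<lambda>a b. ev2 A2 S2 (\<lambda>c d. ev2 A3 S3 (\<lambda>e k. ev2 A4 S4 (\<lambda>m n. ev2 A5 S5 (\<lambda>x y. f a b c d e k m n x y)))))
     = ev2 A1 S1 (\<lambda>a b. ev2 A5 S5 (\<lambda>x y. ev2 A2 S2 (\<lambda>c d. ev2 A3 S3 (\<lambda>e k. ev2 A4 S4 (\<lambda>m n. f a b c d e k m n x y)))))"
    by (intro arg_cong[where f = "ev2 A1 S1"] ext) (rule in3)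
  also note s
  also have "ev2 A5 S5 (\<lambda>x y. ev2 A1 S1 (\<lambda>a b. ev2 A2 S2 (\<lambda>c d. ev2 A3 S3 (\<lambda>e k. ev2 A4 S4 (\<lambda>m n. f a b c d e k m n x y)))))
     = ev2 A5 S5 (\<lambda>x y. ev2 A2 S2 (\<lambda>c d. ev2 A3 S3 (\<lambda>e k. ev2 A4 S4 (\<lambda>m n. ev2 A1 S1 (\<lambda>a b. f a b c d e k m n x y)))))"
    by (intro arg_cong[where f = "ev2 A5 S5"] ext) (rule in3[symmetric])
  finally show ?thesis .
qed

text \<open>The identity in \<open>K \<otimes> K \<otimes> K\<close> behind the compatibility of the two braided squares. On the
  left, \<open>R\<close> stands between \<open>(id \<otimes> \<Delta>)F\<close> and \<open>(id \<otimes> \<Delta>)G\<close>, the latter with permuted legs.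
  Writing the former as \<open>G\<^sub>2\<^sub>3 F\<^sub>1\<^sub>2 (\<Delta> \<otimes> id)F\<close> brings a coproduct next to \<open>R\<close>;
  quasi-cocommutativity moves it to the other side of \<open>R\<close>, where it meets \<open>(id \<otimes> \<Delta>)G\<close> and
  \<open>cocycle_mixed\<close> resolves both. The remaining factors contain \<open>F\<^sub>2\<^sub>1 R G = R\<^sub>F\<close> on two of
  the legs.\<close>

lemma braiding_twist:
  assumes f: "trilx f"
  shows "SG (\<lambda>a b. cop b (\<lambda>x y. SR (\<lambda>r s. SF (\<lambda>c d. cop d (\<lambda>e k. f (c \<star> s \<star> x) (e \<star> r \<star> a) (k \<star> y))))))
    = SF (\<lambda>a b. ev2 K RF (\<lambda>r s. SG (\<lambda>e k. f (s \<star> a) (e \<star> r) (k \<star> b))))" (is "?L = ?r")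
proof -
  note fb = trilxD[OF f]
  let ?h = "\<lambda>p p' m m' r s x y z. f (m \<star> s \<star> y) (p \<star> m' \<star> r \<star> x) (p' \<star> z)"
  have t1: "trilx (\<lambda>c e k. f (c \<star> s \<star> x) (e \<star> r \<star> a) (k \<star> y))" for s x r a y
    by (simp add: trilx_def linx_def Kbil fb)
  have t2: "trilx (\<lambda>x y z. ?h p p' m m' r s x y z)" for p p' m m' r s
    by (simp add: trilx_def linx_def Kbil fb)
  have b: "bilx (\<lambda>x y. SG (\<lambda>u w. cop w (\<lambda>d d'. f (m \<star> y \<star> d) (p \<star> m' \<star> x \<star> u) (p' \<star> b \<star> d'))))" for p p' m m' b
    by (simp add: bilx_def linx_def Kbil fb)
  have "?L = SG (\<lambda>u w. cop w (\<lambda>d d'. SR (\<lambda>r s. SG (\<lambda>p p'. SF (\<lambda>m m'. SF (\<lambda>a b. cop a (\<lambda>x y.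
       f (m \<star> x \<star> s \<star> d) (p \<star> m' \<star> y \<star> r \<star> u) (p' \<star> b \<star> d'))))))))"
    unfolding cocycle_right[OF t1] ..
  \<comment> \<open>Exchange sums that do not depend on each other, moving those from the cocycle identity
    to the outside.\<close>
  also have "\<dots> = SG (\<lambda>p p'. SF (\<lambda>m m'. SF (\<lambda>a b. cop a (\<lambda>x y. SR (\<lambda>r s. SG (\<lambda>u w. cop w (\<lambda>d d'.
       f (m \<star> (x \<star> s) \<star> d) (p \<star> m' \<star> (y \<star> r) \<star> u) (p' \<star> b \<star> d')))))))) "
  proof -
    have "ev2 K G (\<lambda>u w. cop w (\<lambda>d d'. SR (\<lambda>r s. SG (\<lambda>p p'. SF (\<lambda>m m'. SF (\<lambda>a b. cop a (\<lambda>x y. h u w d d' r s p p' m m' a b x y))))))) =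
      SG (\<lambda>p p'. SF (\<lambda>m m'. SF (\<lambda>a b. cop a (\<lambda>x y. SR (\<lambda>r s. ev2 K G (\<lambda>u w. cop w (\<lambda>d d'. h u w d d' r s p p' m m' a b x y)))))))"
      for h :: "_ \<Rightarrow> _ \<Rightarrow> _ \<Rightarrow> _ \<Rightarrow> _ \<Rightarrow> _ \<Rightarrow> _ \<Rightarrow> _ \<Rightarrow> _ \<Rightarrow> _ \<Rightarrow> _ \<Rightarrow> _ \<Rightarrow> _ \<Rightarrow> _ \<Rightarrow> ('k, 'z) uvec"
    proof -
      have out: "ev2 K G (\<lambda>u w. cop w (\<lambda>d d'. SR (\<lambda>r s. ev2 K S (\<lambda>x y. k u w d d' r s x y)))) =
         ev2 K S (\<lambda>x y. ev2 K G (\<lambda>u w. cop w (\<lambda>d d'. SR (\<lambda>r s. k u w d d' r s x y))))"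
        for S and k :: "_ \<Rightarrow> _ \<Rightarrow> _ \<Rightarrow> _ \<Rightarrow> _ \<Rightarrow> _ \<Rightarrow> _ \<Rightarrow> _ \<Rightarrow> ('k, 'z) uvec"
      proof -
        have 1: "SR (\<lambda>r s. ev2 K S (\<lambda>x y. k u w d d' r s x y)) = ev2 K S (\<lambda>x y. SR (\<lambda>r s. k u w d d' r s x y))" for u w d d'
          by (rule ev2_swap)
        have 2: "cop w (\<lambda>d d'. ev2 K S (\<lambda>x y. SR (\<lambda>r s. k u w d d' r s x y))) = ev2 K S (\<lambda>x y. cop w (\<lambda>d d'. SR (\<lambda>r s. k u w d d' r s x y)))" for u w
          by (rule cop_swap)
        show ?thesis unfolding 1 2 by (rule ev2_swap)
      qed
      have 3: "ev2 K G (\<lambda>u w. cop w (\<lambda>d d'. SR (\<lambda>r s. k u w d d' r s))) = SR (\<lambda>r s. ev2 K G (\<lambda>u w. cop w (\<lambda>d d'. k u w d d' r s)))"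
        for k :: "_ \<Rightarrow> _ \<Rightarrow> _ \<Rightarrow> _ \<Rightarrow> _ \<Rightarrow> _ \<Rightarrow> ('k, 'z) uvec"
        unfolding cop_swap by (rule ev2_swap)
      have 4: "ev2 K G (\<lambda>u w. cop w (\<lambda>d d'. SR (\<lambda>r s. cop a (\<lambda>x y. k u w d d' r s x y)))) =
         cop a (\<lambda>x y. ev2 K G (\<lambda>u w. cop w (\<lambda>d d'. SR (\<lambda>r s. k u w d d' r s x y))))"
        for a and k :: "_ \<Rightarrow> _ \<Rightarrow> _ \<Rightarrow> _ \<Rightarrow> _ \<Rightarrow> _ \<Rightarrow> _ \<Rightarrow> _ \<Rightarrow> ('k, 'z) uvec"
        unfolding cop_def[of a] by (rule out)
      show ?thesis by (simp only: out 4, simp only: 3)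
    qed
    then show ?thesis by (simp only: mulx_assoc[OF alg])
  qed
  also have "\<dots> = SG (\<lambda>p p'. SF (\<lambda>m m'. SF (\<lambda>a b. SR (\<lambda>r s. cop a (\<lambda>x y. SG (\<lambda>u w. cop w (\<lambda>d d'.
       f (m \<star> (s \<star> y) \<star> d) (p \<star> m' \<star> (r \<star> x) \<star> u) (p' \<star> b \<star> d')))))))) "
    by (simp only: quasi_cocomm[OF b])
  also have "\<dots> = SG (\<lambda>p p'. SF (\<lambda>m m'. SR (\<lambda>r s. SF (\<lambda>a b. cop a (\<lambda>x y. SG (\<lambda>u w. cop w (\<lambda>d d'.
       ?h p p' m m' r s (x \<star> u) (y \<star> d) (b \<star> d'))))))))"
    unfolding ev2_swap[of K F K R] mulx_assoc[OF alg] ..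
  also have "\<dots> = SG (\<lambda>p p'. SF (\<lambda>m m'. SR (\<lambda>r s. SG (\<lambda>a b. SF (\<lambda>c d. ?h p p' m m' r s a (b \<star> c) d)))))"
    by (simp only: cocycle_mixed[OF t2])
  also have "\<dots> = SF (\<lambda>c d. SF (\<lambda>m m'. SR (\<lambda>r s. SG (\<lambda>a b. SG (\<lambda>p p'. ?h p p' m m' r s a (b \<star> c) d)))))"
    by (rule ev2_rev5)
  also have "\<dots> = ?r"
  proof -
    have b': "bilx (\<lambda>r s. SG (\<lambda>e k. f (s \<star> a) (e \<star> r) (k \<star> b)))" for a b
      by (simp add: bilx_def linx_def Kbil fb)
    show ?thesis unfolding RF_ev[OF b'] mulx_assoc[OF alg] ..
  qed
  finally show ?thesis .
qed

end

context full
begin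

text \<open>With both legs written as images under \<open>\<Phi>\<close>, the braided square of \<open>\<U>(\<gg>\<^sub>F)\<close> is computed
  entirely in terms of products and actions in \<open>\<U>(\<gg>)\<close> (\<open>opDM\<close>).\<close>

abbreviation NN where "NN x y \<equiv> Mpur (Phi x) (Phi y)"

lemma NN_bil: "NN (x + x') y = NN x y + NN x' y" "NN x (y + y') = NN x y + NN x y'"
  "NN (c \<bullet> x) y = c \<bullet> NN x y" "NN x (c \<bullet> y) = c \<bullet> NN x y"
  "NN (ev2 N S f) y = ev2 N S (\<lambda>a b. NN (f a b) y)" "NN x (ev2 N S f) = ev2 N S (\<lambda>a b. NN x (f a b))"
  "NN (cop h f') y = cop h (\<lambda>a b. NN (f' a b) y)" "NN x (cop h f') = cop h (\<lambda>a b. NN x (f' a b))"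
proof -
  have l: "linx (\<lambda>x. NN x y)" "linx (\<lambda>x. NN y x)" for y by (simp_all add: linx_def Vbil)
  show "NN (x + x') y = NN x y + NN x' y" "NN x (y + y') = NN x y + NN x y'"
    "NN (c \<bullet> x) y = c \<bullet> NN x y" "NN x (c \<bullet> y) = c \<bullet> NN x y" by (simp_all add: Vbil)
  show "NN (ev2 N S f) y = ev2 N S (\<lambda>a b. NN (f a b) y)" by (rule ev2_linx[OF l(1)])
  show "NN x (ev2 N S f) = ev2 N S (\<lambda>a b. NN x (f a b))" by (rule ev2_linx[OF l(2)])
  show "NN (cop h f') y = cop h (\<lambda>a b. NN (f' a b) y)" by (rule cop_linx[OF l(1)])
  show "NN x (cop h f') = cop h (\<lambda>a b. NN x (f' a b))" by (rule cop_linx[OF l(2)])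
qed

lemma opDM: "M.opD v (NN x y) = SG (\<lambda>e k. NN ((e \<rhd>\<rhd> qg v) \<odot>\<odot> (k \<rhd>\<rhd> x)) y)
    + ev2 K RF (\<lambda>r s. SG (\<lambda>e k. NN (s \<rhd>\<rhd> x) ((e \<rhd>\<rhd> r \<rhd>\<rhd> qg v) \<odot>\<odot> (k \<rhd>\<rhd> y))))"
  unfolding M.opD_pur Phi_gen[symmetric] ev2_KF Phi_act Phi_mul NN_bil ..

text \<open>The two summands of \<open>u \<boxtimes> 1 + 1 \<boxtimes> u\<close> in the induction step for the coproduct: on one side
  \<open>F\<close> is applied after multiplication in the braided square of \<open>\<U>(\<gg>)\<close>, on the other it is
  applied before multiplication in that of \<open>\<U>(\<gg>\<^sub>F)\<close>. The left summand involves no braiding,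
  and \<open>cocycle_mixed\<close> suffices; the right one is \<open>braiding_twist\<close>.\<close>

lemma braided_left_term:
  "SG (\<lambda>a b. cop b (\<lambda>d d'. SF (\<lambda>c e. NN (c \<rhd>\<rhd> ((a \<rhd>\<rhd> w) \<odot>\<odot> (d \<rhd>\<rhd> x))) (e \<rhd>\<rhd> d' \<rhd>\<rhd> y))))
   = SF (\<lambda>a b. SG (\<lambda>e k. NN ((e \<rhd>\<rhd> w) \<odot>\<odot> (k \<rhd>\<rhd> a \<rhd>\<rhd> x)) (b \<rhd>\<rhd> y)))"
proof -
  let ?f = "\<lambda>p q r. NN ((p \<rhd>\<rhd> w) \<odot>\<odot> (q \<rhd>\<rhd> x)) (r \<rhd>\<rhd> y)"
  have t: "trilx ?f" by (simp add: trilx_def linx_def Ubil NN_bil)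
  have sw: "SG (\<lambda>a b. cop b (\<lambda>d d'. SF (\<lambda>c e. cop c (\<lambda>m n. h a b d d' c e m n))))
     = SF (\<lambda>c e. cop c (\<lambda>m n. SG (\<lambda>a b. cop b (\<lambda>d d'. h a b d d' c e m n))))"
    for h :: "_ \<Rightarrow> _ \<Rightarrow> _ \<Rightarrow> _ \<Rightarrow> _ \<Rightarrow> _ \<Rightarrow> _ \<Rightarrow> _ \<Rightarrow> ('k, 'z) uvec"
  proof -
    have 1: "cop b (\<lambda>d d'. SF (\<lambda>c e. cop c (\<lambda>m n. h a b d d' c e m n))) = SF (\<lambda>c e. cop b (\<lambda>d d'. cop c (\<lambda>m n. h a b d d' c e m n)))" for a b
      by (rule cop_swap)
    have 2: "cop b (\<lambda>d d'. cop c (\<lambda>m n. h a b d d' c e m n)) = cop c (\<lambda>m n. cop b (\<lambda>d d'. h a b d d' c e m n))" for a b c e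
      by (rule cop_cop_swap)
    have 3: "SG (\<lambda>a b. cop c (\<lambda>m n. cop b (\<lambda>d d'. h a b d d' c e m n))) = cop c (\<lambda>m n. SG (\<lambda>a b. cop b (\<lambda>d d'. h a b d d' c e m n)))" for c e
      by (rule cop_swap[symmetric])
    have "SG (\<lambda>a b. SF (\<lambda>c e. cop c (\<lambda>m n. cop b (\<lambda>d d'. h a b d d' c e m n)))) = SF (\<lambda>c e. SG (\<lambda>a b. cop c (\<lambda>m n. cop b (\<lambda>d d'. h a b d d' c e m n))))"
      by (rule ev2_swap)
    then show ?thesis unfolding 1 2 3 .
  qed
  have "SG (\<lambda>a b. cop b (\<lambda>d d'. SF (\<lambda>c e. NN (c \<rhd>\<rhd> ((a \<rhd>\<rhd> w) \<odot>\<odot> (d \<rhd>\<rhd> x))) (e \<rhd>\<rhd> d' \<rhd>\<rhd> y))))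
     = SG (\<lambda>a b. cop b (\<lambda>d d'. SF (\<lambda>c e. cop c (\<lambda>m n. ?f (m \<star> a) (n \<star> d) (e \<star> d')))))"
    by (simp only: actU_mulU NN_bil actU_mul)
  also have "\<dots> = SF (\<lambda>c e. cop c (\<lambda>m n. SG (\<lambda>a b. cop b (\<lambda>d d'. ?f (m \<star> a) (n \<star> d) (e \<star> d')))))"
    by (rule sw)
  also have "\<dots> = SG (\<lambda>a b. SF (\<lambda>c d. ?f a (b \<star> c) d))" by (rule cocycle_mixed[OF t])
  also have "\<dots> = SF (\<lambda>c d. SG (\<lambda>a b. ?f a (b \<star> c) d))" by (rule ev2_swap)
  finally show ?thesis by (simp only: actU_mul)
qed

lemma braided_right_term:
  "SG (\<lambda>a b. cop b (\<lambda>d d'. SR (\<lambda>r s. SF (\<lambda>c e. NN (c \<rhd>\<rhd> s \<rhd>\<rhd> d \<rhd>\<rhd> x) (e \<rhd>\<rhd> ((r \<rhd>\<rhd> a \<rhd>\<rhd> w) \<odot>\<odot> (d' \<rhd>\<rhd> y)))))))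
   = SF (\<lambda>a b. ev2 K RF (\<lambda>r s. SG (\<lambda>e k. NN (s \<rhd>\<rhd> a \<rhd>\<rhd> x) ((e \<rhd>\<rhd> r \<rhd>\<rhd> w) \<odot>\<odot> (k \<rhd>\<rhd> b \<rhd>\<rhd> y)))))"
proof -
  let ?f = "\<lambda>p q r. NN (p \<rhd>\<rhd> x) ((q \<rhd>\<rhd> w) \<odot>\<odot> (r \<rhd>\<rhd> y))"
  have t: "trilx ?f" by (simp add: trilx_def linx_def Ubil NN_bil)
  have "SG (\<lambda>a b. cop b (\<lambda>d d'. SR (\<lambda>r s. SF (\<lambda>c e. NN (c \<rhd>\<rhd> s \<rhd>\<rhd> d \<rhd>\<rhd> x) (e \<rhd>\<rhd> ((r \<rhd>\<rhd> a \<rhd>\<rhd> w) \<odot>\<odot> (d' \<rhd>\<rhd> y)))))))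
     = SG (\<lambda>a b. cop b (\<lambda>d d'. SR (\<lambda>r s. SF (\<lambda>c e. cop e (\<lambda>m n. ?f (c \<star> s \<star> d) (m \<star> r \<star> a) (n \<star> d'))))))"
    by (simp only: actU_mulU NN_bil actU_mul)
  also have "\<dots> = SF (\<lambda>a b. ev2 K RF (\<lambda>r s. SG (\<lambda>e k. ?f (s \<star> a) (e \<star> r) (k \<star> b))))"
    by (rule braiding_twist[OF t])
  finally show ?thesis by (simp only: actU_mul)
qed

lemma comul_step:
  "SF (\<lambda>a b. M.opD v (NN (a \<rhd>\<rhd> x) (b \<rhd>\<rhd> y))) = SG (\<lambda>a b. cop b (\<lambda>d d'. Th (opD (a \<rhd> v) (pur (d \<rhd>\<rhd> x) (d' \<rhd>\<rhd> y)))))"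
  by (simp only: opDM opD_pur linx_add[OF linx_Th] ev2_linx[OF linx_Th] Th_pur qg_act ev2_plus cop_fun
      braided_left_term braided_right_term)

text \<open>The coproduct of \<open>\<U>(\<gg>\<^sub>F)\<close> on \<open>T(\<gg>)\<close> is the twisted coproduct of \<open>\<U>(\<gg>)\<close> composed with
  \<open>psi\<close>. In the induction step \<open>psi\<close> acts on the tail, and \<open>delta_act\<close> turns this into the
  diagonal action.\<close>

lemma comul_match: "M.delta t = Th (delta (psi t))"
proof -
  have "M.delta (pp T t) = Th (delta (psi (pp T t)))"
  proof (rule T_linear_eq[where f = M.delta and h = "\<lambda>t. Th (delta (psi t))"])
    show "linx M.delta" by (rule M.linx_delta)
    show "linx (\<lambda>t. Th (delta (psi t)))"
      by (simp add: linx_def psi_lin linx_simps[OF linx_delta] linx_simps[OF linx_Th])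
    show "M.delta oneT = Th (delta (psi oneT))"
    proof -
      have l: "linx (\<lambda>b. eps b \<bullet> NN oneU oneU)" by (simp add: linx_def Kbil)
      have "Th (delta (psi oneT)) = SF (\<lambda>a b. eps a \<bullet> (eps b \<bullet> NN oneU oneU))"
        unfolding psi_one delta_one Th_pur actU_oneU NN_bil by (simp add: mult.commute)
      also have "\<dots> = NN oneU oneU" unfolding F_eps(1)[OF l] by (simp add: eps_one)
      also have "\<dots> = M.delta oneT" using M.delta_one by (simp only: oneUM KF_simps)
      finally show ?thesis ..
    qed
    fix v t assume IH: "M.delta t = Th (delta (psi t))"
    let ?Z = "delta (psi t)"
    have lM: "linx (M.opD v)" using M.bilx_opD by (simp add: bilx_def)
    have lv: "linx (\<lambda>z. Th (opD v z))" for v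
      using bilx_opD by (simp add: bilx_def linx_def linx_simps[OF linx_Th])
    have "M.delta (gen v \<otimes>\<otimes> t) = M.opD v (Th ?Z)"
      using M.delta_gen[of v t] by (simp only: KF_simps IH)
    also have "\<dots> = lf (\<lambda>x y. SF (\<lambda>a b. M.opD v (NN (a \<rhd>\<rhd> x) (b \<rhd>\<rhd> y)))) ?Z"
      unfolding Th_def lf_linx[OF lM] ev2_linx[OF lM] ..
    also have "\<dots> = lf (\<lambda>x y. SG (\<lambda>a b. cop b (\<lambda>d d'. Th (opD (a \<rhd> v) (pur (d \<rhd>\<rhd> x) (d' \<rhd>\<rhd> y)))))) ?Z"
      unfolding comul_step ..
    also have "\<dots> = SG (\<lambda>a b. Th (opD (a \<rhd> v) (actD b ?Z)))"
      unfolding lf_swap actD_def lf_linx[OF lv] cop_linx[OF lv] ..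
    also have "\<dots> = Th (delta (psi (gen v \<otimes>\<otimes> t)))"
      unfolding psi_gen ev2_linx[OF linx_delta] ev2_linx[OF linx_Th] delta_gen delta_act ..
    finally show "M.delta (gen v \<otimes>\<otimes> t) = Th (delta (psi (gen v \<otimes>\<otimes> t)))" .
  qed
  moreover have "M.delta (pp T t) = M.delta t" using M.delta_pp[of t] by (simp only: KF_simps)
  ultimately show ?thesis by (simp add: psi_pp)
qed

text \<open>As \<open>psi\<close> maps one ideal to the other, the coproduct of \<open>\<U>(\<gg>\<^sub>F)\<close> inherits this from that
  of \<open>\<U>(\<gg>)\<close>.\<close>

lemma M_delta_ideal: "M.q x = 0 \<Longrightarrow> M.delta x = 0"
  unfolding comul_match using delta_ideal[OF q_psi] linx_zero[OF linx_Th] by simp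

lemma M_cou: "M.cou (chi t) = cou t"
proof -
  have g: "M.cou (gen v \<otimes>\<otimes> t) = 0" for v t using M.cou_gen[of v t] by (simp only: KF_simps)
  have "M.cou (chi (pp T t)) = cou (pp T t)"
  proof (rule T_linear_eq[where f = "\<lambda>t. M.cou (chi t)" and h = cou])
    show "linx (\<lambda>t. M.cou (chi t))" by (simp add: linx_def chi_lin linx_simps[OF M.linx_cou])
    show "linx cou" by (rule linx_cou)
    show "M.cou (chi oneT) = cou oneT" using M.cou_one by (simp only: chi_one cou_one KF_simps)
    show "M.cou (chi (gen v \<otimes>\<otimes> t)) = cou (gen v \<otimes>\<otimes> t)" for v t
      by (simp only: chi_gen ev2_linx[OF M.linx_cou] g cou_gen ev2_0)
  qed
  then show ?thesis by (simp add: chi_pp)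
qed

section \<open>The isomorphism\<close>

abbreviation L where "L \<equiv> twist_bhopf K F E"

definition phi where "phi \<xi> = prj M.U (Phi (emb U \<xi>))"

lemma phi_closed: "phi \<xi> \<in> carrier M.U"
  unfolding phi_def by (rule prj_closed[OF M.Umod])

lemma emb_phi: "emb M.U (phi \<xi>) = Phi (emb U \<xi>)"
  unfolding phi_def by (rule Phi_pp2)

lemma eqM: "a \<in> carrier M.U \<Longrightarrow> b \<in> carrier M.U \<Longrightarrow> emb M.U a = emb M.U b \<Longrightarrow> a = b"
  by (simp only: emb_eq_iff[OF M.Umod])

lemma L_simps: "carrier L = carrier U" "\<one>\<^bsub>L\<^esub> = \<one>\<^bsub>U\<^esub>" "ring.zero L = ring.zero U" "add L = add U" "smult L = smult U"
  "act L = act U" "bcounit L = bcounit E"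
  by (simp_all add: twist_bhopf_def E_simps)

text \<open>This lemma and the next express the structure of \<open>\<U>(\<gg>)\<^sub>F\<close>, which is defined by \<open>tlift\<close>,
  by sums in \<open>uvec\<close>.\<close>

lemma L_mult:
  assumes "\<xi> \<in> carrier U" "\<zeta> \<in> carrier U"
  shows "\<xi> \<otimes>\<^bsub>L\<^esub> \<zeta> \<in> carrier U" "emb U (\<xi> \<otimes>\<^bsub>L\<^esub> \<zeta>) = SG (\<lambda>a b. (a \<rhd>\<rhd> emb U \<xi>) \<odot>\<odot> (b \<rhd>\<rhd> emb U \<zeta>))"
proof -
  interpret ring U by (rule ringU)
  have kE: "kmodule E" using kmodule_cong[of E U, OF E_simps(1,5,6,4)] Umod by simp
  have B: "bilx (\<lambda>a b. (a \<rhd>\<rhd> emb U \<xi>) \<odot>\<odot> (b \<rhd>\<rhd> emb U \<zeta>))" by (simp add: bilx_def linx_def Ubil)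
  have e: "\<xi> \<otimes>\<^bsub>L\<^esub> \<zeta> = tlift E (\<lambda>f. act U (f!0) \<xi> \<otimes>\<^bsub>U\<^esub> act U (f!1) \<zeta>) G"
    by (simp add: twist_bhopf_def E_simps)
  have b: "act U x \<xi> \<otimes>\<^bsub>U\<^esub> act U y \<zeta> \<in> carrier E \<and> emb E (act U x \<xi> \<otimes>\<^bsub>U\<^esub> act U y \<zeta>)
     = (emb K x \<rhd>\<rhd> emb U \<xi>) \<odot>\<odot> (emb K y \<rhd>\<rhd> emb U \<zeta>)" if "x \<in> carrier K" "y \<in> carrier K" for x y
    using that assms by (simp only: E_simps emb_E act_U_closed m_closed emb_mult[OF Ualg] actU_emb simp_thms)
  have "tlift E (\<lambda>f. act U (f!0) \<xi> \<otimes>\<^bsub>U\<^esub> act U (f!1) \<zeta>) G \<in> carrier E"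
    "emb E (tlift E (\<lambda>f. act U (f!0) \<xi> \<otimes>\<^bsub>U\<^esub> act U (f!1) \<zeta>) G) = SG (\<lambda>a b. (a \<rhd>\<rhd> emb U \<xi>) \<odot>\<odot> (b \<rhd>\<rhd> emb U \<zeta>))"
    by (rule tlift2[OF kmod kE G_closed B]; use b in \<open>simp only: nth_Cons_0 nth_Cons_Suc One_nat_def simp_thms\<close>)+
  then show "\<xi> \<otimes>\<^bsub>L\<^esub> \<zeta> \<in> carrier U" "emb U (\<xi> \<otimes>\<^bsub>L\<^esub> \<zeta>) = SG (\<lambda>a b. (a \<rhd>\<rhd> emb U \<xi>) \<odot>\<odot> (b \<rhd>\<rhd> emb U \<zeta>))"
    unfolding e by (simp_all only: E_simps emb_E)
qed

lemma L_comul: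
  assumes S: "bcomul E \<xi> \<in> carrier (tspace {2} U)"
  shows "bcomul L \<xi> \<in> carrier (tspace {2} U)"
    "emb (tspace {2} U) (bcomul L \<xi>) = SF (\<lambda>a b. lf (\<lambda>x y. pur (a \<rhd>\<rhd> x) (b \<rhd>\<rhd> y)) (emb (tspace {2} U) (bcomul E \<xi>)))"
proof -
  let ?S = "bcomul E \<xi>"
  let ?j = "\<lambda>f. tlift (tspace {2} U) (\<lambda>d. pure {2} U [act U (f!0) (d!0), act U (f!1) (d!1)]) ?S"
  have e: "bcomul L \<xi> = tlift (tspace {2} U) ?j F"
    by (simp add: twist_bhopf_def E_simps tspace_E)
  have B: "bilx (\<lambda>x y. pur (a \<rhd>\<rhd> x) (b \<rhd>\<rhd> y))" for a b by (simp add: bilx_def linx_def Ubil)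
  have B2: "bilx (\<lambda>a b. lf (\<lambda>x y. pur (a \<rhd>\<rhd> x) (b \<rhd>\<rhd> y)) (emb (tspace {2} U) ?S))"
    by (simp add: bilx_def linx_def Ubil lf_fun)
  have j: "?j [x, y] \<in> carrier (tspace {2} U) \<and>
     emb (tspace {2} U) (?j [x, y]) = lf (\<lambda>p c. pur (emb K x \<rhd>\<rhd> p) (emb K y \<rhd>\<rhd> c)) (emb (tspace {2} U) ?S)"
    if "x \<in> carrier K" "y \<in> carrier K" for x y
  proof -
    have p: "pure {2} U [act U x a, act U y c] \<in> carrier (tspace {2} U) \<and>
      emb (tspace {2} U) (pure {2} U [act U x a, act U y c]) = pur (emb K x \<rhd>\<rhd> emb U a) (emb K y \<rhd>\<rhd> emb U c)"
      if "a \<in> carrier U" "c \<in> carrier U" for a c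
      using that \<open>x \<in> carrier K\<close> \<open>y \<in> carrier K\<close> by (simp only: pur_emb act_U_closed actU_emb simp_thms)
    show ?thesis unfolding lf_def prj_emb[OF kmodule_tspace S]
      by (intro conjI; rule tlift2[OF Umod kmodule_tspace S B]; use p in \<open>simp only: nth_Cons_0 nth_Cons_Suc One_nat_def simp_thms\<close>)
  qed
  show "bcomul L \<xi> \<in> carrier (tspace {2} U)"
    "emb (tspace {2} U) (bcomul L \<xi>) = SF (\<lambda>a b. lf (\<lambda>x y. pur (a \<rhd>\<rhd> x) (b \<rhd>\<rhd> y)) (emb (tspace {2} U) ?S))"
    unfolding e by (rule tlift2[OF kmod kmodule_tspace F_closed B2]; rule j; assumption)+
qed

lemma bhopf_iso_phi: "bhopf_iso KF L M.E phi"
  unfolding bhopf_iso_def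
proof (intro conjI ballI)
  interpret MU: ring M.U by (rule M.ringU)
  have add: "phi (\<xi> \<oplus>\<^bsub>L\<^esub> \<zeta>) = phi \<xi> \<oplus>\<^bsub>M.E\<^esub> phi \<zeta>" if "\<xi> \<in> carrier U" "\<zeta> \<in> carrier U" for \<xi> \<zeta>
  proof (rule eqM)
    show "emb M.U (phi (\<xi> \<oplus>\<^bsub>L\<^esub> \<zeta>)) = emb M.U (phi \<xi> \<oplus>\<^bsub>M.E\<^esub> phi \<zeta>)"
      unfolding M.E_simps L_simps emb_add[OF M.Umod phi_closed phi_closed] emb_phi emb_add[OF Umod that] by (rule linx_add[OF linx_Phi])
  qed (simp_all only: phi_closed M.E_simps MU.a_closed)
  have sm: "phi (c \<odot>\<^bsub>L\<^esub> \<xi>) = c \<odot>\<^bsub>M.E\<^esub> phi \<xi>" if "\<xi> \<in> carrier U" for c \<xi>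
  proof (rule eqM)
    show "emb M.U (phi (c \<odot>\<^bsub>L\<^esub> \<xi>)) = emb M.U (c \<odot>\<^bsub>M.E\<^esub> phi \<xi>)"
      unfolding M.E_simps L_simps emb_smult[OF M.Umod phi_closed] emb_phi emb_smult[OF Umod that] by (rule linx_scale[OF linx_Phi])
  qed (simp_all only: phi_closed M.E_simps module_simps(2)[OF M.Umod])
  have mu: "phi (\<xi> \<otimes>\<^bsub>L\<^esub> \<zeta>) = phi \<xi> \<otimes>\<^bsub>M.E\<^esub> phi \<zeta>" if "\<xi> \<in> carrier U" "\<zeta> \<in> carrier U" for \<xi> \<zeta>
  proof (rule eqM)
    show "emb M.U (phi (\<xi> \<otimes>\<^bsub>L\<^esub> \<zeta>)) = emb M.U (phi \<xi> \<otimes>\<^bsub>M.E\<^esub> phi \<zeta>)"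
      unfolding M.E_simps emb_mult[OF M.Ualg phi_closed phi_closed] emb_phi L_mult(2)[OF that] Phi_mul ..
  qed (simp_all only: phi_closed M.E_simps MU.m_closed)
  have on: "phi \<one>\<^bsub>L\<^esub> = \<one>\<^bsub>M.E\<^esub>"
  proof (rule eqM)
    show "emb M.U (phi \<one>\<^bsub>L\<^esub>) = emb M.U \<one>\<^bsub>M.E\<^esub>" unfolding M.E_simps L_simps emb_phi oneUM ..
  qed (simp_all only: phi_closed M.E_simps MU.one_closed)
  have ac: "phi (act L k \<xi>) = act M.E k (phi \<xi>)" if k: "k \<in> carrier K" and x: "\<xi> \<in> carrier U" for k \<xi>
  proof (rule eqM)
    have k': "k \<in> carrier KF" using k by (simp add: twist_hopf_def)
    show "emb M.U (phi (act L k \<xi>)) = emb M.U (act M.E k (phi \<xi>))"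
      unfolding M.E_simps L_simps M.actU_emb[OF k' phi_closed] emb_phi actU_emb[OF k x] Phi_act emb_twist_hopf ..
    show "act M.E k (phi \<xi>) \<in> carrier M.U" unfolding M.E_simps by (rule M.act_U_closed[OF k' phi_closed])
  qed (rule phi_closed)
  show "alg_hom L M.E phi"
    unfolding alg_hom_def
  proof
    show "phi \<in> ring_hom L M.E"
      by (rule ring_hom_memI) (use phi_closed add mu on in \<open>simp_all only: L_simps(1) M.E_simps(1)\<close>)
    show "lin L M.E phi"
      unfolding lin_def by (simp only: L_simps(1) M.E_simps(1) add sm simp_thms) (simp add: phi_closed add sm)
  qed
  show "phi (act L k \<xi>) = act M.E k (phi \<xi>)" if "k \<in> carrier KF" "\<xi> \<in> carrier L" for k \<xi>
    using that by (intro ac) (simp_all only: L_simps, simp add: twist_hopf_def)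
  show "bij_betw phi (carrier L) (carrier M.E)"
    unfolding L_simps M.E_simps
  proof (rule bij_betwI')
    fix \<xi> \<zeta> assume x: "\<xi> \<in> carrier U" and z: "\<zeta> \<in> carrier U"
    show "phi \<xi> = phi \<zeta> \<longleftrightarrow> \<xi> = \<zeta>"
    proof
      assume "phi \<xi> = phi \<zeta>"
      then have "Phi (emb U \<xi>) = Phi (emb U \<zeta>)" unfolding emb_phi[symmetric] by simp
      then have "Phi (emb U \<xi> - emb U \<zeta>) = 0" by (simp add: linx_diff[OF linx_Phi])
      then have "pp U (emb U \<xi> - emb U \<zeta>) = 0" by (rule Phi_ker)
      then have "emb U \<xi> = emb U \<zeta>" unfolding pp_simps[OF Umod] prj_emb[OF Umod x] prj_emb[OF Umod z] by simp
      then show "\<xi> = \<zeta>" unfolding emb_eq_iff[OF Umod x z] .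
    qed simp
  next
    show "phi \<xi> \<in> carrier M.U" if "\<xi> \<in> carrier U" for \<xi> by (rule phi_closed)
  next
    fix w assume w: "w \<in> carrier M.U"
    obtain t where t: "pp M.U (emb M.U w) = M.q t" by (rule M.q_surj)
    \<comment> \<open>\<open>psi\<close> provides preimages, as \<open>chi\<close> is its inverse.\<close>
    let ?x = "prj U (q (psi t))"
    have "emb M.U (phi ?x) = M.q (chi (psi t))" unfolding emb_phi q_pp Phi_q ..
    also have "\<dots> = emb M.U w" using t unfolding chi_psi Mq_pp prj_emb[OF M.Umod w] by simp
    finally have "phi ?x = w" by (rule eqM[OF phi_closed w])
    then show "\<exists>\<xi>\<in>carrier U. w = phi \<xi>" by (intro bexI[of _ ?x]) (rule sym, assumption, rule prj_closed[OF Umod])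
  qed
  fix \<xi> assume "\<xi> \<in> carrier L"
  then have "\<xi> \<in> carrier U" by (simp only: L_simps)
  then obtain x where x: "x \<in> carrier T" "\<xi> = cls x" by (rule U_E)
  let ?y = "prj T (chi (emb T x))"
  have y: "?y \<in> carrier M.T" unfolding tensor_alg_twist by (rule prj_closed[OF Tmod])
  have ph: "phi \<xi> = M.cls ?y"
  proof (rule eqM[OF phi_closed M.cls_closed[OF y]])
    show "emb M.U (phi \<xi>) = emb M.U (M.cls ?y)"
      unfolding emb_phi x(2) q_emb[OF x(1), symmetric] Phi_q M.q_def KF_simps ..
  qed
  have ey: "emb M.T ?y = chi (emb T x)" unfolding tensor_alg_twist by (rule pp_chi)
  have "bcounit M.E (phi \<xi>) = prj scal (cou (emb T x))" unfolding ph M.counit_E[OF y] ey M_cou ..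
  also have "\<dots> = bcounit L \<xi>" unfolding L_simps x(2) counit_E[OF x(1)] ..
  finally show "bcounit M.E (phi \<xi>) = bcounit L \<xi>" .
  have cE: "bcomul E \<xi> \<in> carrier (tspace {2} U)" "emb (tspace {2} U) (bcomul E \<xi>) = delta (emb T x)"
    unfolding x(2) by (rule comul_E; (rule x(1) | rule delta_ideal, assumption))+
  have cM: "bcomul M.E (phi \<xi>) \<in> carrier (tspace {2} M.U)"
    "emb (tspace {2} M.U) (bcomul M.E (phi \<xi>)) = M.delta (emb M.T ?y)"
    unfolding ph by (rule M.comul_E; (rule y | rule M_delta_ideal, assumption))+
  let ?r = "tlift (tspace {2} M.U) (\<lambda>d. pure {2} M.U [phi (d!0), phi (d!1)]) (bcomul L \<xi>)"
  have B: "bilx NN" by (simp add: bilx_def linx_def NN_bil)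
  have p: "pure {2} M.U [phi a, phi c] \<in> carrier (tspace {2} M.U) \<and>
      emb (tspace {2} M.U) (pure {2} M.U [phi a, phi c]) = NN (emb U a) (emb U c)" for a c
    using M.pur_emb[OF phi_closed phi_closed, of a c] unfolding emb_phi .
  have r: "?r \<in> carrier (tspace {2} M.U)" "emb (tspace {2} M.U) ?r = ev2 U (bcomul L \<xi>) NN"
    by (rule tlift2[OF Umod kmodule_tspace L_comul(1)[OF cE(1)] B]; use p in \<open>simp only: nth_Cons_0 nth_Cons_Suc One_nat_def simp_thms\<close>)+
  have "ev2 U (bcomul L \<xi>) NN = lf NN (emb (tspace {2} U) (bcomul L \<xi>))"
    unfolding lf_def prj_emb[OF kmodule_tspace L_comul(1)[OF cE(1)]] ..
  also have "\<dots> = SF (\<lambda>a b. lf (\<lambda>x y. NN (a \<rhd>\<rhd> x) (b \<rhd>\<rhd> y)) (delta (emb T x)))"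
    unfolding L_comul(2)[OF cE(1)] cE(2) ev2_linx[OF linx_lf[OF B]] lf_linx[OF linx_lf[OF B]]
    by (simp add: lf_pur[OF B])
  also have "\<dots> = Th (delta (emb T x))" unfolding Th_def lf_swap ..
  also have "\<dots> = M.delta (chi (emb T x))" unfolding comul_match psi_chi prj_emb[OF Tmod x(1)] ..
  finally have "emb (tspace {2} M.U) (bcomul M.E (phi \<xi>)) = emb (tspace {2} M.U) ?r" unfolding cM(2) ey r(2) by (rule sym)
  then have "bcomul M.E (phi \<xi>) = ?r" unfolding emb_eq_iff[OF kmodule_tspace cM(1) r(1)] .
  then show "bcomul M.E (phi \<xi>) = tlift (tspace {2} M.E) (\<lambda>d. pure {2} M.E [phi (d!0), phi (d!1)]) (bcomul L \<xi>)"
    unfolding M.tspace_E .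
qed

end

theorem proposition5p18:
  fixes K :: "('k::comm_ring_1, 'a) coalg"
    and R F :: "('k, 'a) tens"
    and \<gg> :: "('k, 'v, 'a) blie"
  assumes "ground_ring TYPE('f::field) TYPE('k)"
    and "triangular_hopf K R"
    and "braided_lie K R \<gg>"
    and "twist K F"
  shows "bhopf_isomorphic (twist_hopf K F)
           (twist_bhopf K F (enveloping K R \<gg>))
           (enveloping (twist_hopf K F) (twist_R K F R) (twist_lie K F \<gg>))"
proof -
  interpret full K R F \<gg>
    using assms(2-4)
    by unfold_locales (auto simp: triangular_hopf_def hopf_algebra_def bialgebra_def braided_lie_def alg_hom_def lin_def tpow_alg_def)
  show ?thesis unfolding bhopf_isomorphic_def using bhopf_iso_phi by blast
qed

end
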